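(* Let $W_n=\prod_{i=1}^{l_n}W_{n,i}$ be a sequence of direct products of classical Weyl groups, with total rank $N_n:=\mathrm{rk}(W_n)=\sum_{i=1}^{l_n}\mathrm{rk}(W_{n,i})$ satisfying $\log(n)^3=o(N_n)$. Fix one statistic $\mathrm{stat}\in\{\mathrm{inv},\mathrm{des}\}$. For each $n$, let $X_{n1},\dots,X_{nn}$ be i.i.d., each distributed as $\mathrm{stat}(w)$ for $w$ uniform on $W_n$, and $M_n:=\max\{X_{n1},\dots,X_{nn}\}$. Let $\mu_n:=\mathbb{E}(X_{n1})$, $s_n^2:=\mathrm{Var}(X_{n1})$, $\alpha_n=\sqrt{2\log n}$, $\beta_n=\alpha_n-(2\alpha_n)^{-1}(\log\log n+\log(4\pi))$, $a_n:=\alpha_ns_n$, $b_n:=\beta_ns_n+\mu_n$. Let $n_{\max}:=\max\{\mathrm{rk}(W_{n,1}),\dots,\mathrm{rk}(W_{n,l_n})\}$. If either $\mathrm{stat}=\mathrm{inv}$ and $$\limsup_{n\to\infty}\frac{n_{\max}\sqrt{N_n}}{\sqrt{\mathrm{rk}(W_{n,1})^3+\dots+\mathrm{rk}(W_{n,l_n})^3}}<\infty,$$ or $\mathrm{stat}=\mathrm{des}$, then for every $x\in\mathbb{R}$, $\mathbb{P}(M_n\le a_nx+b_n)\longrightarrow\exp(-\exp(-x))$.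
   Context: A Coxeter system $(W,S)$: $W$ generated by finite $S$ with $s^2=e$ and $(ss')^{M(s,s')}=e$; rank $\#S$. With $l$ the word length and $T=\{wsw^{-1}\}$ the reflections, $\mathrm{inv}(w)=\#\{t\in T: l(wt)<l(w)\}$, $\mathrm{des}(w)=\#\{s\in S: l(ws)<l(w)\}$. Classical Weyl groups are the finite irreducible Coxeter groups of types $A$ (symmetric groups $S_{m+1}=A_m$ with adjacent transpositions), $B$ (signed permutations $B_m$, generated by adjacent transpositions and the sign change of the first entry) and $D$ (even-signed permutations $D_m$, generated by adjacent transpositions and the sign change of the first two entries). A direct product of Coxeter groups is a Coxeter group whose generating set is the union of the components' generating sets.
   Formalization: Proved with a_n = s_n/α_n instead of a_n = α_n s_n, for which the claim fails when x ≠ 0 (e.g. W_n a product of n copies of A_1); the type D "sign change of the first two entries" is read as the standard generator that also interchanges them. *)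

theory Defs
  imports "HOL-Probability.Probability" "HOL-Algebra.Product_Groups"
    "HOL-Combinatorics.Permutations" "HOL-Library.Landau_Symbols"
begin

section \<open>Groups with a distinguished set of generating involutions\<close>

record 'a coxeter = "'a monoid" +
  gens :: "'a set"

definition cox_rank :: "'a coxeter \<Rightarrow> nat" where
  "cox_rank W = card (gens W)"

(* Words in the generators alone suffice, because every generator is an involution. *)
definition cox_length :: "'a coxeter \<Rightarrow> 'a \<Rightarrow> nat" where
  "cox_length W w =
     (LEAST k. \<exists>ss. length ss = k \<and> set ss \<subseteq> gens W \<and> foldr (mult W) ss (one W) = w)"

definition reflections :: "'a coxeter \<Rightarrow> 'a set" where
  "reflections W =
     {w \<otimes>\<^bsub>W\<^esub> s \<otimes>\<^bsub>W\<^esub> inv\<^bsub>W\<^esub> w | w s. w \<in> carrier W \<and> s \<in> gens W}"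

definition cox_inv :: "'a coxeter \<Rightarrow> 'a \<Rightarrow> nat" where
  "cox_inv W w = card {t \<in> reflections W. cox_length W (w \<otimes>\<^bsub>W\<^esub> t) < cox_length W w}"

definition cox_des :: "'a coxeter \<Rightarrow> 'a \<Rightarrow> nat" where
  "cox_des W w = card {s \<in> gens W. cox_length W (w \<otimes>\<^bsub>W\<^esub> s) < cox_length W w}"

(* A generator of a component is embedded in the product by the identity in all other
   components; product_group consists of functions that are undefined outside of I. *)
definition cox_embed :: "'i set \<Rightarrow> ('i \<Rightarrow> 'a coxeter) \<Rightarrow> 'i \<Rightarrow> 'a \<Rightarrow> 'i \<Rightarrow> 'a" where
  "cox_embed I W i s = (\<lambda>j\<in>I. if j = i then s else \<one>\<^bsub>W j\<^esub>)"

definition cox_prod :: "'i set \<Rightarrow> ('i \<Rightarrow> 'a coxeter) \<Rightarrow> ('i \<Rightarrow> 'a) coxeter" where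
  "cox_prod I W =
     monoid.extend (product_group I W) \<lparr> gens = (\<Union>i\<in>I. cox_embed I W i ` gens (W i)) \<rparr>"


section \<open>The classical Weyl groups\<close>

(* All three families are realised by bijections of the integers, so that components of
   different types can occur in one product. An element w is identified with the window
   w 1, ..., w m; since the multiplication is composition, multiplying by a generator on
   the right acts on the positions (the entries) of the window. *)

definition weyl_A :: "nat \<Rightarrow> (int \<Rightarrow> int) coxeter" where
  "weyl_A m =
     \<lparr> carrier = {p. p permutes {1..int m + 1}},
       mult = (\<circ>), one = id,
       gens = (\<lambda>i. Transposition.transpose i (i + 1)) ` {1..int m} \<rparr>"

definition signed_perms :: "nat \<Rightarrow> (int \<Rightarrow> int) set" where
  "signed_perms m = {p. p permutes {- int m..int m} \<and> (\<forall>i. p (- i) = - p i)}"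

definition signed_swap :: "int \<Rightarrow> int \<Rightarrow> int \<Rightarrow> int" where
  "signed_swap i j = Transposition.transpose i j \<circ> Transposition.transpose (- i) (- j)"

definition weyl_B :: "nat \<Rightarrow> (int \<Rightarrow> int) coxeter" where
  "weyl_B m =
     \<lparr> carrier = signed_perms m,
       mult = (\<circ>), one = id,
       gens = insert (Transposition.transpose 1 (-1))
                ((\<lambda>i. signed_swap i (i + 1)) ` {1..int m - 1}) \<rparr>"

(* The additional generator signed_swap 1 (-2) turns the window (w 1, w 2, w 3, ...) into
   (- w 2, - w 1, w 3, ...). Negating the first two entries without interchanging them
   would not give a Coxeter system of type D (it is not a reflection). *)
definition weyl_D :: "nat \<Rightarrow> (int \<Rightarrow> int) coxeter" where
  "weyl_D m =
     \<lparr> carrier = {p \<in> signed_perms m. even (card {i \<in> {1..int m}. p i < 0})},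
       mult = (\<circ>), one = id,
       gens = insert (signed_swap 1 (-2)) ((\<lambda>i. signed_swap i (i + 1)) ` {1..int m - 1}) \<rparr>"

(* The lower bounds are those for which the group is non-trivial and irreducible. As Coxeter
   systems, weyl_B 1 and weyl_A 1 are isomorphic, as are weyl_D 3 and weyl_A 3. *)
definition classical_weyl_groups :: "(int \<Rightarrow> int) coxeter set" where
  "classical_weyl_groups =
     weyl_A ` {m. m \<ge> 1} \<union> weyl_B ` {m. m \<ge> 1} \<union> weyl_D ` {m. m \<ge> 3}"


section \<open>The rank of the components and of a product\<close>

lemma cox_rank_weyl_A: "cox_rank (weyl_A m) = m"
proof -
  have "inj_on (\<lambda>i::int. Transposition.transpose i (i + 1)) {1..int m}"
  proof (rule inj_onI)
    fix i j :: int
    assume h: "Transposition.transpose i (i + 1) = Transposition.transpose j (j + 1)"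
    from fun_cong[OF h, of i] fun_cong[OF h, of j] show "i = j"
      by (auto simp: Transposition.transpose_def split: if_splits)
  qed
  then show ?thesis
    by (simp add: cox_rank_def weyl_A_def card_image)
qed

lemma inj_on_signed_swap: "inj_on (\<lambda>i. signed_swap i (i + 1)) {1..k}"
proof (rule inj_onI)
  fix i j :: int
  assume "i \<in> {1..k}" "j \<in> {1..k}" and h: "signed_swap i (i + 1) = signed_swap j (j + 1)"
  with fun_cong[OF h, of i] fun_cong[OF h, of j] show "i = j"
    by (auto simp: signed_swap_def Transposition.transpose_def split: if_splits)
qed

lemma cox_rank_weyl_B:
  assumes "m \<ge> 1"
  shows "cox_rank (weyl_B m) = m"
proof -
  have "Transposition.transpose 1 (-1) \<noteq> signed_swap i (i + 1)" if "i \<ge> 1" for i :: int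
  proof
    assume h: "Transposition.transpose 1 (-1) = signed_swap i (i + 1)"
    from fun_cong[OF h, of "i + 1"] that show False
      by (auto simp: signed_swap_def Transposition.transpose_def split: if_splits)
  qed
  then have "Transposition.transpose 1 (-1) \<notin> (\<lambda>i. signed_swap i (i + 1)) ` {1..int m - 1}"
    by (metis (no_types, lifting) atLeastAtMost_iff imageE)
  with assms show ?thesis
    by (simp add: cox_rank_def weyl_B_def card_image inj_on_signed_swap)
qed

lemma cox_rank_weyl_D:
  assumes "m \<ge> 3"
  shows "cox_rank (weyl_D m) = m"
proof -
  have "signed_swap 1 (-2) \<noteq> signed_swap i (i + 1)" if "i \<ge> 1" for i :: int
  proof
    assume h: "signed_swap 1 (-2) = signed_swap i (i + 1)"
    from fun_cong[OF h, of 1] fun_cong[OF h, of "i + 1"] that show False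
      by (auto simp: signed_swap_def Transposition.transpose_def split: if_splits)
  qed
  then have "signed_swap 1 (-2) \<notin> (\<lambda>i. signed_swap i (i + 1)) ` {1..int m - 1}"
    by (metis (no_types, lifting) atLeastAtMost_iff imageE)
  with assms show ?thesis
    by (simp add: cox_rank_def weyl_D_def card_image inj_on_signed_swap)
qed

lemma classical_weyl_groups_gens:
  assumes "W \<in> classical_weyl_groups"
  shows "finite (gens W)" and "\<one>\<^bsub>W\<^esub> \<notin> gens W"
proof -
  show "finite (gens W)"
    using assms
    by (auto simp: classical_weyl_groups_def weyl_A_def weyl_B_def weyl_D_def)
  have a: "id \<noteq> Transposition.transpose i (i + 1)" for i :: int
  proof
    assume h: "id = Transposition.transpose i (i + 1)"
    from fun_cong[OF h, of i] show False by simp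
  qed
  have b: "id \<noteq> Transposition.transpose 1 (-1 :: int)"
  proof
    assume h: "id = Transposition.transpose 1 (-1 :: int)"
    from fun_cong[OF h, of 1] show False by simp
  qed
  have s: "id \<noteq> signed_swap i (i + 1)" if "i \<ge> 1" for i :: int
  proof
    assume h: "id = signed_swap i (i + 1)"
    from fun_cong[OF h, of i] that show False
      by (auto simp: signed_swap_def Transposition.transpose_def split: if_splits)
  qed
  have d: "id \<noteq> signed_swap 1 (-2)"
  proof
    assume h: "id = signed_swap 1 (-2)"
    from fun_cong[OF h, of 1] show False
      by (auto simp: signed_swap_def Transposition.transpose_def split: if_splits)
  qed
  from a b s d assms show "\<one>\<^bsub>W\<^esub> \<notin> gens W"
    by (auto simp: classical_weyl_groups_def weyl_A_def weyl_B_def weyl_D_def)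
qed

lemma cox_prod_simps:
  "carrier (cox_prod I W) = (\<Pi>\<^sub>E i\<in>I. carrier (W i))"
  "mult (cox_prod I W) = (\<lambda>x y. \<lambda>i\<in>I. x i \<otimes>\<^bsub>W i\<^esub> y i)"
  "one (cox_prod I W) = (\<lambda>i\<in>I. \<one>\<^bsub>W i\<^esub>)"
  "gens (cox_prod I W) = (\<Union>i\<in>I. cox_embed I W i ` gens (W i))"
  by (simp_all add: cox_prod_def monoid.defs product_group_def)

lemma cox_rank_cox_prod:
  assumes "finite I" and W: "\<And>i. i \<in> I \<Longrightarrow> W i \<in> classical_weyl_groups"
  shows "cox_rank (cox_prod I W) = (\<Sum>i\<in>I. cox_rank (W i))"
proof -
  have inj: "inj_on (cox_embed I W i) (gens (W i))" if "i \<in> I" for i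
  proof (rule inj_onI)
    fix s t assume h: "cox_embed I W i s = cox_embed I W i t"
    from fun_cong[OF h, of i] that show "s = t" by (simp add: cox_embed_def)
  qed
  have disj: "cox_embed I W i ` gens (W i) \<inter> cox_embed I W j ` gens (W j) = {}"
    if ij: "i \<in> I" "j \<in> I" "i \<noteq> j" for i j
  proof -
    have "cox_embed I W i s \<noteq> cox_embed I W j t" if "s \<in> gens (W i)" for s t
    proof
      assume h: "cox_embed I W i s = cox_embed I W j t"
      from fun_cong[OF h, of i] ij have "s = \<one>\<^bsub>W i\<^esub>" by (simp add: cox_embed_def)
      with that classical_weyl_groups_gens(2)[OF W[OF ij(1)]] show False by simp
    qed
    then show ?thesis by blast
  qed
  show ?thesis
    unfolding cox_rank_def cox_prod_simps
    using assms disj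
    by (subst card_UN_disjoint) (auto simp: classical_weyl_groups_gens card_image inj)
qed


section \<open>Norming constants\<close>

(* The maximum Z of n independent standard normal variables satisfies
   P (gumbel_alpha n * (Z - gumbel_beta n) <= x) --> exp (- exp (- x)). The scale that belongs
   to these constants is therefore the standard deviation divided by gumbel_alpha n. *)
definition gumbel_alpha :: "nat \<Rightarrow> real" where
  "gumbel_alpha n = sqrt (2 * ln (real n))"

definition gumbel_beta :: "nat \<Rightarrow> real" where
  "gumbel_beta n =
     gumbel_alpha n - (ln (ln (real n)) + ln (4 * pi)) / (2 * gumbel_alpha n)"

end

theory Submission
  imports Defs "HOL-Probability.Probability" "HOL-Complex_Analysis.Complex_Analysis" "HOL-Real_Asymp.Real_Asymp"
begin

text \<open>
  Lengths and descents in a classical Weyl group count roots that become negative, so both statistics are additive over the components.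
  The generating function of \<open>inv\<close> is a product of generating functions of uniform distributions. The centred moment generating functions
  \<open>f n\<close> of \<open>des\<close> satisfy \<open>f (n + 1) z = cosh (z / 2) * f n z - 2 / (n + 1) * sinh (z / 2) * f' n z\<close>. Hence they are polynomials in
  \<open>cosh (z / 2)\<close> with nonnegative coefficients, which makes them small away from the real axis, and \<open>(sinh (z / 2) / (z / 2)) ^ (n + 1)\<close> up to
  a factor \<open>1 + O(z ^ 4)\<close>. Type D reduces to \<open>2 * f_B m - f_A (m - 1)\<close>.

  Consequently the centred moment generating function of the statistic is \<open>exp (s\<^sup>2 * z\<^sup>2 / 2) * (1 + O(N * (B * z) ^ 4))\<close> near the origin, with
  \<open>B = 1\<close> for \<open>des\<close> and \<open>B = n_max\<close> for \<open>inv\<close>, and it decays exponentially in \<open>N\<close> away from the real axis. Fourier inversion on the line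
  \<open>Re z = y / s\<close> yields \<open>P(stat \<ge> \<mu> + s * y) ~ exp (- y\<^sup>2 / 2) / (y * sqrt (2 * pi))\<close> whenever \<open>y \<rightarrow> \<infinity>\<close> and \<open>y ^ 4 = o(N)\<close>. On the scale
  \<open>y ~ sqrt (2 * ln n)\<close> of the maximum, this is covered by the growth of \<open>N\<close>, and the lattice spacing is negligible.
\<close>

text \<open>At the threshold of the maximum the tail probability is of order \<open>1 / n\<close>
  and is needed with relative error o(1). A normal approximation with an absolute error, at best of
  order \<open>N ^ (-1 / 2)\<close>, says nothing there, since \<open>n\<close> may exceed every
  power of \<open>N\<close>. This forces a moderate deviation estimate, and with it control of the
  moment generating function off the real axis. The parameter \<open>B\<close> measures the largest
  component: near the origin only arguments of size \<open>1 / B\<close> are under control, and the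
  Gaussian integral, of width \<open>1 / s\<close> in \<open>z\<close>, must fit well inside. This
  is the content of \<open>s \<ge> c * B * sqrt N\<close>. For \<open>des\<close> it holds with
  \<open>B = 1\<close>; for \<open>inv\<close> the variance is comparable to the sum of the cubes of
  the ranks, so that it amounts to the hypothesis on \<open>n_max\<close>. No mean or variance is
  computed from the combinatorics. The quartic estimate at the origin determines both, and they are
  identified with those of the theorem afterwards.\<close>

section \<open>Length, descents and inversions in terms of roots\<close>

text \<open>A group acting on roots, with positive roots \<open>P\<close> and simple roots
  \<open>S\<close>; \<open>act w r \<notin> P\<close> means that \<open>w\<close> makes
  \<open>r\<close> negative. The axioms speak about positive roots and their images only, so that
  the negative roots need no carrier of their own. The geometry enters through \<open>simple\<close>
  (a simple reflection permutes the other positive roots) and \<open>all_pos\<close> (only the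
  identity keeps all simple roots positive).\<close>

locale root_action = group W for W :: "'a coxeter" (structure) +
  fixes act :: "'a \<Rightarrow> 'r \<Rightarrow> 'r" and neg :: "'r \<Rightarrow> 'r" and refl :: "'r \<Rightarrow> 'a"
    and P S :: "'r set"
  assumes finite_P: "finite P" and S_P: "S \<subseteq> P"
    and neg_neg: "r \<in> P \<Longrightarrow> neg (neg r) = r"
    and neg_P: "r \<in> P \<Longrightarrow> neg r \<notin> P"
    and act_P: "w \<in> carrier W \<Longrightarrow> r \<in> P \<Longrightarrow> act w r \<in> P \<or> neg (act w r) \<in> P"
    and neg_neg_act: "w \<in> carrier W \<Longrightarrow> r \<in> P \<Longrightarrow> neg (neg (act w r)) = act w r"
    and act_neg: "w \<in> carrier W \<Longrightarrow> r \<in> P \<Longrightarrow> act w (neg r) = neg (act w r)"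
    and act_mult: "w \<in> carrier W \<Longrightarrow> v \<in> carrier W \<Longrightarrow> r \<in> P \<Longrightarrow> act (w \<otimes> v) r = act w (act v r)"
    and act_one: "r \<in> P \<Longrightarrow> act \<one> r = r"
    and refl_carrier: "r \<in> P \<Longrightarrow> refl r \<in> carrier W"
    and refl_refl: "r \<in> P \<Longrightarrow> refl r \<otimes> refl r = \<one>"
    and act_refl: "r \<in> P \<Longrightarrow> act (refl r) r = neg r"
    and inj_refl: "inj_on refl P"
    and refl_neg: "r \<in> P \<Longrightarrow> refl (neg r) = refl r"
    and refl_act: "w \<in> carrier W \<Longrightarrow> r \<in> P \<Longrightarrow> refl (act w r) \<otimes> w = w \<otimes> refl r"
    and gens_eq: "gens W = refl ` S"
    and simple: "\<alpha> \<in> S \<Longrightarrow> \<beta> \<in> P \<Longrightarrow> \<beta> \<noteq> \<alpha> \<Longrightarrow> act (refl \<alpha>) \<beta> \<in> P"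
    and all_pos: "w \<in> carrier W \<Longrightarrow> \<forall>\<alpha>\<in>S. act w \<alpha> \<in> P \<Longrightarrow> w = \<one>"
begin

definition N :: "'a \<Rightarrow> nat" where "N w = card {r \<in> P. act w r \<notin> P}"

lemma gens_carrier: "gens W \<subseteq> carrier W"
  using gens_eq S_P refl_carrier by auto

lemma foldr_carrier: "set ss \<subseteq> gens W \<Longrightarrow> foldr (\<otimes>) ss \<one> \<in> carrier W"
  using gens_carrier by (induction ss) auto

lemma act_neg_P: "w \<in> carrier W \<Longrightarrow> r \<in> P \<Longrightarrow> act w r \<notin> P \<Longrightarrow> neg (act w r) \<in> P"
  using act_P by blast

lemma act_act_refl: "\<alpha> \<in> S \<Longrightarrow> \<beta> \<in> P \<Longrightarrow> act (refl \<alpha>) (act (refl \<alpha>) \<beta>) = \<beta>"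
  using act_mult[of "refl \<alpha>" "refl \<alpha>" \<beta>] refl_carrier S_P refl_refl act_one by (metis subsetD)

lemma bij_refl:
  assumes "\<alpha> \<in> S" shows "bij_betw (act (refl \<alpha>)) (P - {\<alpha>}) (P - {\<alpha>})"
proof (rule bij_betw_byWitness[where f' = "act (refl \<alpha>)"])
  have "\<alpha> \<in> P" using assms S_P by auto
  have "act (refl \<alpha>) \<beta> \<noteq> \<alpha>" if "\<beta> \<in> P" "\<beta> \<noteq> \<alpha>" for \<beta>
  proof
    assume "act (refl \<alpha>) \<beta> = \<alpha>"
    then have "\<beta> = act (refl \<alpha>) \<alpha>" using act_act_refl[OF assms that(1)] by simp
    then show False using act_refl neg_P that(1) \<open>\<alpha> \<in> P\<close> by auto
  qed
  then show sub: "act (refl \<alpha>) ` (P - {\<alpha>}) \<subseteq> P - {\<alpha>}" using simple[OF assms] by auto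
  show "act (refl \<alpha>) ` (P - {\<alpha>}) \<subseteq> P - {\<alpha>}" by (rule sub)
qed (use act_act_refl[OF assms] in auto)

text \<open>By \<open>bij_refl\<close> the inverted roots other than \<open>\<alpha>\<close> of the
  two elements correspond to each other, so only the sign of the image of \<open>\<alpha>\<close>
  itself matters.\<close>

lemma N_refl_pos:
  assumes "\<alpha> \<in> S" "w \<in> carrier W" "act w \<alpha> \<in> P"
  shows "N (w \<otimes> refl \<alpha>) = Suc (N w)"
proof -
  have aP: "\<alpha> \<in> P" using assms S_P by auto
  have b: "bij_betw (act (refl \<alpha>)) {r \<in> P - {\<alpha>}. act (w \<otimes> refl \<alpha>) r \<notin> P} {r \<in> P - {\<alpha>}. act w r \<notin> P}"
    by (rule bij_betw_Collect[OF bij_refl[OF assms(1)]])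
      (use assms(2) refl_carrier[OF aP] in \<open>auto simp: act_mult\<close>)
  have "act (w \<otimes> refl \<alpha>) \<alpha> = neg (act w \<alpha>)"
    using assms(2) refl_carrier[OF aP] aP by (simp add: act_mult act_refl act_neg)
  then have "act (w \<otimes> refl \<alpha>) \<alpha> \<notin> P" using assms(3) neg_P by auto
  then have "{r \<in> P. act (w \<otimes> refl \<alpha>) r \<notin> P} = insert \<alpha> {r \<in> P - {\<alpha>}. act (w \<otimes> refl \<alpha>) r \<notin> P}"
    using aP by auto
  moreover have "{r \<in> P. act w r \<notin> P} = {r \<in> P - {\<alpha>}. act w r \<notin> P}" using assms(3) by auto
  ultimately show ?thesis unfolding N_def using bij_betw_same_card[OF b] finite_P by simp
qed

lemma mult_refl_refl: "w \<in> carrier W \<Longrightarrow> r \<in> P \<Longrightarrow> w \<otimes> refl r \<otimes> refl r = w"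
  using refl_carrier refl_refl by (simp add: m_assoc)

lemma N_refl_neg:
  assumes "\<alpha> \<in> S" "w \<in> carrier W" "act w \<alpha> \<notin> P"
  shows "Suc (N (w \<otimes> refl \<alpha>)) = N w"
proof -
  have aP: "\<alpha> \<in> P" using assms S_P by auto
  have "act (w \<otimes> refl \<alpha>) \<alpha> = neg (act w \<alpha>)"
    using assms(2) refl_carrier[OF aP] aP by (simp add: act_mult act_refl act_neg)
  then have "act (w \<otimes> refl \<alpha>) \<alpha> \<in> P" using assms act_neg_P aP by auto
  from N_refl_pos[OF assms(1) _ this] show ?thesis
    using assms(2) refl_carrier[OF aP] mult_refl_refl[OF assms(2) aP] by auto
qed

lemma N_foldr_le: "set ss \<subseteq> gens W \<Longrightarrow> w \<in> carrier W \<Longrightarrow> N (w \<otimes> foldr (\<otimes>) ss \<one>) \<le> N w + length ss"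
proof (induction ss arbitrary: w)
  case (Cons s ss)
  then obtain \<alpha> where \<alpha>: "s = refl \<alpha>" "\<alpha> \<in> S" using gens_eq by auto
  have s: "s \<in> carrier W" using Cons gens_carrier by auto
  have "N (w \<otimes> s) \<le> Suc (N w)"
    using N_refl_pos[OF \<alpha>(2) Cons.prems(2)] N_refl_neg[OF \<alpha>(2) Cons.prems(2)] \<alpha>
    by (cases "act w \<alpha> \<in> P") auto
  moreover have "w \<otimes> foldr (\<otimes>) (s # ss) \<one> = (w \<otimes> s) \<otimes> foldr (\<otimes>) ss \<one>"
    using Cons.prems s foldr_carrier by (simp add: m_assoc)
  ultimately show ?case using Cons.IH[of "w \<otimes> s"] Cons.prems s by auto
qed simp

lemma N_one: "N \<one> = 0"
proof -
  have "{r \<in> P. act \<one> r \<notin> P} = {}" using act_one by auto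
  then show ?thesis unfolding N_def by (simp only: card.empty)
qed

lemma foldr_append_one:
  "set ss \<subseteq> gens W \<Longrightarrow> s \<in> carrier W \<Longrightarrow> foldr (\<otimes>) (ss @ [s]) \<one> = foldr (\<otimes>) ss \<one> \<otimes> s"
proof (induction ss)
  case (Cons a ss)
  then have "a \<in> carrier W" using gens_carrier by auto
  with Cons foldr_carrier[of ss] show ?case by (simp add: m_assoc)
qed simp

text \<open>Greedy reduction: an element other than \<open>\<one>\<close> makes some simple root
  negative by \<open>all_pos\<close>, and multiplying by the reflection of that root lowers
  \<open>N\<close> by one. Together with \<open>N_foldr_le\<close> this identifies \<open>N\<close>
  with the length.\<close>

lemma word_exists: "w \<in> carrier W \<Longrightarrow> \<exists>ss. length ss = N w \<and> set ss \<subseteq> gens W \<and> foldr (\<otimes>) ss \<one> = w"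
proof (induction "N w" arbitrary: w)
  case 0
  then have "\<forall>\<alpha>\<in>S. act w \<alpha> \<in> P"
    using S_P finite_P unfolding N_def by auto
  then have "w = \<one>" using all_pos 0 by blast
  then show ?case using 0 by auto
next
  case (Suc n)
  have "w \<noteq> \<one>" using Suc N_one by auto
  then obtain \<alpha> where a: "\<alpha> \<in> S" "act w \<alpha> \<notin> P" using all_pos Suc by blast
  have c: "refl \<alpha> \<in> carrier W" "\<alpha> \<in> P" using a S_P refl_carrier by auto
  have n: "N (w \<otimes> refl \<alpha>) = n" using N_refl_neg[OF a(1) Suc(3) a(2)] Suc(2) by auto
  obtain ss where ss: "length ss = n" "set ss \<subseteq> gens W" "foldr (\<otimes>) ss \<one> = w \<otimes> refl \<alpha>"
    using Suc(1)[OF n[symmetric]] n c Suc by auto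
  show ?case
    using ss Suc a c gens_eq foldr_append_one[OF ss(2) c(1)] mult_refl_refl[OF Suc(3) c(2)]
    by (intro exI[of _ "ss @ [refl \<alpha>]"]) auto
qed

lemma cox_length_eq: "w \<in> carrier W \<Longrightarrow> cox_length W w = N w"
  unfolding cox_length_def
proof (rule Least_equality)
  assume w: "w \<in> carrier W"
  show "\<exists>ss. length ss = N w \<and> set ss \<subseteq> gens W \<and> foldr (\<otimes>) ss \<one> = w" by (rule word_exists[OF w])
  fix k assume "\<exists>ss. length ss = k \<and> set ss \<subseteq> gens W \<and> foldr (\<otimes>) ss \<one> = w"
  then show "N w \<le> k" using N_foldr_le[of _ \<one>] N_one foldr_carrier by fastforce
qed

lemma N_refl_less_iff:
  "\<alpha> \<in> S \<Longrightarrow> w \<in> carrier W \<Longrightarrow> N (w \<otimes> refl \<alpha>) < N w \<longleftrightarrow> act w \<alpha> \<notin> P"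
  using N_refl_pos N_refl_neg by fastforce

lemma cox_des_eq:
  assumes "w \<in> carrier W" shows "cox_des W w = card {\<alpha> \<in> S. act w \<alpha> \<notin> P}"
proof -
  have "{s \<in> gens W. cox_length W (w \<otimes> s) < cox_length W w} = refl ` {\<alpha> \<in> S. act w \<alpha> \<notin> P}"
    using assms gens_eq N_refl_less_iff S_P refl_carrier by (auto simp: cox_length_eq subset_iff)
  moreover have "inj_on refl {\<alpha> \<in> S. act w \<alpha> \<notin> P}"
    by (rule inj_on_subset[OF inj_refl]) (use S_P in auto)
  ultimately show ?thesis unfolding cox_des_def by (simp add: card_image)
qed

text \<open>The strong exchange condition. Along the word, \<open>r\<close> turns from positive to
  negative at some letter \<open>refl \<alpha>\<close>. At that moment its image is
  \<open>\<alpha>\<close>, the only positive root that this letter makes negative, so deleting the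
  letter amounts to multiplying by \<open>refl r\<close>. The same argument exhibits
  \<open>r\<close> in the orbit of a simple root, which \<open>reflections_eq\<close> needs.\<close>

lemma exchange:
  "set ss \<subseteq> gens W \<Longrightarrow> r \<in> P \<Longrightarrow> act (foldr (\<otimes>) ss \<one>) r \<notin> P \<Longrightarrow>
    (\<exists>ss'. Suc (length ss') = length ss \<and> set ss' \<subseteq> gens W \<and> foldr (\<otimes>) ss' \<one> = foldr (\<otimes>) ss \<one> \<otimes> refl r) \<and>
    (\<exists>v \<in> carrier W. act v r \<in> S)"
proof (induction ss)
  case Nil then show ?case using act_one by auto
next
  case (Cons s ss)
  let ?v = "foldr (\<otimes>) ss \<one>"
  have v: "?v \<in> carrier W" and s: "s \<in> carrier W" "s \<in> gens W"
    using Cons foldr_carrier gens_carrier by auto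
  obtain \<alpha> where \<alpha>: "s = refl \<alpha>" "\<alpha> \<in> S" using gens_eq s by auto
  have r: "refl r \<in> carrier W" using Cons refl_carrier by auto
  show ?case
  proof (cases "act ?v r \<in> P")
    case False
    then obtain ss' where "Suc (length ss') = length ss" "set ss' \<subseteq> gens W"
      "foldr (\<otimes>) ss' \<one> = ?v \<otimes> refl r" "\<exists>v \<in> carrier W. act v r \<in> S" using Cons by auto
    then show ?thesis using s v r by (intro conjI exI[of _ "s # ss'"]) (auto simp: m_assoc)
  next
    case True
    have "act s (act ?v r) \<notin> P" using Cons.prems act_mult[OF s(1) v Cons.prems(2)] by simp
    then have e: "act ?v r = \<alpha>" using simple[OF \<alpha>(2) True] \<alpha> by auto
    then have "s \<otimes> ?v = ?v \<otimes> refl r" using refl_act[OF v Cons.prems(2)] \<alpha> by simp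
    then have "?v = s \<otimes> ?v \<otimes> refl r" using mult_refl_refl[OF v Cons.prems(2)] by simp
    then show ?thesis using Cons.prems e \<alpha> v s by (intro conjI exI[of _ ss]) auto
  qed
qed

lemma reflections_eq: "reflections W = refl ` P"
proof safe
  fix t assume "t \<in> reflections W"
  then obtain w \<alpha> where w: "w \<in> carrier W" "\<alpha> \<in> S" "t = w \<otimes> refl \<alpha> \<otimes> inv w"
    unfolding reflections_def gens_eq by auto
  have a: "\<alpha> \<in> P" using w S_P by auto
  have t: "t = refl (act w \<alpha>)"
  proof -
    obtain r where "r \<in> P" "refl (act w \<alpha>) = refl r"
      using act_P[OF w(1) a] refl_neg neg_neg_act[OF w(1) a] by metis
    then have "refl (act w \<alpha>) \<in> carrier W" using refl_carrier by auto
    then show ?thesis using w refl_act[OF w(1) a] refl_carrier[OF a] by (metis inv_solve_right m_closed)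
  qed
  then show "t \<in> refl ` P" using act_P[OF w(1) a] refl_neg neg_neg_act[OF w(1) a] by (metis imageI)
next
  fix r assume r: "r \<in> P"
  have rc: "refl r \<in> carrier W" using refl_carrier r by auto
  obtain ss where ss: "set ss \<subseteq> gens W" "foldr (\<otimes>) ss \<one> = refl r" using word_exists rc by blast
  \<comment> \<open>A word for \<open>refl r\<close> sends \<open>r\<close> to its negative, so
    \<open>exchange\<close> applies to it and moves \<open>r\<close> to a simple root.\<close>
  obtain v where v: "v \<in> carrier W" "act v r \<in> S"
    using exchange[OF ss(1) r] ss act_refl[OF r] neg_P[OF r] by auto
  have "refl r = inv v \<otimes> (v \<otimes> refl r)" using v rc by (simp add: m_assoc[symmetric])
  also have "\<dots> = inv v \<otimes> refl (act v r) \<otimes> inv (inv v)"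
    using v refl_act[OF v(1) r] S_P refl_carrier by (auto simp: m_assoc)
  finally show "refl r \<in> reflections W" unfolding reflections_def using v gens_eq by blast
qed

lemma N_refl_less:
  assumes "w \<in> carrier W" "r \<in> P" "act w r \<notin> P"
  shows "N (w \<otimes> refl r) < N w"
proof -
  obtain ss where ss: "length ss = N w" "set ss \<subseteq> gens W" "foldr (\<otimes>) ss \<one> = w"
    using word_exists assms by blast
  obtain ss' where ss': "Suc (length ss') = length ss" "set ss' \<subseteq> gens W"
      "foldr (\<otimes>) ss' \<one> = w \<otimes> refl r" using exchange[OF ss(2) assms(2)] ss assms by auto
  have "w \<otimes> refl r \<in> carrier W" using assms refl_carrier by auto
  with N_foldr_le[OF ss'(2) one_closed] ss' ss show ?thesis by (simp add: N_one)
qed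

text \<open>If \<open>w\<close> keeps \<open>r\<close> positive, then
  \<open>w \<otimes> refl r\<close> makes it negative, and \<open>N_refl_less\<close> for that
  element gives the opposite inequality. So being shortened by a reflection is equivalent to
  inverting its root.\<close>

lemma cox_inv_eq:
  assumes w: "w \<in> carrier W" shows "cox_inv W w = N w"
proof -
  have iff: "N (w \<otimes> refl r) < N w \<longleftrightarrow> act w r \<notin> P" if r: "r \<in> P" for r
  proof
    assume l: "N (w \<otimes> refl r) < N w"
    show "act w r \<notin> P"
    proof
      assume p: "act w r \<in> P"
      have "act (w \<otimes> refl r) r = neg (act w r)"
        using w refl_carrier[OF r] r by (simp add: act_mult act_refl act_neg)
      then have "act (w \<otimes> refl r) r \<notin> P" using p neg_P by auto
      from N_refl_less[OF _ r this] show False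
        using l w refl_carrier[OF r] mult_refl_refl[OF w r] by auto
    qed
  qed (rule N_refl_less[OF w r])
  have "{t \<in> reflections W. cox_length W (w \<otimes> t) < cox_length W w} = refl ` {r \<in> P. act w r \<notin> P}"
    using w iff refl_carrier by (auto simp: cox_length_eq reflections_eq)
  moreover have "inj_on refl {r \<in> P. act w r \<notin> P}"
    by (rule inj_on_subset[OF inj_refl]) auto
  ultimately show ?thesis unfolding cox_inv_def N_def by (simp add: card_image)
qed

text \<open>The values 0 and 1 of \<open>cox_des\<close> are both attained, so the statistic lives
  on no coarser lattice than the integers. This is what \<open>small_far\<close> needs about a
  single group.\<close>

lemma cox_des_one: "cox_des W \<one> = 0"
proof -
  have "{\<alpha> \<in> S. act \<one> \<alpha> \<notin> P} = {}" using act_one S_P by auto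
  then show ?thesis using cox_des_eq[OF one_closed] by (simp only: card.empty)
qed

lemma cox_des_gen: "\<alpha> \<in> S \<Longrightarrow> cox_des W (refl \<alpha>) = 1"
proof -
  assume a: "\<alpha> \<in> S"
  have "{\<beta> \<in> S. act (refl \<alpha>) \<beta> \<notin> P} = {\<alpha>}"
    using a simple S_P act_refl neg_P by (auto simp: subset_iff)
  then show ?thesis using cox_des_eq[of "refl \<alpha>"] refl_carrier a S_P by auto
qed

end

section \<open>Root systems of direct products\<close>

lemma group_cox_prod:
  assumes "\<And>i. i \<in> I \<Longrightarrow> group (V i)"
  shows "group (cox_prod I V)"
proof (rule groupI)
  fix x assume "x \<in> carrier (cox_prod I V)"
  then show "\<exists>y\<in>carrier (cox_prod I V). y \<otimes>\<^bsub>cox_prod I V\<^esub> x = \<one>\<^bsub>cox_prod I V\<^esub>"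
    by (intro bexI[of _ "\<lambda>i\<in>I. inv\<^bsub>V i\<^esub> x i"])
      (use assms in \<open>auto simp: cox_prod_simps restrict_def PiE_def Pi_def fun_eq_iff extensional_def
        intro: group.inv_closed group.l_inv\<close>)
qed (use assms[THEN group.is_monoid] in \<open>auto simp: cox_prod_simps restrict_def PiE_def Pi_def fun_eq_iff extensional_def
       monoid.m_closed monoid.one_closed monoid.m_assoc monoid.l_one\<close>)

lemma root_action_cox_prod:
  fixes V :: "'i \<Rightarrow> 'a coxeter" and act :: "'i \<Rightarrow> 'a \<Rightarrow> 'r \<Rightarrow> 'r" and rfl :: "'i \<Rightarrow> 'r \<Rightarrow> 'a"
  assumes I: "finite I"
    and V: "\<And>i. i \<in> I \<Longrightarrow> root_action (V i) (act i) (neg i) (rfl i) (P i) (S i)"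
  shows "root_action (cox_prod I V) (\<lambda>w (i, r). (i, act i (w i) r)) (\<lambda>(i, r). (i, neg i r))
    (\<lambda>(i, r). cox_embed I V i (rfl i r)) (Sigma I P) (Sigma I S)"
proof -
  note V_grp = V[THEN root_action.axioms(1)]
  note V_S_P = V[THEN root_action.S_P]
  note V_act_P = V[THEN root_action.act_P]
  note V_act_mult = V[THEN root_action.act_mult]
  note V_act_neg = V[THEN root_action.act_neg]
  note V_act_one = V[THEN root_action.act_one]
  note V_act_refl = V[THEN root_action.act_refl]
  note V_all_pos = V[THEN root_action.all_pos]
  note V_finite_P = V[THEN root_action.finite_P]
  note V_gens_eq = V[THEN root_action.gens_eq]
  note V_inj_refl = V[THEN root_action.inj_refl]
  note V_is_monoid = V_grp[THEN group.is_monoid]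
  note V_neg_P = V[THEN root_action.neg_P]
  note V_neg_neg = V[THEN root_action.neg_neg]
  note V_neg_neg_act = V[THEN root_action.neg_neg_act]
  note V_refl_act = V[THEN root_action.refl_act]
  note V_refl_carrier = V[THEN root_action.refl_carrier]
  note V_refl_neg = V[THEN root_action.refl_neg]
  note V_refl_refl = V[THEN root_action.refl_refl]
  note V_simple = V[THEN root_action.simple]
  note simps = cox_prod_simps
  have inj: "s = s'" if "i \<in> I" "cox_embed I V i s = cox_embed I V i s'" for i s s'
    using fun_cong[OF that(2), of i] that(1) by (simp add: cox_embed_def)
  have emb: "cox_embed I V i s \<in> carrier (cox_prod I V)" if "i \<in> I" "s \<in> carrier (V i)" for i s
    using that by (auto simp: simps cox_embed_def V_is_monoid[THEN monoid.one_closed])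
  have emb_app: "cox_embed I V i s j = (if j = i then s else \<one>\<^bsub>V j\<^esub>)" if "j \<in> I" for i j s
    using that by (simp add: cox_embed_def)
  have car: "w i \<in> carrier (V i)" if "w \<in> carrier (cox_prod I V)" "i \<in> I" for w i
    using that by (auto simp: simps)
  interpret W: group "cox_prod I V" by (rule group_cox_prod) (rule V_grp)
  \<comment> \<open>For injectivity of the reflection map across components: embeddings from two
    different components can agree only at the identities.\<close>
  have neq: "rfl i r \<noteq> \<one>\<^bsub>V i\<^esub>" if "i \<in> I" "r \<in> P i" for i r
    using that V_act_refl[of i r] V_act_one[of i r] V_neg_P[of i r] by metis
  show ?thesis
  proof unfold_locales
    show "finite (Sigma I P)" using I V_finite_P by auto
    show "Sigma I S \<subseteq> Sigma I P" using V_S_P by auto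
    show "gens (cox_prod I V) = (\<lambda>(i, r). cox_embed I V i (rfl i r)) ` Sigma I S"
      using V_gens_eq by (auto simp: simps image_iff)
    show "inj_on (\<lambda>(i, r). cox_embed I V i (rfl i r)) (Sigma I P)"
    proof (rule inj_onI, safe)
      fix i r j r' assume a: "i \<in> I" "r \<in> P i" "j \<in> I" "r' \<in> P j"
        and e: "cox_embed I V i (rfl i r) = cox_embed I V j (rfl j r')"
      show ij: "i = j"
        using fun_cong[OF e, of i] neq[OF a(1,2)] a by (auto simp: emb_app split: if_splits)
      show "r = r'" using e a inj ij V_inj_refl[OF a(1)] by (auto dest: inj_onD)
    qed
    fix \<alpha> \<beta> assume "\<alpha> \<in> Sigma I S" "\<beta> \<in> Sigma I P" "\<beta> \<noteq> \<alpha>"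
    then obtain i a j b where e: "\<alpha> = (i, a)" "\<beta> = (j, b)" "i \<in> I" "j \<in> I" "a \<in> S i" "b \<in> P j"
      "i = j \<Longrightarrow> b \<noteq> a" by auto
    show "(case \<beta> of (i, r) \<Rightarrow> (i, act i ((case \<alpha> of (i, r) \<Rightarrow> cox_embed I V i (rfl i r)) i) r)) \<in> Sigma I P"
    proof (cases "i = j")
      case True
      then show ?thesis using e V_simple[of j a b] by (simp add: emb_app)
    next
      case False
      then show ?thesis using e V_act_one[of j b] by (simp add: emb_app)
    qed
  next
    fix w assume w: "w \<in> carrier (cox_prod I V)" and pos: "\<forall>\<alpha>\<in>Sigma I S. (case \<alpha> of (i, r) \<Rightarrow> (i, act i (w i) r)) \<in> Sigma I P"
    have "w i = \<one>\<^bsub>V i\<^esub>" if "i \<in> I" for i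
      using V_all_pos[OF that car[OF w that]] pos that by auto
    then show "w = \<one>\<^bsub>cox_prod I V\<^esub>" using w by (auto simp: simps PiE_iff extensional_def fun_eq_iff)
  next
    fix w r assume w: "w \<in> carrier (cox_prod I V)" and r: "r \<in> Sigma I P"
    obtain i q where q: "r = (i, q)" "i \<in> I" "q \<in> P i" using r by auto
    have "cox_embed I V i (rfl i (act i (w i) q)) \<otimes>\<^bsub>cox_prod I V\<^esub> w = w \<otimes>\<^bsub>cox_prod I V\<^esub> cox_embed I V i (rfl i q)"
    proof
      fix j show "(cox_embed I V i (rfl i (act i (w i) q)) \<otimes>\<^bsub>cox_prod I V\<^esub> w) j = (w \<otimes>\<^bsub>cox_prod I V\<^esub> cox_embed I V i (rfl i q)) j"
        using V_refl_act[OF q(2) car[OF w q(2)] q(3)] q(2) V_is_monoid car[OF w]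
        by (cases "j \<in> I") (auto simp: simps emb_app)
    qed
    then show "(case case r of (i, r) \<Rightarrow> (i, act i (w i) r) of (i, r) \<Rightarrow> cox_embed I V i (rfl i r)) \<otimes>\<^bsub>cox_prod I V\<^esub> w =
       w \<otimes>\<^bsub>cox_prod I V\<^esub> (case r of (i, r) \<Rightarrow> cox_embed I V i (rfl i r))" using q by simp
  next
    fix r assume r: "r \<in> Sigma I P"
    obtain i q where q: "r = (i, q)" "i \<in> I" "q \<in> P i" using r by auto
    show "(case r of (i, r) \<Rightarrow> cox_embed I V i (rfl i r)) \<otimes>\<^bsub>cox_prod I V\<^esub> (case r of (i, r) \<Rightarrow> cox_embed I V i (rfl i r)) = \<one>\<^bsub>cox_prod I V\<^esub>"
      using q V_refl_refl[OF q(2,3)] V_is_monoid by (auto simp: simps emb_app fun_eq_iff restrict_def)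
  qed (use car in \<open>auto simp: emb_app V_neg_neg V_neg_P V_neg_neg_act V_act_neg V_act_mult V_act_one
     V_act_refl V_refl_neg V_simple simps(2,3) emb V_refl_carrier dest: V_act_P split: if_splits\<close>)
qed

lemma
  fixes V :: "'i \<Rightarrow> 'a coxeter" and act :: "'i \<Rightarrow> 'a \<Rightarrow> 'r \<Rightarrow> 'r" and rfl :: "'i \<Rightarrow> 'r \<Rightarrow> 'a"
  assumes I: "finite I"
    and V: "\<And>i. i \<in> I \<Longrightarrow> root_action (V i) (act i) (neg i) (rfl i) (P i) (S i)"
    and w: "w \<in> carrier (cox_prod I V)"
  shows cox_des_cox_prod: "cox_des (cox_prod I V) w = (\<Sum>i\<in>I. cox_des (V i) (w i))"
    and cox_inv_cox_prod: "cox_inv (cox_prod I V) w = (\<Sum>i\<in>I. cox_inv (V i) (w i))"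
proof -
  note V_grp = V[THEN root_action.axioms(1)]
  note V_N_def = V[THEN root_action.N_def]
  note V_S_P = V[THEN root_action.S_P]
  note V_cox_des_eq = V[THEN root_action.cox_des_eq]
  note V_cox_inv_eq = V[THEN root_action.cox_inv_eq]
  note V_finite_P = V[THEN root_action.finite_P]
  interpret W: root_action "cox_prod I V" "\<lambda>w (i, r). (i, act i (w i) r)" "\<lambda>(i, r). (i, neg i r)"
    "\<lambda>(i, r). cox_embed I V i (rfl i r)" "Sigma I P" "Sigma I S"
    using I V by (rule root_action_cox_prod)
  have car: "w i \<in> carrier (V i)" if "i \<in> I" for i
    using that w by (auto simp: cox_prod_simps)
  have S: "finite (S i)" if "i \<in> I" for i
    using that V_finite_P V_S_P finite_subset by metis
  have "{\<alpha> \<in> Sigma I S. (case \<alpha> of (i, r) \<Rightarrow> (i, act i (w i) r)) \<notin> Sigma I P} =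
     (SIGMA i:I. {\<alpha> \<in> S i. act i (w i) \<alpha> \<notin> P i})" by auto
  then show "cox_des (cox_prod I V) w = (\<Sum>i\<in>I. cox_des (V i) (w i))"
    using W.cox_des_eq[OF w] V_cox_des_eq[OF _ car] I S by (simp add: card_SigmaI)
  have "{\<alpha> \<in> Sigma I P. (case \<alpha> of (i, r) \<Rightarrow> (i, act i (w i) r)) \<notin> Sigma I P} =
     (SIGMA i:I. {\<alpha> \<in> P i. act i (w i) \<alpha> \<notin> P i})" by auto
  then show "cox_inv (cox_prod I V) w = (\<Sum>i\<in>I. cox_inv (V i) (w i))"
    using W.cox_inv_eq[OF w] V_cox_inv_eq[OF _ car] I V_finite_P by (simp add: card_SigmaI W.N_def V_N_def)
qed

section \<open>Roots as sets of pairs of integers\<close>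

text \<open>A root is a matching of integers, namely \<open>{(i, j)}\<close> in type A and \<open>{(i, j), (- j, - i)}\<close> in types B and D.
  It is positive if \<open>i < j\<close>, and its negative is the converse relation.\<close>

definition pact :: "('a \<Rightarrow> 'a) \<Rightarrow> ('a \<times> 'a) set \<Rightarrow> ('a \<times> 'a) set" where
  "pact w r = map_prod w w ` r"

text \<open>For a matching \<open>r\<close> this is the involution that exchanges the two members of
  every pair and fixes all other points, hence the reflection in the root \<open>r\<close>.\<close>

definition prefl :: "('a \<times> 'a) set \<Rightarrow> 'a \<Rightarrow> 'a" where
  "prefl r k = (if \<exists>j. (k, j) \<in> r \<union> r\<inverse> then THE j. (k, j) \<in> r \<union> r\<inverse> else k)"

text \<open>Single-valuedness of the symmetric closure says that the pairs are disjoint, so that the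
  partner in \<open>prefl r\<close> is unique.\<close>

definition pos_matching :: "('a::linorder \<times> 'a) set \<Rightarrow> bool" where
  "pos_matching r \<longleftrightarrow> r \<noteq> {} \<and> (\<forall>(i, j) \<in> r. i < j) \<and> single_valued (r \<union> r\<inverse>)"

lemma prefl_eq: "single_valued (r \<union> r\<inverse>) \<Longrightarrow> (k, j) \<in> r \<union> r\<inverse> \<Longrightarrow> prefl r k = j"
  unfolding prefl_def by (auto dest: single_valuedD intro!: the_equality)

lemma prefl_notin: "\<nexists>j. (k, j) \<in> r \<union> r\<inverse> \<Longrightarrow> prefl r k = k"
  unfolding prefl_def by auto

lemma prefl_converse: "prefl (r\<inverse>) = prefl r"
  unfolding prefl_def by (auto simp: Un_commute)

lemma pact_converse: "pact w (r\<inverse>) = (pact w r)\<inverse>"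
  unfolding pact_def by force

lemma pact_comp: "pact (w \<circ> v) r = pact w (pact v r)"
  unfolding pact_def by force

lemma pact_id: "pact id r = r"
  unfolding pact_def by force

text \<open>The third part recovers a positive root from its reflection, whence \<open>prefl\<close>
  is injective on positive roots.\<close>

lemma pos_matching_prefl:
  assumes "pos_matching r"
  shows "prefl r \<circ> prefl r = id" and "pact (prefl r) r = r\<inverse>" and "r = {(k, prefl r k) | k. k < prefl r k}"
proof -
  have sv: "single_valued (r \<union> r\<inverse>)" and lt: "\<And>i j. (i, j) \<in> r \<Longrightarrow> i < j"
    using assms unfolding pos_matching_def by auto
  have *: "prefl r i = j" "prefl r j = i" if "(i, j) \<in> r" for i j
    using prefl_eq[OF sv] that by auto
  show "prefl r \<circ> prefl r = id"
  proof
    fix k show "(prefl r \<circ> prefl r) k = id k"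
    proof (cases "\<exists>j. (k, j) \<in> r \<union> r\<inverse>")
      case True
      then obtain j where "(k, j) \<in> r \<union> r\<inverse>" by auto
      then show ?thesis using * by auto
    qed (simp add: prefl_notin)
  qed
  show "pact (prefl r) r = r\<inverse>"
  proof -
    have "pact (prefl r) r = (\<lambda>(i, j). (j, i)) ` r"
      unfolding pact_def by (rule image_cong) (use * in auto)
    then show ?thesis by (auto simp: image_iff)
  qed
  show "r = {(k, prefl r k) | k. k < prefl r k}"
  proof safe
    fix a b assume "(a, b) \<in> r" then show "\<exists>k. (a, b) = (k, prefl r k) \<and> k < prefl r k" using * lt by auto
  next
    fix k assume k: "k < prefl r k"
    have "\<exists>j. (k, j) \<in> r \<union> r\<inverse>"
    proof (rule ccontr)
      assume "\<nexists>j. (k, j) \<in> r \<union> r\<inverse>"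
      from prefl_notin[OF this] k show False by simp
    qed
    then obtain j where j: "(k, j) \<in> r \<or> (j, k) \<in> r" by blast
    then have "prefl r k = j" using * by blast
    then show "(k, prefl r k) \<in> r" using lt[of j k] k j by auto
  qed
qed

lemma prefl_pact:
  assumes "bij w" and sv: "single_valued (r \<union> r\<inverse>)"
  shows "prefl (pact w r) \<circ> w = w \<circ> prefl r"
proof
  fix k
  have mem: "(w k, w j) \<in> pact w r \<union> (pact w r)\<inverse> \<longleftrightarrow> (k, j) \<in> r \<union> r\<inverse>" for j k
    using assms(1) unfolding pact_def bij_def by (auto simp: inj_eq)
  have sv': "single_valued (pact w r \<union> (pact w r)\<inverse>)"
  proof (rule single_valuedI)
    fix x y z assume a: "(x, y) \<in> pact w r \<union> (pact w r)\<inverse>" "(x, z) \<in> pact w r \<union> (pact w r)\<inverse>"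
    obtain x' y' z' where "x = w x'" "y = w y'" "z = w z'" using assms(1) by (metis bij_pointE)
    then show "y = z" using a mem sv by (metis single_valuedD)
  qed
  show "(prefl (pact w r) \<circ> w) k = (w \<circ> prefl r) k"
  proof (cases "\<exists>j. (k, j) \<in> r \<union> r\<inverse>")
    case True
    then obtain j where j: "(k, j) \<in> r \<union> r\<inverse>" by auto
    with mem have "(w k, w j) \<in> pact w r \<union> (pact w r)\<inverse>" by blast
    from prefl_eq[OF sv' this] prefl_eq[OF sv j] show ?thesis by simp
  next
    case False
    then have "\<nexists>j. (w k, j) \<in> pact w r \<union> (pact w r)\<inverse>" using mem assms(1) by (metis bij_pointE)
    from prefl_notin[OF this] prefl_notin[OF False] show ?thesis by simp
  qed
qed

text \<open>For groups of permutations the locale reduces to order relations: a positive root stays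
  positive exactly if \<open>w\<close> is increasing on its pairs.\<close>

lemma root_action_pairs:
  fixes W :: "('a::linorder \<Rightarrow> 'a) coxeter"
  assumes grp: "group W" and W: "mult W = (\<circ>)" "one W = id" "\<And>w. w \<in> carrier W \<Longrightarrow> bij w"
    and P: "finite P" "\<And>r. r \<in> P \<Longrightarrow> pos_matching r"
    and act_P: "\<And>w r. w \<in> carrier W \<Longrightarrow> r \<in> P \<Longrightarrow> pact w r \<in> P \<or> (pact w r)\<inverse> \<in> P"
    and prefl: "\<And>r. r \<in> P \<Longrightarrow> prefl r \<in> carrier W"
    and S: "S \<subseteq> P" "gens W = prefl ` S"
    and simple: "\<And>\<alpha> \<beta> i j. \<alpha> \<in> S \<Longrightarrow> \<beta> \<in> P \<Longrightarrow> (i, j) \<in> \<beta> \<Longrightarrow> \<beta> \<noteq> \<alpha> \<Longrightarrow> prefl \<alpha> i < prefl \<alpha> j"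
    and all_pos: "\<And>w. w \<in> carrier W \<Longrightarrow> (\<And>\<alpha> i j. \<alpha> \<in> S \<Longrightarrow> (i, j) \<in> \<alpha> \<Longrightarrow> w i < w j) \<Longrightarrow> w = id"
  shows "root_action W pact converse prefl P S"
proof -
  interpret group W by fact
  have conv: "r\<inverse> \<notin> P" if r: "r \<in> P" for r
  proof
    assume "r\<inverse> \<in> P"
    then have "\<forall>(i, j) \<in> r\<inverse>. i < j" using P(2) unfolding pos_matching_def by blast
    moreover obtain x where "x \<in> r" using P(2)[OF r] unfolding pos_matching_def by blast
    moreover obtain i j where "x = (i, j)" by (cases x)
    ultimately have "(i, j) \<in> r" "j < i" by auto
    then show False using P(2)[OF r] unfolding pos_matching_def by auto
  qed
  \<comment> \<open>All pairs of a positive root are increasing, and either the image of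
    \<open>r\<close> or its converse is such a root. Hence a single pair of \<open>r\<close> decides
    between the two.\<close>
  have pos: "pact w r \<in> P \<longleftrightarrow> (\<forall>(i, j) \<in> r. w i < w j)" if w: "w \<in> carrier W" and r: "r \<in> P" for w r
  proof
    assume "pact w r \<in> P"
    then have "\<forall>(i, j) \<in> pact w r. i < j" using P(2) unfolding pos_matching_def by blast
    then show "\<forall>(i, j) \<in> r. w i < w j" unfolding pact_def by auto
  next
    assume a: "\<forall>(i, j) \<in> r. w i < w j"
    show "pact w r \<in> P"
    proof (rule ccontr)
      assume "pact w r \<notin> P"
      then have "(pact w r)\<inverse> \<in> P" using act_P[OF w r] by simp
      then have "\<forall>(i, j) \<in> (pact w r)\<inverse>. i < j" using P(2) unfolding pos_matching_def by blast
      moreover obtain x where "x \<in> r" using P(2)[OF r] unfolding pos_matching_def by blast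
      moreover obtain i j where "x = (i, j)" by (cases x)
      ultimately have "(i, j) \<in> r" by simp
      have "(w i, w j) \<in> pact w r" using \<open>(i, j) \<in> r\<close> unfolding pact_def by force
      then have "(w j, w i) \<in> (pact w r)\<inverse>" by simp
      then have "w j < w i" using \<open>\<forall>(i, j) \<in> (pact w r)\<inverse>. i < j\<close> by blast
      then show False using a \<open>(i, j) \<in> r\<close> by fastforce
    qed
  qed
  have sv: "single_valued (r \<union> r\<inverse>)" if "r \<in> P" for r using P(2)[OF that] by (simp add: pos_matching_def)
  have refl_act: "prefl (pact w r) \<circ> w = w \<circ> prefl r" if "w \<in> carrier W" "r \<in> P" for w r
    by (rule prefl_pact[OF W(3)[OF that(1)] sv[OF that(2)]])
  show ?thesis
  proof unfold_locales
    show "inj_on prefl P"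
    proof (rule inj_onI)
      fix r q assume a: "r \<in> P" "q \<in> P" "prefl r = prefl q"
      have "r = {(k, prefl r k) | k. k < prefl r k}" by (rule pos_matching_prefl(3)[OF P(2)[OF a(1)]])
      also have "\<dots> = q" unfolding a(3) by (rule pos_matching_prefl(3)[OF P(2)[OF a(2)], symmetric])
      finally show "r = q" .
    qed
    fix \<alpha> \<beta> assume a: "\<alpha> \<in> S" "\<beta> \<in> P" "\<beta> \<noteq> \<alpha>"
    then have "\<forall>(i, j) \<in> \<beta>. prefl \<alpha> i < prefl \<alpha> j" using simple[OF a(1,2) _ a(3)] by blast
    then show "pact (prefl \<alpha>) \<beta> \<in> P" using pos[of "prefl \<alpha>" \<beta>] a S prefl by blast
  next
    fix w assume w: "w \<in> carrier W" and "\<forall>\<alpha>\<in>S. pact w \<alpha> \<in> P"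
    then have "w i < w j" if "\<alpha> \<in> S" "(i, j) \<in> \<alpha>" for \<alpha> i j using pos[OF w, of \<alpha>] S that by auto
    from all_pos[OF w this] show "w = \<one>\<^bsub>W\<^esub>" using W by simp
  qed (use S prefl act_P conv P(1) in \<open>simp_all add: W refl_act pact_comp pact_id pact_converse prefl_converse pos_matching_prefl(1,2)[OF P(2)]\<close>)
qed

section \<open>The roots and groups of types A, B and D\<close>

definition sroot :: "int \<Rightarrow> int \<Rightarrow> (int \<times> int) set" where
  "sroot i j = {(i, j), (- j, - i)}"

definition rootsA :: "nat \<Rightarrow> (int \<times> int) set set" where
  "rootsA m = (\<lambda>(i, j). {(i, j)}) ` {(i, j). 1 \<le> i \<and> i < j \<and> j \<le> int m + 1}"

text \<open>\<open>sroot i j\<close> and \<open>sroot (- j) (- i)\<close> are the same root. The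
  condition \<open>- j \<le> i\<close> selects one of the two names; equality gives the root of the
  sign change of \<open>j\<close>, which type D omits.\<close>

definition rootsB :: "nat \<Rightarrow> (int \<times> int) set set" where
  "rootsB m = (\<lambda>(i, j). sroot i j) ` {(i, j). i \<noteq> 0 \<and> - j \<le> i \<and> i < j \<and> j \<le> int m}"

definition rootsD :: "nat \<Rightarrow> (int \<times> int) set set" where
  "rootsD m = (\<lambda>(i, j). sroot i j) ` {(i, j). i \<noteq> 0 \<and> - j < i \<and> i < j \<and> j \<le> int m}"

definition simpleA :: "nat \<Rightarrow> (int \<times> int) set set" where
  "simpleA m = (\<lambda>i. {(i, i + 1)}) ` {1..int m}"

definition simpleB :: "nat \<Rightarrow> (int \<times> int) set set" where
  "simpleB m = insert (sroot (-1) 1) ((\<lambda>i. sroot i (i + 1)) ` {1..int m - 1})"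

definition simpleD :: "nat \<Rightarrow> (int \<times> int) set set" where
  "simpleD m = insert (sroot (-1) 2) ((\<lambda>i. sroot i (i + 1)) ` {1..int m - 1})"

lemma sroot_swap: "sroot (- j) (- i) = sroot i j"
  by (simp add: sroot_def insert_commute)

lemma converse_sroot: "(sroot i j)\<inverse> = sroot j i"
  by (auto simp: sroot_def)

lemma pact_sroot: "w (- i) = - w i \<Longrightarrow> w (- j) = - w j \<Longrightarrow> pact w (sroot i j) = sroot (w i) (w j)"
  by (auto simp: sroot_def pact_def)

lemma sroot_rootsB:
  "i < j \<Longrightarrow> i \<noteq> 0 \<Longrightarrow> j \<noteq> 0 \<Longrightarrow> - int m \<le> i \<Longrightarrow> j \<le> int m \<Longrightarrow> sroot i j \<in> rootsB m"
proof -
  assume a: "i < j" "i \<noteq> 0" "j \<noteq> 0" "- int m \<le> i" "j \<le> int m"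
  show ?thesis
  proof (cases "- j \<le> i")
    case True then show ?thesis unfolding rootsB_def using a by (auto intro!: image_eqI[of _ _ "(i, j)"])
  next
    case False then show ?thesis unfolding rootsB_def using a
      by (auto simp: sroot_swap intro!: image_eqI[of _ _ "(- j, - i)"])
  qed
qed

lemma sroot_rootsD:
  "i < j \<Longrightarrow> i \<noteq> 0 \<Longrightarrow> j \<noteq> 0 \<Longrightarrow> i \<noteq> - j \<Longrightarrow> - int m \<le> i \<Longrightarrow> j \<le> int m \<Longrightarrow> sroot i j \<in> rootsD m"
proof -
  assume a: "i < j" "i \<noteq> 0" "j \<noteq> 0" "i \<noteq> - j" "- int m \<le> i" "j \<le> int m"
  show ?thesis
  proof (cases "- j \<le> i")
    case True then show ?thesis unfolding rootsD_def using a by (auto intro!: image_eqI[of _ _ "(i, j)"])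
  next
    case False then show ?thesis unfolding rootsD_def using a
      by (auto simp: sroot_swap intro!: image_eqI[of _ _ "(- j, - i)"])
  qed
qed

lemma rootsD_B: "rootsD m \<subseteq> rootsB m"
  unfolding rootsD_def rootsB_def by auto

lemma pos_matching_singleton: "i < j \<Longrightarrow> pos_matching {(i, j)}"
  by (auto simp: pos_matching_def single_valued_def)

lemma pos_matching_sroot: "i \<noteq> 0 \<Longrightarrow> - j \<le> i \<Longrightarrow> i < j \<Longrightarrow> pos_matching (sroot i j)"
  by (auto simp: pos_matching_def single_valued_def sroot_def)

lemma prefl_singleton: "prefl {(i, j)} = Transposition.transpose i j"
proof
  fix k
  have sv: "single_valued ({(i, j)} \<union> {(i, j)}\<inverse>)" by (auto simp: single_valued_def)
  show "prefl {(i, j)} k = Transposition.transpose i j k"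
    using prefl_eq[OF sv, of k "Transposition.transpose i j k"] prefl_notin[of k "{(i, j)}"]
    by (cases "k = i \<or> k = j") auto
qed

lemma signed_swap_app:
  assumes "i \<noteq> 0" "- j < i" "i < j"
  shows "signed_swap i j k = (if k = i then j else if k = j then i else if k = - i then - j else if k = - j then - i else k)"
  using assms by (auto simp: signed_swap_def Transposition.transpose_def)

lemma prefl_sroot:
  assumes "i \<noteq> 0" "- j < i" "i < j"
  shows "prefl (sroot i j) = signed_swap i j"
proof
  fix k
  have sv: "single_valued (sroot i j \<union> (sroot i j)\<inverse>)"
    using assms pos_matching_sroot[of i j] by (auto simp: pos_matching_def)
  note app = signed_swap_app[OF assms, of k]
  consider "k = i" | "k = j" | "k = - i" | "k = - j" | "k \<notin> {i, j, - i, - j}" by blast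
  then show "prefl (sroot i j) k = signed_swap i j k"
  proof cases
    case 1
    then have "(k, j) \<in> sroot i j \<union> (sroot i j)\<inverse>" by (simp add: sroot_def)
    from prefl_eq[OF sv this] show ?thesis using app 1 by simp
  next
    case 2
    then have "(k, i) \<in> sroot i j \<union> (sroot i j)\<inverse>" by (simp add: sroot_def)
    from prefl_eq[OF sv this] show ?thesis using app 2 assms by simp
  next
    case 3
    then have "(k, - j) \<in> sroot i j \<union> (sroot i j)\<inverse>" by (simp add: sroot_def)
    from prefl_eq[OF sv this] show ?thesis using app 3 assms by simp
  next
    case 4
    then have "(k, - i) \<in> sroot i j \<union> (sroot i j)\<inverse>" by (simp add: sroot_def)
    from prefl_eq[OF sv this] show ?thesis using app 4 assms by simp
  next
    case 5
    then have "\<nexists>l. (k, l) \<in> sroot i j \<union> (sroot i j)\<inverse>" by (auto simp: sroot_def)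
    from prefl_notin[OF this] show ?thesis using app 5 by simp
  qed
qed

lemma prefl_sroot_self: "prefl (sroot (- j) j) = Transposition.transpose j (- j)"
  using prefl_singleton[of "- j" j] by (simp add: sroot_def transpose_commute)

lemma finite_int_pairs: "finite {(i::int, j). - j \<le> i \<and> i < j \<and> j \<le> int m}"
  by (rule finite_subset[of _ "{- int m..int m} \<times> {- int m..int m}"]) auto

lemma finite_roots: "finite (rootsA m)" "finite (rootsB m)" "finite (rootsD m)"
proof -
  have "finite {(i::int, j). 1 \<le> i \<and> i < j \<and> j \<le> int m + 1}"
    by (rule finite_subset[of _ "{1..int m + 1} \<times> {1..int m + 1}"]) auto
  then show "finite (rootsA m)" unfolding rootsA_def by (rule finite_imageI)
  have "finite {(i::int, j). i \<noteq> 0 \<and> - j \<le> i \<and> i < j \<and> j \<le> int m}"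
    by (rule finite_subset[OF _ finite_int_pairs[of m]]) auto
  then show B: "finite (rootsB m)" unfolding rootsB_def by (rule finite_imageI)
  show "finite (rootsD m)" using finite_subset[OF rootsD_B B] .
qed

text \<open>Climbing from 1 gives \<open>i \<le> f i\<close>, and descending from \<open>m\<close>
  gives \<open>f i \<le> i\<close>. This is the source of \<open>all_pos\<close> in all three
  types.\<close>

lemma int_increasing_eq_id:
  fixes f :: "int \<Rightarrow> int"
  assumes mono: "\<And>i. 1 \<le> i \<Longrightarrow> i < m \<Longrightarrow> f i < f (i + 1)" and "1 \<le> f 1" "f m \<le> m" and i: "1 \<le> i" "i \<le> m"
  shows "f i = i"
proof -
  have "i \<le> f i" using i(1,2)
  proof (induction i rule: int_ge_induct)
    case (step i) then show ?case using mono[of i] by auto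
  qed (use assms in auto)
  moreover have "f i \<le> i" using i(2,1)
  proof (induction i rule: int_le_induct)
    case (step i) then show ?case using mono[of "i - 1"] by auto
  qed (use assms in auto)
  ultimately show ?thesis by simp
qed

lemma group_permutes:
  assumes "mult W = (\<circ>)" "one W = id" "id \<in> carrier W"
    and "\<And>p q. p \<in> carrier W \<Longrightarrow> q \<in> carrier W \<Longrightarrow> p \<circ> q \<in> carrier W"
    and "\<And>p. p \<in> carrier W \<Longrightarrow> bij p" "\<And>p. p \<in> carrier W \<Longrightarrow> Hilbert_Choice.inv p \<in> carrier W"
  shows "group W"
proof (rule groupI)
  fix x assume "x \<in> carrier W"
  then show "\<exists>y\<in>carrier W. y \<otimes>\<^bsub>W\<^esub> x = \<one>\<^bsub>W\<^esub>"
    using assms by (intro bexI[of _ "Hilbert_Choice.inv x"]) (auto simp: bij_is_inj)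
qed (use assms in \<open>auto simp: comp_assoc\<close>)

lemma group_weyl_A: "group (weyl_A m)"
  by (rule group_permutes)
    (auto simp: weyl_A_def permutes_id permutes_compose permutes_bij permutes_inv)

lemma signed_perms_uminus: "p \<in> signed_perms m \<Longrightarrow> p (- i) = - p i"
  by (auto simp: signed_perms_def)

lemma signed_perms_inv: "p \<in> signed_perms m \<Longrightarrow> Hilbert_Choice.inv p \<in> signed_perms m"
  unfolding signed_perms_def
proof safe
  fix i assume p: "p permutes {- int m..int m}" "\<forall>i. p (- i) = - p i"
  then show "Hilbert_Choice.inv p permutes {- int m..int m}" by (simp add: permutes_inv)
  have "p (- Hilbert_Choice.inv p i) = - i" using p by (simp add: permutes_inverses)
  then show "Hilbert_Choice.inv p (- i) = - Hilbert_Choice.inv p i" using permutes_inv_eq[OF p(1)] by blast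
qed

lemma signed_perms_comp: "p \<in> signed_perms m \<Longrightarrow> q \<in> signed_perms m \<Longrightarrow> p \<circ> q \<in> signed_perms m"
  by (auto simp: signed_perms_def permutes_compose)

lemma signed_perms_id: "id \<in> signed_perms m"
  by (auto simp: signed_perms_def permutes_id)

lemma signed_perms_bij: "p \<in> signed_perms m \<Longrightarrow> bij p"
  by (auto simp: signed_perms_def permutes_bij)

lemma signed_perms_0: "p \<in> signed_perms m \<Longrightarrow> p 0 = 0"
  using signed_perms_uminus[of p m 0] by simp

lemma signed_perms_eq_0: "p \<in> signed_perms m \<Longrightarrow> p i = 0 \<longleftrightarrow> i = 0"
  using signed_perms_0 signed_perms_bij by (metis bij_pointE)

lemma signed_perms_range:
  "p \<in> signed_perms m \<Longrightarrow> - int m \<le> p i \<and> p i \<le> int m \<longleftrightarrow> - int m \<le> i \<and> i \<le> int m"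
  using permutes_in_image[of p "{- int m..int m}" i] by (auto simp: signed_perms_def)

lemma signed_perms_inj: "p \<in> signed_perms m \<Longrightarrow> p i = p j \<longleftrightarrow> i = j"
  using signed_perms_bij by (metis bij_pointE)

lemma group_weyl_B: "group (weyl_B m)"
  by (rule group_permutes)
    (auto simp: weyl_B_def signed_perms_id signed_perms_comp signed_perms_bij signed_perms_inv)

text \<open>The sign character whose kernel among the signed permutations is the group of type D. As
  a product of signs, rather than the parity of a count, it is seen to be multiplicative by
  reindexing.\<close>

definition sgn_char :: "nat \<Rightarrow> (int \<Rightarrow> int) \<Rightarrow> int" where
  "sgn_char m p = (\<Prod>i\<in>{1..int m}. sgn (p i))"

lemma sgn_char_eq:
  assumes "p \<in> signed_perms m"
  shows "sgn_char m p = (-1) ^ card {i \<in> {1..int m}. p i < 0}"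
proof -
  have "sgn_char m p = (\<Prod>i\<in>{1..int m}. if p i < 0 then -1 else 1)"
    unfolding sgn_char_def using signed_perms_eq_0[OF assms] by (intro prod.cong) (auto simp: sgn_if)
  also have "\<dots> = (-1) ^ card {i \<in> {1..int m}. p i < 0}"
    by (simp add: prod.If_cases Int_def)
  finally show ?thesis .
qed

text \<open>\<open>p\<close> is odd, so the sign of \<open>p (q i)\<close> splits into the signs of
  \<open>p \<bar>q i\<bar>\<close> and of \<open>q i\<close>, and the map from \<open>i\<close> to
  \<open>\<bar>q i\<bar>\<close> permutes \<open>{1..int m}\<close>.\<close>

lemma sgn_char_comp:
  assumes p: "p \<in> signed_perms m" and q: "q \<in> signed_perms m"
  shows "sgn_char m (p \<circ> q) = sgn_char m p * sgn_char m q"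
proof -
  have b: "bij_betw (\<lambda>i. \<bar>q i\<bar>) {1..int m} {1..int m}"
  proof -
    have "inj_on (\<lambda>i. \<bar>q i\<bar>) {1..int m}"
    proof (rule inj_onI)
      fix i j assume ij: "i \<in> {1..int m}" "j \<in> {1..int m}" "\<bar>q i\<bar> = \<bar>q j\<bar>"
      then have "q i = q j \<or> q i = q (- j)" using signed_perms_uminus[OF q] by (auto simp: abs_if split: if_splits)
      then show "i = j" using signed_perms_inj[OF q] ij by auto
    qed
    moreover have "(\<lambda>i. \<bar>q i\<bar>) ` {1..int m} \<subseteq> {1..int m}"
    proof safe
      fix i assume "i \<in> {1..int m}"
      then show "\<bar>q i\<bar> \<in> {1..int m}" using signed_perms_range[OF q, of i] signed_perms_eq_0[OF q, of i] by auto
    qed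
    ultimately show ?thesis by (simp add: bij_betw_def endo_inj_surj)
  qed
  have e: "sgn (p (q i)) = sgn (p \<bar>q i\<bar>) * sgn (q i)" if "i \<in> {1..int m}" for i
    using that signed_perms_uminus[OF p, of "q i"] signed_perms_eq_0[OF q, of i]
    by (cases "q i > 0") (auto simp: sgn_minus)
  have "sgn_char m (p \<circ> q) = (\<Prod>i\<in>{1..int m}. sgn (p \<bar>q i\<bar>)) * sgn_char m q"
    unfolding sgn_char_def using e by (simp add: prod.distrib)
  also have "(\<Prod>i\<in>{1..int m}. sgn (p \<bar>q i\<bar>)) = sgn_char m p"
    unfolding sgn_char_def using prod.reindex_bij_betw[OF b, of "\<lambda>i. sgn (p i)"] by simp
  finally show ?thesis .
qed

lemma weyl_D_carrier: "p \<in> carrier (weyl_D m) \<longleftrightarrow> p \<in> signed_perms m \<and> sgn_char m p = 1"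
  by (auto simp: weyl_D_def sgn_char_eq minus_one_power_iff split: if_splits)

lemma sgn_char_id: "sgn_char m id = 1"
  by (simp add: sgn_char_def)

lemma group_weyl_D: "group (weyl_D m)"
proof (rule group_permutes)
  fix p assume p: "p \<in> carrier (weyl_D m)"
  then have "Hilbert_Choice.inv p \<in> signed_perms m" "p \<in> signed_perms m"
    using signed_perms_inv weyl_D_carrier by auto
  moreover have "p \<circ> Hilbert_Choice.inv p = id"
    using p weyl_D_carrier signed_perms_bij by (metis bij_is_surj surj_iff)
  ultimately show "Hilbert_Choice.inv p \<in> carrier (weyl_D m)"
    using sgn_char_comp[of p m "Hilbert_Choice.inv p"] sgn_char_id p weyl_D_carrier by auto
qed (auto simp: weyl_D_carrier sgn_char_comp sgn_char_id signed_perms_id signed_perms_comp signed_perms_bij,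
    auto simp: weyl_D_def)

lemma transpose_signed:
  assumes "j \<noteq> 0" "j \<le> int m" "- int m \<le> j" shows "Transposition.transpose j (- j) \<in> signed_perms m"
proof -
  have "Transposition.transpose j (- j) (- i) = - Transposition.transpose j (- j) i" for i
    using assms by (cases "i = j"; cases "i = - j") (simp_all add: transpose_apply_other)
  then show ?thesis unfolding signed_perms_def using assms by (simp add: permutes_swap_id)
qed

lemma signed_swap_signed:
  assumes "i \<noteq> 0" "- j < i" "i < j" "j \<le> int m"
  shows "signed_swap i j \<in> signed_perms m"
proof -
  have "signed_swap i j permutes {- int m..int m}"
    unfolding signed_swap_def using assms by (intro permutes_compose permutes_swap_id) auto
  moreover have "signed_swap i j (- k) = - signed_swap i j k" for k
    unfolding signed_swap_app[OF assms(1-3)] using assms by (simp; linarith)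
  ultimately show ?thesis by (simp add: signed_perms_def)
qed

lemma sgn_char_signed_swap:
  assumes "i \<noteq> 0" "- j < i" "i < j" "j \<le> int m"
  shows "sgn_char m (signed_swap i j) = 1"
proof -
  have "sgn_char m (signed_swap i j) = (\<Prod>k\<in>{1..int m}. if k = \<bar>i\<bar> \<or> k = j then sgn i else 1)"
    unfolding sgn_char_def
  proof (intro prod.cong refl)
    fix k assume "k \<in> {1..int m}"
    then have k: "0 < k" by simp
    consider "k = j" | "k = i" "0 < i" | "k = - i" "i < 0" | "k \<noteq> j" "k \<noteq> \<bar>i\<bar>" using k by linarith
    then show "sgn (signed_swap i j k) = (if k = \<bar>i\<bar> \<or> k = j then sgn i else 1)"
    proof cases
      case 1 then show ?thesis using assms(1-3) by (simp add: signed_swap_app)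
    next
      case 2 then show ?thesis using assms(1-3) by (simp add: signed_swap_app)
    next
      case 3 then show ?thesis using assms(1-3) by (simp add: signed_swap_app)
    next
      case 4
      then have "k \<noteq> i" "k \<noteq> - i" "k \<noteq> - j" using k assms by linarith+
      then have "signed_swap i j k = k" using assms(1-3) 4 by (simp add: signed_swap_app)
      then show ?thesis using 4 k by simp
    qed
  qed
  also have "\<dots> = (\<Prod>k\<in>{\<bar>i\<bar>, j}. sgn i)"
    by (rule prod.mono_neutral_cong_right) (use assms in auto)
  also have "\<dots> = 1" using assms by (auto simp: sgn_if)
  finally show ?thesis .
qed

section \<open>The three families satisfy the root axioms\<close>

lemma root_action_weyl_A: "root_action (weyl_A m) pact converse prefl (rootsA m) (simpleA m)"
proof (rule root_action_pairs)
  show "gens (weyl_A m) = prefl ` simpleA m"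
    unfolding weyl_A_def simpleA_def by (simp add: image_image prefl_singleton)
  fix w assume w: "w \<in> carrier (weyl_A m)"
  then have wp: "w permutes {1..int m + 1}" by (simp add: weyl_A_def)
  show "w = id" if "\<And>\<alpha> i j. \<alpha> \<in> simpleA m \<Longrightarrow> (i, j) \<in> \<alpha> \<Longrightarrow> w i < w j"
  proof
    have mono: "w i < w (i + 1)" if "1 \<le> i" "i < int m + 1" for i
      using that \<open>\<And>\<alpha> i j. \<alpha> \<in> simpleA m \<Longrightarrow> (i, j) \<in> \<alpha> \<Longrightarrow> w i < w j\<close>[of "{(i, i + 1)}" i "i + 1"]
      by (auto simp: simpleA_def)
    have "w 1 \<in> {1..int m + 1}" "w (int m + 1) \<in> {1..int m + 1}"
      by (auto simp del: atLeastAtMost_iff simp: permutes_in_image[OF wp]) auto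
    then show "w i = id i" for i
      using int_increasing_eq_id[of "int m + 1" w i, OF mono] permutes_not_in[OF wp, of i] by force
  qed
next
  fix w r assume "w \<in> carrier (weyl_A m)" "r \<in> rootsA m"
  then obtain i j where ij: "r = {(i, j)}" "1 \<le> i" "i < j" "j \<le> int m + 1"
    and wp: "w permutes {1..int m + 1}" by (auto simp: weyl_A_def rootsA_def)
  have "w i \<in> {1..int m + 1}" "w j \<in> {1..int m + 1}" "w i \<noteq> w j"
    using ij wp permutes_in_image[OF wp] permutes_inj[OF wp] by (auto simp: inj_eq)
  then show "pact w r \<in> rootsA m \<or> (pact w r)\<inverse> \<in> rootsA m"
    using ij by (cases "w i < w j") (auto simp: pact_def rootsA_def)
next
  fix \<alpha> \<beta> i j assume a: "\<alpha> \<in> simpleA m" "\<beta> \<in> rootsA m" "(i, j) \<in> \<beta>" "\<beta> \<noteq> \<alpha>"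
  then have \<beta>: "\<beta> = {(i, j)}" "i < j" by (auto simp: rootsA_def)
  obtain k where k: "\<alpha> = {(k, k + 1)}" using a(1) by (auto simp: simpleA_def)
  show "prefl \<alpha> i < prefl \<alpha> j" using k \<beta> a(4) by (auto simp: prefl_singleton Transposition.transpose_def)
next
  show "simpleA m \<subseteq> rootsA m" by (auto simp: simpleA_def rootsA_def)
  show "bij w" if "w \<in> carrier (weyl_A m)" for w using that by (auto simp: weyl_A_def permutes_bij)
  show "prefl r \<in> carrier (weyl_A m)" if "r \<in> rootsA m" for r
    using that by (auto simp: weyl_A_def rootsA_def prefl_singleton intro!: permutes_swap_id)
  show "pos_matching r" if "r \<in> rootsA m" for r
    using that by (auto simp: rootsA_def pos_matching_singleton)
qed (simp_all add: group_weyl_A finite_roots, simp_all add: weyl_A_def)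

lemma signed_perms_all_pos:
  assumes w: "w \<in> signed_perms m" and mono: "\<And>i. 1 \<le> i \<Longrightarrow> i < int m \<Longrightarrow> w i < w (i + 1)" and "0 < w 1"
  shows "w = id"
proof
  fix i
  have pos: "w i = i" if "1 \<le> i" "i \<le> int m" for i
  proof (rule int_increasing_eq_id[of "int m" w, OF mono])
    show "w (int m) \<le> int m" using signed_perms_range[OF w, of "int m"] by auto
  qed (use that assms in auto)
  consider "i = 0" | "1 \<le> i" "i \<le> int m" | "1 \<le> - i" "- i \<le> int m" | "i \<notin> {- int m..int m}" by fastforce
  then show "w i = id i"
  proof cases
    case 3 then show ?thesis using pos[of "- i"] signed_perms_uminus[OF w, of i] by simp
  next
    case 4 then show ?thesis using w permutes_not_in[of w "{- int m..int m}" i] by (simp add: signed_perms_def)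
  qed (use pos signed_perms_0[OF w] in simp_all)
qed

lemma signed_perms_pact_cases:
  assumes w: "w \<in> signed_perms m" and ij: "i \<noteq> 0" "j \<noteq> 0" "i < j" "- int m \<le> i" "j \<le> int m"
  shows "pact w (sroot i j) = sroot (w i) (w j)" "w i \<noteq> w j" "w i \<noteq> 0" "w j \<noteq> 0"
    "- int m \<le> w i" "w i \<le> int m" "- int m \<le> w j" "w j \<le> int m" "w i = - w j \<longleftrightarrow> i = - j"
proof -
  have *: "- int m \<le> w i \<and> w i \<le> int m" "- int m \<le> w j \<and> w j \<le> int m"
    using ij signed_perms_range[OF w, of i] signed_perms_range[OF w, of j] by auto
  show "pact w (sroot i j) = sroot (w i) (w j)"
    by (intro pact_sroot signed_perms_uminus[OF w])
  show "w i = - w j \<longleftrightarrow> i = - j"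
    using signed_perms_inj[OF w, of i "- j"] signed_perms_uminus[OF w, of j] by simp
  show "w i \<noteq> w j" using signed_perms_inj[OF w, of i j] ij by simp
  show "w i \<noteq> 0" "w j \<noteq> 0" using signed_perms_eq_0[OF w] ij by simp_all
  show "- int m \<le> w i" "w i \<le> int m" "- int m \<le> w j" "w j \<le> int m" using * by simp_all
qed

lemma signed_swap_less:
  assumes "1 \<le> k" "i < j" "i \<noteq> 0" "j \<noteq> 0" "i = k \<longrightarrow> j \<noteq> k + 1" "i = - (k + 1) \<longrightarrow> j \<noteq> - k"
  shows "signed_swap k (k + 1) i < signed_swap k (k + 1) j"
proof -
  have k: "k \<noteq> 0" "- (k + 1) < k" "k < k + 1" using assms by auto
  show ?thesis unfolding signed_swap_app[OF k] using assms by (smt (verit))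
qed

lemma signed_swap_less':
  assumes "i < j" "i \<noteq> 0" "j \<noteq> 0" "i \<noteq> - j" "i = -1 \<longrightarrow> j \<noteq> 2" "i = -2 \<longrightarrow> j \<noteq> 1"
  shows "signed_swap (-1) 2 i < signed_swap (-1) 2 j"
proof -
  have s: "signed_swap (-1) 2 k = (if k = -1 then 2 else if k = 2 then -1 else if k = 1 then -2 else if k = -2 then 1 else k)" for k
    by (simp add: signed_swap_app)
  show ?thesis unfolding s using assms by (smt (verit))
qed

lemma transpose_less:
  fixes i j :: int
  assumes "i < j" "i \<noteq> 0" "j \<noteq> 0" "i = -1 \<longrightarrow> j \<noteq> 1"
  shows "Transposition.transpose 1 (-1) i < Transposition.transpose 1 (-1) j"
  unfolding Transposition.transpose_def using assms by (smt (verit))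

lemma sroot_neqD: "sroot i j \<noteq> sroot k l \<Longrightarrow> (i = k \<longrightarrow> j \<noteq> l) \<and> (i = - l \<longrightarrow> j \<noteq> - k)"
  using sroot_swap[of l k] by auto

lemma sroot_cases_rootsB:
  assumes "r \<in> rootsB m"
  obtains i j where "r = sroot i j" "i \<noteq> 0" "j \<noteq> 0" "- j \<le> i" "i < j" "- int m \<le> i" "j \<le> int m"
  using assms unfolding rootsB_def by auto

lemma root_action_weyl_B:
  assumes m: "m \<ge> 1"
  shows "root_action (weyl_B m) pact converse prefl (rootsB m) (simpleB m)"
proof (rule root_action_pairs)
  have simple_cases: "\<alpha> = sroot (-1) 1 \<or> (\<exists>k. \<alpha> = sroot k (k + 1) \<and> 1 \<le> k \<and> k < int m)" if "\<alpha> \<in> simpleB m" for \<alpha>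
    using that unfolding simpleB_def by auto
  show S: "simpleB m \<subseteq> rootsB m"
    unfolding simpleB_def using m by (auto intro: sroot_rootsB)
  have prefl1: "prefl (sroot (-1) 1) = Transposition.transpose 1 (-1)" using prefl_sroot_self[of 1] by simp
  show "gens (weyl_B m) = prefl ` simpleB m"
    unfolding weyl_B_def simpleB_def by (simp add: image_image prefl1 prefl_sroot cong: image_cong_simp)
  show "prefl r \<in> carrier (weyl_B m)" if "r \<in> rootsB m" for r
    using that
  proof (cases rule: sroot_cases_rootsB)
    case (1 i j)
    then show ?thesis using m transpose_signed[of j m] signed_swap_signed[of i j m]
      by (cases "i = - j") (simp_all add: weyl_B_def prefl_sroot_self prefl_sroot)
  qed
  fix w assume "w \<in> carrier (weyl_B m)"
  then have w: "w \<in> signed_perms m" by (simp add: weyl_B_def)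
  show "pact w r \<in> rootsB m \<or> (pact w r)\<inverse> \<in> rootsB m" if "r \<in> rootsB m" for r
    using that
  proof (cases rule: sroot_cases_rootsB)
    case (1 i j)
    note f = signed_perms_pact_cases[OF w 1(2,3,5,6,7)]
    show ?thesis
    proof (cases "w i < w j")
      case True
      then have "sroot (w i) (w j) \<in> rootsB m" using f(2-8) by (intro sroot_rootsB; linarith)
      then show ?thesis using f(1) 1(1) by simp
    next
      case False
      then have "sroot (w j) (w i) \<in> rootsB m" using f(2-8) by (intro sroot_rootsB; linarith)
      then show ?thesis using f(1) 1(1) by (simp add: converse_sroot)
    qed
  qed
  show "w = id" if a: "\<And>\<alpha> i j. \<alpha> \<in> simpleB m \<Longrightarrow> (i, j) \<in> \<alpha> \<Longrightarrow> w i < w j"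
  proof (rule signed_perms_all_pos[OF w])
    show "w i < w (i + 1)" if "1 \<le> i" "i < int m" for i
      using a[of "sroot i (i + 1)" i "i + 1"] that by (auto simp: simpleB_def sroot_def)
    show "0 < w 1" using a[of "sroot (-1) 1" "-1" 1] signed_perms_uminus[OF w, of 1] by (auto simp: simpleB_def sroot_def)
  qed
next
  fix \<alpha> \<beta> i j assume a: "\<alpha> \<in> simpleB m" "\<beta> \<in> rootsB m" "(i, j) \<in> \<beta>" "\<beta> \<noteq> \<alpha>"
  obtain p q where b: "\<beta> = sroot p q" "p \<noteq> 0" "q \<noteq> 0" "- q \<le> p" "p < q" using a(2) by (rule sroot_cases_rootsB)
  then have \<beta>: "\<beta> = sroot i j" "i < j" "i \<noteq> 0" "j \<noteq> 0" using a(3) by (auto simp: sroot_def)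
  have "\<alpha> = sroot (-1) 1 \<or> (\<exists>k. \<alpha> = sroot k (k + 1) \<and> 1 \<le> k \<and> k < int m)"
    using a(1) unfolding simpleB_def by auto
  then show "prefl \<alpha> i < prefl \<alpha> j"
  proof (elim disjE exE conjE)
    assume "\<alpha> = sroot (-1) 1"
    then show ?thesis using prefl_sroot_self[of 1] \<beta> a(4) transpose_less[of i j] sroot_neqD[of i j "-1" 1] by simp
  next
    fix k assume k: "\<alpha> = sroot k (k + 1)" "1 \<le> k" "k < int m"
    have "sroot i j \<noteq> sroot k (k + 1)" using a(4) \<beta>(1) k(1) by simp
    from signed_swap_less[OF k(2) \<beta>(2-4)] sroot_neqD[OF this] show ?thesis using k by (simp add: prefl_sroot)
  qed
next
  show "pos_matching r" if "r \<in> rootsB m" for r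
    using that by (cases rule: sroot_cases_rootsB) (simp add: pos_matching_sroot)
  show "bij w" if "w \<in> carrier (weyl_B m)" for w using that signed_perms_bij by (auto simp: weyl_B_def)
qed (simp_all add: group_weyl_B finite_roots, simp_all add: weyl_B_def)

lemma sroot_cases_rootsD:
  assumes "r \<in> rootsD m"
  obtains i j where "r = sroot i j" "i \<noteq> 0" "j \<noteq> 0" "- j < i" "i < j" "- int m \<le> i" "j \<le> int m"
  using assms unfolding rootsD_def by auto

lemma root_action_weyl_D:
  assumes m: "m \<ge> 2"
  shows "root_action (weyl_D m) pact converse prefl (rootsD m) (simpleD m)"
proof (rule root_action_pairs)
  show S: "simpleD m \<subseteq> rootsD m"
    unfolding simpleD_def using m by (auto intro: sroot_rootsD)
  have "signed_swap (-1) 2 k = signed_swap 1 (-2) k" for k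
    by (cases "k = 1"; cases "k = -1"; cases "k = 2"; cases "k = -2")
      (simp_all add: signed_swap_def transpose_apply_other)
  then have prefl1: "prefl (sroot (-1) 2) = signed_swap 1 (-2)"
    by (simp add: prefl_sroot fun_eq_iff)
  show "gens (weyl_D m) = prefl ` simpleD m"
    unfolding weyl_D_def simpleD_def by (simp add: image_image prefl1 prefl_sroot cong: image_cong_simp)
  show "prefl r \<in> carrier (weyl_D m)" if "r \<in> rootsD m" for r
    using that
  proof (cases rule: sroot_cases_rootsD)
    case (1 i j)
    then show ?thesis using signed_swap_signed[of i j m] sgn_char_signed_swap[of i j m]
      by (simp add: weyl_D_carrier prefl_sroot)
  qed
  fix w assume wD: "w \<in> carrier (weyl_D m)"
  then have w: "w \<in> signed_perms m" by (simp add: weyl_D_def)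
  show "pact w r \<in> rootsD m \<or> (pact w r)\<inverse> \<in> rootsD m" if "r \<in> rootsD m" for r
    using that
  proof (cases rule: sroot_cases_rootsD)
    case (1 i j)
    note f = signed_perms_pact_cases[OF w 1(2,3,5,6,7)]
    have g: "w i \<noteq> - w j" using f(9) 1(4) by auto
    show ?thesis
    proof (cases "w i < w j")
      case True
      then have "sroot (w i) (w j) \<in> rootsD m" using f(2-8) g by (intro sroot_rootsD; linarith)
      then show ?thesis using f(1) 1(1) by simp
    next
      case False
      then have "sroot (w j) (w i) \<in> rootsD m" using f(2-8) g by (intro sroot_rootsD; linarith)
      then show ?thesis using f(1) 1(1) by (simp add: converse_sroot)
    qed
  qed
  show "w = id" if a: "\<And>\<alpha> i j. \<alpha> \<in> simpleD m \<Longrightarrow> (i, j) \<in> \<alpha> \<Longrightarrow> w i < w j"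
  proof (rule signed_perms_all_pos[OF w])
    show mono: "w i < w (i + 1)" if "1 \<le> i" "i < int m" for i
      using a[of "sroot i (i + 1)" i "i + 1"] that by (auto simp: simpleD_def sroot_def)
    \<comment> \<open>Together these give \<open>0 < w 2\<close>, and then all later entries are
      positive as well. The sign character, which is 1 on this group, is thereby reduced to the sign
      of \<open>w 1\<close>.\<close>
    have 12: "w 1 < w 2" "- w 1 < w 2" using mono[of 1] m a[of "sroot (-1) 2" "-1" 2] signed_perms_uminus[OF w, of 1]
      by (auto simp: simpleD_def sroot_def)
    have pos: "0 < w i" if "2 \<le> i" "i \<le> int m" for i
      using that
    proof (induction i rule: int_ge_induct)
      case (step i) then show ?case using mono[of i] by auto
    qed (use 12 in auto)
    have "sgn_char m w = (\<Prod>i\<in>{1..int m}. if i = 1 then sgn (w 1) else 1)"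
      unfolding sgn_char_def
    proof (intro prod.cong refl)
      fix i assume "i \<in> {1..int m}"
      then show "sgn (w i) = (if i = 1 then sgn (w 1) else 1)" using pos[of i] by auto
    qed
    also have "\<dots> = sgn (w 1)" using m by (simp add: prod.delta)
    finally show "0 < w 1" using wD weyl_D_carrier by (auto simp: sgn_if split: if_splits)
  qed
next
  fix \<alpha> \<beta> i j assume a: "\<alpha> \<in> simpleD m" "\<beta> \<in> rootsD m" "(i, j) \<in> \<beta>" "\<beta> \<noteq> \<alpha>"
  obtain p q where b: "\<beta> = sroot p q" "p \<noteq> 0" "q \<noteq> 0" "- q < p" "p < q" using a(2) by (rule sroot_cases_rootsD)
  then have \<beta>: "\<beta> = sroot i j" "i < j" "i \<noteq> 0" "j \<noteq> 0" "i \<noteq> - j" using a(3) by (auto simp: sroot_def)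
  have "\<alpha> = sroot (-1) 2 \<or> (\<exists>k. \<alpha> = sroot k (k + 1) \<and> 1 \<le> k \<and> k < int m)"
    using a(1) unfolding simpleD_def by auto
  then show "prefl \<alpha> i < prefl \<alpha> j"
  proof (elim disjE exE conjE)
    assume k: "\<alpha> = sroot (-1) 2"
    then have "sroot i j \<noteq> sroot (-1) 2" using a(4) \<beta>(1) by simp
    from signed_swap_less'[OF \<beta>(2-5)] sroot_neqD[OF this] show ?thesis using k by (simp add: prefl_sroot)
  next
    fix k assume k: "\<alpha> = sroot k (k + 1)" "1 \<le> k" "k < int m"
    have "sroot i j \<noteq> sroot k (k + 1)" using a(4) \<beta>(1) k(1) by simp
    from signed_swap_less[OF k(2) \<beta>(2-4)] sroot_neqD[OF this] show ?thesis using k by (simp add: prefl_sroot)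
  qed
next
  show "pos_matching r" if "r \<in> rootsD m" for r
    using that by (cases rule: sroot_cases_rootsD) (simp add: pos_matching_sroot)
  show "bij w" if "w \<in> carrier (weyl_D m)" for w using that signed_perms_bij by (auto simp: weyl_D_def)
qed (simp_all add: group_weyl_D finite_roots del: One_nat_def, simp_all add: weyl_D_def)

section \<open>Descents and inversions of windows\<close>

definition desA :: "nat \<Rightarrow> (int \<Rightarrow> int) \<Rightarrow> nat" where
  "desA m w = (\<Sum>k\<in>{1..m}. of_bool (w (int k) > w (int k + 1)))"

definition desB :: "nat \<Rightarrow> (int \<Rightarrow> int) \<Rightarrow> nat" where
  "desB m w = of_bool (w 1 < 0) + (\<Sum>k\<in>{1..<m}. of_bool (w (int k) > w (int k + 1)))"

definition desD :: "nat \<Rightarrow> (int \<Rightarrow> int) \<Rightarrow> nat" where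
  "desD m w = of_bool (w 1 + w 2 < 0) + (\<Sum>k\<in>{1..<m}. of_bool (w (int k) > w (int k + 1)))"

definition lenA :: "nat \<Rightarrow> (int \<Rightarrow> int) \<Rightarrow> nat" where
  "lenA n w = (\<Sum>b\<in>{1..n}. \<Sum>a\<in>{1..<b}. of_bool (w (int a) > w (int b)))"

text \<open>The first indicator belongs to the root \<open>sroot a b\<close> and the second one to
  \<open>sroot (- a) b\<close>; \<open>lenB\<close> adds the roots
  \<open>sroot (- b) b\<close>.\<close>

definition lenD :: "nat \<Rightarrow> (int \<Rightarrow> int) \<Rightarrow> nat" where
  "lenD n w = (\<Sum>b\<in>{1..n}. \<Sum>a\<in>{1..<b}. of_bool (w (int a) > w (int b)) + of_bool (w (int a) + w (int b) < 0))"

definition lenB :: "nat \<Rightarrow> (int \<Rightarrow> int) \<Rightarrow> nat" where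
  "lenB n w = lenD n w + (\<Sum>b\<in>{1..n}. of_bool (w (int b) < 0))"

lemma card_Collect_image:
  assumes "inj_on f K" "finite K"
  shows "card {r \<in> f ` K. Q r} = (\<Sum>k\<in>K. of_bool (Q (f k)))"
proof -
  have "{r \<in> f ` K. Q r} = f ` {k \<in> K. Q (f k)}" by auto
  then have "card {r \<in> f ` K. Q r} = card {k \<in> K. Q (f k)}"
    using assms by (simp add: card_image inj_on_subset)
  also have "\<dots> = (\<Sum>k\<in>K. of_bool (Q (f k)))"
    using assms(2) by (simp add: of_bool_def sum.If_cases Int_def)
  finally show ?thesis .
qed

lemma root_action_pact_notin:
  assumes "root_action W pact converse rfl P S" "\<And>r. r \<in> P \<Longrightarrow> pos_matching r"
    and w: "w \<in> carrier W" and r: "r \<in> P" and ij: "(i, j) \<in> r"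
  shows "pact w r \<notin> P \<longleftrightarrow> w i > w j"
proof -
  have mem: "(w i, w j) \<in> pact w r" "(w j, w i) \<in> (pact w r)\<inverse>"
    using ij by (force simp: pact_def)+
  show ?thesis
  proof (cases "pact w r \<in> P")
    case True
    then show ?thesis using assms(2)[OF True] mem by (auto simp: pos_matching_def)
  next
    case False
    then have "(pact w r)\<inverse> \<in> P" using root_action.act_P[OF assms(1) w r] by simp
    from assms(2)[OF this] show ?thesis using mem False by (auto simp: pos_matching_def)
  qed
qed

lemma pos_matching_rootsA: "r \<in> rootsA m \<Longrightarrow> pos_matching r"
  by (auto simp: rootsA_def pos_matching_singleton)

lemma pos_matching_rootsB: "r \<in> rootsB m \<Longrightarrow> pos_matching r"
  by (erule sroot_cases_rootsB) (simp add: pos_matching_sroot)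

lemma pos_matching_rootsD: "r \<in> rootsD m \<Longrightarrow> pos_matching r"
  using pos_matching_rootsB rootsD_B by blast

lemma sum_int_nat: "(\<Sum>i\<in>{1..int m}. f i) = (\<Sum>k\<in>{1..m}. f (int k))"
  by (rule sum.reindex_bij_witness[of _ int nat]) auto

lemma sum_int_nat': "(\<Sum>i\<in>{1..int m - 1}. f i) = (\<Sum>k\<in>{1..<m}. f (int k))"
  by (rule sum.reindex_bij_witness[of _ int nat]) auto

lemma sum_int_nat'': "(\<Sum>i\<in>{1..<int m}. f i) = (\<Sum>k\<in>{1..<m}. f (int k))"
  by (rule sum.reindex_bij_witness[of _ int nat]) auto

lemma cox_des_weyl_A:
  assumes w: "w \<in> carrier (weyl_A m)" shows "cox_des (weyl_A m) w = desA m w"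
proof -
  note R = root_action_weyl_A[of m]
  have S: "{(i, i + 1)} \<in> rootsA m" if "i \<in> {1..int m}" for i
    using that by (auto simp: rootsA_def)
  have "cox_des (weyl_A m) w = (\<Sum>i\<in>{1..int m}. of_bool (pact w {(i, i + 1)} \<notin> rootsA m))"
    unfolding root_action.cox_des_eq[OF R w] simpleA_def
    by (rule card_Collect_image) (auto simp: inj_on_def)
  also have "\<dots> = (\<Sum>i\<in>{1..int m}. of_bool (w i > w (i + 1)))"
    by (intro sum.cong refl arg_cong[of _ _ of_bool] root_action_pact_notin[OF R pos_matching_rootsA w S]) auto
  finally show ?thesis unfolding desA_def by (simp add: sum_int_nat)
qed

lemma cox_inv_weyl_A:
  assumes w: "w \<in> carrier (weyl_A m)" shows "cox_inv (weyl_A m) w = lenA (m + 1) w"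
proof -
  note R = root_action_weyl_A[of m]
  define K where "K = (SIGMA j:{1..int (m + 1)}. {1..<j})"
  have roots: "rootsA m = (\<lambda>(j, i). {(i, j)}) ` K"
    unfolding rootsA_def K_def by (auto simp: image_iff)
  have "cox_inv (weyl_A m) w = (\<Sum>(j, i)\<in>K. of_bool (pact w {(i, j)} \<notin> rootsA m))"
    unfolding root_action.cox_inv_eq[OF R w] root_action.N_def[OF R]
    by (subst (1) roots, subst card_Collect_image) (auto simp: inj_on_def K_def case_prod_unfold)
  also have "\<dots> = (\<Sum>(j, i)\<in>K. of_bool (w i > w j))"
  proof (intro sum.cong refl, clarify)
    fix j i assume "(j, i) \<in> K"
    then have "{(i, j)} \<in> rootsA m" unfolding roots by (auto intro: rev_image_eqI)
    then show "of_bool (pact w {(i, j)} \<notin> rootsA m) = of_bool (w i > w j)"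
      using root_action_pact_notin[OF R pos_matching_rootsA w, where r = "{(i, j)}" and i = i and j = j] by simp
  qed
  also have "\<dots> = (\<Sum>j\<in>{1..int (m + 1)}. \<Sum>i\<in>{1..<j}. of_bool (w i > w j))"
    unfolding K_def by (subst sum.Sigma) auto
  finally show ?thesis unfolding lenA_def by (simp only: sum_int_nat sum_int_nat'')
qed

lemma inj_on_sroot_simple: "inj_on (\<lambda>i. sroot i (i + 1)) {1..int m - 1}"
  by (rule inj_onI) (auto simp: sroot_def doubleton_eq_iff)

text \<open>Types B and D differ here only in the extra simple root \<open>sroot (-1) j\<close>,
  with \<open>j = 1\<close> and \<open>j = 2\<close>.\<close>

lemma cox_des_signed:
  assumes R: "root_action W pact converse rfl P (insert (sroot (-1) j) ((\<lambda>i. sroot i (i + 1)) ` {1..int m - 1}))"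
    and P: "\<And>r. r \<in> P \<Longrightarrow> pos_matching r" and w: "w \<in> carrier W" and j: "0 < j"
  shows "cox_des W w = of_bool (w (-1) > w j) + (\<Sum>k\<in>{1..<m}. of_bool (w (int k) > w (int k + 1)))"
proof -
  let ?T = "(\<lambda>i. sroot i (i + 1)) ` {1..int m - 1}"
  have notin: "sroot (-1) j \<notin> ?T" using j by (auto simp: sroot_def doubleton_eq_iff)
  have S: "insert (sroot (-1) j) ?T \<subseteq> P" using root_action.S_P[OF R] .
  have "{\<alpha> \<in> insert (sroot (-1) j) ?T. pact w \<alpha> \<notin> P} =
      (if pact w (sroot (-1) j) \<notin> P then insert (sroot (-1) j) {\<alpha> \<in> ?T. pact w \<alpha> \<notin> P} else {\<alpha> \<in> ?T. pact w \<alpha> \<notin> P})"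
    by auto
  then have "cox_des W w = of_bool (pact w (sroot (-1) j) \<notin> P) + card {\<alpha> \<in> ?T. pact w \<alpha> \<notin> P}"
    unfolding root_action.cox_des_eq[OF R w] using notin by simp
  also have "card {\<alpha> \<in> ?T. pact w \<alpha> \<notin> P} = (\<Sum>i\<in>{1..int m - 1}. of_bool (pact w (sroot i (i + 1)) \<notin> P))"
    by (rule card_Collect_image[OF inj_on_sroot_simple]) simp
  also have "\<dots> = (\<Sum>i\<in>{1..int m - 1}. of_bool (w i > w (i + 1)))"
    using S by (intro sum.cong refl arg_cong[of _ _ of_bool] root_action_pact_notin[OF R P w]) (auto simp: sroot_def)
  also have "pact w (sroot (-1) j) \<notin> P \<longleftrightarrow> w (-1) > w j"
    using S by (intro root_action_pact_notin[OF R P w]) (auto simp: sroot_def)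
  finally show ?thesis by (simp add: sum_int_nat')
qed

lemma weyl_B_signed: "w \<in> carrier (weyl_B m) \<Longrightarrow> w \<in> signed_perms m"
  by (simp add: weyl_B_def)

lemma weyl_D_signed: "w \<in> carrier (weyl_D m) \<Longrightarrow> w \<in> signed_perms m"
  by (simp add: weyl_D_def)

lemma cox_des_weyl_B:
  assumes "m \<ge> 1" and w: "w \<in> carrier (weyl_B m)" shows "cox_des (weyl_B m) w = desB m w"
proof -
  note R = root_action_weyl_B[OF assms(1)]
  have "w (-1) > w 1 \<longleftrightarrow> w 1 < 0" using signed_perms_uminus[OF weyl_B_signed[OF w], of 1] by auto
  then show ?thesis
    using cox_des_signed[OF R[unfolded simpleB_def] pos_matching_rootsB w] by (simp add: desB_def)
qed

lemma cox_des_weyl_D: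
  assumes "m \<ge> 2" and w: "w \<in> carrier (weyl_D m)" shows "cox_des (weyl_D m) w = desD m w"
proof -
  note R = root_action_weyl_D[OF assms(1)]
  have "w (-1) > w 2 \<longleftrightarrow> w 1 + w 2 < 0" using signed_perms_uminus[OF weyl_D_signed[OF w], of 1] by auto
  then show ?thesis
    using cox_des_signed[OF R[unfolded simpleD_def] pos_matching_rootsD w] by (simp add: desD_def)
qed

lemma inj_on_sroot: "inj_on (\<lambda>(j, i). sroot i j) {(j, i). - j \<le> i \<and> i < j}"
proof (rule inj_onI, clarify)
  fix j i j' i' assume a: "- j \<le> i" "i < j" "- j' \<le> i'" "i' < j'" and e: "sroot i j = sroot i' j'"
  have "(i, j) = (i', j') \<or> (i, j) = (- j', - i')" using e by (simp add: sroot_def doubleton_eq_iff) blast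
  then show "j = j' \<and> i = i'" using a by auto
qed

text \<open>\<open>A j\<close> contains the smaller ends \<open>i\<close> of the roots named
  \<open>sroot i j\<close>: all nonzero integers in \<open>{- j..<j}\<close> for type B, without
  \<open>- j\<close> for type D.\<close>

lemma cox_inv_signed:
  assumes R: "root_action W pact converse rfl P S" and P: "P = (\<lambda>(j, i). sroot i j) ` K"
    and K: "K = (SIGMA j:{1..int m}. A j)" "\<And>j. finite (A j)" "\<And>j. A j \<subseteq> {- j..<j}"
    and pos: "\<And>r. r \<in> P \<Longrightarrow> pos_matching r" and w: "w \<in> carrier W"
  shows "cox_inv W w = (\<Sum>b\<in>{1..m}. \<Sum>i\<in>A (int b). of_bool (w i > w (int b)))"
proof -
  have "inj_on (\<lambda>(j, i). sroot i j) K"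
    by (rule inj_on_subset[OF inj_on_sroot]) (use K in fastforce)
  then have "card {r \<in> (\<lambda>(j, i). sroot i j) ` K. pact w r \<notin> P} = (\<Sum>k\<in>K. of_bool (pact w ((\<lambda>(j, i). sroot i j) k) \<notin> P))"
    using K by (intro card_Collect_image) auto
  then have "cox_inv W w = (\<Sum>k\<in>K. of_bool (pact w ((\<lambda>(j, i). sroot i j) k) \<notin> P))"
    unfolding root_action.cox_inv_eq[OF R w] root_action.N_def[OF R] using P by simp
  also have "\<dots> = (\<Sum>(j, i)\<in>K. of_bool (w i > w j))"
  proof (intro sum.cong refl, clarify)
    fix j i assume "(j, i) \<in> K"
    then have "sroot i j \<in> P" unfolding P by (auto intro: rev_image_eqI)
    then show "of_bool (pact w (sroot i j) \<notin> P) = of_bool (w i > w j)"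
      using root_action_pact_notin[OF R pos w, of "sroot i j" i j] by (simp add: sroot_def)
  qed
  also have "\<dots> = (\<Sum>j\<in>{1..int m}. \<Sum>i\<in>A j. of_bool (w i > w j))"
    unfolding K(1) using K(2) by (subst sum.Sigma) auto
  finally show ?thesis by (simp only: sum_int_nat)
qed

lemma sum_signed_range:
  fixes g :: "int \<Rightarrow> nat"
  shows "(\<Sum>i\<in>{- int b<..<int b} - {0}. g i) = (\<Sum>a\<in>{1..<b}. g (int a) + g (- int a))"
proof -
  have "{- int b<..<int b} - {0} = {1..<int b} \<union> uminus ` {1..<int b}"
    by (auto simp: image_iff)
  moreover have "{1..<int b} \<inter> uminus ` {1..<int b} = {}" by auto
  ultimately have "(\<Sum>i\<in>{- int b<..<int b} - {0}. g i) = (\<Sum>i\<in>{1..<int b}. g i) + (\<Sum>i\<in>uminus ` {1..<int b}. g i)"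
    by (simp add: sum.union_disjoint)
  also have "(\<Sum>i\<in>uminus ` {1..<int b}. g i) = (\<Sum>i\<in>{1..<int b}. g (- i))"
    by (subst sum.reindex) (auto simp: inj_on_def)
  finally show ?thesis by (simp add: sum_int_nat'' sum.distrib)
qed

lemma cox_inv_weyl_D:
  assumes "m \<ge> 2" and w: "w \<in> carrier (weyl_D m)" shows "cox_inv (weyl_D m) w = lenD m w"
proof -
  note R = root_action_weyl_D[OF assms(1)]
  have roots: "rootsD m = (\<lambda>(j, i). sroot i j) ` (SIGMA j:{1..int m}. {- j<..<j} - {0})"
    unfolding rootsD_def by (auto simp: image_iff)
  have *: "w (- i) > w j \<longleftrightarrow> w i + w j < 0" for i j
    using signed_perms_uminus[OF weyl_D_signed[OF w], of i] by auto
  have "cox_inv (weyl_D m) w = (\<Sum>b\<in>{1..m}. \<Sum>i\<in>{- int b<..<int b} - {0}. of_bool (w i > w (int b)))"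
    by (rule cox_inv_signed[OF R roots refl _ _ pos_matching_rootsD w]) auto
  then show ?thesis by (simp only: sum_signed_range lenD_def *)
qed

lemma cox_inv_weyl_B:
  assumes "m \<ge> 1" and w: "w \<in> carrier (weyl_B m)" shows "cox_inv (weyl_B m) w = lenB m w"
proof -
  note R = root_action_weyl_B[OF assms(1)]
  have roots: "rootsB m = (\<lambda>(j, i). sroot i j) ` (SIGMA j:{1..int m}. {- j..<j} - {0})"
    unfolding rootsB_def by (auto simp: image_iff)
  have *: "w (- i) > w j \<longleftrightarrow> w i + w j < 0" for i j
    using signed_perms_uminus[OF weyl_B_signed[OF w], of i] by auto
  have **: "w (int b) + w (int b) < 0 \<longleftrightarrow> w (int b) < 0" for b by auto
  have "cox_inv (weyl_B m) w = (\<Sum>b\<in>{1..m}. \<Sum>i\<in>{- int b..<int b} - {0}. of_bool (w i > w (int b)))"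
    by (rule cox_inv_signed[OF R roots refl _ _ pos_matching_rootsB w]) auto
  also have "\<dots> = (\<Sum>b\<in>{1..m}. of_bool (w (- int b) > w (int b)) + (\<Sum>i\<in>{- int b<..<int b} - {0}. of_bool (w i > w (int b))))"
  proof (intro sum.cong refl)
    fix b assume b: "b \<in> {1..m}"
    then have "{- int b..<int b} - {0} = insert (- int b) ({- int b<..<int b} - {0})" by auto
    then show "(\<Sum>i\<in>{- int b..<int b} - {0}. of_bool (w i > w (int b))) =
       (of_bool (w (- int b) > w (int b)) + (\<Sum>i\<in>{- int b<..<int b} - {0}. of_bool (w i > w (int b))) :: nat)"
      by simp
  qed
  finally show ?thesis by (simp only: sum_signed_range lenD_def lenB_def * ** sum.distrib add.commute)
qed

section \<open>Generating functions over lists of signed entries\<close>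

fun desl :: "int list \<Rightarrow> nat" where
  "desl (x # y # xs) = of_bool (x > y) + desl (y # xs)"
| "desl _ = 0"

fun pairs :: "(int \<Rightarrow> int \<Rightarrow> nat) \<Rightarrow> int list \<Rightarrow> nat" where
  "pairs g [] = 0"
| "pairs g (x # xs) = (\<Sum>y\<leftarrow>xs. g x y) + pairs g xs"

text \<open>All generating functions over windows are computed by inserting an entry of largest
  absolute value into a shorter window, at any place and with any admissible sign.\<close>

definition ins :: "nat \<Rightarrow> 'a \<Rightarrow> 'a list \<Rightarrow> 'a list" where
  "ins i e ys = take i ys @ e # drop i ys"

text \<open>The flag \<open>pm\<close> permits negative entries: windows of signed permutations
  instead of permutations.\<close>

definition wins :: "bool \<Rightarrow> nat \<Rightarrow> int list set" where
  "wins pm n = {xs. distinct (map abs xs) \<and> abs ` set xs = {1..int n} \<and> (pm \<or> (\<forall>x\<in>set xs. 0 < x))}"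

definition signs :: "bool \<Rightarrow> nat \<Rightarrow> int set" where
  "signs pm n = (if pm then {int n, - int n} else {int n})"

lemma wins_length: "xs \<in> wins pm n \<Longrightarrow> length xs = n"
  unfolding wins_def by (auto dest!: distinct_card)

lemma wins_abs: "xs \<in> wins pm n \<Longrightarrow> x \<in> set xs \<Longrightarrow> \<bar>x\<bar> \<in> {1..int n}"
  unfolding wins_def by blast

lemma wins_0: "wins pm 0 = {[]}"
  using wins_length[of _ pm 0] by (auto simp: wins_def)

lemma set_ins: "set (ins i e ys) = insert e (set ys)"
proof -
  have "set (take i ys) \<union> set (drop i ys) = set ys" by (metis append_take_drop_id set_append)
  then show ?thesis by (auto simp: ins_def)
qed

lemma ins_wins:
  assumes "ys \<in> wins pm n" "e \<in> signs pm (Suc n)"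
  shows "ins i e ys \<in> wins pm (Suc n)"
proof -
  have e: "\<bar>e\<bar> = int (Suc n)" "pm \<or> 0 < e" using assms(2) by (auto simp: signs_def split: if_splits)
  have "\<bar>e\<bar> \<notin> abs ` set ys" using assms(1) e by (auto simp: wins_def)
  moreover have "distinct (map abs (take i ys) @ map abs (drop i ys))"
    using assms(1) by (simp add: wins_def flip: map_append)
  moreover have "abs ` set (take i ys) \<subseteq> abs ` set ys" "abs ` set (drop i ys) \<subseteq> abs ` set ys"
    by (auto dest: in_set_takeD in_set_dropD)
  ultimately have "distinct (map abs (ins i e ys))" by (auto simp: ins_def)
  moreover have "abs ` set (ins i e ys) = {1..int (Suc n)}"
    using assms(1) e by (auto simp: set_ins wins_def)
  ultimately show ?thesis using assms(1) e by (auto simp: wins_def set_ins)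
qed

text \<open>The inserted entry is the only one of absolute value \<open>Suc n\<close>, so cutting
  the list at it recovers the shorter window and the place.\<close>

lemma bij_ins:
  "bij_betw (\<lambda>(e, ys, i). ins i e ys) (signs pm (Suc n) \<times> wins pm n \<times> {..n}) (wins pm (Suc n))"
proof (rule bij_betw_imageI)
  have tw: "takeWhile (\<lambda>x. \<bar>x\<bar> \<noteq> int (Suc n)) (ins i e ys) = take i ys \<and> dropWhile (\<lambda>x. \<bar>x\<bar> \<noteq> int (Suc n)) (ins i e ys) = e # drop i ys"
    if "e \<in> signs pm (Suc n)" "ys \<in> wins pm n" for e ys i
  proof -
    have "\<bar>x\<bar> \<noteq> int (Suc n)" if "x \<in> set (take i ys)" for x
      using wins_abs[OF \<open>ys \<in> wins pm n\<close> in_set_takeD[OF that]] by auto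
    moreover have "\<bar>e\<bar> = int (Suc n)" using that(1) by (auto simp: signs_def split: if_splits)
    ultimately show ?thesis by (simp add: ins_def takeWhile_append2 dropWhile_append2)
  qed
  show "inj_on (\<lambda>(e, ys, i). ins i e ys) (signs pm (Suc n) \<times> wins pm n \<times> {..n})"
  proof (rule inj_onI)
    fix p q assume pq: "p \<in> signs pm (Suc n) \<times> wins pm n \<times> {..n}" "q \<in> signs pm (Suc n) \<times> wins pm n \<times> {..n}"
      "(case p of (e, ys, i) \<Rightarrow> ins i e ys) = (case q of (e, ys, i) \<Rightarrow> ins i e ys)"
    obtain e ys i e' ys' i' where c: "p = (e, ys, i)" "q = (e', ys', i')" by (cases p, cases q)
    have a: "e \<in> signs pm (Suc n)" "ys \<in> wins pm n" "i \<in> {..n}"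
      "e' \<in> signs pm (Suc n)" "ys' \<in> wins pm n" "i' \<in> {..n}" and eq: "ins i e ys = ins i' e' ys'"
      using pq c by auto
    have 1: "take i ys = take i' ys'" "e # drop i ys = e' # drop i' ys'"
      using tw[OF a(1,2), of i] tw[OF a(4,5), of i'] eq by simp_all
    then have "ys = ys'" by (metis append_take_drop_id list.inject)
    moreover have "i = i'" using arg_cong[OF 1(1), of length] a wins_length by simp
    ultimately show "p = q" using 1 c by simp
  qed
  show "(\<lambda>(e, ys, i). ins i e ys) ` (signs pm (Suc n) \<times> wins pm n \<times> {..n}) = wins pm (Suc n)"
  proof (intro equalityI subsetI)
    fix xs assume xs: "xs \<in> wins pm (Suc n)"
    have "int (Suc n) \<in> abs ` set xs" using xs by (auto simp: wins_def)
    then obtain e where e: "e \<in> set xs" "\<bar>e\<bar> = int (Suc n)" by auto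
    obtain us vs where uv: "xs = us @ e # vs" using e(1) by (meson split_list)
    have "e \<in> signs pm (Suc n)" using e xs by (auto simp: signs_def wins_def abs_if split: if_splits)
    moreover have "us @ vs \<in> wins pm n"
    proof -
      have d: "distinct (map abs (us @ vs))" "\<bar>e\<bar> \<notin> abs ` set (us @ vs)" using xs uv by (auto simp: wins_def)
      have "insert \<bar>e\<bar> (abs ` set (us @ vs)) = abs ` set xs" using uv by auto
      then have "abs ` set (us @ vs) = abs ` set xs - {\<bar>e\<bar>}"
        using d(2) by (metis Diff_insert_absorb)
      also have "\<dots> = {1..int (Suc n)} - {int (Suc n)}" using xs e(2) by (simp add: wins_def)
      also have "\<dots> = {1..int n}" by auto
      finally show ?thesis using d xs uv by (auto simp: wins_def)
    qed
    moreover have "ins (length us) e (us @ vs) = xs" by (simp add: ins_def uv)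
    moreover have "length us \<le> n" using wins_length[OF xs] uv by simp
    ultimately show "xs \<in> (\<lambda>(e, ys, i). ins i e ys) ` (signs pm (Suc n) \<times> wins pm n \<times> {..n})"
      by (auto intro!: image_eqI[of _ _ "(e, us @ vs, length us)"])
  qed (auto intro: ins_wins)
qed

lemma finite_wins: "finite (wins pm n)"
proof (induction n)
  case (Suc n)
  then have "finite (signs pm (Suc n) \<times> wins pm n \<times> {..n})" by (auto simp: signs_def)
  then show ?case using bij_betw_finite[OF bij_ins] by blast
qed (simp add: wins_0)

lemma sum_wins_Suc:
  fixes F :: "int list \<Rightarrow> 'b :: comm_monoid_add"
  shows "(\<Sum>xs\<in>wins pm (Suc n). F xs) = (\<Sum>e\<in>signs pm (Suc n). \<Sum>ys\<in>wins pm n. \<Sum>i\<le>n. F (ins i e ys))"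
proof -
  have "(\<Sum>xs\<in>wins pm (Suc n). F xs) = (\<Sum>p\<in>signs pm (Suc n) \<times> wins pm n \<times> {..n}. F (case p of (e, ys, i) \<Rightarrow> ins i e ys))"
    by (rule sum.reindex_bij_betw[OF bij_ins, symmetric])
  then show ?thesis by (simp add: sum.cartesian_product case_prod_unfold)
qed

lemma card_signs: "card (signs pm (Suc n)) = (if pm then 2 else 1)"
  by (auto simp: signs_def)

lemma card_wins: "card (wins pm n) = (if pm then 2 ^ n else 1) * fact n"
proof (induction n)
  case (Suc n)
  have "card (wins pm (Suc n)) = (\<Sum>xs\<in>wins pm (Suc n). 1)" by simp
  also have "\<dots> = card (signs pm (Suc n)) * (card (wins pm n) * Suc n)" unfolding sum_wins_Suc by simp
  finally show ?case using Suc by (simp add: card_signs algebra_simps)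
qed (simp add: wins_0)

text \<open>A new maximum leaves the number of descents unchanged in every descent gap and at the
  end, and adds one in every ascent gap. The leading entry \<open>z\<close> forbids insertion in
  front. The complementary count is a difference in the ring, which avoids truncated
  subtraction.\<close>

lemma desl_ins_top:
  fixes F :: "nat \<Rightarrow> 'b :: comm_ring_1"
  assumes "\<And>y. y \<in> set (z # ys) \<Longrightarrow> y < e"
  shows "(\<Sum>i\<le>length ys. F (desl (z # ins i e ys))) =
    of_nat (desl (z # ys) + 1) * F (desl (z # ys)) + (of_nat (length ys) - of_nat (desl (z # ys))) * F (desl (z # ys) + 1)"
  using assms
proof (induction ys arbitrary: z F)
  case (Cons y ys)
  have "(\<Sum>i\<le>length (y # ys). F (desl (z # ins i e (y # ys)))) = F (desl (z # e # y # ys)) +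
     (\<Sum>i\<le>length ys. F (of_bool (z > y) + desl (y # ins i e ys)))"
    by (simp add: sum.atMost_Suc_shift ins_def del: sum.atMost_Suc)
  also have "(\<Sum>i\<le>length ys. F (of_bool (z > y) + desl (y # ins i e ys))) =
    of_nat (desl (y # ys) + 1) * F (of_bool (z > y) + desl (y # ys)) +
    (of_nat (length ys) - of_nat (desl (y # ys))) * F (of_bool (z > y) + (desl (y # ys) + 1))"
    by (rule Cons.IH) (use Cons.prems in auto)
  finally show ?case using Cons.prems[of z] Cons.prems[of y] by (simp add: algebra_simps)
qed (auto simp: ins_def)

text \<open>A new minimum differs from a new maximum only at the end of the list, where it creates a
  descent.\<close>

lemma desl_ins_bot:
  fixes F :: "nat \<Rightarrow> 'b :: comm_ring_1"
  assumes "\<And>y. y \<in> set (z # ys) \<Longrightarrow> e < y"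
  shows "(\<Sum>i\<le>length ys. F (desl (z # ins i e ys))) =
    of_nat (desl (z # ys)) * F (desl (z # ys)) + (of_nat (length ys) + 1 - of_nat (desl (z # ys))) * F (desl (z # ys) + 1)"
  using assms
proof (induction ys arbitrary: z F)
  case (Cons y ys)
  have "(\<Sum>i\<le>length (y # ys). F (desl (z # ins i e (y # ys)))) = F (desl (z # e # y # ys)) +
     (\<Sum>i\<le>length ys. F (of_bool (z > y) + desl (y # ins i e ys)))"
    by (simp add: sum.atMost_Suc_shift ins_def del: sum.atMost_Suc)
  also have "(\<Sum>i\<le>length ys. F (of_bool (z > y) + desl (y # ins i e ys))) =
    of_nat (desl (y # ys)) * F (of_bool (z > y) + desl (y # ys)) +
    (of_nat (length ys) + 1 - of_nat (desl (y # ys))) * F (of_bool (z > y) + (desl (y # ys) + 1))"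
    by (rule Cons.IH) (use Cons.prems in auto)
  finally show ?case using Cons.prems[of z] Cons.prems[of y] by (simp add: algebra_simps)
qed (auto simp: ins_def)

text \<open>The functionals \<open>F \<mapsto> (\<Sum>w. F (des w))\<close> on the symmetric and the hyperoctahedral groups.\<close>

primrec eulA :: "nat \<Rightarrow> (nat \<Rightarrow> 'b) \<Rightarrow> 'b :: comm_ring_1" where
  "eulA 0 F = F 0"
| "eulA (Suc n) F = eulA n (\<lambda>d. of_nat (d + 1) * F d + (of_nat n - of_nat d) * F (d + 1))"

primrec eulB :: "nat \<Rightarrow> (nat \<Rightarrow> 'b) \<Rightarrow> 'b :: comm_ring_1" where
  "eulB 0 F = F 0"
| "eulB (Suc n) F = eulB n (\<lambda>d. of_nat (2 * d + 1) * F d + (2 * (of_nat n - of_nat d) + 1) * F (d + 1))"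

text \<open>The leading 0 turns the type B descent at the sign of the first entry into an ordinary
  descent; in front of positive entries it contributes nothing, so that both types share one
  form.\<close>

lemma sum_wins_desl_A:
  fixes F :: "nat \<Rightarrow> 'b :: comm_ring_1"
  shows "(\<Sum>xs\<in>wins False n. F (desl (0 # xs))) = eulA n F"
proof (induction n arbitrary: F)
  case (Suc n)
  have "(\<Sum>xs\<in>wins False (Suc n). F (desl (0 # xs))) = (\<Sum>ys\<in>wins False n. \<Sum>i\<le>n. F (desl (0 # ins i (int (Suc n)) ys)))"
    by (simp add: sum_wins_Suc signs_def)
  also have "\<dots> = (\<Sum>ys\<in>wins False n. of_nat (desl (0 # ys) + 1) * F (desl (0 # ys)) + (of_nat n - of_nat (desl (0 # ys))) * F (desl (0 # ys) + 1))"
  proof (intro sum.cong refl)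
    fix ys assume ys: "ys \<in> wins False n"
    have "y < int (Suc n)" if "y \<in> set (0 # ys)" for y
      using that wins_abs[OF ys, of y] by auto
    from desl_ins_top[where z = 0 and ys = ys and F = F, OF this] wins_length[OF ys]
    show "(\<Sum>i\<le>n. F (desl (0 # ins i (int (Suc n)) ys))) = of_nat (desl (0 # ys) + 1) * F (desl (0 # ys)) + (of_nat n - of_nat (desl (0 # ys))) * F (desl (0 # ys) + 1)"
      by simp
  qed
  finally show ?case using Suc by simp
qed (simp add: wins_0)

lemma sum_wins_desl_B:
  fixes F :: "nat \<Rightarrow> 'b :: comm_ring_1"
  shows "(\<Sum>xs\<in>wins True n. F (desl (0 # xs))) = eulB n F"
proof (induction n arbitrary: F)
  case (Suc n)
  have "(\<Sum>xs\<in>wins True (Suc n). F (desl (0 # xs))) = (\<Sum>ys\<in>wins True n.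
      (\<Sum>i\<le>n. F (desl (0 # ins i (int (Suc n)) ys))) + (\<Sum>i\<le>n. F (desl (0 # ins i (- int (Suc n)) ys))))"
    by (simp add: sum_wins_Suc signs_def sum.distrib)
  also have "\<dots> = (\<Sum>ys\<in>wins True n. of_nat (2 * desl (0 # ys) + 1) * F (desl (0 # ys)) + (2 * (of_nat n - of_nat (desl (0 # ys))) + 1) * F (desl (0 # ys) + 1))"
  proof (intro sum.cong refl)
    fix ys assume ys: "ys \<in> wins True n"
    have top: "y < int (Suc n)" if "y \<in> set (0 # ys)" for y
      using that wins_abs[OF ys, of y] by auto
    have bot: "- int (Suc n) < y" if "y \<in> set (0 # ys)" for y
      using that wins_abs[OF ys, of y] by auto
    have t: "(\<Sum>i\<le>n. F (desl (0 # ins i (int (Suc n)) ys))) =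
        of_nat (desl (0 # ys) + 1) * F (desl (0 # ys)) + (of_nat n - of_nat (desl (0 # ys))) * F (desl (0 # ys) + 1)"
      using desl_ins_top[where z = 0 and ys = ys and F = F, OF top] wins_length[OF ys] by simp
    have b: "(\<Sum>i\<le>n. F (desl (0 # ins i (- int (Suc n)) ys))) =
        of_nat (desl (0 # ys)) * F (desl (0 # ys)) + (of_nat n + 1 - of_nat (desl (0 # ys))) * F (desl (0 # ys) + 1)"
      using desl_ins_bot[where z = 0 and ys = ys and F = F, OF bot] wins_length[OF ys] by simp
    show "(\<Sum>i\<le>n. F (desl (0 # ins i (int (Suc n)) ys))) + (\<Sum>i\<le>n. F (desl (0 # ins i (- int (Suc n)) ys))) =
      of_nat (2 * desl (0 # ys) + 1) * F (desl (0 # ys)) + (2 * (of_nat n - of_nat (desl (0 # ys))) + 1) * F (desl (0 # ys) + 1)"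
      unfolding t b by (simp add: algebra_simps)
  qed
  finally show ?case using Suc by simp
qed (simp add: wins_0)

text \<open>Without a leading entry, a maximum adds a descent in front but not at the end, and a
  minimum behaves the other way round. The counts therefore agree, so ordinary descents of signed
  windows are distributed like those of permutations.\<close>

lemma desl_ins_free:
  fixes F :: "nat \<Rightarrow> 'b :: comm_ring_1"
  assumes "(\<forall>y \<in> set ys. y < e) \<or> (\<forall>y \<in> set ys. e < y)"
  shows "(\<Sum>i\<le>length ys. F (desl (ins i e ys))) =
    of_nat (desl ys + 1) * F (desl ys) + (of_nat (length ys) - of_nat (desl ys)) * F (desl ys + 1)"
proof (cases ys)
  case (Cons z zs)
  have e: "(\<Sum>i\<le>length ys. F (desl (ins i e ys))) = F (desl (e # z # zs)) + (\<Sum>i\<le>length zs. F (desl (z # ins i e zs)))"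
    unfolding Cons by (simp add: sum.atMost_Suc_shift ins_def del: sum.atMost_Suc)
  from assms show ?thesis
  proof
    assume top: "\<forall>y \<in> set ys. y < e"
    then have s: "(\<Sum>i\<le>length zs. F (desl (z # ins i e zs))) = of_nat (desl (z # zs) + 1) * F (desl (z # zs)) +
      (of_nat (length zs) - of_nat (desl (z # zs))) * F (desl (z # zs) + 1)"
      by (intro desl_ins_top) (auto simp: Cons)
    have "desl (e # z # zs) = desl (z # zs) + 1" using top by (simp add: Cons)
    then show ?thesis unfolding e unfolding s Cons by (simp add: algebra_simps)
  next
    assume bot: "\<forall>y \<in> set ys. e < y"
    then have s: "(\<Sum>i\<le>length zs. F (desl (z # ins i e zs))) = of_nat (desl (z # zs)) * F (desl (z # zs)) +
      (of_nat (length zs) + 1 - of_nat (desl (z # zs))) * F (desl (z # zs) + 1)"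
      by (intro desl_ins_bot) (auto simp: Cons)
    have "desl (e # z # zs) = desl (z # zs)" using bot by (simp add: Cons)
    then show ?thesis unfolding e unfolding s Cons by (simp add: algebra_simps)
  qed
qed (simp add: ins_def)

lemma wins_True_cases:
  assumes ys: "ys \<in> wins True n" and e: "e \<in> signs True (Suc n)" and zs: "set zs \<subseteq> set ys"
  shows "(\<forall>y \<in> set zs. y < e) \<or> (\<forall>y \<in> set zs. e < y)"
proof -
  have "y < int (Suc n)" "- int (Suc n) < y" if "y \<in> set zs" for y
    using wins_abs[OF ys subsetD[OF zs that]] by auto
  then show ?thesis using e by (auto simp: signs_def)
qed

lemma sum_wins_desl_free:
  fixes F :: "nat \<Rightarrow> 'b :: comm_ring_1"
  shows "(\<Sum>xs\<in>wins True n. F (desl xs)) = 2 ^ n * eulA n F"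
proof (induction n arbitrary: F)
  case (Suc n)
  have "(\<Sum>xs\<in>wins True (Suc n). F (desl xs)) = (\<Sum>e\<in>signs True (Suc n). \<Sum>ys\<in>wins True n.
      of_nat (desl ys + 1) * F (desl ys) + (of_nat n - of_nat (desl ys)) * F (desl ys + 1))"
    unfolding sum_wins_Suc
  proof (intro sum.cong refl)
    fix e ys assume e: "e \<in> signs True (Suc n)" and ys: "ys \<in> wins True n"
    from desl_ins_free[OF wins_True_cases[OF ys e subset_refl], of F] wins_length[OF ys]
    show "(\<Sum>i\<le>n. F (desl (ins i e ys))) = of_nat (desl ys + 1) * F (desl ys) + (of_nat n - of_nat (desl ys)) * F (desl ys + 1)"
      by simp
  qed
  also have "\<dots> = 2 * (2 ^ n * eulA n (\<lambda>d. of_nat (d + 1) * F d + (of_nat n - of_nat d) * F (d + 1)))"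
    by (subst Suc.IH[symmetric]) (simp add: card_signs)
  finally show ?case by simp
qed (simp add: wins_0)

text \<open>Insertion in front leaves the whole old window as the tail, and insertion at any other
  place is an insertion into the old tail. These sums are the difference between types B and
  D.\<close>

lemma sum_wins_desl_tl:
  fixes F :: "nat \<Rightarrow> 'b :: comm_ring_1"
  shows "(\<Sum>xs\<in>wins True (Suc n). F (desl (tl xs))) = 2 ^ Suc n * of_nat (Suc n) * eulA n F"
proof (induction n arbitrary: F)
  case 0
  show ?case by (simp add: sum_wins_Suc wins_0 signs_def ins_def)
next
  case (Suc n)
  let ?G = "\<lambda>d. of_nat (d + 1) * F d + (of_nat n - of_nat d) * F (d + 1)"
  have "(\<Sum>xs\<in>wins True (Suc (Suc n)). F (desl (tl xs))) = (\<Sum>e\<in>signs True (Suc (Suc n)). \<Sum>ys\<in>wins True (Suc n). F (desl ys) + ?G (desl (tl ys)))"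
    unfolding sum_wins_Suc[where n = "Suc n"]
  proof (intro sum.cong refl)
    fix e ys assume e: "e \<in> signs True (Suc (Suc n))" and ys: "ys \<in> wins True (Suc n)"
    obtain z zs where zs: "ys = z # zs" using wins_length[OF ys] by (cases ys) auto
    have "(\<Sum>i\<le>Suc n. F (desl (tl (ins i e ys)))) = F (desl ys) + (\<Sum>i\<le>n. F (desl (ins i e zs)))"
      unfolding zs by (simp add: sum.atMost_Suc_shift ins_def del: sum.atMost_Suc)
    also have "(\<Sum>i\<le>n. F (desl (ins i e zs))) = ?G (desl zs)"
      using desl_ins_free[OF wins_True_cases[OF ys e, of zs], of F] wins_length[OF ys] zs by auto
    finally show "(\<Sum>i\<le>Suc n. F (desl (tl (ins i e ys)))) = F (desl ys) + ?G (desl (tl ys))" using zs by simp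
  qed
  also have "\<dots> = 2 * ((\<Sum>ys\<in>wins True (Suc n). F (desl ys)) + (\<Sum>ys\<in>wins True (Suc n). ?G (desl (tl ys))))"
    by (simp add: card_signs sum.distrib)
  also have "\<dots> = 2 * (2 ^ Suc n * eulA (Suc n) F + 2 ^ Suc n * of_nat (Suc n) * eulA n ?G)"
    by (simp only: sum_wins_desl_free[of F] Suc.IH[of ?G])
  finally show ?case by (simp add: algebra_simps)
qed

section \<open>Descents of type D\<close>

fun neg_hd :: "int list \<Rightarrow> int list" where
  "neg_hd (x # xs) = (- x) # xs"
| "neg_hd [] = []"

fun deslD :: "int list \<Rightarrow> nat" where
  "deslD (x # y # xs) = of_bool (x + y < 0) + desl (x # y # xs)"
| "deslD _ = 0"

lemma bij_neg_hd: "bij_betw neg_hd (wins True n) (wins True n)"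
proof (rule bij_betw_byWitness[where f' = neg_hd])
  show "neg_hd ` wins True n \<subseteq> wins True n"
  proof
    fix xs assume "xs \<in> neg_hd ` wins True n"
    then obtain ys where ys: "xs = neg_hd ys" "ys \<in> wins True n" by auto
    then show "xs \<in> wins True n" by (cases ys) (auto simp: wins_def)
  qed
  show "neg_hd ` wins True n \<subseteq> wins True n" by fact
  show "\<forall>a\<in>wins True n. neg_hd (neg_hd a) = a"
  proof
    fix a assume "a \<in> wins True n" show "neg_hd (neg_hd a) = a" by (cases a) auto
  qed
  then show "\<forall>a\<in>wins True n. neg_hd (neg_hd a) = a" .
qed

text \<open>Changing the sign of the first entry \<open>a\<close> exchanges the conditions
  \<open>a > b\<close> and \<open>a + b < 0\<close>, so both windows have the same
  \<open>deslD\<close>. It remains to see whether the second entry \<open>b\<close> lies above,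
  below or between \<open>a\<close> and \<open>- a\<close>, and each case gives the same right
  side.\<close>

lemma deslD_identity:
  fixes y :: "'b :: comm_ring_1"
  assumes xs: "xs \<in> wins True n" and n: "n \<ge> 2"
  shows "2 * (y ^ desl (0 # xs) + y ^ desl (0 # neg_hd xs)) - (y ^ deslD xs + y ^ deslD (neg_hd xs)) = 2 * y * y ^ desl (tl xs)"
proof -
  obtain a b r where r: "xs = a # b # r" using wins_length[OF xs] n by (cases xs; cases "tl xs") auto
  have "a \<noteq> 0" "b \<noteq> 0" "a \<noteq> b" "a \<noteq> - b" using xs wins_abs[OF xs, of a] wins_abs[OF xs, of b] by (auto simp: r wins_def)
  then consider "b > a" "b > - a" "a > 0" | "b > a" "b > - a" "a < 0" | "b < a" "b < - a" "a > 0" | "b < a" "b < - a" "a < 0"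
    | "b < a" "b > - a" | "b > a" "b < - a" by linarith
  then show ?thesis unfolding r by cases (simp_all add: algebra_simps)
qed

text \<open>Summing the identity over the involution \<open>neg_hd\<close> counts every window
  twice, and the factor 2 cancels. After halving in \<open>sum_des_D\<close> this is the classical
  relation D_n(t) = B_n(t) - n 2^(n-1) t A_(n-1)(t) between Eulerian polynomials, normalised to
  constant term 1.\<close>

lemma sum_wins_deslD:
  fixes y :: "'b :: {comm_ring_1, ring_char_0, idom}"
  assumes "n \<ge> 2"
  shows "(\<Sum>xs\<in>wins True n. y ^ deslD xs) = 2 * eulB n (\<lambda>d. y ^ d) - y * 2 ^ n * of_nat n * eulA (n - 1) (\<lambda>d. y ^ d)"
proof -
  obtain k where k: "n = Suc k" using assms by (cases n) auto
  have neg: "(\<Sum>xs\<in>wins True n. f (neg_hd xs)) = (\<Sum>xs\<in>wins True n. f xs)" for f :: "int list \<Rightarrow> 'b"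
    by (rule sum.reindex_bij_betw[OF bij_neg_hd])
  have "(\<Sum>xs\<in>wins True n. 2 * (y ^ desl (0 # xs) + y ^ desl (0 # neg_hd xs)) - (y ^ deslD xs + y ^ deslD (neg_hd xs))) =
     (\<Sum>xs\<in>wins True n. 2 * y * y ^ desl (tl xs))"
    using deslD_identity assms by (intro sum.cong refl) blast
  then have "2 * (2 * (\<Sum>xs\<in>wins True n. y ^ desl (0 # xs))) - 2 * (\<Sum>xs\<in>wins True n. y ^ deslD xs) = 2 * (y * (\<Sum>xs\<in>wins True n. y ^ desl (tl xs)))"
    using neg[of "\<lambda>xs. y ^ desl (0 # xs)"] neg[of "\<lambda>xs. y ^ deslD xs"]
    by (simp add: sum_subtractf sum.distrib sum_distrib_left[symmetric] mult.assoc)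
  then have "2 * (\<Sum>xs\<in>wins True n. y ^ desl (0 # xs)) - (\<Sum>xs\<in>wins True n. y ^ deslD xs) = y * (\<Sum>xs\<in>wins True n. y ^ desl (tl xs))"
    by (metis mult_left_cancel right_diff_distrib zero_neq_numeral)
  moreover have "(\<Sum>xs\<in>wins True n. y ^ desl (tl xs)) = 2 ^ n * of_nat n * eulA (n - 1) (\<lambda>d. y ^ d)"
    using sum_wins_desl_tl[of "\<lambda>d. y ^ d" k] k by simp
  ultimately show ?thesis by (simp add: sum_wins_desl_B algebra_simps)
qed

section \<open>Inversions of windows\<close>

lemma pairs_append: "pairs g (xs @ ys) = pairs g xs + pairs g ys + (\<Sum>x\<leftarrow>xs. \<Sum>y\<leftarrow>ys. g x y)"
  by (induction xs) (auto simp: algebra_simps)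

lemma pairs_ins: "pairs g (ins i e ys) = pairs g ys + (\<Sum>x\<leftarrow>take i ys. g x e) + (\<Sum>y\<leftarrow>drop i ys. g e y)"
proof -
  have "pairs g ys = pairs g (take i ys @ drop i ys)" by simp
  then show ?thesis unfolding ins_def pairs_append by (simp add: algebra_simps sum_list_addf)
qed

definition gA :: "int \<Rightarrow> int \<Rightarrow> nat" where "gA x y = of_bool (x > y)"
definition gD :: "int \<Rightarrow> int \<Rightarrow> nat" where "gD x y = of_bool (x > y) + of_bool (x + y < 0)"

lemma sum_list_const_on: "(\<And>x. x \<in> set xs \<Longrightarrow> f x = (c::nat)) \<Longrightarrow> (\<Sum>x\<leftarrow>xs. f x) = length xs * c"
  by (induction xs) auto

lemma sum_list_take_drop:
  fixes f :: "int \<Rightarrow> nat"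
  assumes "\<And>y. y \<in> set ys \<Longrightarrow> f y = c" "i \<le> length ys"
  shows "(\<Sum>y\<leftarrow>take i ys. f y) = i * c" "(\<Sum>y\<leftarrow>drop i ys. f y) = (length ys - i) * c"
  using sum_list_const_on[of "take i ys" f c, OF assms(1)[OF in_set_takeD]]
    sum_list_const_on[of "drop i ys" f c, OF assms(1)[OF in_set_dropD]] assms(2) by simp_all

text \<open>A positive entry that dominates all others is counted exactly once with each entry
  behind it.\<close>

lemma pairs_ins_pos:
  assumes "\<And>y. y \<in> set ys \<Longrightarrow> \<bar>y\<bar> < e" "i \<le> length ys"
  shows "pairs gA (ins i e ys) = pairs gA ys + (length ys - i)" "pairs gD (ins i e ys) = pairs gD ys + (length ys - i)"
proof -
  have g: "gA x e = 0" "gD x e = 0" "gA e x = 1" "gD e x = 1" if "x \<in> set ys" for x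
    using assms(1)[OF that] by (auto simp: gA_def gD_def)
  show "pairs gA (ins i e ys) = pairs gA ys + (length ys - i)"
    using sum_list_take_drop(1)[where f = "\<lambda>x. gA x e", OF g(1) assms(2)]
      sum_list_take_drop(2)[where f = "gA e", OF g(3) assms(2)] by (simp add: pairs_ins)
  show "pairs gD (ins i e ys) = pairs gD ys + (length ys - i)"
    using sum_list_take_drop(1)[where f = "\<lambda>x. gD x e", OF g(2) assms(2)]
      sum_list_take_drop(2)[where f = "gD e", OF g(4) assms(2)] by (simp add: pairs_ins)
qed

text \<open>A negative entry of dominating absolute value is counted twice with each entry in front
  of it and once with each entry behind it, in total \<open>2 * i + (length ys - i)\<close>.\<close>

lemma pairs_ins_neg:
  assumes "\<And>y. y \<in> set ys \<Longrightarrow> \<bar>y\<bar> < e" "i \<le> length ys"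
  shows "pairs gD (ins i (- e) ys) = pairs gD ys + (length ys + i)"
proof -
  have g: "gD x (- e) = 2" "gD (- e) x = 1" if "x \<in> set ys" for x
    using assms(1)[OF that] by (auto simp: gD_def)
  show ?thesis using assms(2) sum_list_take_drop(1)[where f = "\<lambda>x. gD x (- e)", OF g(1) assms(2)]
      sum_list_take_drop(2)[where f = "gD (- e)", OF g(2) assms(2)] by (simp add: pairs_ins)
qed

lemma sum_wins_pairs_A: "(\<Sum>xs\<in>wins False n. y ^ pairs gA xs) = (\<Prod>k\<in>{1..n}. \<Sum>j<k. (y :: 'b :: comm_ring_1) ^ j)"
proof (induction n)
  case (Suc n)
  have "(\<Sum>xs\<in>wins False (Suc n). y ^ pairs gA xs) = (\<Sum>ys\<in>wins False n. y ^ pairs gA ys * (\<Sum>j<Suc n. y ^ j))"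
  proof -
    have "(\<Sum>i\<le>n. y ^ pairs gA (ins i (int (Suc n)) ys)) = y ^ pairs gA ys * (\<Sum>j<Suc n. y ^ j)" if ys: "ys \<in> wins False n" for ys
    proof -
      have a: "\<bar>x\<bar> < int (Suc n)" if "x \<in> set ys" for x using wins_abs[OF ys that] by auto
      have "(\<Sum>i\<le>n. y ^ pairs gA (ins i (int (Suc n)) ys)) = (\<Sum>i\<le>n. y ^ pairs gA ys * y ^ (n - i))"
      proof (intro sum.cong refl)
        fix i assume "i \<in> {..n}"
        then have "pairs gA (ins i (int (Suc n)) ys) = pairs gA ys + (n - i)"
          using pairs_ins_pos(1)[of ys "int (Suc n)" i, OF a] wins_length[OF ys] by simp
        then show "y ^ pairs gA (ins i (int (Suc n)) ys) = y ^ pairs gA ys * y ^ (n - i)" by (simp only: power_add)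
      qed
      also have "\<dots> = y ^ pairs gA ys * (\<Sum>j<Suc n. y ^ j)"
        unfolding sum_distrib_left[symmetric] lessThan_Suc_atMost
        by (subst sum.nat_diff_reindex[symmetric, of _ "Suc n", unfolded lessThan_Suc_atMost]) simp
      finally show ?thesis .
    qed
    then show ?thesis by (simp add: sum_wins_Suc signs_def)
  qed
  then show ?case using Suc by (simp add: sum_distrib_right[symmetric])
qed (simp add: wins_0)

definition lenBl :: "int list \<Rightarrow> nat" where "lenBl xs = pairs gD xs + (\<Sum>x\<leftarrow>xs. of_bool (x < 0))"

lemma sum_pow_split: "(\<Sum>i\<le>n. (y :: 'b :: comm_ring_1) ^ (n - i)) + (\<Sum>i\<le>n. y ^ (c + i)) = (\<Sum>j<Suc n. y ^ j) + y ^ c * (\<Sum>j<Suc n. y ^ j)"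
proof -
  have "(\<Sum>i\<le>n. y ^ (n - i)) = (\<Sum>j<Suc n. y ^ j)"
    unfolding lessThan_Suc_atMost by (subst sum.nat_diff_reindex[symmetric, of _ "Suc n", unfolded lessThan_Suc_atMost]) simp
  then show ?thesis by (simp add: power_add sum_distrib_left lessThan_Suc_atMost)
qed

text \<open>A positive insertion contributes the exponents from 0 to \<open>n\<close> and a negative
  one those from \<open>n\<close> to \<open>2 * n\<close>, hence the factor
  \<open>1 + y ^ n\<close>. In type B the sign itself counts once more, which shifts the second
  range by one.\<close>

lemma sum_wins_pairs_D: "(\<Sum>xs\<in>wins True n. y ^ pairs gD xs) = (\<Prod>k\<in>{1..n}. (1 + y ^ (k - 1)) * (\<Sum>j<k. (y :: 'b :: comm_ring_1) ^ j))"
proof (induction n)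
  case (Suc n)
  have "(\<Sum>xs\<in>wins True (Suc n). y ^ pairs gD xs) = (\<Sum>ys\<in>wins True n. y ^ pairs gD ys * ((1 + y ^ n) * (\<Sum>j<Suc n. y ^ j)))"
  proof -
    have "(\<Sum>i\<le>n. y ^ pairs gD (ins i (int (Suc n)) ys)) + (\<Sum>i\<le>n. y ^ pairs gD (ins i (- int (Suc n)) ys)) =
       y ^ pairs gD ys * ((1 + y ^ n) * (\<Sum>j<Suc n. y ^ j))" if ys: "ys \<in> wins True n" for ys
    proof -
      have a: "\<bar>x\<bar> < int (Suc n)" if "x \<in> set ys" for x using wins_abs[OF ys that] by auto
      have "(\<Sum>i\<le>n. y ^ pairs gD (ins i (int (Suc n)) ys)) + (\<Sum>i\<le>n. y ^ pairs gD (ins i (- int (Suc n)) ys)) =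
         y ^ pairs gD ys * ((\<Sum>i\<le>n. y ^ (n - i)) + (\<Sum>i\<le>n. y ^ (n + i)))"
        unfolding sum_distrib_left distrib_left
      proof (intro arg_cong2[of _ _ _ _ "(+)"] sum.cong refl)
        fix i assume "i \<in> {..n}"
        then have "pairs gD (ins i (int (Suc n)) ys) = pairs gD ys + (n - i)"
          using pairs_ins_pos(2)[of ys "int (Suc n)" i, OF a] wins_length[OF ys]  by simp
        then show "y ^ pairs gD (ins i (int (Suc n)) ys) = y ^ pairs gD ys * y ^ (n - i)" by (simp only: power_add)
      next
        fix i assume "i \<in> {..n}"
        then have "pairs gD (ins i (- int (Suc n)) ys) = pairs gD ys + (n + i)"
          using pairs_ins_neg[of ys "int (Suc n)" i, OF a] wins_length[OF ys]  by simp
        then show "y ^ pairs gD (ins i (- int (Suc n)) ys) = y ^ pairs gD ys * y ^ (n + i)" by (simp only: power_add)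
      qed
      then show ?thesis unfolding sum_pow_split by (simp add: algebra_simps)
    qed
    then show ?thesis by (simp add: sum_wins_Suc signs_def sum.distrib[symmetric])
  qed
  then show ?case using Suc by (simp add: sum_distrib_right[symmetric])
qed (simp add: wins_0)

lemma sum_list_ins: "(\<Sum>x\<leftarrow>ins i e ys. f x) = f e + (\<Sum>x\<leftarrow>ys. f x :: nat)"
proof -
  have "(\<Sum>x\<leftarrow>ys. f x) = (\<Sum>x\<leftarrow>take i ys @ drop i ys. f x)" by simp
  then show ?thesis unfolding ins_def by (simp only: map_append sum_list.append list.map sum_list.Cons)
qed

lemma sum_wins_lenBl: "(\<Sum>xs\<in>wins True n. y ^ lenBl xs) = (\<Prod>k\<in>{1..n}. (1 + y ^ k) * (\<Sum>j<k. (y :: 'b :: comm_ring_1) ^ j))"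
proof (induction n)
  case (Suc n)
  have "(\<Sum>xs\<in>wins True (Suc n). y ^ lenBl xs) = (\<Sum>ys\<in>wins True n. y ^ lenBl ys * ((1 + y ^ Suc n) * (\<Sum>j<Suc n. y ^ j)))"
  proof -
    have "(\<Sum>i\<le>n. y ^ lenBl (ins i (int (Suc n)) ys)) + (\<Sum>i\<le>n. y ^ lenBl (ins i (- int (Suc n)) ys)) =
       y ^ lenBl ys * ((1 + y ^ Suc n) * (\<Sum>j<Suc n. y ^ j))" if ys: "ys \<in> wins True n" for ys
    proof -
      have a: "\<bar>x\<bar> < int (Suc n)" if "x \<in> set ys" for x using wins_abs[OF ys that] by auto
      have "(\<Sum>i\<le>n. y ^ lenBl (ins i (int (Suc n)) ys)) + (\<Sum>i\<le>n. y ^ lenBl (ins i (- int (Suc n)) ys)) =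
         y ^ lenBl ys * ((\<Sum>i\<le>n. y ^ (n - i)) + (\<Sum>i\<le>n. y ^ (Suc n + i)))"
        unfolding sum_distrib_left distrib_left
      proof (intro arg_cong2[of _ _ _ _ "(+)"] sum.cong refl)
        fix i assume "i \<in> {..n}"
        then have "lenBl (ins i (int (Suc n)) ys) = lenBl ys + (n - i)"
          using pairs_ins_pos(2)[of ys "int (Suc n)" i, OF a] wins_length[OF ys] unfolding lenBl_def sum_list_ins by simp
        then show "y ^ lenBl (ins i (int (Suc n)) ys) = y ^ lenBl ys * y ^ (n - i)" by (simp only: power_add)
      next
        fix i assume "i \<in> {..n}"
        then have "lenBl (ins i (- int (Suc n)) ys) = lenBl ys + (Suc n + i)"
          using pairs_ins_neg[of ys "int (Suc n)" i, OF a] wins_length[OF ys] unfolding lenBl_def sum_list_ins by simp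
        then show "y ^ lenBl (ins i (- int (Suc n)) ys) = y ^ lenBl ys * y ^ (Suc n + i)" by (simp only: power_add)
      qed
      then show ?thesis unfolding sum_pow_split by (simp add: algebra_simps)
    qed
    then show ?thesis by (simp add: sum_wins_Suc signs_def sum.distrib[symmetric])
  qed
  then show ?case using Suc by (simp add: sum_distrib_right[symmetric])
qed (simp add: wins_0 lenBl_def)

section \<open>Windows of group elements\<close>

definition window :: "nat \<Rightarrow> (int \<Rightarrow> int) \<Rightarrow> int list" where
  "window n w = map (\<lambda>k. w (int k)) [1..<Suc n]"

lemma desl_conv_sum: "desl xs = (\<Sum>i<length xs - 1. of_bool (xs ! i > xs ! Suc i))"
proof (induction xs rule: desl.induct)
  case (1 x y xs)
  then show ?case by (simp add: sum.lessThan_Suc_shift del: sum.lessThan_Suc)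
qed auto

lemma desl_window: "desl (window n w) = (\<Sum>k\<in>{1..<n}. of_bool (w (int k) > w (int k + 1)))"
proof -
  have "desl (window n w) = (\<Sum>i<n - 1. of_bool (w (int (Suc i)) > w (int (Suc i) + 1)))"
    unfolding desl_conv_sum by (intro sum.cong) (auto simp: window_def add.commute simp del: upt_Suc)
  also have "\<dots> = (\<Sum>k\<in>{1..<n}. of_bool (w (int k) > w (int k + 1)))"
    by (rule sum.reindex_bij_witness[of _ "\<lambda>k. k - 1" Suc]) auto
  finally show ?thesis .
qed

lemma pairs_window: "pairs g (window n w) = (\<Sum>b\<in>{1..n}. \<Sum>a\<in>{1..<b}. g (w (int a)) (w (int b)))"
proof (induction n)
  case (Suc n)
  have "window (Suc n) w = window n w @ [w (int (Suc n))]" by (simp add: window_def)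
  moreover have "(\<Sum>x\<leftarrow>window n w. g x e) = (\<Sum>a\<in>{1..<Suc n}. g (w (int a)) e)" for e
    unfolding window_def by (simp add: o_def interv_sum_list_conv_sum_set_nat del: upt_Suc)
  ultimately show ?case using Suc by (simp add: pairs_append)
qed (simp add: window_def)

lemma set_window: "set (window n w) = w ` {1..int n}"
proof -
  have "int ` {1..<Suc n} = {1..int n}" by (auto simp: image_int_atLeastLessThan)
  then show ?thesis unfolding window_def by (simp add: image_image[of w int, symmetric] del: upt_Suc)
qed

lemma window_eq_iff: "window n w = window n v \<longleftrightarrow> (\<forall>i\<in>{1..int n}. w i = v i)"
proof -
  have "window n w = window n v \<longleftrightarrow> (\<forall>k\<in>{1..<Suc n}. w (int k) = v (int k))" by (simp add: window_def del: upt_Suc)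
  also have "\<dots> \<longleftrightarrow> (\<forall>i\<in>int ` {1..<Suc n}. w i = v i)" by blast
  also have "int ` {1..<Suc n} = {1..int n}" by (auto simp: image_int_atLeastLessThan)
  finally show ?thesis .
qed

lemma distinct_abs_window:
  assumes "\<And>i j. i \<in> {1..int n} \<Longrightarrow> j \<in> {1..int n} \<Longrightarrow> \<bar>w i\<bar> = \<bar>w j\<bar> \<Longrightarrow> i = j"
  shows "distinct (map abs (window n w))"
proof -
  have "inj_on (\<lambda>k. \<bar>w (int k)\<bar>) {1..<Suc n}"
    by (rule inj_onI) (use assms[of "int _" "int _"] in fastforce)
  then show ?thesis unfolding window_def by (simp add: distinct_map o_def del: upt_Suc)
qed

lemma bij_window_A: "bij_betw (window (m + 1)) (carrier (weyl_A m)) (wins False (m + 1))"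
proof -
  have car: "carrier (weyl_A m) = {p. p permutes {1..int (m + 1)}}" by (simp add: weyl_A_def add.commute)
  have inj: "inj_on (window (m + 1)) (carrier (weyl_A m))"
  proof (rule inj_onI)
    fix p q assume a: "p \<in> carrier (weyl_A m)" "q \<in> carrier (weyl_A m)" "window (m + 1) p = window (m + 1) q"
    show "p = q"
    proof
      fix i show "p i = q i"
        using a unfolding car window_eq_iff mem_Collect_eq by (cases "i \<in> {1..int (m + 1)}") (blast, metis permutes_not_in)
    qed
  qed
  have sub: "window (m + 1) ` carrier (weyl_A m) \<subseteq> wins False (m + 1)"
  proof safe
    fix p assume "p \<in> carrier (weyl_A m)"
    then have p: "p permutes {1..int (m + 1)}" by (simp add: car)
    have pos: "p i \<in> {1..int (m + 1)}" if "i \<in> {1..int (m + 1)}" for i using permutes_in_image[OF p] that by blast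
    have "distinct (map abs (window (m + 1) p))"
    proof (rule distinct_abs_window)
      fix i j assume ij: "i \<in> {1..int (m + 1)}" "j \<in> {1..int (m + 1)}" "\<bar>p i\<bar> = \<bar>p j\<bar>"
      then have "p i = p j" using pos[of i] pos[of j] by auto
      then show "i = j" using permutes_inj[OF p] by (simp add: inj_eq)
    qed
    moreover have "set (window (m + 1) p) = {1..int (m + 1)}" unfolding set_window by (rule permutes_image[OF p])
    ultimately show "window (m + 1) p \<in> wins False (m + 1)" by (auto simp: wins_def)
  qed
  \<comment> \<open>Surjectivity follows from injectivity by comparing cardinalities.\<close>
  have "card (carrier (weyl_A m)) = card (wins False (m + 1))"
    using card_permutations[of "{1..int (m + 1)}" "m + 1"] by (simp add: car card_wins)
  then have "window (m + 1) ` carrier (weyl_A m) = wins False (m + 1)"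
    using sub inj finite_wins by (metis card_image card_subset_eq)
  with inj show ?thesis by (simp add: bij_betw_def)
qed

lemma signed_perms_abs_inj: "p \<in> signed_perms n \<Longrightarrow> \<bar>p i\<bar> = \<bar>p j\<bar> \<longleftrightarrow> \<bar>i\<bar> = \<bar>j\<bar>"
  using signed_perms_inj[of p n i j] signed_perms_inj[of p n i "- j"] signed_perms_uminus[of p n j]
  by (auto simp: abs_eq_iff)

lemma bij_window_signed: "bij_betw (window n) (signed_perms n) (wins True n)"
proof (rule bij_betw_imageI)
  show "inj_on (window n) (signed_perms n)"
  proof (rule inj_onI)
    fix p q assume a: "p \<in> signed_perms n" "q \<in> signed_perms n" "window n p = window n q"
    show "p = q"
    proof
      fix i
      consider "i = 0" | "i \<in> {1..int n}" | "- i \<in> {1..int n}" | "i \<notin> {- int n..int n}" by fastforce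
      then show "p i = q i"
      proof cases
        case 3
        then have "p (- i) = q (- i)" using a(3) unfolding window_eq_iff by blast
        then show ?thesis using signed_perms_uminus[OF a(1), of i] signed_perms_uminus[OF a(2), of i] by simp
      next
        case 4
        have "p permutes {- int n..int n}" "q permutes {- int n..int n}" using a by (auto simp: signed_perms_def)
        from permutes_not_in[OF this(1) 4] permutes_not_in[OF this(2) 4] show ?thesis by simp
      next
        case 1 then show ?thesis using signed_perms_0[OF a(1)] signed_perms_0[OF a(2)] by simp
      next
        case 2 then show ?thesis using a(3) by (simp add: window_eq_iff)
      qed
    qed
  qed
  show "window n ` signed_perms n = wins True n"
  proof (intro equalityI subsetI)
    fix xs assume "xs \<in> window n ` signed_perms n"
    then obtain p where p: "xs = window n p" "p \<in> signed_perms n" by auto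
    have "inj_on (\<lambda>i. \<bar>p i\<bar>) {1..int n}" by (rule inj_onI) (simp add: signed_perms_abs_inj[OF p(2)])
    moreover have "(\<lambda>i. \<bar>p i\<bar>) ` {1..int n} \<subseteq> {1..int n}"
    proof safe
      fix i assume "i \<in> {1..int n}"
      then show "\<bar>p i\<bar> \<in> {1..int n}" using signed_perms_range[OF p(2), of i] signed_perms_eq_0[OF p(2), of i] by auto
    qed
    ultimately have "(\<lambda>i. \<bar>p i\<bar>) ` {1..int n} = {1..int n}" by (simp add: endo_inj_surj)
    moreover have "distinct (map abs (window n p))"
      by (rule distinct_abs_window) (simp add: signed_perms_abs_inj[OF p(2)])
    ultimately show "xs \<in> wins True n" by (simp add: wins_def p(1) set_window image_image)
  next
    fix xs assume xs: "xs \<in> wins True n"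
    \<comment> \<open>The preimage of a window is its odd extension, continued by the
      identity.\<close>
    define p where "p k = (if k \<noteq> 0 \<and> \<bar>k\<bar> \<le> int n then sgn k * xs ! (nat \<bar>k\<bar> - 1) else k)" for k
    have len: "length xs = n" by (rule wins_length[OF xs])
    have idx: "nat \<bar>k\<bar> - 1 < length xs" if "k \<noteq> 0" "\<bar>k\<bar> \<le> int n" for k using that len by auto
    have absp: "\<bar>p k\<bar> = map abs xs ! (nat \<bar>k\<bar> - 1)" if "k \<noteq> 0" "\<bar>k\<bar> \<le> int n" for k
      using that idx[OF that] by (simp add: p_def abs_mult)
    have odd: "p (- k) = - p k" for k by (simp add: p_def)
    have rng: "1 \<le> \<bar>p k\<bar> \<and> \<bar>p k\<bar> \<le> int n" if "k \<noteq> 0" "\<bar>k\<bar> \<le> int n" for k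
      using wins_abs[OF xs nth_mem[OF idx[OF that]]] absp[OF that] idx[OF that] by simp
    have inj: "k = l" if "k \<in> {- int n..int n}" "l \<in> {- int n..int n}" "p k = p l" for k l
    proof (cases "k = 0 \<or> l = 0")
      case True
      have "p 0 = 0" by (simp add: p_def)
      then show ?thesis using True rng[of k] rng[of l] that by fastforce
    next
      case False
      then have k: "k \<noteq> 0" "\<bar>k\<bar> \<le> int n" and l: "l \<noteq> 0" "\<bar>l\<bar> \<le> int n" using that by auto
      have "map abs xs ! (nat \<bar>k\<bar> - 1) = map abs xs ! (nat \<bar>l\<bar> - 1)"
        using absp[OF k] absp[OF l] that(3) by simp
      moreover have "distinct (map abs xs)" using xs by (simp add: wins_def)
      ultimately have "nat \<bar>k\<bar> - 1 = nat \<bar>l\<bar> - 1"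
        using idx[OF k] idx[OF l] by (metis length_map nth_eq_iff_index_eq)
      moreover have "0 < nat \<bar>k\<bar>" "0 < nat \<bar>l\<bar>" using k(1) l(1) by simp_all
      ultimately have "nat \<bar>k\<bar> = nat \<bar>l\<bar>" by (metis One_nat_def Suc_pred)
      then have "\<bar>k\<bar> = \<bar>l\<bar>" by simp
      then have "k = l \<or> k = - l" by (auto simp: abs_eq_iff)
      then show ?thesis using odd[of l] rng[OF l] that(3) by auto
    qed
    have "p ` {- int n..int n} \<subseteq> {- int n..int n}"
    proof safe
      fix k assume "k \<in> {- int n..int n}"
      then have "\<bar>p k\<bar> \<le> int n" using rng[of k] by (cases "k = 0") (simp add: p_def, auto)
      then show "p k \<in> {- int n..int n}" by (simp add: abs_le_iff)
    qed
    moreover have "inj_on p {- int n..int n}" using inj by (auto intro: inj_onI)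
    ultimately have "bij_betw p {- int n..int n} {- int n..int n}" by (simp add: bij_betw_def endo_inj_surj)
    then have "p permutes {- int n..int n}" by (rule bij_imp_permutes) (auto simp: p_def)
    then have "p \<in> signed_perms n" using odd by (simp add: signed_perms_def)
    moreover have "window n p = xs"
      by (rule nth_equalityI) (auto simp: window_def p_def len nat_add_distrib simp del: upt_Suc)
    ultimately show "xs \<in> window n ` signed_perms n" by blast
  qed
qed

lemma desl_window_0:
  assumes "n \<ge> 1"
  shows "desl (0 # window n w) = of_bool (w 1 < 0) + (\<Sum>k\<in>{1..<n}. of_bool (w (int k) > w (int k + 1)))"
proof -
  have "window n w = w 1 # tl (window n w)" using assms by (simp add: window_def upt_conv_Cons del: upt_Suc)
  then show ?thesis using desl_window[of n w] by (metis desl.simps(1) order_refl)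
qed

lemma deslD_window:
  assumes "n \<ge> 2" shows "deslD (window n w) = desD n w"
proof -
  obtain r where "window n w = w 1 # w 2 # r" using assms by (simp add: window_def upt_conv_Cons numeral_2_eq_2 del: upt_Suc)
  then show ?thesis using desl_window[of n w] by (simp add: desD_def)
qed

lemma lenBl_window: "lenBl (window n w) = lenB n w"
proof -
  have "(\<Sum>x\<leftarrow>window n w. of_bool (x < 0)) = (\<Sum>b\<in>{1..n}. of_bool (w (int b) < 0) :: nat)"
    unfolding window_def by (simp add: o_def interv_sum_list_conv_sum_set_nat atLeastLessThanSuc_atLeastAtMost del: upt_Suc)
  then show ?thesis by (simp add: lenBl_def lenB_def lenD_def pairs_window gD_def)
qed

lemma sum_des_A: "(\<Sum>w\<in>carrier (weyl_A m). F (cox_des (weyl_A m) w)) = eulA (m + 1) (F :: nat \<Rightarrow> 'b :: comm_ring_1)"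
proof -
  have "F (cox_des (weyl_A m) w) = F (desl (0 # window (m + 1) w))" if "w \<in> carrier (weyl_A m)" for w
  proof -
    have "w 1 \<in> {1..int m + 1}" using that permutes_in_image[of w "{1..int m + 1}" 1] by (auto simp: weyl_A_def)
    moreover have "{1..<m + 1} = {1..m}" by auto
    ultimately show ?thesis using that by (simp add: cox_des_weyl_A desA_def desl_window_0)
  qed
  then have "(\<Sum>w\<in>carrier (weyl_A m). F (cox_des (weyl_A m) w)) = (\<Sum>w\<in>carrier (weyl_A m). F (desl (0 # window (m + 1) w)))"
    by simp
  then show ?thesis unfolding sum.reindex_bij_betw[OF bij_window_A, of "\<lambda>xs. F (desl (0 # xs))"] sum_wins_desl_A .
qed

lemma sum_inv_A: "(\<Sum>w\<in>carrier (weyl_A m). y ^ cox_inv (weyl_A m) w) = (\<Prod>k\<in>{1..m + 1}. \<Sum>j<k. (y :: 'b :: comm_ring_1) ^ j)"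
proof -
  have "(\<Sum>w\<in>carrier (weyl_A m). y ^ cox_inv (weyl_A m) w) = (\<Sum>w\<in>carrier (weyl_A m). y ^ pairs gA (window (m + 1) w))"
    by (intro sum.cong refl) (simp only: cox_inv_weyl_A lenA_def pairs_window gA_def)
  then show ?thesis unfolding sum.reindex_bij_betw[OF bij_window_A, of "\<lambda>xs. y ^ pairs gA xs"] sum_wins_pairs_A .
qed

lemma carrier_B: "carrier (weyl_B m) = signed_perms m" by (simp add: weyl_B_def)

lemma sum_des_B:
  assumes "m \<ge> 1"
  shows "(\<Sum>w\<in>carrier (weyl_B m). F (cox_des (weyl_B m) w)) = eulB m (F :: nat \<Rightarrow> 'b :: comm_ring_1)"
proof -
  have "(\<Sum>w\<in>carrier (weyl_B m). F (cox_des (weyl_B m) w)) = (\<Sum>w\<in>signed_perms m. F (desl (0 # window m w)))"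
    unfolding carrier_B using assms by (intro sum.cong refl) (simp add: cox_des_weyl_B carrier_B desB_def desl_window_0)
  then show ?thesis unfolding sum.reindex_bij_betw[OF bij_window_signed, of "\<lambda>xs. F (desl (0 # xs))"] sum_wins_desl_B .
qed

lemma sum_inv_B:
  assumes "m \<ge> 1"
  shows "(\<Sum>w\<in>carrier (weyl_B m). y ^ cox_inv (weyl_B m) w) = (\<Prod>k\<in>{1..m}. (1 + y ^ k) * (\<Sum>j<k. (y :: 'b :: comm_ring_1) ^ j))"
proof -
  have "(\<Sum>w\<in>carrier (weyl_B m). y ^ cox_inv (weyl_B m) w) = (\<Sum>w\<in>signed_perms m. y ^ lenBl (window m w))"
    unfolding carrier_B using assms by (intro sum.cong refl) (simp add: cox_inv_weyl_B carrier_B lenBl_window)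
  then show ?thesis unfolding sum.reindex_bij_betw[OF bij_window_signed, of "\<lambda>xs. y ^ lenBl xs"] sum_wins_lenBl .
qed

text \<open>Left multiplication by \<open>flip1\<close> changes the sign of the entry of absolute
  value 1 and so exchanges the two cosets of the group of type D. Only 0 lies between -1 and 1, so
  no comparison between entries of different absolute value is affected, and sums over type D can be
  taken over all signed permutations.\<close>

definition flip1 :: "int \<Rightarrow> int" where "flip1 = Transposition.transpose 1 (-1)"

lemma flip1_simps: "flip1 x = (if x = 1 then -1 else if x = -1 then 1 else x)"
  by (simp add: flip1_def Transposition.transpose_def)

lemma flip1_mono:
  assumes "x \<noteq> 0" "y \<noteq> 0" "\<bar>x\<bar> \<noteq> \<bar>y\<bar>"
  shows "flip1 x > flip1 y \<longleftrightarrow> x > y" "flip1 x + flip1 y < 0 \<longleftrightarrow> x + y < 0"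
  using assms unfolding flip1_simps by (smt (verit))+

lemma sum_weyl_D:
  assumes m: "m \<ge> 1" and F: "\<And>w. w \<in> signed_perms m \<Longrightarrow> F (flip1 \<circ> w) = (F w :: 'b :: comm_ring_1)"
  shows "(\<Sum>w\<in>signed_perms m. F w) = 2 * (\<Sum>w\<in>carrier (weyl_D m). F w)"
proof -
  have flip: "flip1 \<in> signed_perms m" unfolding flip1_def using transpose_signed[of 1 m] m by simp
  have "sgn_char m flip1 = (\<Prod>i\<in>{1..int m}. if i = 1 then -1 else 1)"
    unfolding sgn_char_def by (intro prod.cong refl) (auto simp: flip1_simps)
  then have ch: "sgn_char m flip1 = -1" using m by (simp add: prod.delta)
  have ff: "flip1 \<circ> (flip1 \<circ> w) = w" for w by (rule ext) (simp add: flip1_def)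
  have fin: "finite (signed_perms m)" using bij_betw_finite[OF bij_window_signed] finite_wins by blast
  define Dm where "Dm = {w \<in> signed_perms m. sgn_char m w = -1}"
  have D: "carrier (weyl_D m) = {w \<in> signed_perms m. sgn_char m w = 1}" using weyl_D_carrier by blast
  have "sgn_char m w = 1 \<or> sgn_char m w = -1" if "w \<in> signed_perms m" for w
    unfolding sgn_char_eq[OF that] by (simp add: minus_one_power_iff)
  then have "signed_perms m = carrier (weyl_D m) \<union> Dm" unfolding D Dm_def by blast
  then have "(\<Sum>w\<in>signed_perms m. F w) = (\<Sum>w\<in>carrier (weyl_D m). F w) + (\<Sum>w\<in>Dm. F w)"
    using fin by (simp only:) (subst sum.union_disjoint, auto simp: D Dm_def)
  also have "(\<Sum>w\<in>Dm. F w) = (\<Sum>w\<in>carrier (weyl_D m). F w)"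
    by (rule sum.reindex_bij_witness[of _ "\<lambda>w. flip1 \<circ> w" "\<lambda>w. flip1 \<circ> w"])
      (use F flip ch in \<open>auto simp: D Dm_def ff signed_perms_comp sgn_char_comp\<close>)
  finally show ?thesis by simp
qed

lemma signed_perms_neq:
  assumes "w \<in> signed_perms m" "a \<noteq> 0" "b \<noteq> 0" "\<bar>a\<bar> \<noteq> \<bar>b\<bar>"
  shows "w a \<noteq> 0" "w b \<noteq> 0" "\<bar>w a\<bar> \<noteq> \<bar>w b\<bar>"
  using assms signed_perms_eq_0 signed_perms_abs_inj by blast+

lemma desD_flip1: "w \<in> signed_perms m \<Longrightarrow> desD m (flip1 \<circ> w) = desD m w"
proof -
  assume w: "w \<in> signed_perms m"
  have "of_bool (flip1 (w (int k)) > flip1 (w (int k + 1))) = (of_bool (w (int k) > w (int k + 1)) :: nat)" if "k \<in> {1..<m}" for k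
    using flip1_mono(1)[OF signed_perms_neq[OF w, of "int k" "int k + 1"]] that by simp
  then have "(\<Sum>k\<in>{1..<m}. of_bool (flip1 (w (int k)) > flip1 (w (int k + 1)))) = ((\<Sum>k\<in>{1..<m}. of_bool (w (int k) > w (int k + 1))) :: nat)"
    by (intro sum.cong refl)
  then show ?thesis
    unfolding desD_def using flip1_mono(2)[OF signed_perms_neq[OF w, of 1 2]] by (simp only: o_apply) simp
qed

lemma lenD_flip1:
  assumes w: "w \<in> signed_perms m" shows "lenD m (flip1 \<circ> w) = lenD m w"
  unfolding lenD_def
proof (intro sum.cong refl)
  fix b a assume "b \<in> {1..m}" "a \<in> {1..<b}"
  then have ab: "int a \<noteq> 0" "int b \<noteq> 0" "\<bar>int a\<bar> \<noteq> \<bar>int b\<bar>" by auto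
  show "of_bool ((flip1 \<circ> w) (int b) < (flip1 \<circ> w) (int a)) + of_bool ((flip1 \<circ> w) (int a) + (flip1 \<circ> w) (int b) < 0) =
     of_bool (w (int b) < w (int a)) + of_bool (w (int a) + w (int b) < 0)"
    using flip1_mono[OF signed_perms_neq[OF w ab]] by simp
qed

lemma sum_des_D:
  assumes "m \<ge> 2"
  shows "2 * (\<Sum>w\<in>carrier (weyl_D m). (y :: 'b :: {comm_ring_1, ring_char_0, idom}) ^ cox_des (weyl_D m) w) =
    2 * eulB m (\<lambda>d. y ^ d) - y * 2 ^ m * of_nat m * eulA (m - 1) (\<lambda>d. y ^ d)"
proof -
  have "2 * (\<Sum>w\<in>carrier (weyl_D m). y ^ cox_des (weyl_D m) w) = 2 * (\<Sum>w\<in>carrier (weyl_D m). y ^ desD m w)"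
    using assms by (simp add: cox_des_weyl_D)
  also have "\<dots> = (\<Sum>w\<in>signed_perms m. y ^ desD m w)"
    using assms desD_flip1 by (intro sum_weyl_D[symmetric]) auto
  also have "\<dots> = (\<Sum>w\<in>signed_perms m. y ^ deslD (window m w))" using deslD_window[OF assms] by simp
  finally show ?thesis unfolding sum.reindex_bij_betw[OF bij_window_signed, of "\<lambda>xs. y ^ deslD xs"] sum_wins_deslD[OF assms] .
qed

lemma sum_inv_D:
  assumes "m \<ge> 2"
  shows "2 * (\<Sum>w\<in>carrier (weyl_D m). (y :: 'b :: comm_ring_1) ^ cox_inv (weyl_D m) w) =
    (\<Prod>k\<in>{1..m}. (1 + y ^ (k - 1)) * (\<Sum>j<k. y ^ j))"
proof -
  have "2 * (\<Sum>w\<in>carrier (weyl_D m). y ^ cox_inv (weyl_D m) w) = 2 * (\<Sum>w\<in>carrier (weyl_D m). y ^ lenD m w)"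
    using assms by (simp add: cox_inv_weyl_D)
  also have "\<dots> = (\<Sum>w\<in>signed_perms m. y ^ lenD m w)"
    using assms lenD_flip1 by (intro sum_weyl_D[symmetric]) auto
  also have "\<dots> = (\<Sum>w\<in>signed_perms m. y ^ pairs gD (window m w))" by (simp only: pairs_window lenD_def gD_def)
  finally show ?thesis unfolding sum.reindex_bij_betw[OF bij_window_signed, of "\<lambda>xs. y ^ pairs gD xs"] sum_wins_pairs_D .
qed

lemma card_weyl_A: "card (carrier (weyl_A m)) = fact (m + 1)"
  using bij_betw_same_card[OF bij_window_A] by (simp add: card_wins)

lemma card_weyl_B: "card (carrier (weyl_B m)) = 2 ^ m * fact m"
  using bij_betw_same_card[OF bij_window_signed] by (simp add: card_wins carrier_B)

lemma card_weyl_D: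
  assumes "m \<ge> 1" shows "2 * card (carrier (weyl_D m)) = 2 ^ m * fact m"
proof -
  have "int (card (signed_perms m)) = 2 * int (card (carrier (weyl_D m)))"
    using sum_weyl_D[OF assms, of "\<lambda>_. 1 :: int"] by simp
  then show ?thesis using card_weyl_B[of m] unfolding carrier_B by (metis of_nat_eq_iff of_nat_mult of_nat_numeral)
qed

section \<open>Tail asymptotics by Fourier inversion\<close>

abbreviation cpl :: "real \<Rightarrow> real \<Rightarrow> complex" where
  "cpl t \<theta> \<equiv> of_real t + \<i> * of_real \<theta>"

lemma has_integral_exp_int:
  "((\<lambda>\<theta>. exp (of_int d * cpl t \<theta>)) has_integral (if d = 0 then 2 * pi else 0)) {-pi..pi}"
proof (cases "d = 0")
  case True
  then show ?thesis using has_integral_const_real[of "1 :: complex" "-pi" pi] by (simp add: scaleR_conv_of_real)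
next
  case False
  let ?f = "\<lambda>\<theta>. exp (of_int d * cpl t \<theta>) / (of_int d * \<i>)"
  have "((\<lambda>\<theta>. exp (of_int d * cpl t \<theta>)) has_integral (?f pi - ?f (-pi))) {-pi..pi}"
  proof (intro fundamental_theorem_of_calculus has_vector_derivative_real_field)
    fix x
    show "((\<lambda>w. exp (of_int d * (of_real t + \<i> * w)) / (of_int d * \<i>)) has_field_derivative exp (of_int d * cpl t x)) (at (of_real x))"
      using False by (auto intro!: derivative_eq_intros)
  qed simp
  moreover have "exp (of_int d * cpl t pi) = exp (of_int d * cpl t (-pi))"
  proof -
    have "of_int d * cpl t pi = of_int d * cpl t (-pi) + of_int d * (of_real (2 * pi) * \<i>)" by (simp add: algebra_simps)
    then show ?thesis by (simp add: exp_add exp_eq_1)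
  qed
  ultimately show ?thesis using False by simp
qed

lemma norm_one_minus_exp: "0 < t \<Longrightarrow> 1 - exp (- t) \<le> norm (1 - exp (- cpl t \<theta>))"
proof -
  have "norm (exp (- cpl t \<theta>)) = exp (- t)" by simp
  then show ?thesis using norm_triangle_ineq2[of 1 "exp (- cpl t \<theta>)"] by simp
qed

lemma one_minus_exp_neq_0: "0 < t \<Longrightarrow> 1 - exp (- cpl t \<theta>) \<noteq> 0"
  using norm_one_minus_exp[of t \<theta>] by (metis diff_gt_0_iff_gt exp_less_one_iff neg_less_0_iff_less norm_zero not_less)

text \<open>Formally, \<open>1 / (1 - exp (- z))\<close> is a geometric series from which
  orthogonality selects one term. Instead of exchanging sum and integral, the values
  \<open>I d\<close> are shown to satisfy \<open>I d = I (d - 1)\<close> except for a jump of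
  \<open>2 * pi\<close> at 0. They are constant for negative \<open>d\<close>, and this constant is
  0 because the integrand decays as \<open>d\<close> tends to minus infinity.\<close>

lemma has_integral_kernel:
  assumes t: "0 < t"
  shows "((\<lambda>\<theta>. exp (of_int d * cpl t \<theta>) / (1 - exp (- cpl t \<theta>))) has_integral (if 0 \<le> d then 2 * pi else 0)) {-pi..pi}"
proof -
  define I where "I d = integral {-pi..pi} (\<lambda>\<theta>. exp (of_int d * cpl t \<theta>) / (1 - exp (- cpl t \<theta>)))" for d :: int
  have int: "(\<lambda>\<theta>. exp (of_int d * cpl t \<theta>) / (1 - exp (- cpl t \<theta>))) integrable_on {-pi..pi}" for d :: int
    using one_minus_exp_neq_0[OF t] by (intro integrable_continuous_interval continuous_intros) auto
  have rec: "I d = I (d - 1) + (if d = 0 then 2 * pi else 0)" for d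
  proof -
    have "exp (of_int d * cpl t \<theta>) / (1 - exp (- cpl t \<theta>)) = exp (of_int (d - 1) * cpl t \<theta>) / (1 - exp (- cpl t \<theta>)) + exp (of_int d * cpl t \<theta>)" for \<theta>
    proof -
      have "exp (of_int (d - 1) * cpl t \<theta>) = exp (of_int d * cpl t \<theta>) * exp (- cpl t \<theta>)"
        by (simp add: exp_add[symmetric] algebra_simps)
      then show ?thesis using one_minus_exp_neq_0[OF t, of \<theta>] by (simp add: field_simps)
    qed
    then have "((\<lambda>\<theta>. exp (of_int d * cpl t \<theta>) / (1 - exp (- cpl t \<theta>))) has_integral (I (d - 1) + (if d = 0 then 2 * pi else 0))) {-pi..pi}"
      using has_integral_add[OF integrable_integral[OF int[of "d - 1"]] has_integral_exp_int[of d t]] by (simp add: I_def)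
    then show ?thesis unfolding I_def by (rule integral_unique)
  qed
  have neg: "I (- int (Suc n)) = I (-1)" for n
  proof (induction n)
    case (Suc n)
    have "- int (Suc n) - 1 = - int (Suc (Suc n))" by simp
    then show ?case using rec[of "- int (Suc n)"] Suc by simp
  qed simp
  have bound: "norm (I (- int (Suc n))) \<le> exp (- t) ^ Suc n / (1 - exp (- t)) * (2 * pi)" for n
  proof -
    have "norm (I (- int (Suc n))) \<le> integral {-pi..pi} (\<lambda>\<theta>. exp (- t) ^ Suc n / (1 - exp (- t)))"
      unfolding I_def
    proof (rule integral_norm_bound_integral[OF int])
      fix \<theta>
      have "norm (exp (of_int (- int (Suc n)) * cpl t \<theta>)) = exp (- t) ^ Suc n"
        by (simp add: exp_of_nat_mult[symmetric] algebra_simps del: power_Suc)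
      then show "norm (exp (of_int (- int (Suc n)) * cpl t \<theta>) / (1 - exp (- cpl t \<theta>))) \<le> exp (- t) ^ Suc n / (1 - exp (- t))"
        using norm_one_minus_exp[OF t, of \<theta>] t unfolding norm_divide by (intro frac_le) auto
    qed (intro integrable_continuous_interval continuous_intros)
    then show ?thesis by (simp add: mult_ac)
  qed
  have "(\<lambda>n. exp (- t) ^ Suc n / (1 - exp (- t)) * (2 * pi)) \<longlonglongrightarrow> 0 / (1 - exp (- t)) * (2 * pi)"
    using t by (intro tendsto_intros LIMSEQ_Suc LIMSEQ_realpow_zero) auto
  then have "norm (I (-1)) \<le> 0"
    using bound neg by (intro LIMSEQ_le_const[of _ 0]) auto
  then have z: "I (-1) = 0" by simp
  have "I d = (if 0 \<le> d then 2 * pi else 0)"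
  proof (cases "0 \<le> d")
    case True
    then show ?thesis
    proof (induction d rule: int_ge_induct)
      case base show ?case using rec[of 0] z by simp
    next
      case (step i) then show ?case using rec[of "i + 1"] by simp
    qed
  next
    case False
    then have e: "- int (Suc (nat (- d - 1))) = d" by simp
    from neg[of "nat (- d - 1)"] show ?thesis unfolding e using z False by simp
  qed
  with integrable_integral[OF int[of d]] show ?thesis by (simp add: I_def)
qed

definition mgf :: "'w set \<Rightarrow> ('w \<Rightarrow> nat) \<Rightarrow> real \<Rightarrow> complex \<Rightarrow> complex" where
  "mgf A X \<mu> z = (\<Sum>w\<in>A. exp (z * (of_nat (X w) - of_real \<mu>))) / of_nat (card A)"

definition tail :: "'w set \<Rightarrow> ('w \<Rightarrow> nat) \<Rightarrow> int \<Rightarrow> real" where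
  "tail A X k = card {w \<in> A. k \<le> int (X w)} / card A"

lemma has_integral_tail:
  assumes t: "0 < t" and A: "finite A"
  shows "((\<lambda>\<theta>. mgf A X \<mu> (cpl t \<theta>) * exp (- cpl t \<theta> * (of_int k - of_real \<mu>)) / (1 - exp (- cpl t \<theta>)))
     has_integral of_real (2 * pi * tail A X k)) {-pi..pi}"
proof -
  have "((\<lambda>\<theta>. \<Sum>w\<in>A. exp (of_int (int (X w) - k) * cpl t \<theta>) / (1 - exp (- cpl t \<theta>)) / of_nat (card A)) has_integral
     (\<Sum>w\<in>A. complex_of_real (if 0 \<le> int (X w) - k then 2 * pi else 0) / of_nat (card A))) {-pi..pi}"
    by (intro has_integral_sum[OF A] ballI has_integral_divide has_integral_kernel[OF t])
  moreover have "(\<Sum>w\<in>A. complex_of_real (if 0 \<le> int (X w) - k then 2 * pi else 0) / of_nat (card A)) = (of_real (2 * pi * tail A X k) :: complex)"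
  proof -
    have "(\<Sum>w\<in>A. (if 0 \<le> int (X w) - k then 2 * pi else 0)) = 2 * pi * card {w \<in> A. k \<le> int (X w)}"
      using A by (simp add: sum.If_cases Int_def)
    then show ?thesis by (simp add: tail_def sum_divide_distrib[symmetric] of_real_sum[symmetric] del: of_real_sum)
  qed
  moreover have "(\<Sum>w\<in>A. exp (of_int (int (X w) - k) * cpl t \<theta>) / (1 - exp (- cpl t \<theta>)) / of_nat (card A)) =
     mgf A X \<mu> (cpl t \<theta>) * exp (- cpl t \<theta> * (of_int k - of_real \<mu>)) / (1 - exp (- cpl t \<theta>))" for \<theta>
  proof -
    have "exp (of_int (int (X w) - k) * cpl t \<theta>) = exp (cpl t \<theta> * (of_nat (X w) - of_real \<mu>)) * exp (- cpl t \<theta> * (of_int k - of_real \<mu>))" for w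
      by (simp add: exp_add[symmetric] algebra_simps)
    moreover have "a * b / c / n = a / n * b / c" for a b c n :: complex by simp
    ultimately show ?thesis unfolding mgf_def sum_divide_distrib sum_distrib_right by (simp only:)
  qed
  ultimately show ?thesis by simp
qed

text \<open>The normalisation \<open>y * exp (y ^ 2 / 2)\<close> is distributed so that every factor
  has a limit: \<open>y / s\<close> compensates the pole of the kernel, and the exponential
  completes the square. Extension by 0 puts all integrals on one domain, as dominated convergence
  requires.\<close>

lemma has_integral_tail_scaled:
  assumes y: "0 < y" and s: "0 < s" and A: "finite A" and k: "of_int k = \<mu> + s * y"
  defines "z \<equiv> \<lambda>u. cpl (y / s) (u / s)"
  shows "((\<lambda>u. if \<bar>u\<bar> \<le> pi * s then of_real (y / s) / (1 - exp (- z u)) * mgf A X \<mu> (z u) * exp (- z u * of_real (s * y) + of_real (y\<^sup>2 / 2)) else 0)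
     has_integral of_real (2 * pi * (tail A X k * (y * exp (y\<^sup>2 / 2))))) UNIV"
proof -
  have t: "0 < y / s" using y s by simp
  have "((\<lambda>\<theta>. (of_real (y / s * exp (y\<^sup>2 / 2)) * (mgf A X \<mu> (cpl (y / s) \<theta>) * exp (- cpl (y / s) \<theta> * (of_int k - of_real \<mu>)) / (1 - exp (- cpl (y / s) \<theta>)))) )
     has_integral of_real (y / s * exp (y\<^sup>2 / 2)) * of_real (2 * pi * tail A X k)) {-pi..pi}"
    by (intro has_integral_mult_right has_integral_tail[OF t A])
  from has_integral_stretch_real[OF this, of "1 / s"] s
  have "((\<lambda>u. (of_real (y / s * exp (y\<^sup>2 / 2)) * (mgf A X \<mu> (z u) * exp (- z u * (of_int k - of_real \<mu>)) / (1 - exp (- z u)))) )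
     has_integral s *\<^sub>R (of_real (y / s * exp (y\<^sup>2 / 2)) * of_real (2 * pi * tail A X k))) ((\<lambda>x. x * s) ` {-pi..pi})"
    by (simp add: z_def)
  also have "(\<lambda>x. x * s) ` {-pi..pi} = {- pi * s..pi * s}"
    using s image_mult_atLeastAtMost[of s "-pi" pi] by (simp add: mult.commute)
  also have "s *\<^sub>R (of_real (y / s * exp (y\<^sup>2 / 2)) * of_real (2 * pi * tail A X k)) = (of_real (2 * pi * (tail A X k * (y * exp (y\<^sup>2 / 2)))) :: complex)"
    using s by (simp add: scaleR_conv_of_real)
  also have "(\<lambda>u. (of_real (y / s * exp (y\<^sup>2 / 2)) * (mgf A X \<mu> (z u) * exp (- z u * (of_int k - of_real \<mu>)) / (1 - exp (- z u)))) ) =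
    (\<lambda>u. of_real (y / s) / (1 - exp (- z u)) * mgf A X \<mu> (z u) * exp (- z u * of_real (s * y) + of_real (y\<^sup>2 / 2)))"
  proof
    fix u
    have "of_int k - of_real \<mu> = (of_real (s * y) :: complex)"
      using arg_cong[OF k, of complex_of_real] by (simp add: algebra_simps)
    show "of_real (y / s * exp (y\<^sup>2 / 2)) * (mgf A X \<mu> (z u) * exp (- z u * (of_int k - of_real \<mu>)) / (1 - exp (- z u))) =
      of_real (y / s) / (1 - exp (- z u)) * mgf A X \<mu> (z u) * exp (- z u * of_real (s * y) + of_real (y\<^sup>2 / 2))"
    proof -
      have "exp (- z u * of_real (s * y) + of_real (y\<^sup>2 / 2)) = exp (- z u * of_real (s * y)) * of_real (exp (y\<^sup>2 / 2))"
        by (simp only: exp_add exp_of_real)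
      then show ?thesis unfolding \<open>of_int k - of_real \<mu> = of_real (s * y)\<close> by simp
    qed
  qed
  finally have "((\<lambda>u. if u \<in> {- pi * s..pi * s} then of_real (y / s) / (1 - exp (- z u)) * mgf A X \<mu> (z u) * exp (- z u * of_real (s * y) + of_real (y\<^sup>2 / 2)) else 0)
     has_integral of_real (2 * pi * (tail A X k * (y * exp (y\<^sup>2 / 2))))) UNIV"
    by (simp only: has_integral_restrict_UNIV)
  moreover have "u \<in> {- pi * s..pi * s} \<longleftrightarrow> \<bar>u\<bar> \<le> pi * s" for u by auto
  ultimately show ?thesis by simp
qed

section \<open>Limit and domination of the integrand\<close>

lemma has_integral_gauss: "((\<lambda>u::real. complex_of_real (exp (- u\<^sup>2 / 2))) has_integral of_real (sqrt (2 * pi))) UNIV"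
proof -
  have "has_bochner_integral lborel (std_normal_density) 1"
    using integral_normal_density[of 1 0] integrable_normal_density[of 1 0] by (simp add: has_bochner_integral_iff)
  then have "has_bochner_integral lborel (\<lambda>u. sqrt (2 * pi) * std_normal_density u) (sqrt (2 * pi) * 1)"
    by (intro has_bochner_integral_mult_right)
  moreover have "sqrt (2 * pi) * std_normal_density u = exp (- u\<^sup>2 / 2)" for u by (simp add: std_normal_density_def)
  ultimately have "has_bochner_integral lborel (\<lambda>u. exp (- u\<^sup>2 / 2)) (sqrt (2 * pi))" by simp
  then have "((\<lambda>u. exp (- u\<^sup>2 / 2)) has_integral sqrt (2 * pi)) UNIV"
    using has_integral_integral_lborel[of "\<lambda>u::real. exp (- u\<^sup>2 / 2) :: real"] by (simp add: has_bochner_integral_iff)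
  from has_integral_of_real[OF this] show ?thesis .
qed

lemma integrable_inv_square: "(\<lambda>u::real. K / (1 + u\<^sup>2)) integrable_on UNIV"
proof -
  have "integrable lborel (\<lambda>u::real. inverse (1 + u\<^sup>2))"
    using integrable_inverse_1_plus_square by (simp add: set_integrable_def einterval_def)
  then have "(\<lambda>u::real. inverse (1 + u\<^sup>2)) integrable_on UNIV" using integrable_on_lborel by blast
  then have "(\<lambda>u::real. K * inverse (1 + u\<^sup>2)) integrable_on UNIV" by (rule integrable_on_mult_right)
  then show ?thesis by (simp add: divide_inverse)
qed

lemma tendsto_div_one_minus_exp: "((\<lambda>z::complex. z / (1 - exp (- z))) \<longlongrightarrow> 1) (at 0)"
proof -
  have "((\<lambda>z::complex. 1 - exp (- z)) has_field_derivative 1) (at 0)"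
    by (auto intro!: derivative_eq_intros)
  then have "((\<lambda>z::complex. (1 - exp (- z)) / z) \<longlongrightarrow> 1) (at 0)" by (simp add: has_field_derivative_iff)
  from tendsto_inverse[OF this] show ?thesis by (simp add: inverse_eq_divide)
qed

lemma pow4_sum_le: "(a + b) ^ 4 \<le> 8 * (a ^ 4 + (b::real) ^ 4)"
proof -
  have "(a + b) ^ 2 \<le> 2 * (a ^ 2 + b ^ 2)" using sum_squares_bound[of a b] by (simp add: power2_sum)
  then have "((a + b) ^ 2) ^ 2 \<le> (2 * (a ^ 2 + b ^ 2)) ^ 2" by (intro power_mono) auto
  also have "\<dots> \<le> 4 * (2 * (a ^ 4 + b ^ 4))" using sum_squares_bound[of "a ^ 2" "b ^ 2"]
    by (simp add: power_mult_distrib power2_sum algebra_simps flip: power_mult)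
  finally show ?thesis by (simp flip: power_mult)
qed

lemma pow4_le_exp:
  fixes x c :: real
  assumes "0 \<le> x" "0 < c" shows "x ^ 4 \<le> (4 / c) ^ 4 * exp (c * x)"
proof -
  have "c * x / 4 \<le> exp (c * x / 4)" using exp_ge_add_one_self[of "c * x / 4"] by linarith
  then have "(c * x / 4) ^ 4 \<le> exp (c * x / 4) ^ 4" using assms by (intro power_mono) auto
  also have "exp (c * x / 4) ^ 4 = exp (c * x)" by (simp add: exp_of_nat_mult[symmetric])
  finally show ?thesis using assms by (simp add: field_simps)
qed

lemma one_minus_exp_ge:
  assumes "0 < t" "t \<le> (1::real)" shows "t / 2 \<le> 1 - exp (- t)"
proof -
  have "exp (- t) \<le> 1 / (1 + t)" using exp_ge_add_one_self[of t] assms by (simp add: exp_minus field_simps)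
  also have "\<dots> \<le> 1 - t / 2" using assms by (simp add: field_simps power2_eq_square)
  finally show ?thesis by simp
qed

lemma kernel_bound:
  assumes "0 < t" "t \<le> 1" shows "norm (of_real t / (1 - exp (- cpl t \<theta>))) \<le> 2"
proof -
  have "t / 2 \<le> norm (1 - exp (- cpl t \<theta>))"
    using one_minus_exp_ge[OF assms] norm_one_minus_exp[OF assms(1), of \<theta>] by linarith
  then show ?thesis using assms one_minus_exp_neq_0[OF assms(1), of \<theta>] by (simp add: norm_divide field_simps)
qed

lemma norm_cpl_pow4: "norm (cpl a b) ^ 4 \<le> 8 * (a ^ 4 + b ^ 4)"
proof -
  have "norm (cpl a b) \<le> \<bar>a\<bar> + \<bar>b\<bar>" using norm_triangle_ineq[of "of_real a" "\<i> * of_real b"] by (simp add: norm_mult)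
  then have "norm (cpl a b) ^ 4 \<le> (\<bar>a\<bar> + \<bar>b\<bar>) ^ 4" by (intro power_mono) auto
  also have "\<dots> \<le> 8 * (\<bar>a\<bar> ^ 4 + \<bar>b\<bar> ^ 4)" by (rule pow4_sum_le)
  finally show ?thesis by simp
qed

text \<open>Since \<open>s * z = y + i * u\<close>, the left side is \<open>(y + i * u) ^ 2 / 2 - (y
  + i * u) * y + y ^ 2 / 2 = (i * u) ^ 2 / 2\<close>.\<close>

lemma saddle_exponent:
  assumes "s \<noteq> 0"
  shows "(of_real s)\<^sup>2 * (cpl (y / s) (u / s))\<^sup>2 / 2 + (- cpl (y / s) (u / s) * of_real (s * y) + of_real (y\<^sup>2 / 2)) = of_real (- u\<^sup>2 / 2)"
proof -
  have "of_real s * cpl (y / s) (u / s) = cpl y u" using assms by (simp add: algebra_simps)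
  then have e: "(of_real s)\<^sup>2 * (cpl (y / s) (u / s))\<^sup>2 = (cpl y u)\<^sup>2" "cpl (y / s) (u / s) * of_real (s * y) = cpl y u * of_real y"
    by (simp_all add: power_mult_distrib[symmetric] mult_ac)
  show ?thesis unfolding minus_mult_left[symmetric] e by (simp add: field_simps power2_eq_square)
qed

text \<open>The saddle point \<open>y / s\<close> of the Gaussian approximation is used instead of the exact one.
  This is accurate enough because the third cumulant vanishes, as is implicit in the hypothesis on \<open>F\<close>.\<close>

lemma quartic_error_split:
  fixes s :: real
  assumes "0 < s"
  shows "C * N * (B ^ 4 * (8 * ((y / s) ^ 4 + (u / s) ^ 4))) =
    8 * C * y ^ 4 * (N * B ^ 4 / s ^ 4) + 8 * C * ((N * B\<^sup>2 / s\<^sup>2) * ((B * \<bar>u / s\<bar>)\<^sup>2 * u\<^sup>2))"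
proof -
  have a: "(B * \<bar>u / s\<bar>)\<^sup>2 = B\<^sup>2 * u\<^sup>2 / s\<^sup>2" by (simp add: power_mult_distrib power_divide)
  show ?thesis unfolding a power_divide using assms by (simp add: field_simps power2_eq_square power4_eq_xxxx)
qed

lemma scale_bounds:
  fixes s :: real
  assumes s: "0 < s" and B: "0 < B" and N: "0 < N" and c: "0 < c" "c * B * sqrt N \<le> s"
  shows "N * B ^ 4 / s ^ 4 \<le> 1 / (c ^ 4 * N)" "N * B\<^sup>2 / s\<^sup>2 \<le> 1 / c\<^sup>2"
proof -
  have "(c * B * sqrt N) ^ 4 \<le> s ^ 4" using c B N by (intro power_mono) auto
  moreover have "sqrt N ^ 4 = (sqrt N ^ 2) ^ 2" by (simp flip: power_mult)
  ultimately have "c ^ 4 * B ^ 4 * N\<^sup>2 \<le> s ^ 4" using N by (simp add: power_mult_distrib)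
  then show "N * B ^ 4 / s ^ 4 \<le> 1 / (c ^ 4 * N)" using c N s by (simp add: field_simps power2_eq_square)
  have "(c * B * sqrt N)\<^sup>2 \<le> s\<^sup>2" using c B N by (intro power_mono) auto
  then have "c\<^sup>2 * B\<^sup>2 * N \<le> s\<^sup>2" using N by (simp add: power_mult_distrib)
  then show "N * B\<^sup>2 / s\<^sup>2 \<le> 1 / c\<^sup>2" using c N s by (simp add: field_simps)
qed

text \<open>The error may consume half of the Gaussian exponent \<open>u ^ 2 / 2\<close>. The part
  with \<open>y\<close> is at most 1 because \<open>y ^ 4 / N\<close> is small; in the part with
  \<open>u\<close>, two of the four powers are traded for \<open>\<epsilon> ^ 2\<close>.\<close>

lemma quartic_error_bound:
  fixes s :: real
  assumes s: "0 < s" and B: "0 < B" and N: "0 < N" and c: "0 < c" "c * B * sqrt N \<le> s"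
    and C: "0 \<le> C" "8 * C * \<epsilon>\<^sup>2 / c\<^sup>2 \<le> 1 / 4" "8 * C * y ^ 4 / (c ^ 4 * N) \<le> 1"
    and u: "B * \<bar>u / s\<bar> \<le> \<epsilon>"
  shows "C * N * (B * norm (cpl (y / s) (u / s))) ^ 4 \<le> 1 + u\<^sup>2 / 4"
proof -
  note sb = scale_bounds[OF s B N c]
  have "C * N * (B * norm (cpl (y / s) (u / s))) ^ 4 \<le> C * N * (B ^ 4 * (8 * ((y / s) ^ 4 + (u / s) ^ 4)))"
    unfolding power_mult_distrib using C N B norm_cpl_pow4[of "y / s" "u / s"]
    by (intro mult_left_mono) (simp_all only: zero_le_power mult_nonneg_nonneg less_imp_le)
  also have "\<dots> = 8 * C * y ^ 4 * (N * B ^ 4 / s ^ 4) + 8 * C * ((N * B\<^sup>2 / s\<^sup>2) * ((B * \<bar>u / s\<bar>)\<^sup>2 * u\<^sup>2))"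
    by (rule quartic_error_split[OF s])
  also have "\<dots> \<le> 1 + u\<^sup>2 / 4"
  proof (rule add_mono)
    have "8 * C * y ^ 4 * (N * B ^ 4 / s ^ 4) \<le> 8 * C * y ^ 4 * (1 / (c ^ 4 * N))"
      using sb(1) C by (intro mult_left_mono) auto
    then show "8 * C * y ^ 4 * (N * B ^ 4 / s ^ 4) \<le> 1" using C(3) by simp
    have "(B * \<bar>u / s\<bar>)\<^sup>2 \<le> \<epsilon>\<^sup>2" using u B by (intro power_mono) auto
    then have "(N * B\<^sup>2 / s\<^sup>2) * ((B * \<bar>u / s\<bar>)\<^sup>2 * u\<^sup>2) \<le> 1 / c\<^sup>2 * (\<epsilon>\<^sup>2 * u\<^sup>2)"
      using sb(2) by (intro mult_mono mult_right_mono) auto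
    then have "8 * C * ((N * B\<^sup>2 / s\<^sup>2) * ((B * \<bar>u / s\<bar>)\<^sup>2 * u\<^sup>2)) \<le> 8 * C * (1 / c\<^sup>2 * (\<epsilon>\<^sup>2 * u\<^sup>2))"
      using C by (intro mult_left_mono) auto
    also have "\<dots> = (8 * C * \<epsilon>\<^sup>2 / c\<^sup>2) * u\<^sup>2" by simp
    also have "\<dots> \<le> 1 / 4 * u\<^sup>2" using C(2) by (intro mult_right_mono) auto
    finally show "8 * C * ((N * B\<^sup>2 / s\<^sup>2) * ((B * \<bar>u / s\<bar>)\<^sup>2 * u\<^sup>2)) \<le> u\<^sup>2 / 4" by simp
  qed
  finally show ?thesis .
qed

lemma integrand_eq:
  fixes y u :: real
  assumes s: "s \<noteq> 0"
  defines "z \<equiv> cpl (y / s) (u / s)"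
  shows "F z * exp (- z * of_real (s * y) + of_real (y\<^sup>2 / 2)) = (F z * exp (- (of_real s)\<^sup>2 * z\<^sup>2 / 2)) * of_real (exp (- u\<^sup>2 / 2))"
proof -
  have "F z = (F z * exp (- (of_real s)\<^sup>2 * z\<^sup>2 / 2)) * exp ((of_real s)\<^sup>2 * z\<^sup>2 / 2)" by (simp add: mult.assoc exp_add[symmetric])
  then have "F z * exp (- z * of_real (s * y) + of_real (y\<^sup>2 / 2)) =
     (F z * exp (- (of_real s)\<^sup>2 * z\<^sup>2 / 2)) * exp ((of_real s)\<^sup>2 * z\<^sup>2 / 2 + (- z * of_real (s * y) + of_real (y\<^sup>2 / 2)))"
    by (metis exp_add mult.assoc)
  also have "(of_real s)\<^sup>2 * z\<^sup>2 / 2 + (- z * of_real (s * y) + of_real (y\<^sup>2 / 2)) = of_real (- u\<^sup>2 / 2)"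
    unfolding z_def by (rule saddle_exponent[OF s])
  finally show ?thesis by (simp only: exp_of_real)
qed

lemma gauss_le_inv_square: "exp (- ((u::real)\<^sup>2 / 4)) \<le> 4 / (1 + u\<^sup>2)"
proof -
  have "1 + u\<^sup>2 / 4 \<le> exp (u\<^sup>2 / 4)" by (rule exp_ge_add_one_self)
  then have "1 + u\<^sup>2 \<le> 4 * exp (u\<^sup>2 / 4)" by linarith
  moreover have "0 < 1 + u\<^sup>2" by (rule add_pos_nonneg) auto
  ultimately show ?thesis by (simp add: exp_minus field_simps)
qed

lemma integrand_bound_near:
  fixes F :: "complex \<Rightarrow> complex"
  assumes y: "1 \<le> y" and s: "0 < s" and B: "0 < B" and N: "0 < N" and c: "0 < c" "c * B * sqrt N \<le> s"
    and t: "y / s \<le> 1" and C: "0 \<le> C" "8 * C * \<epsilon>\<^sup>2 / c\<^sup>2 \<le> 1 / 4" "8 * C * y ^ 4 / (c ^ 4 * N) \<le> 1"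
    and H1: "\<And>z. B * norm z \<le> 2 * \<epsilon> \<Longrightarrow> norm (F z * exp (- (of_real s)\<^sup>2 * z\<^sup>2 / 2) - 1) \<le> exp (C * N * (B * norm z) ^ 4) - 1"
    and Bt: "B * (y / s) \<le> \<epsilon>" and u: "B * \<bar>u / s\<bar> \<le> \<epsilon>"
  defines "z \<equiv> cpl (y / s) (u / s)"
  shows "norm (of_real (y / s) / (1 - exp (- z)) * F z * exp (- z * of_real (s * y) + of_real (y\<^sup>2 / 2))) \<le> 24 / (1 + u\<^sup>2)"
proof -
  have t0: "0 < y / s" using y s by simp
  have K: "norm (of_real (y / s) / (1 - exp (- z))) \<le> 2" unfolding z_def by (rule kernel_bound[OF t0 t])
  have "norm z \<le> norm (complex_of_real (y / s)) + norm (\<i> * complex_of_real (u / s))"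
    unfolding z_def by (rule norm_triangle_ineq)
  then have "norm z \<le> y / s + \<bar>u / s\<bar>" using t0 by (simp only: norm_mult norm_of_real norm_ii abs_of_pos mult_1)
  then have "B * norm z \<le> B * (y / s + \<bar>u / s\<bar>)" using B by (intro mult_left_mono) auto
  then have Bz: "B * norm z \<le> 2 * \<epsilon>" using Bt u unfolding distrib_left by linarith
  define R where "R = F z * exp (- (of_real s)\<^sup>2 * z\<^sup>2 / 2)"
  have "norm R \<le> exp (C * N * (B * norm z) ^ 4)"
    using norm_triangle_ineq[of "R - 1" 1] H1[OF Bz] unfolding R_def[symmetric] by simp
  also have "\<dots> \<le> exp (1 + u\<^sup>2 / 4)"
    unfolding z_def using quartic_error_bound[OF s B N c C u] by simp
  finally have R: "norm R \<le> exp (1 + u\<^sup>2 / 4)" .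
  have "F z * exp (- z * of_real (s * y) + of_real (y\<^sup>2 / 2)) = R * of_real (exp (- u\<^sup>2 / 2))"
    unfolding z_def R_def by (rule integrand_eq) (use s in simp)
  then have "norm (F z * exp (- z * of_real (s * y) + of_real (y\<^sup>2 / 2))) = norm R * exp (- u\<^sup>2 / 2)"
    by (simp only: norm_mult norm_of_real abs_exp_cancel)
  also have "\<dots> \<le> exp (1 + u\<^sup>2 / 4) * exp (- u\<^sup>2 / 2)" using R by (intro mult_right_mono) auto
  also have "\<dots> = exp 1 * exp (- (u\<^sup>2 / 4))" by (simp add: exp_add[symmetric])
  \<comment> \<open>The final 24 is composed of 2 from the kernel, 3 from \<open>exp 1\<close>, and
    4 from \<open>gauss_le_inv_square\<close>.\<close>
  also have "\<dots> \<le> 3 * (4 / (1 + u\<^sup>2))"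
    using gauss_le_inv_square[of u] exp_le by (intro mult_mono) auto
  finally have "norm (of_real (y / s) / (1 - exp (- z))) * norm (F z * exp (- z * of_real (s * y) + of_real (y\<^sup>2 / 2))) \<le> 2 * (3 * (4 / (1 + u\<^sup>2)))"
    using K by (intro mult_mono) auto
  also have "\<dots> = 24 / (1 + u\<^sup>2)" by simp
  finally show ?thesis by (simp only: norm_mult mult.assoc)
qed

text \<open>On this range \<open>\<bar>u\<bar>\<close> is at most a constant times
  \<open>N ^ 2\<close>, so \<open>u ^ 2\<close> is absorbed by \<open>exp (c' * N)\<close>. The
  exponential smallness thus takes the same integrable form as the bound near the centre.\<close>

lemma integrand_bound_far:
  fixes F :: "complex \<Rightarrow> complex"
  assumes y: "1 \<le> y" and s: "0 < s" and N: "0 < N" and t: "y / s \<le> 1"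
    and H2: "norm (F (cpl (y / s) (u / s))) \<le> exp (- c' * N)" and c': "0 < c'"
    and D: "s \<le> D * N\<^sup>2" "0 < D" and u: "\<bar>u\<bar> \<le> pi * s"
  defines "z \<equiv> cpl (y / s) (u / s)"
  shows "norm (of_real (y / s) / (1 - exp (- z)) * F z * exp (- z * of_real (s * y) + of_real (y\<^sup>2 / 2)))
    \<le> 2 * (1 + pi\<^sup>2 * D\<^sup>2 * (4 / c') ^ 4) / (1 + u\<^sup>2)"
proof -
  have t0: "0 < y / s" using y s by simp
  have K: "norm (of_real (y / s) / (1 - exp (- z))) \<le> 2" unfolding z_def by (rule kernel_bound[OF t0 t])
  have pos: "0 < 1 + u\<^sup>2" by (rule add_pos_nonneg) auto
  have E: "norm (exp (- z * of_real (s * y) + of_real (y\<^sup>2 / 2))) \<le> 1"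
  proof -
    have "Re (- z * of_real (s * y) + of_real (y\<^sup>2 / 2)) = - (y\<^sup>2 / 2)"
      using s by (simp add: z_def power2_eq_square)
    then have "norm (exp (- z * of_real (s * y) + of_real (y\<^sup>2 / 2))) = exp (- (y\<^sup>2 / 2))" by (simp only: norm_exp_eq_Re)
    also have "\<dots> \<le> 1" by simp
    finally show ?thesis .
  qed
  have "norm (of_real (y / s) / (1 - exp (- z))) * norm (F z) * norm (exp (- z * of_real (s * y) + of_real (y\<^sup>2 / 2))) \<le> 2 * exp (- c' * N) * 1"
    using K H2 E unfolding z_def by (intro mult_mono) auto
  also have "\<dots> \<le> 2 * ((1 + pi\<^sup>2 * D\<^sup>2 * (4 / c') ^ 4) / (1 + u\<^sup>2))"
  proof -
    have "pi * s \<le> pi * (D * N\<^sup>2)" using D(1) by (intro mult_left_mono) auto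
    then have "\<bar>u\<bar> \<le> pi * (D * N\<^sup>2)" using u by linarith
    then have "\<bar>u\<bar>\<^sup>2 \<le> (pi * (D * N\<^sup>2))\<^sup>2" by (intro power_mono) auto
    also have "\<dots> = pi\<^sup>2 * D\<^sup>2 * N ^ 4" by (simp add: power_mult_distrib flip: power_mult)
    also have "\<dots> \<le> pi\<^sup>2 * D\<^sup>2 * ((4 / c') ^ 4 * exp (c' * N))"
      using pow4_le_exp[of N c'] N c' by (intro mult_left_mono) auto
    finally have "u\<^sup>2 \<le> pi\<^sup>2 * D\<^sup>2 * (4 / c') ^ 4 * exp (c' * N)" by (simp add: mult.assoc)
    moreover have "1 \<le> exp (c' * N)" using N c' by simp
    ultimately have "1 + u\<^sup>2 \<le> (1 + pi\<^sup>2 * D\<^sup>2 * (4 / c') ^ 4) * exp (c' * N)" unfolding distrib_right by linarith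
    then have "exp (- c' * N) \<le> (1 + pi\<^sup>2 * D\<^sup>2 * (4 / c') ^ 4) / (1 + u\<^sup>2)"
      using pos by (simp add: exp_minus pos_le_divide_eq) (simp add: divide_simps mult.commute)
    then have "2 * exp (- c' * N) \<le> 2 * ((1 + pi\<^sup>2 * D\<^sup>2 * (4 / c') ^ 4) / (1 + u\<^sup>2))" by (intro mult_left_mono) auto
    then show ?thesis by (simp only: mult_1_right)
  qed
  finally show ?thesis by (simp only: norm_mult times_divide_eq_right)
qed

lemma error_le:
  fixes s :: real
  assumes s: "0 < s" and B: "0 < B" and N: "0 < N" and c: "0 < c" "c * B * sqrt N \<le> s" and C: "0 \<le> C"
  shows "C * N * (B * norm (cpl (y / s) (u / s))) ^ 4 \<le> 8 * C / c ^ 4 * (y ^ 4 / N + u ^ 4 / N)"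
proof -
  have "C * N * (B * norm (cpl (y / s) (u / s))) ^ 4 \<le> C * N * (B ^ 4 * (8 * ((y / s) ^ 4 + (u / s) ^ 4)))"
    unfolding power_mult_distrib using C N B norm_cpl_pow4[of "y / s" "u / s"]
    by (intro mult_left_mono) (simp_all only: zero_le_power mult_nonneg_nonneg less_imp_le)
  also have "\<dots> = 8 * C * (y ^ 4 + u ^ 4) * (N * B ^ 4 / s ^ 4)" using s by (simp add: field_simps)
  also have "\<dots> \<le> 8 * C * (y ^ 4 + u ^ 4) * (1 / (c ^ 4 * N))"
    using scale_bounds(1)[OF s B N c] C by (intro mult_left_mono) auto
  also have "\<dots> = 8 * C / c ^ 4 * (y ^ 4 / N + u ^ 4 / N)" using c N by (simp add: field_simps)
  finally show ?thesis .
qed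

text \<open>Since \<open>z = (y / s) * (1 + i * u / y)\<close>, the expression is
  \<open>z / (1 - exp (- z))\<close> divided by \<open>1 + i * u / y\<close>, and both tend to
  1.\<close>

lemma kernel_factor_tendsto:
  fixes y s :: "nat \<Rightarrow> real"
  assumes "filterlim y at_top sequentially" "filterlim s at_top sequentially" "(\<lambda>n. y n / s n) \<longlonglongrightarrow> 0"
  shows "(\<lambda>n. of_real (y n / s n) / (1 - exp (- cpl (y n / s n) (u / s n)))) \<longlonglongrightarrow> 1"
proof -
  let ?z = "\<lambda>n. cpl (y n / s n) (u / s n)"
  have "(\<lambda>n. u / s n) \<longlonglongrightarrow> 0" by (rule tendsto_divide_0[OF tendsto_const filterlim_at_top_imp_at_infinity[OF assms(2)]])
  then have "?z \<longlonglongrightarrow> of_real 0 + \<i> * of_real 0" by (intro tendsto_intros assms(3))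
  then have z: "?z \<longlonglongrightarrow> 0" by simp
  have pos: "\<forall>\<^sub>F n in sequentially. 0 < y n \<and> 0 < s n"
    using assms(1,2) by (auto simp: filterlim_at_top_dense intro: eventually_conj)
  have nz: "\<forall>\<^sub>F n in sequentially. ?z n \<noteq> 0"
    using pos by eventually_elim (auto simp: complex_eq_iff)
  have k1: "(\<lambda>n. ?z n / (1 - exp (- ?z n))) \<longlonglongrightarrow> 1"
    by (rule filterlim_compose[OF tendsto_div_one_minus_exp]) (use z nz in \<open>auto simp: filterlim_at\<close>)
  have "(\<lambda>n. u / y n) \<longlonglongrightarrow> 0" by (rule tendsto_divide_0[OF tendsto_const filterlim_at_top_imp_at_infinity[OF assms(1)]])
  then have "(\<lambda>n. 1 / (1 + \<i> * of_real (u / y n))) \<longlonglongrightarrow> 1 / (1 + \<i> * of_real 0)"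
    by (intro tendsto_intros) auto
  then have k2: "(\<lambda>n. 1 / (1 + \<i> * of_real (u / y n))) \<longlonglongrightarrow> 1" by simp
  have "(\<lambda>n. ?z n / (1 - exp (- ?z n)) * (1 / (1 + \<i> * of_real (u / y n)))) \<longlonglongrightarrow> 1 * 1"
    by (intro tendsto_mult k1 k2)
  moreover have "\<forall>\<^sub>F n in sequentially. ?z n / (1 - exp (- ?z n)) * (1 / (1 + \<i> * of_real (u / y n))) = of_real (y n / s n) / (1 - exp (- ?z n))"
    using pos
  proof eventually_elim
    case (elim n)
    have e: "?z n = of_real (y n / s n) * (1 + \<i> * of_real (u / y n))" using elim by (simp add: field_simps)
    have "1 + \<i> * of_real (u / y n) \<noteq> 0" by (auto simp: complex_eq_iff)
    moreover have "a * b / c * (1 / b) = a / c" if "b \<noteq> 0" for a b c :: complex using that by simp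
    ultimately show ?case by (subst (1) e) blast
  qed
  ultimately show ?thesis by (simp add: Lim_transform_eventually)
qed

text \<open>What the two statistics have in common. \<open>B\<close> is the scale of the largest
  component and \<open>N\<close> the total rank; \<open>H1\<close> describes the moment generating
  function within distance \<open>\<delta> / B\<close> of the origin, and \<open>H2\<close> bounds
  it for imaginary parts beyond that scale. \<open>\<mu>\<close> and \<open>s\<close> are mere
  parameters: \<open>moments\<close> shows that \<open>H1\<close> forces them to be the mean and the
  standard deviation.\<close>

locale tail_setup =
  fixes A :: "nat \<Rightarrow> 'w set" and X :: "nat \<Rightarrow> 'w \<Rightarrow> nat" and \<mu> s N B :: "nat \<Rightarrow> real" and c C \<delta> D :: real
  assumes cst: "0 < c" "0 \<le> C" "0 < \<delta>" "0 < D"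
    and fin: "\<And>n. finite (A n)" and B: "\<And>n. 1 \<le> B n" and N: "\<And>n. 0 < N n"
    and s_ge: "\<And>n. c * B n * sqrt (N n) \<le> s n" and s_le: "\<And>n. s n \<le> D * (N n)\<^sup>2"
    and H1: "\<And>n z. B n * norm z \<le> \<delta> \<Longrightarrow>
      norm (mgf (A n) (X n) (\<mu> n) z * exp (- (of_real (s n))\<^sup>2 * z\<^sup>2 / 2) - 1) \<le> exp (C * N n * (B n * norm z) ^ 4) - 1"
    and H2: "\<And>\<epsilon>. 0 < \<epsilon> \<Longrightarrow> \<exists>c' \<eta>. 0 < c' \<and> 0 < \<eta> \<and> (\<forall>n t \<theta>. 0 \<le> t \<longrightarrow> B n * t \<le> \<eta> \<longrightarrow> \<epsilon> \<le> B n * \<bar>\<theta>\<bar> \<longrightarrow> \<bar>\<theta>\<bar> \<le> pi \<longrightarrow>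
      norm (mgf (A n) (X n) (\<mu> n) (cpl t \<theta>)) \<le> exp (- c' * N n))"
    and N_top: "filterlim N at_top sequentially"
begin

lemma Bpos: "0 < B n" using B[of n] by linarith

lemma s_pos: "0 < s n"
proof -
  have "0 < c * B n * sqrt (N n)" using cst Bpos N by simp
  then show ?thesis using s_ge[of n] by linarith
qed

lemma s_top: "filterlim s at_top sequentially"
proof (rule filterlim_at_top_mono)
  show "filterlim (\<lambda>n. c * sqrt (N n)) at_top sequentially"
    by (intro filterlim_tendsto_pos_mult_at_top[OF tendsto_const] cst filterlim_compose[OF sqrt_at_top N_top])
  show "\<forall>\<^sub>F n in sequentially. c * sqrt (N n) \<le> s n"
  proof (intro always_eventually allI)
    fix n
    have "c * 1 * sqrt (N n) \<le> c * B n * sqrt (N n)" using cst B[of n] N[of n] by (intro mult_right_mono mult_left_mono) auto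
    then show "c * sqrt (N n) \<le> s n" using s_ge[of n] by simp
  qed
qed

theorem tail_asymp:
  fixes y :: "nat \<Rightarrow> real" and k :: "nat \<Rightarrow> int"
  assumes k: "\<And>n. of_int (k n) = \<mu> n + s n * y n"
    and y_top: "filterlim y at_top sequentially" and y_small: "(\<lambda>n. y n ^ 4 / N n) \<longlonglongrightarrow> 0"
  shows "(\<lambda>n. tail (A n) (X n) (k n) * (sqrt (2 * pi) * (y n * exp ((y n)\<^sup>2 / 2)))) \<longlonglongrightarrow> 1"
proof -
  \<comment> \<open>The first bound places the near region
    \<open>B * norm z \<le> 2 * \<epsilon>\<close> inside the domain of \<open>H1\<close>. The
    second one makes \<open>8 * C * \<epsilon> ^ 2 / c ^ 2\<close> at most 8 / 36, as
    \<open>quartic_error_bound\<close> requires.\<close>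
  define \<epsilon> where "\<epsilon> = min (\<delta> / 2) (c / (6 * sqrt (C + 1)))"
  have \<epsilon>: "0 < \<epsilon>" "2 * \<epsilon> \<le> \<delta>" using cst by (auto simp: \<epsilon>_def)
  have \<epsilon>C: "8 * C * \<epsilon>\<^sup>2 / c\<^sup>2 \<le> 1 / 4"
  proof -
    have "\<epsilon>\<^sup>2 \<le> (c / (6 * sqrt (C + 1)))\<^sup>2" using \<epsilon>(1) by (intro power_mono) (auto simp: \<epsilon>_def)
    also have "\<dots> = c\<^sup>2 / (36 * (C + 1))" using cst by (simp add: power_divide power_mult_distrib)
    finally have "8 * C * \<epsilon>\<^sup>2 / c\<^sup>2 \<le> 8 * C * (c\<^sup>2 / (36 * (C + 1))) / c\<^sup>2"
      using cst by (intro divide_right_mono mult_left_mono) auto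
    also have "\<dots> = 8 * C / (36 * (C + 1))" using cst by simp
    also have "\<dots> \<le> 1 / 4" using cst by (simp add: field_simps)
    finally show ?thesis .
  qed
  obtain c' \<eta> where c': "0 < c'" and \<eta>: "0 < \<eta>" and H2': "\<And>n t \<theta>. 0 \<le> t \<Longrightarrow> B n * t \<le> \<eta> \<Longrightarrow> \<epsilon> \<le> B n * \<bar>\<theta>\<bar> \<Longrightarrow> \<bar>\<theta>\<bar> \<le> pi \<Longrightarrow>
      norm (mgf (A n) (X n) (\<mu> n) (cpl t \<theta>)) \<le> exp (- c' * N n)"
    using H2[OF \<epsilon>(1)] by blast
  have r0: "(\<lambda>n. sqrt (y n ^ 4 / N n) / c) \<longlonglongrightarrow> 0"
    using tendsto_real_sqrt[OF y_small] cst by (auto intro!: tendsto_eq_intros)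
  have y1: "\<forall>\<^sub>F n in sequentially. 1 \<le> y n" using y_top by (simp add: filterlim_at_top)
  \<comment> \<open>The saddle point \<open>y / s\<close> is small even on the scale
    \<open>1 / B\<close>: the lower bound on \<open>s\<close> and \<open>y \<le> y ^ 2\<close>
    reduce this to the smallness of \<open>y ^ 4 / N\<close>.\<close>
  have By: "B n * (y n / s n) \<le> sqrt (y n ^ 4 / N n) / c" if "1 \<le> y n" for n
  proof -
    have "y n \<le> (y n)\<^sup>2" using that by (simp add: power2_eq_square)
    also have "(y n)\<^sup>2 = sqrt (y n ^ 4)" by (rule real_sqrt_unique[symmetric]) (auto simp flip: power_mult)
    finally have "y n / sqrt (N n) \<le> sqrt (y n ^ 4 / N n)" using N[of n] by (simp add: real_sqrt_divide divide_right_mono)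
    moreover have "B n * (y n / s n) \<le> y n / sqrt (N n) / c"
    proof -
      have "y n * (c * B n * sqrt (N n)) \<le> y n * s n" using s_ge[of n] that by (intro mult_left_mono) auto
      then show ?thesis using s_pos[of n] N[of n] cst by (simp add: field_simps)
    qed
    ultimately show ?thesis using cst by (meson divide_right_mono less_imp_le order_trans)
  qed
  have "\<forall>\<^sub>F n in sequentially. 1 \<le> y n \<and> y n / s n \<le> 1 \<and> 8 * C * y n ^ 4 / (c ^ 4 * N n) \<le> 1 \<and> B n * (y n / s n) \<le> \<epsilon> \<and> B n * (y n / s n) \<le> \<eta>"
  proof -
    have "(\<lambda>n. 8 * C / c ^ 4 * (y n ^ 4 / N n)) \<longlonglongrightarrow> 8 * C / c ^ 4 * 0" by (intro tendsto_intros y_small)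
    then have e1: "\<forall>\<^sub>F n in sequentially. 8 * C / c ^ 4 * (y n ^ 4 / N n) < 1" by (rule order_tendstoD) simp
    have e2: "\<forall>\<^sub>F n in sequentially. sqrt (y n ^ 4 / N n) / c < min 1 (min \<epsilon> \<eta>)" using r0 by (rule order_tendstoD) (use \<epsilon> \<eta> in auto)
    show ?thesis using y1 e1 e2
    proof eventually_elim
      case (elim n)
      have "0 \<le> y n / s n" using elim s_pos[of n] by simp
      then have "1 * (y n / s n) \<le> B n * (y n / s n)" using B[of n] by (intro mult_right_mono)
      then show ?case using By[OF elim(1)] elim by (simp add: field_simps)
    qed
  qed
  then obtain n0 where n0: "\<And>n. n \<ge> n0 \<Longrightarrow> 1 \<le> y n \<and> y n / s n \<le> 1 \<and> 8 * C * y n ^ 4 / (c ^ 4 * N n) \<le> 1 \<and> B n * (y n / s n) \<le> \<epsilon> \<and> B n * (y n / s n) \<le> \<eta>"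
    unfolding eventually_sequentially by blast
  define F where "F n = mgf (A n) (X n) (\<mu> n)" for n
  define z where "z n u = cpl (y n / s n) (u / s n)" for n u
  define G where "G n u = (if \<bar>u\<bar> \<le> pi * s n then of_real (y n / s n) / (1 - exp (- z n u)) * F n (z n u) * exp (- z n u * of_real (s n * y n) + of_real ((y n)\<^sup>2 / 2)) else 0)" for n u
  define T where "T n = tail (A n) (X n) (k n) * (y n * exp ((y n)\<^sup>2 / 2))" for n
  have G_int: "(G n has_integral of_real (2 * pi * T n)) UNIV" if "n \<ge> n0" for n
    unfolding G_def T_def F_def z_def using n0[OF that] s_pos fin k by (intro has_integral_tail_scaled) auto
  define K where "K = 24 + 2 * (1 + pi\<^sup>2 * D\<^sup>2 * (4 / c') ^ 4)"
  have bound: "norm (G n u) \<le> K / (1 + u\<^sup>2)" if "n \<ge> n0" for n u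
  proof -
    have pos: "0 < 1 + u\<^sup>2" by (rule add_pos_nonneg) auto
    note e = n0[OF that]
    have K0: "24 / (1 + u\<^sup>2) \<le> K / (1 + u\<^sup>2)" "2 * (1 + pi\<^sup>2 * D\<^sup>2 * (4 / c') ^ 4) / (1 + u\<^sup>2) \<le> K / (1 + u\<^sup>2)" "0 \<le> K / (1 + u\<^sup>2)"
      using pos by (auto simp: K_def intro!: divide_right_mono divide_nonneg_pos add_nonneg_nonneg)
    consider "\<bar>u\<bar> > pi * s n" | "\<bar>u\<bar> \<le> pi * s n" "B n * \<bar>u / s n\<bar> \<le> \<epsilon>" | "\<bar>u\<bar> \<le> pi * s n" "\<epsilon> \<le> B n * \<bar>u / s n\<bar>" by linarith
    then show ?thesis
    proof cases
      case 1 then show ?thesis using K0 by (simp add: G_def)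
    next
      case 2
      have "norm (F n w * exp (- (of_real (s n))\<^sup>2 * w\<^sup>2 / 2) - 1) \<le> exp (C * N n * (B n * norm w) ^ 4) - 1" if "B n * norm w \<le> 2 * \<epsilon>" for w
        unfolding F_def using H1[of n w] that \<epsilon> by simp
      then have "norm (G n u) \<le> 24 / (1 + u\<^sup>2)"
        unfolding G_def z_def using 2 e s_pos Bpos N cst s_ge \<epsilon>C
        by (simp only: if_True) (intro integrand_bound_near[where B = "B n" and N = "N n" and c = c and C = C and \<epsilon> = \<epsilon>], auto)
      then show ?thesis using K0 by linarith
    next
      case 3
      have "\<bar>u / s n\<bar> \<le> pi" using 3 s_pos[of n] by (simp add: field_simps)
      then have "norm (F n (cpl (y n / s n) (u / s n))) \<le> exp (- c' * N n)"
        unfolding F_def using 3 e s_pos[of n] by (intro H2') auto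
      then have "norm (G n u) \<le> 2 * (1 + pi\<^sup>2 * D\<^sup>2 * (4 / c') ^ 4) / (1 + u\<^sup>2)"
        unfolding G_def z_def using 3 e s_pos N cst s_le c'
        by (simp only: if_True) (intro integrand_bound_far[where N = "N n"], auto)
      then show ?thesis using K0 by linarith
    qed
  qed
  have ys0: "(\<lambda>n. y n / s n) \<longlonglongrightarrow> 0"
  proof (rule tendsto_sandwich[OF _ _ tendsto_const r0])
    show "\<forall>\<^sub>F n in sequentially. 0 \<le> y n / s n" using y1 by eventually_elim (use s_pos in \<open>auto intro!: divide_nonneg_pos\<close>)
    show "\<forall>\<^sub>F n in sequentially. y n / s n \<le> sqrt (y n ^ 4 / N n) / c"
      using y1
    proof eventually_elim
      case (elim n)
      have "0 \<le> y n / s n" using elim s_pos[of n] by simp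
      then have "1 * (y n / s n) \<le> B n * (y n / s n)" using B[of n] by (intro mult_right_mono)
      then show ?case using By[OF elim] by linarith
    qed
  qed
  have ptw: "(\<lambda>n. G n u) \<longlonglongrightarrow> of_real (exp (- u\<^sup>2 / 2))" for u
  proof -
    define R where "R n = F n (z n u) * exp (- (of_real (s n))\<^sup>2 * (z n u)\<^sup>2 / 2)" for n
    have k: "(\<lambda>n. of_real (y n / s n) / (1 - exp (- z n u))) \<longlonglongrightarrow> 1"
      unfolding z_def by (rule kernel_factor_tendsto[OF y_top s_top ys0])
    define E where "E n = 8 * C / c ^ 4 * (y n ^ 4 / N n + u ^ 4 / N n)" for n
    have "(\<lambda>n. u ^ 4 / N n) \<longlonglongrightarrow> 0" by (rule tendsto_divide_0[OF tendsto_const filterlim_at_top_imp_at_infinity[OF N_top]])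
    then have "E \<longlonglongrightarrow> 8 * C / c ^ 4 * (0 + 0)" unfolding E_def by (intro tendsto_intros y_small)
    then have "(\<lambda>n. exp (E n) - 1) \<longlonglongrightarrow> exp (8 * C / c ^ 4 * (0 + 0)) - 1" by (intro tendsto_intros)
    then have E0: "(\<lambda>n. exp (E n) - 1) \<longlonglongrightarrow> 0" by simp
    have "(\<lambda>n. B n * norm (z n u)) \<longlonglongrightarrow> 0"
    proof (rule tendsto_sandwich[OF _ _ tendsto_const])
      show "\<forall>\<^sub>F n in sequentially. 0 \<le> B n * norm (z n u)" by (intro always_eventually allI mult_nonneg_nonneg norm_ge_zero less_imp_le[OF Bpos])
      have "(\<lambda>n. \<bar>u\<bar> / (c * sqrt (N n))) \<longlonglongrightarrow> 0"
        by (intro tendsto_divide_0[OF tendsto_const] filterlim_at_top_imp_at_infinity filterlim_tendsto_pos_mult_at_top[OF tendsto_const] cst filterlim_compose[OF sqrt_at_top N_top])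
      then show "(\<lambda>n. sqrt (y n ^ 4 / N n) / c + \<bar>u\<bar> / (c * sqrt (N n))) \<longlonglongrightarrow> 0" using tendsto_add[OF r0] by simp
      show "\<forall>\<^sub>F n in sequentially. B n * norm (z n u) \<le> sqrt (y n ^ 4 / N n) / c + \<bar>u\<bar> / (c * sqrt (N n))"
        using y1
      proof eventually_elim
        case (elim n)
        have "norm (z n u) \<le> norm (complex_of_real (y n / s n)) + norm (\<i> * complex_of_real (u / s n))" unfolding z_def by (rule norm_triangle_ineq)
        also have "\<dots> = y n / s n + \<bar>u\<bar> / s n" unfolding norm_mult norm_of_real using elim s_pos[of n] by simp
        finally have "B n * norm (z n u) \<le> B n * (y n / s n + \<bar>u\<bar> / s n)" using Bpos[of n] by (intro mult_left_mono) auto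
        also have "\<dots> = B n * (y n / s n) + \<bar>u\<bar> * (B n / s n)" by (simp add: algebra_simps)
        also have "\<bar>u\<bar> * (B n / s n) \<le> \<bar>u\<bar> * (1 / (c * sqrt (N n)))"
          using s_ge[of n] s_pos[of n] cst N[of n] by (intro mult_left_mono) (auto simp: field_simps)
        finally show ?case using By[OF elim] by simp
      qed
    qed
    then have "\<forall>\<^sub>F n in sequentially. B n * norm (z n u) < \<delta>" by (rule order_tendstoD) (rule cst)
    then have "\<forall>\<^sub>F n in sequentially. norm (R n - 1) \<le> exp (E n) - 1"
    proof eventually_elim
      case (elim n)
      have "norm (R n - 1) \<le> exp (C * N n * (B n * norm (z n u)) ^ 4) - 1" unfolding R_def F_def using elim by (intro H1) simp
      also have "\<dots> \<le> exp (E n) - 1" unfolding E_def z_def using error_le[OF s_pos Bpos N cst(1) s_ge cst(2)] by simp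
      finally show ?case .
    qed
    then have "(\<lambda>n. R n - 1) \<longlonglongrightarrow> 0" by (rule Lim_null_comparison[OF _ E0])
    then have R1: "R \<longlonglongrightarrow> 1" by (simp add: LIM_zero_iff)
    have lim: "(\<lambda>n. of_real (y n / s n) / (1 - exp (- z n u)) * (R n * of_real (exp (- u\<^sup>2 / 2)))) \<longlonglongrightarrow> 1 * (1 * of_real (exp (- u\<^sup>2 / 2)))"
      by (intro tendsto_mult k R1 tendsto_const)
    have "\<forall>\<^sub>F n in sequentially. \<bar>u\<bar> / pi \<le> s n" using s_top by (simp add: filterlim_at_top)
    then have "\<forall>\<^sub>F n in sequentially. of_real (y n / s n) / (1 - exp (- z n u)) * (R n * of_real (exp (- u\<^sup>2 / 2))) = G n u"
    proof eventually_elim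
      case (elim n)
      then have le: "\<bar>u\<bar> \<le> pi * s n" by (simp add: field_simps)
      have "s n \<noteq> 0" using s_pos[of n] by simp
      from integrand_eq[OF this, of "F n" "y n" u] show ?case unfolding G_def R_def z_def using le by (simp only: if_True mult.assoc)
    qed
    from Lim_transform_eventually[OF lim this] show ?thesis by simp
  qed
  \<comment> \<open>The integral formula and the domination hold from \<open>n0\<close> on only,
    hence the shift.\<close>
  have "(\<lambda>n. integral UNIV (G (n + n0))) \<longlonglongrightarrow> integral UNIV (\<lambda>u. complex_of_real (exp (- u\<^sup>2 / 2)))"
  proof (rule dominated_convergence(2))
    show "G (n + n0) integrable_on UNIV" for n using G_int[of "n + n0"] by (auto simp: integrable_on_def)
    show "(\<lambda>u. K / (1 + u\<^sup>2)) integrable_on UNIV" by (rule integrable_inv_square)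
    show "norm (G (n + n0) u) \<le> K / (1 + u\<^sup>2)" for n u by (rule bound) simp
    show "(\<lambda>n. G (n + n0) u) \<longlonglongrightarrow> complex_of_real (exp (- u\<^sup>2 / 2))" for u
      using LIMSEQ_ignore_initial_segment[OF ptw] .
  qed
  moreover have "integral UNIV (G (n + n0)) = of_real (2 * pi * T (n + n0))" for n by (rule integral_unique[OF G_int]) simp
  moreover have "integral UNIV (\<lambda>u. complex_of_real (exp (- u\<^sup>2 / 2))) = of_real (sqrt (2 * pi))" by (rule integral_unique[OF has_integral_gauss])
  ultimately have "(\<lambda>n. complex_of_real (2 * pi * T (n + n0))) \<longlonglongrightarrow> of_real (sqrt (2 * pi))" by simp
  then have "(\<lambda>n. 2 * pi * T (n + n0)) \<longlonglongrightarrow> sqrt (2 * pi)" by (simp only: tendsto_of_real_iff)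
  then have "(\<lambda>n. 2 * pi * T n) \<longlonglongrightarrow> sqrt (2 * pi)" by (rule LIMSEQ_offset)
  then have "(\<lambda>n. 2 * pi * T n / sqrt (2 * pi)) \<longlonglongrightarrow> sqrt (2 * pi) / sqrt (2 * pi)" by (intro tendsto_intros) auto
  moreover have "2 * pi * T n / sqrt (2 * pi) = tail (A n) (X n) (k n) * (sqrt (2 * pi) * (y n * exp ((y n)\<^sup>2 / 2)))" for n
  proof -
    have "2 * pi / sqrt (2 * pi) = sqrt (2 * pi)" by (simp add: real_div_sqrt)
    then have "2 * pi * T n / sqrt (2 * pi) = sqrt (2 * pi) * T n" by (metis times_divide_eq_left)
    then show ?thesis by (simp add: T_def)
  qed
  ultimately show ?thesis by simp
qed

end

section \<open>The recursion for the centred descent numbers\<close>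

lemma holomorphic_quadratic_remainder:
  fixes \<phi> :: "complex \<Rightarrow> complex"
  assumes hol: "\<phi> holomorphic_on ball 0 R" and r: "r < R" and d0: "deriv \<phi> 0 = 0"
  shows "\<exists>C\<ge>0. \<forall>v. norm v \<le> r \<longrightarrow> norm (\<phi> v - \<phi> 0) \<le> C * norm v ^ 2"
proof (cases "0 \<le> r")
  case False
  then show ?thesis by (intro exI[of _ 0]) (auto dest: order_trans[OF norm_ge_zero])
next
  case True
  have sub: "cball 0 r \<subseteq> ball 0 R" using r by auto
  have hol1: "deriv \<phi> holomorphic_on ball 0 R" by (rule holomorphic_deriv[OF hol]) simp
  have hol2: "deriv (deriv \<phi>) holomorphic_on ball 0 R" by (rule holomorphic_deriv[OF hol1]) simp
  have "continuous_on (cball 0 r) (deriv (deriv \<phi>))"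
    using holomorphic_on_imp_continuous_on[OF hol2] sub by (rule continuous_on_subset)
  then have "bounded (deriv (deriv \<phi>) ` cball 0 r)" by (intro compact_imp_bounded compact_continuous_image) auto
  then obtain B where B: "B > 0" "\<And>v. v \<in> cball 0 r \<Longrightarrow> norm (deriv (deriv \<phi>) v) \<le> B"
    unfolding bounded_pos by auto
  show ?thesis
  proof (intro exI[of _ B] conjI allI impI)
    fix v :: complex assume v: "norm v \<le> r"
    define f where "f i = (if i = 0 then \<phi> else if i = 1 then deriv \<phi> else deriv (deriv \<phi>))" for i :: nat
    have "norm (f 0 v - (\<Sum>i\<le>1. f i 0 * (v - 0) ^ i / fact i)) \<le> B * norm (v - 0) ^ Suc 1 / fact 1"
    proof (rule field_Taylor[of "cball 0 r"])
      fix i :: nat and x :: complex assume x: "x \<in> cball 0 r" "i \<le> 1"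
      have xb: "x \<in> ball 0 R" using x(1) r by auto
      have "(\<phi> has_field_derivative deriv \<phi> x) (at x)" "(deriv \<phi> has_field_derivative deriv (deriv \<phi>) x) (at x)"
        using holomorphic_derivI[OF hol _ xb] holomorphic_derivI[OF hol1 _ xb] by auto
      then show "(f i has_field_derivative f (Suc i) x) (at x within cball 0 r)"
        using x(2) by (cases i) (auto simp: f_def intro: has_field_derivative_at_within)
    qed (use B v True in \<open>auto simp: f_def\<close>)
    then show "norm (\<phi> v - \<phi> 0) \<le> B * norm v ^ 2" by (simp add: f_def d0 numeral_2_eq_2)
  qed (use B in simp)
qed

text \<open>\<open>Gh (z\<^sup>2)\<close> is the entire function \<open>sinh (z / 2) / (z / 2)\<close>, the mgf of the uniform distribution on \<open>[- 1 / 2, 1 / 2]\<close>.\<close>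

definition Gh :: "complex \<Rightarrow> complex" where
  "Gh v = (\<Sum>k. v ^ k / (4 ^ k * fact (2 * k + 1)))"

lemma sums_sinh_half: "(\<lambda>k. z * ((z\<^sup>2) ^ k / (4 ^ k * fact (2 * k + 1)))) sums (2 * sinh (z / 2 :: complex))"
proof -
  define h where "h n = (if even n then 0 else (z / 2) ^ n /\<^sub>R fact n)" for n
  have "strict_mono (\<lambda>k::nat. 2 * k + 1)" by (auto simp: strict_mono_def)
  moreover have "h n = 0" if "n \<notin> range (\<lambda>k. 2 * k + 1)" for n
    using that unfolding h_def by (metis oddE rangeI)
  ultimately have "(\<lambda>k. h (2 * k + 1)) sums sinh (z / 2) \<longleftrightarrow> h sums sinh (z / 2)" by (rule sums_mono_reindex)
  moreover have "h sums sinh (z / 2)" unfolding h_def by (rule sinh_converges)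
  ultimately have "(\<lambda>k. h (2 * k + 1)) sums sinh (z / 2)" by blast
  then have "(\<lambda>k. (z / 2) ^ (2 * k + 1) /\<^sub>R fact (2 * k + 1)) sums sinh (z / 2)" by (simp add: h_def)
  then have "(\<lambda>k. 2 * ((z / 2) ^ (2 * k + 1) /\<^sub>R fact (2 * k + 1))) sums (2 * sinh (z / 2))" by (rule sums_mult)
  moreover have "2 * ((z / 2) ^ (2 * k + 1) /\<^sub>R fact (2 * k + 1)) = z * ((z\<^sup>2) ^ k / (4 ^ k * fact (2 * k + 1)))" for k
  proof -
    have "(2 :: complex) ^ (2 * k) = 4 ^ k" by (simp add: power_mult)
    then show ?thesis by (simp add: scaleR_conv_of_real power_divide power_mult[symmetric] field_simps del: fact_Suc)
  qed
  ultimately show ?thesis by simp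
qed

text \<open>Every \<open>v\<close> is a square \<open>z ^ 2\<close>, and the terms are then those of
  the series of \<open>2 * sinh (z / 2)\<close> up to the factor \<open>z\<close>.\<close>

lemma summable_Gh: "summable (\<lambda>k. (1 / (4 ^ k * fact (2 * k + 1))) * v ^ k :: complex)"
proof (cases "v = 0")
  case False
  define z where "z = csqrt v"
  have z: "z\<^sup>2 = v" "z \<noteq> 0" using False by (auto simp: z_def)
  from sums_summable[OF sums_sinh_half[of z]] show ?thesis unfolding summable_cmult_iff z(1) using z(2) by simp
next
  case True
  have "summable (\<lambda>k. if k = 0 then 1 else 0 :: complex)" by (rule summable_finite[of "{0}"]) auto
  moreover have "(\<lambda>k. (1 / (4 ^ k * fact (2 * k + 1))) * v ^ k) = (\<lambda>k. if k = 0 then 1 else 0)" using True by auto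
  ultimately show ?thesis by simp
qed

lemma Gh_sinh: "z * Gh (z\<^sup>2) = 2 * sinh (z / 2)"
proof -
  have "summable (\<lambda>k. (z\<^sup>2) ^ k / (4 ^ k * fact (2 * k + 1)))" using summable_Gh[of "z\<^sup>2"] by simp
  from sums_mult[OF summable_sums[OF this], of z] sums_sinh_half[of z] show ?thesis
    unfolding Gh_def by (rule sums_unique2)
qed

lemma Gh_0: "Gh 0 = 1"
proof -
  have "Gh 0 = (\<Sum>k. if k = 0 then 1 else 0)" unfolding Gh_def by (intro suminf_cong) auto
  also have "\<dots> = 1" by (subst suminf_finite[of "{0}"]) auto
  finally show ?thesis .
qed

definition Gh' :: "complex \<Rightarrow> complex" where "Gh' v = (\<Sum>k. diffs (\<lambda>k. 1 / (4 ^ k * fact (2 * k + 1))) k * v ^ k)"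

lemma Gh_deriv: "(Gh has_field_derivative Gh' v) (at v)"
proof -
  have "Gh = (\<lambda>v. \<Sum>k. (1 / (4 ^ k * fact (2 * k + 1))) * v ^ k)" by (auto simp: Gh_def)
  then show ?thesis unfolding Gh'_def using termdiffs_strong_converges_everywhere[OF summable_Gh] by simp
qed

lemma Gh_holomorphic: "Gh holomorphic_on S"
  using Gh_deriv by (auto simp: holomorphic_on_def field_differentiable_def intro: has_field_derivative_at_within)

lemma Gh'_0: "Gh' 0 = 1 / 24"
proof -
  have "Gh' 0 = (\<Sum>k. if k = 0 then 1 / 24 else 0)" unfolding Gh'_def
    by (intro suminf_cong) (auto simp: diffs_def fact_numeral)
  also have "\<dots> = 1 / 24" by (subst suminf_finite[of "{0}"]) auto
  finally show ?thesis .
qed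

text \<open>Obtained by differentiating \<open>z * Gh (z ^ 2) = 2 * sinh (z / 2)\<close>. In
  \<open>f_eq\<close> the derivative of the power of \<open>Gh\<close> thereby cancels the
  \<open>cosh\<close> term of the recursion and leaves one more power of \<open>Gh\<close>.\<close>

lemma Gh_ode: "2 * sinh (z / 2) * (2 * z * Gh' (z\<^sup>2)) = Gh (z\<^sup>2) * (cosh (z / 2) - Gh (z\<^sup>2))"
proof -
  have "((\<lambda>z. z * Gh (z\<^sup>2)) has_field_derivative (Gh (z\<^sup>2) + z * (Gh' (z\<^sup>2) * (2 * z)))) (at z)"
    by (auto intro!: derivative_eq_intros DERIV_chain2[OF Gh_deriv])
  moreover have "((\<lambda>z. z * Gh (z\<^sup>2)) has_field_derivative cosh (z / 2)) (at z)"
    unfolding Gh_sinh by (auto intro!: derivative_eq_intros)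
  ultimately have "Gh (z\<^sup>2) + z * (Gh' (z\<^sup>2) * (2 * z)) = cosh (z / 2)" by (rule DERIV_unique)
  then have e: "z * (2 * z * Gh' (z\<^sup>2)) = cosh (z / 2) - Gh (z\<^sup>2)" by (simp add: algebra_simps)
  have "2 * sinh (z / 2) * (2 * z * Gh' (z\<^sup>2)) = Gh (z\<^sup>2) * (z * (2 * z * Gh' (z\<^sup>2)))"
    unfolding Gh_sinh[symmetric] by (simp only: mult_ac)
  then show ?thesis unfolding e .
qed

text \<open>The zeros of \<open>sinh (z / 2)\<close> are the multiples of \<open>2 * pi * i\<close>,
  and the one at 0 is divided out, so the zeros of \<open>Gh\<close> have modulus at least
  \<open>4 * pi ^ 2 > 36\<close>.\<close>

lemma Gh_nonzero:
  assumes "norm v < 36" shows "Gh v \<noteq> 0"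
proof
  assume 0: "Gh v = 0"
  define z where "z = csqrt v"
  have z: "z\<^sup>2 = v" by (simp add: z_def)
  have z0: "z \<noteq> 0" using 0 Gh_0 z by (intro notI) simp
  have "sinh (z / 2) = 0" using Gh_sinh[of z] 0 z by simp
  then have "exp (z / 2) = exp (- (z / 2))" by (simp add: sinh_def)
  then have "exp (z / 2) * exp (z / 2) = 1" by (simp add: exp_minus divide_simps)
  then have "exp z = 1" by (simp add: exp_add[symmetric])
  then obtain n :: int where n: "Re z = 0" "Im z = of_int (2 * n) * pi" by (auto simp: exp_eq_1)
  then have "n \<noteq> 0" using z0 by (auto simp: complex_eq_iff)
  then have "1 \<le> \<bar>of_int n :: real\<bar>" by linarith
  then have "2 * pi * 1 \<le> 2 * pi * \<bar>of_int n\<bar>" by (intro mult_left_mono) auto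
  also have "\<dots> = norm z" using n by (simp add: cmod_eq_Im abs_mult)
  finally have "6 < norm z" using pi_gt3 by linarith
  then have "6\<^sup>2 < norm z ^ 2" by (intro power_strict_mono) auto
  then show False using assms z by (simp add: norm_power[symmetric])
qed

text \<open>The factor that the coefficient of \<open>z ^ k\<close> collects in the recursion
  between \<open>n0\<close> and \<open>n\<close>.\<close>

definition wc :: "nat \<Rightarrow> nat \<Rightarrow> nat \<Rightarrow> real" where
  "wc n0 n k = (\<Prod>j\<in>{n0<..n}. 1 - real k / real j)"

text \<open>For \<open>n0 = 0\<close> and \<open>n < k\<close> the product is, up to sign, the
  binomial coefficient \<open>k - 1 choose n\<close>. At \<open>j = k\<close> the factor is 0, and
  the later ones lie in the unit interval, so the bound is uniform in \<open>n\<close>.\<close>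

lemma wc_bound:
  assumes n: "n0 \<le> n" and n0: "n0 \<le> 1" shows "\<bar>wc n0 n k\<bar> \<le> 2 ^ k"
proof -
  have "\<bar>wc n0 n k\<bar> \<le> 1 \<or> (n < k \<and> \<bar>wc n0 n k\<bar> \<le> real (k - 1 choose n))"
    using n
  proof (induction n rule: dec_induct)
    case base
    then show ?case by (simp add: wc_def)
  next
    case (step n)
    have set: "{n0<..Suc n} = insert (Suc n) {n0<..n}" using step by auto
    have rec: "wc n0 (Suc n) k = (1 - real k / real (Suc n)) * wc n0 n k"
      unfolding wc_def set by simp
    have A: "\<bar>wc n0 n k\<bar> \<le> real (k - 1 choose n)" if "n < k"
    proof -
      have "0 < (k - 1 choose n)" using that by (intro zero_less_binomial) simp
      then have "1 \<le> real (k - 1 choose n)" by linarith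
      then show ?thesis using step.IH by linarith
    qed
    have B: "\<bar>wc n0 n k\<bar> \<le> 1" if "\<not> n < k" using step.IH that by simp
    consider "k \<le> n" | "k = Suc n" | "Suc n < k" by linarith
    then show ?case
    proof cases
      case 1
      have "\<bar>1 - real k / real (Suc n)\<bar> \<le> 1" using 1 by (simp add: field_simps)
      then show ?thesis using 1 B unfolding rec abs_mult by (intro disjI1 mult_le_one) auto
    next
      case 2 then show ?thesis unfolding rec by simp
    next
      case 3
      have "\<bar>1 - real k / real (Suc n)\<bar> = real (k - 1 - n) / real (Suc n)"
        using 3 by (simp add: field_simps of_nat_diff)
      then have "\<bar>wc n0 (Suc n) k\<bar> \<le> real (k - 1 - n) / real (Suc n) * real (k - 1 choose n)"
        using 3 A unfolding rec abs_mult by (intro mult_mono) auto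
      also have "\<dots> = real (k - 1 choose Suc n)"
      proof -
        have "Suc n * (k - 1 choose Suc n) = (k - 1 - n) * (k - 1 choose n)"
          using binomial_absorb_comp[of "k - 1" n] binomial_absorption[of n "k - 1"] 3 by simp
        then have "real (Suc n) * real (k - 1 choose Suc n) = real (k - 1 - n) * real (k - 1 choose n)"
          by (metis of_nat_mult)
        then show ?thesis by (simp add: field_simps)
      qed
      finally show ?thesis using 3 by simp
    qed
  qed
  moreover have "real (k - 1 choose n) \<le> 2 ^ k"
  proof -
    have "(k - 1 choose n) \<le> 2 ^ (k - 1)" by (rule binomial_le_pow2)
    also have "(2::nat) ^ (k - 1) \<le> 2 ^ k" by (intro power_increasing) auto
    finally show ?thesis by (metis of_nat_le_iff of_nat_numeral of_nat_power)
  qed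
  moreover have "(1::real) \<le> 2 ^ k" by simp
  ultimately show ?thesis by linarith
qed

lemma cosh_sinh_sq: "sinh (z / 2) * sinh (z / 2) = cosh (z / 2) ^ 2 - (1 :: complex)"
  using cosh_square_eq[of "z / 2"] by (simp add: power2_eq_square)

text \<open>The recursion shared by types A and B, instantiated by \<open>fA\<close> from
  \<open>n0 = 1\<close> and by \<open>fB\<close> from \<open>n0 = 0\<close>.\<close>

locale des_mgf =
  fixes n0 :: nat and f f' :: "nat \<Rightarrow> complex \<Rightarrow> complex"
  assumes n0: "n0 \<le> 1"
    and deriv: "\<And>n z. n0 \<le> n \<Longrightarrow> (f n has_field_derivative f' n z) (at z)"
    and rec: "\<And>n z. n0 \<le> n \<Longrightarrow> f (Suc n) z = cosh (z / 2) * f n z - 2 / of_nat (Suc n) * sinh (z / 2) * f' n z"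
    and f_base: "\<And>z. f n0 z = 1"
begin

text \<open>Since \<open>sinh ^ 2 = cosh ^ 2 - 1\<close>, one step maps \<open>cosh ^ e\<close> to
  \<open>cosh ^ (e + 1)\<close> and \<open>cosh ^ (e - 1)\<close> with weights
  \<open>1 - e / (n + 1)\<close> and \<open>e / (n + 1)\<close>, which are nonnegative as
  \<open>e \<le> n\<close>. This is the gamma-nonnegativity of the Eulerian polynomials; the list of
  pairs allows repeated exponents.\<close>

lemma cosh_expansion:
  assumes "n0 \<le> n"
  shows "\<exists>ps. (\<forall>(a, e)\<in>set ps. 0 \<le> a \<and> e \<le> n) \<and> (\<forall>z. f n z = (\<Sum>(a, e)\<leftarrow>ps. of_real a * cosh (z / 2) ^ e))"
  using assms
proof (induction n rule: dec_induct)
  case base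
  show ?case by (rule exI[of _ "[(1, 0)]"]) (simp add: f_base)
next
  case (step n)
  then obtain ps where ps: "\<And>a e. (a, e) \<in> set ps \<Longrightarrow> 0 \<le> a \<and> e \<le> n"
    and f: "\<And>z. f n z = (\<Sum>(a, e)\<leftarrow>ps. of_real a * cosh (z / 2) ^ e)" by blast
  define qs where "qs = concat (map (\<lambda>(a, e). [(a * (1 - real e / real (Suc n)), Suc e), (a * (real e / real (Suc n)), e - 1)]) ps)"
  have D: "((\<lambda>z. \<Sum>(a, e)\<leftarrow>xs. of_real a * cosh (z / 2) ^ e) has_field_derivative
     (\<Sum>(a, e)\<leftarrow>xs. of_real a * (of_nat e * cosh (z / 2) ^ (e - 1) * (sinh (z / 2) / 2)))) (at z)" for z :: complex and xs :: "(real \<times> nat) list"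
    by (induction xs) (auto intro!: derivative_eq_intros)
  have fe: "f n = (\<lambda>z. \<Sum>(a, e)\<leftarrow>ps. of_real a * cosh (z / 2) ^ e)" by (rule ext) (rule f)
  have f': "f' n z = (\<Sum>(a, e)\<leftarrow>ps. of_real a * (of_nat e * cosh (z / 2) ^ (e - 1) * (sinh (z / 2) / 2)))" for z
    by (rule DERIV_unique[OF deriv[OF step(1), of z, unfolded fe] D])
  have 1: "cosh (z / 2) * (of_real a * cosh (z / 2) ^ e) - 2 / of_nat (Suc n) * sinh (z / 2) * (of_real a * (of_nat e * cosh (z / 2) ^ (e - 1) * (sinh (z / 2) / 2)))
     = of_real (a * (1 - real e / real (Suc n))) * cosh (z / 2) ^ Suc e + of_real (a * (real e / real (Suc n))) * cosh (z / 2) ^ (e - 1)" for a :: real and e :: nat and z :: complex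
  proof -
    have "2 / of_nat (Suc n) * sinh (z / 2) * (of_real a * (of_nat e * cosh (z / 2) ^ (e - 1) * (sinh (z / 2) / 2))) =
      of_real (a * (real e / real (Suc n))) * (sinh (z / 2) * sinh (z / 2)) * cosh (z / 2) ^ (e - 1)"
    proof -
      have "2 / N * S * (b * (d * p * (S / 2))) = b * (d / N) * (S * S) * p" for N S b d p :: complex by simp
      then show ?thesis by (simp only: of_real_mult of_real_divide of_real_of_nat_eq)
    qed
    also have "\<dots> = of_real (a * (real e / real (Suc n))) * (cosh (z / 2) ^ Suc e - cosh (z / 2) ^ (e - 1))"
      unfolding cosh_sinh_sq by (cases e) (simp_all add: algebra_simps power2_eq_square)
    finally show ?thesis by (simp add: algebra_simps)
  qed
  have "f (Suc n) z = (\<Sum>(a, e)\<leftarrow>qs. of_real a * cosh (z / 2) ^ e)" for z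
  proof -
    have "cosh (z / 2) * (\<Sum>(a, e)\<leftarrow>xs. of_real a * cosh (z / 2) ^ e) - 2 / of_nat (Suc n) * sinh (z / 2) * (\<Sum>(a, e)\<leftarrow>xs. of_real a * (of_nat e * cosh (z / 2) ^ (e - 1) * (sinh (z / 2) / 2)))
      = (\<Sum>(a, e)\<leftarrow>concat (map (\<lambda>(a, e). [(a * (1 - real e / real (Suc n)), Suc e), (a * (real e / real (Suc n)), e - 1)]) xs). of_real a * cosh (z / 2) ^ e)" for xs :: "(real \<times> nat) list"
    proof (induction xs)
      case (Cons x xs)
      obtain a e where x: "x = (a, e)" by (cases x)
      have ring: "c * (t + S) - k * (t' + S') = (c * t - k * t') + (c * S - k * S')" for c t S k t' S' :: complex
        by (simp add: algebra_simps)
      show ?case unfolding x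
        by (simp only: list.map prod.case sum_list.Cons concat.simps append_Cons append_Nil ring 1 Cons.IH add.assoc)
    qed simp
    then show ?thesis unfolding rec[OF step(1)] f f' qs_def .
  qed
  moreover have "\<forall>(a, e)\<in>set qs. 0 \<le> a \<and> e \<le> Suc n"
  proof clarify
    fix a e assume "(a, e) \<in> set qs"
    then obtain b d where bd: "(b, d) \<in> set ps"
      and c: "a = b * (1 - real d / real (Suc n)) \<and> e = Suc d \<or> a = b * (real d / real (Suc n)) \<and> e = d - 1"
      unfolding qs_def by auto
    have b: "0 \<le> b" "d \<le> n" using ps[OF bd] by auto
    then have "0 \<le> 1 - real d / real (Suc n)" by simp
    with b have "0 \<le> b * (1 - real d / real (Suc n))" "0 \<le> b * (real d / real (Suc n))" by simp_all
    then show "0 \<le> a \<and> e \<le> Suc n" using c b(2) by auto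
  qed
  ultimately show ?case by blast
qed

text \<open>With nonnegative coefficients the modulus only grows when \<open>cosh (z / 2)\<close> is
  replaced by the upper bound \<open>cos (\<theta> / 2)\<close>, and the result is the value at
  \<open>i * \<theta>\<close>. Points far from the real axis are thus compared with one fixed small
  \<open>\<theta>\<close>, where the expansion at the origin applies.\<close>

lemma norm_le_imaginary:
  assumes "n0 \<le> n" "norm (cosh (z / 2)) \<le> cos (\<theta> / 2)"
  shows "norm (f n z) \<le> norm (f n (\<i> * of_real \<theta>))"
proof -
  obtain ps where ps: "\<forall>(a, e)\<in>set ps. 0 \<le> a \<and> e \<le> n" and f: "\<And>z. f n z = (\<Sum>(a, e)\<leftarrow>ps. of_real a * cosh (z / 2) ^ e)"
    using cosh_expansion[OF assms(1)] by blast
  have c: "cosh (\<i> * of_real \<theta> / 2) = of_real (cos (\<theta> / 2))"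
    using cosh_conv_cos[of "\<i> * of_real \<theta> / 2"] by (simp add: cos_of_real[symmetric])
  have "norm (f n z) \<le> (\<Sum>(a, e)\<leftarrow>ps. a * cos (\<theta> / 2) ^ e)"
    unfolding f using ps
  proof (induction ps)
    case (Cons x xs)
    obtain a e where x: "x = (a, e)" by (cases x)
    have "norm (of_real a * cosh (z / 2) ^ e) \<le> a * cos (\<theta> / 2) ^ e"
      using Cons.prems assms(2) by (auto simp: x norm_mult norm_power intro!: mult_left_mono power_mono)
    moreover have "norm (\<Sum>(a, e)\<leftarrow>xs. of_real a * cosh (z / 2) ^ e) \<le> (\<Sum>(a, e)\<leftarrow>xs. a * cos (\<theta> / 2) ^ e)" using Cons by simp
    ultimately show ?case using norm_triangle_ineq[of "of_real a * cosh (z / 2) ^ e" "\<Sum>(a, e)\<leftarrow>xs. of_real a * cosh (z / 2) ^ e"] by (simp add: x)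
  qed simp
  also have "\<dots> = Re (f n (\<i> * of_real \<theta>))"
    unfolding f c by (induction ps) (auto simp flip: of_real_power of_real_mult)
  also have "\<dots> \<le> norm (f n (\<i> * of_real \<theta>))" by (rule complex_Re_le_cmod)
  finally show ?thesis .
qed

text \<open>With \<open>f n z = Gh (z\<^sup>2) ^ (n + 1) * gh n (z\<^sup>2)\<close> the recursion turns into \<open>g (n + 1) = g n - z * g' n / (n + 1)\<close> for
  \<open>g n z = gh n (z\<^sup>2)\<close>, so each step multiplies the coefficient of \<open>z ^ k\<close> by \<open>1 - k / (n + 1)\<close>. In particular the coefficient
  of \<open>z\<^sup>2\<close> vanishes from \<open>n = 2\<close> on.\<close>

definition H :: "complex \<Rightarrow> complex" where "H v = 1 / Gh v ^ (n0 + 1)"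
definition co :: "nat \<Rightarrow> complex" where "co k = (deriv ^^ k) H 0 / fact k"
definition ac :: "nat \<Rightarrow> nat \<Rightarrow> complex" where "ac n k = co k * of_real (wc n0 n (2 * k))"
definition gh :: "nat \<Rightarrow> complex \<Rightarrow> complex" where "gh n v = (\<Sum>k. ac n k * v ^ k)"
definition gh' :: "nat \<Rightarrow> complex \<Rightarrow> complex" where "gh' n v = (\<Sum>k. diffs (ac n) k * v ^ k)"

lemma H_sums: "norm v < 36 \<Longrightarrow> (\<lambda>k. co k * v ^ k) sums H v"
proof -
  assume v: "norm v < 36"
  have "H holomorphic_on ball 0 36" unfolding H_def using Gh_nonzero by (intro holomorphic_intros Gh_holomorphic) auto
  from holomorphic_power_series[OF this, of v] v show ?thesis by (simp add: co_def)
qed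

text \<open>The radius 25 is below 36, and after the loss of \<open>2 ^ (2 * k) = 4 ^ k\<close>
  through \<open>wc_bound\<close> it still leaves the radius 25 / 4 for the series in
  \<open>z ^ 2\<close>. This covers \<open>norm z < 2\<close>.\<close>

lemma co_bound: obtains M where "0 < M" "\<And>k. norm (co k) \<le> M / 25 ^ k"
proof -
  have "summable (\<lambda>k. co k * 25 ^ k)" using H_sums[of 25] by (simp add: sums_iff)
  then have "Bseq (\<lambda>k. co k * 25 ^ k)" by (rule summable_imp_Bseq)
  then obtain M where "0 < M" "\<And>k. norm (co k * 25 ^ k) \<le> M" by (rule BseqE) blast
  then show thesis using that[of M] by (simp add: norm_mult norm_power field_simps)
qed

lemma ac_bound: obtains M where "0 < M" "\<And>n k. n0 \<le> n \<Longrightarrow> norm (ac n k) \<le> M * (4 / 25) ^ k"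
proof -
  obtain M where M: "0 < M" "\<And>k. norm (co k) \<le> M / 25 ^ k" using co_bound by blast
  have "norm (ac n k) \<le> M * (4 / 25) ^ k" if "n0 \<le> n" for n k
  proof -
    have "norm (ac n k) \<le> M / 25 ^ k * 2 ^ (2 * k)"
      unfolding ac_def norm_mult using M wc_bound[OF that n0, of "2 * k"] by (intro mult_mono) auto
    then show ?thesis by (simp add: power_mult power_divide)
  qed
  then show thesis using that M by blast
qed

lemma summable_ac:
  assumes "n0 \<le> n" "norm v < 25 / 4" shows "summable (\<lambda>k. ac n k * v ^ k)"
proof -
  obtain M where M: "0 < M" "\<And>n k. n0 \<le> n \<Longrightarrow> norm (ac n k) \<le> M * (4 / 25) ^ k" using ac_bound by blast
  show ?thesis
  proof (rule summable_comparison_test')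
    show "summable (\<lambda>k. M * (4 / 25 * norm v) ^ k)" using assms by (intro summable_mult summable_geometric) auto
    show "norm (ac n k * v ^ k) \<le> M * (4 / 25 * norm v) ^ k" for k
    proof -
      have "norm (ac n k) * norm v ^ k \<le> M * (4 / 25) ^ k * norm v ^ k" using M(2)[OF assms(1), of k] by (intro mult_right_mono) auto
      then show ?thesis by (simp only: norm_mult norm_power power_mult_distrib mult.assoc)
    qed
  qed
qed

lemma gh_deriv: "n0 \<le> n \<Longrightarrow> norm v < 25 / 4 \<Longrightarrow> (gh n has_field_derivative gh' n v) (at v)"
  unfolding gh_def gh'_def using termdiffs_strong'[of "25 / 4" "ac n" v] summable_ac by blast

lemma gh_Suc:
  assumes "n0 \<le> n" "norm v < 25 / 4"
  shows "gh (Suc n) v = gh n v - 2 * v / of_nat (Suc n) * gh' n v"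
proof -
  have s: "(\<lambda>k. ac n k * v ^ k) sums gh n v" unfolding gh_def by (rule summable_sums[OF summable_ac[OF assms]])
  have "summable (\<lambda>k. diffs (ac n) k * v ^ k)"
    using summable_ac[OF assms(1)] assms(2) by (intro termdiff_converges[of v "25 / 4"]) auto
  then have "(\<lambda>k. diffs (ac n) k * v ^ k) sums gh' n v" unfolding gh'_def by (rule summable_sums)
  from sums_mult[OF this, of v] have "(\<lambda>k. of_nat (Suc k) * ac n (Suc k) * v ^ Suc k) sums (v * gh' n v)"
    by (simp add: diffs_def mult_ac)
  then have "(\<lambda>k. of_nat k * ac n k * v ^ k) sums (v * gh' n v)"
    by (subst (asm) sums_Suc_iff[of "\<lambda>k. of_nat k * ac n k * v ^ k"]) simp
  from sums_diff[OF s sums_mult[OF this, of "2 / of_nat (Suc n)"]]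
  have "(\<lambda>k. ac n k * v ^ k - 2 / of_nat (Suc n) * (of_nat k * ac n k * v ^ k)) sums (gh n v - 2 / of_nat (Suc n) * (v * gh' n v))" .
  moreover have "ac n k * v ^ k - 2 / of_nat (Suc n) * (of_nat k * ac n k * v ^ k) = ac (Suc n) k * v ^ k" for k
  proof -
    have "{n0<..Suc n} = insert (Suc n) {n0<..n}" using assms(1) by auto
    then have "wc n0 (Suc n) (2 * k) = (1 - real (2 * k) / real (Suc n)) * wc n0 n (2 * k)" by (simp add: wc_def)
    from arg_cong[OF this, of complex_of_real] have w: "complex_of_real (wc n0 (Suc n) (2 * k)) =
        (1 - 2 * of_nat k / of_nat (Suc n)) * complex_of_real (wc n0 n (2 * k))" by simp
    have "c * W * p - 2 / N * (j * (c * W) * p) = c * ((1 - 2 * j / N) * W) * p" for c W p N j :: complex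
      by (simp add: algebra_simps)
    then show ?thesis unfolding ac_def w .
  qed
  ultimately have "(\<lambda>k. ac (Suc n) k * v ^ k) sums (gh n v - 2 / of_nat (Suc n) * (v * gh' n v))" by simp
  then show ?thesis unfolding gh_def by (simp add: sums_iff)
qed

lemma f_eq:
  assumes "n0 \<le> n" "norm z < 2" shows "f n z = Gh (z\<^sup>2) ^ (n + 1) * gh n (z\<^sup>2)"
  using assms
proof (induction n arbitrary: z rule: dec_induct)
  case base
  have v: "norm (z\<^sup>2) < 36" using power_strict_mono[OF base, of 2] by (simp add: norm_power)
  have "gh n0 (z\<^sup>2) = H (z\<^sup>2)" using H_sums[OF v] by (simp add: gh_def ac_def wc_def sums_iff)
  then show ?case using Gh_nonzero[OF v] by (simp add: f_base H_def)
next
  case (step n)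
  have v: "norm (w\<^sup>2) < 25 / 4" if "norm w < 2" for w :: complex using power_strict_mono[OF that, of 2] by (simp add: norm_power)
  let ?v = "z\<^sup>2"
  have "((\<lambda>z. Gh (z\<^sup>2) ^ (n + 1) * gh n (z\<^sup>2)) has_field_derivative
     (of_nat (n + 1) * Gh ?v ^ n * (Gh' ?v * (2 * z)) * gh n ?v + Gh ?v ^ (n + 1) * (gh' n ?v * (2 * z)))) (at z)"
  proof -
    have sq: "((\<lambda>z. z\<^sup>2) has_field_derivative 2 * z) (at z)" by (auto intro!: derivative_eq_intros)
    have d1: "((\<lambda>z. Gh (z\<^sup>2)) has_field_derivative Gh' ?v * (2 * z)) (at z)"
      by (rule DERIV_chain2[where g = "\<lambda>z. z\<^sup>2", OF Gh_deriv sq])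
    have d2: "((\<lambda>z. gh n (z\<^sup>2)) has_field_derivative gh' n ?v * (2 * z)) (at z)"
      by (rule DERIV_chain2[where g = "\<lambda>z. z\<^sup>2", OF gh_deriv[OF step(1) v[OF step.prems]] sq])
    from DERIV_mult[OF DERIV_power[OF d1, of "n + 1"] d2] show ?thesis by (simp add: algebra_simps)
  qed
  \<comment> \<open>The induction hypothesis holds on a whole disc around 0, so it also determines
    the derivative of \<open>f n\<close> at \<open>z\<close>.\<close>
  then have "(f n has_field_derivative (of_nat (n + 1) * Gh ?v ^ n * (Gh' ?v * (2 * z)) * gh n ?v + Gh ?v ^ (n + 1) * (gh' n ?v * (2 * z)))) (at z)"
  proof (rule DERIV_cong_ev[THEN iffD1, rotated -1, OF _ refl _ refl])
    have "\<forall>\<^sub>F w in nhds z. w \<in> ball 0 2" using step.prems by (intro eventually_nhds_in_open) auto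
    then show "\<forall>\<^sub>F w in nhds z. Gh (w\<^sup>2) ^ (n + 1) * gh n (w\<^sup>2) = f n w"
      by eventually_elim (use step.IH in auto)
  qed
  with deriv[OF step(1), of z] have f': "f' n z = of_nat (n + 1) * Gh ?v ^ n * (Gh' ?v * (2 * z)) * gh n ?v + Gh ?v ^ (n + 1) * (gh' n ?v * (2 * z))"
    by (rule DERIV_unique)
  define N where "N = (of_nat (Suc n) :: complex)"
  have N: "N \<noteq> 0" unfolding N_def by (rule of_nat_neq_0)
  have "f (Suc n) z = cosh (z / 2) * (Gh ?v ^ (n + 1) * gh n ?v) - 2 / N * sinh (z / 2) * (N * Gh ?v ^ n * (Gh' ?v * (2 * z)) * gh n ?v + Gh ?v ^ (n + 1) * (gh' n ?v * (2 * z)))"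
    using rec[OF step(1), of z] step.IH[OF step.prems] f' by (simp add: N_def)
  also have "\<dots> = cosh (z / 2) * (Gh ?v ^ (n + 1) * gh n ?v) - Gh ?v ^ n * gh n ?v * (2 * sinh (z / 2) * (2 * z * Gh' ?v)) - (2 * sinh (z / 2)) * (2 * z / N) * gh' n ?v * Gh ?v ^ (n + 1)"
    using N by (simp add: field_simps)
  also have "\<dots> = cosh (z / 2) * (Gh ?v ^ (n + 1) * gh n ?v) - Gh ?v ^ n * gh n ?v * (Gh ?v * (cosh (z / 2) - Gh ?v)) - (z * Gh ?v) * (2 * z / N) * gh' n ?v * Gh ?v ^ (n + 1)"
    unfolding Gh_ode Gh_sinh ..
  also have "\<dots> = Gh ?v ^ (Suc n + 1) * (gh n ?v - 2 * ?v / N * gh' n ?v)"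
    by (simp add: algebra_simps power2_eq_square)
  also have "gh n ?v - 2 * ?v / N * gh' n ?v = gh (Suc n) ?v" unfolding N_def by (rule gh_Suc[OF step(1) v[OF step.prems], symmetric])
  finally show ?case .
qed

lemma gh_bound: "\<exists>K\<ge>0. \<forall>n\<ge>2. \<forall>v. norm v \<le> 1 \<longrightarrow> norm (gh n v - 1) \<le> K * norm v ^ 2"
proof -
  obtain M where M: "0 < M" "\<And>n k. n0 \<le> n \<Longrightarrow> norm (ac n k) \<le> M * (4 / 25) ^ k" using ac_bound by blast
  have co0: "co 0 = 1" using H_sums[of 0] by (simp add: co_def H_def Gh_0)
  have "norm (gh n v - 1) \<le> (M * (25 / 21)) * norm v ^ 2" if n: "n \<ge> 2" and v: "norm v \<le> 1" for n v
  proof -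
    have nn: "n0 \<le> n" using n n0 by linarith
    have a0: "ac n 0 = 1" by (simp add: ac_def co0 wc_def)
    have a1: "ac n 1 = 0"
    proof -
      have "2 \<in> {n0<..n}" using n n0 by simp
      then have "wc n0 n 2 = 0" unfolding wc_def by (intro prod_zero bexI[of _ 2]) auto
      then show ?thesis by (simp add: ac_def)
    qed
    have s: "summable (\<lambda>k. ac n k * v ^ k)" using v by (intro summable_ac nn) auto
    have "gh n v - 1 = (\<Sum>k. ac n (k + 2) * v ^ (k + 2))"
      unfolding gh_def using suminf_split_initial_segment[OF s, of 2] a0 a1 by (simp add: numeral_2_eq_2)
    also have "norm \<dots> \<le> (\<Sum>k. M * norm v ^ 2 * (4 / 25) ^ k)"
    proof (rule norm_suminf_le)
      show "summable (\<lambda>k. M * norm v ^ 2 * (4 / 25) ^ k)" by (intro summable_mult summable_geometric) auto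
      fix k
      have "norm (ac n (k + 2) * v ^ (k + 2)) \<le> M * (4 / 25) ^ (k + 2) * norm v ^ (k + 2)"
        unfolding norm_mult norm_power using M(2)[OF nn, of "k + 2"] by (intro mult_right_mono) auto
      also have "\<dots> \<le> M * (4 / 25) ^ k * norm v ^ 2"
        using M v by (intro mult_mono power_decreasing mult_left_mono) (auto simp: power_decreasing)
      finally show "norm (ac n (k + 2) * v ^ (k + 2)) \<le> M * norm v ^ 2 * (4 / 25) ^ k" by (simp add: mult_ac)
    qed
    \<comment> \<open>25 / 21 is the sum of the geometric series with ratio 4 / 25.\<close>
    also have "\<dots> = M * norm v ^ 2 * (25 / 21)" by (subst suminf_mult) (simp_all add: suminf_geometric summable_geometric)
    finally show ?thesis by (simp add: mult_ac)
  qed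
  then show ?thesis using M by (intro exI[of _ "M * (25 / 21)"]) auto
qed

end

section \<open>The descent recursions as differential recursions\<close>

lemma eulA_linear: "eulA n (\<lambda>d. a * F d + b * G d) = a * eulA n F + b * eulA n (G :: nat \<Rightarrow> 'b :: comm_ring_1)"
proof (induction n arbitrary: F G)
  case (Suc n)
  have "(\<lambda>d. of_nat (d + 1) * (a * F d + b * G d) + (of_nat n - of_nat d) * (a * F (d + 1) + b * G (d + 1))) =
    (\<lambda>d. a * (of_nat (d + 1) * F d + (of_nat n - of_nat d) * F (d + 1)) + b * (of_nat (d + 1) * G d + (of_nat n - of_nat d) * G (d + 1)))"
    by (auto simp: algebra_simps)
  then show ?case unfolding eulA.simps by (simp only: Suc.IH)
qed simp

lemma eulB_linear: "eulB n (\<lambda>d. a * F d + b * G d) = a * eulB n F + b * eulB n (G :: nat \<Rightarrow> 'b :: comm_ring_1)"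
proof (induction n arbitrary: F G)
  case (Suc n)
  have "(\<lambda>d. of_nat (2 * d + 1) * (a * F d + b * G d) + (2 * (of_nat n - of_nat d) + 1) * (a * F (d + 1) + b * G (d + 1))) =
    (\<lambda>d. a * (of_nat (2 * d + 1) * F d + (2 * (of_nat n - of_nat d) + 1) * F (d + 1)) + b * (of_nat (2 * d + 1) * G d + (2 * (of_nat n - of_nat d) + 1) * G (d + 1)))"
    by (auto simp: algebra_simps)
  then show ?case unfolding eulB.simps by (simp only: Suc.IH)
qed simp

lemma eulA_deriv:
  assumes "\<And>d. ((\<lambda>z. F z d) has_field_derivative F' z d) (at (z :: complex))"
  shows "((\<lambda>z. eulA n (F z)) has_field_derivative eulA n (F' z)) (at z)"
  using assms
proof (induction n arbitrary: F F')
  case (Suc n)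
  show ?case unfolding eulA.simps
    by (rule Suc.IH[where F' = "\<lambda>z d. of_nat (d + 1) * F' z d + (of_nat n - of_nat d) * F' z (d + 1)"])
      (intro DERIV_add DERIV_cmult Suc.prems)
qed simp

lemma eulB_deriv:
  assumes "\<And>d. ((\<lambda>z. F z d) has_field_derivative F' z d) (at (z :: complex))"
  shows "((\<lambda>z. eulB n (F z)) has_field_derivative eulB n (F' z)) (at z)"
  using assms
proof (induction n arbitrary: F F')
  case (Suc n)
  show ?case unfolding eulB.simps
    by (rule Suc.IH[where F' = "\<lambda>z d. of_nat (2 * d + 1) * F' z d + (2 * (of_nat n - of_nat d) + 1) * F' z (d + 1)"])
      (intro DERIV_add DERIV_cmult Suc.prems)
qed simp

text \<open>The recursions of \<open>eulA\<close> and \<open>eulB\<close> multiply by the number of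
  descents \<open>d\<close>, which on \<open>exp z ^ d\<close> is differentiation in
  \<open>z\<close>; this produces the companions \<open>pA'\<close> and \<open>pB'\<close>.\<close>

definition pA :: "nat \<Rightarrow> complex \<Rightarrow> complex" where "pA n z = eulA n (\<lambda>d. exp z ^ d)"
definition pA' :: "nat \<Rightarrow> complex \<Rightarrow> complex" where "pA' n z = eulA n (\<lambda>d. of_nat d * exp z ^ d)"
definition pB :: "nat \<Rightarrow> complex \<Rightarrow> complex" where "pB n z = eulB n (\<lambda>d. exp z ^ d)"
definition pB' :: "nat \<Rightarrow> complex \<Rightarrow> complex" where "pB' n z = eulB n (\<lambda>d. of_nat d * exp z ^ d)"

lemma exp_pow_deriv: "((\<lambda>z. exp z ^ d) has_field_derivative (of_nat d * exp z ^ d)) (at (z :: complex))"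
  using DERIV_power[OF DERIV_exp[of z], of d] by (cases d) (simp_all add: mult_ac)

lemma pA_deriv: "(pA n has_field_derivative pA' n z) (at z)"
  unfolding pA_def[abs_def] pA'_def by (rule eulA_deriv[where F' = "\<lambda>z d. of_nat d * exp z ^ d"]) (rule exp_pow_deriv)

lemma pB_deriv: "(pB n has_field_derivative pB' n z) (at z)"
  unfolding pB_def[abs_def] pB'_def by (rule eulB_deriv[where F' = "\<lambda>z d. of_nat d * exp z ^ d"]) (rule exp_pow_deriv)

lemma pA_Suc: "pA (Suc n) z = (1 + of_nat n * exp z) * pA n z + (1 - exp z) * pA' n z"
proof -
  have "(\<lambda>d. of_nat (d + 1) * exp z ^ d + (of_nat n - of_nat d) * exp z ^ (d + 1)) =
    (\<lambda>d. (1 + of_nat n * exp z) * exp z ^ d + (1 - exp z) * (of_nat d * exp z ^ d))" by (auto simp: algebra_simps)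
  then show ?thesis unfolding pA_def pA'_def eulA.simps by (simp only: eulA_linear)
qed

lemma pB_Suc: "pB (Suc n) z = (1 + (2 * of_nat n + 1) * exp z) * pB n z + 2 * (1 - exp z) * pB' n z"
proof -
  have "(\<lambda>d. of_nat (2 * d + 1) * exp z ^ d + (2 * (of_nat n - of_nat d) + 1) * exp z ^ (d + 1)) =
    (\<lambda>d. (1 + (2 * of_nat n + 1) * exp z) * exp z ^ d + (2 * (1 - exp z)) * (of_nat d * exp z ^ d))" by (auto simp: algebra_simps)
  then show ?thesis unfolding pB_def pB'_def eulB.simps by (simp only: eulB_linear)
qed

text \<open>The index is the number of letters, so \<open>weyl_A m\<close> belongs to
  \<open>fA (m + 1)\<close>; the exponential factor centres at \<open>(n - 1) / 2\<close>.\<close>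

definition fA :: "nat \<Rightarrow> complex \<Rightarrow> complex" where
  "fA n z = exp (- (of_nat n - 1) * z / 2) * pA n z / fact n"
definition fA' :: "nat \<Rightarrow> complex \<Rightarrow> complex" where
  "fA' n z = exp (- (of_nat n - 1) * z / 2) * (pA' n z - (of_nat n - 1) / 2 * pA n z) / fact n"
definition fB :: "nat \<Rightarrow> complex \<Rightarrow> complex" where
  "fB n z = exp (- of_nat n * z / 2) * pB n z / (2 ^ n * fact n)"
definition fB' :: "nat \<Rightarrow> complex \<Rightarrow> complex" where
  "fB' n z = exp (- of_nat n * z / 2) * (pB' n z - of_nat n / 2 * pB n z) / (2 ^ n * fact n)"

lemma fA_deriv: "(fA n has_field_derivative fA' n z) (at z)"
proof -
  have "((\<lambda>z. exp (- (of_nat n - 1) * z / 2)) has_field_derivative exp (- (of_nat n - 1) * z / 2) * (- (of_nat n - 1) / 2)) (at z)"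
    by (auto intro!: derivative_eq_intros)
  from DERIV_cdivide[OF DERIV_mult[OF this pA_deriv[of n]], of "fact n"]
  moreover have "(E * (- M / 2) * p + q * E) / F = E * (q - M / 2 * p) / F" for E M p q F :: complex
    by (simp add: algebra_simps)
  ultimately show ?thesis unfolding fA_def[abs_def] fA'_def by (simp only:)
qed

lemma fB_deriv: "(fB n has_field_derivative fB' n z) (at z)"
proof -
  have "((\<lambda>z. exp (- of_nat n * z / 2)) has_field_derivative exp (- of_nat n * z / 2) * (- of_nat n / 2)) (at z)"
    by (auto intro!: derivative_eq_intros)
  from DERIV_cdivide[OF DERIV_mult[OF this pB_deriv[of n]], of "2 ^ n * fact n"]
  moreover have "(E * (- M / 2) * p + q * E) / F = E * (q - M / 2 * p) / F" for E M p q F :: complex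
    by (simp add: algebra_simps)
  ultimately show ?thesis unfolding fB_def[abs_def] fB'_def by (simp only:)
qed

lemma cosh_half: "cosh (z / 2) = exp (- z / 2) * (exp z + 1) / 2" "sinh (z / 2) = exp (- z / 2) * (exp z - 1) / (2 :: complex)"
proof -
  have "exp (z / 2) = exp (- z / 2) * exp z" by (simp add: exp_add[symmetric])
  then show "cosh (z / 2) = exp (- z / 2) * (exp z + 1) / 2" "sinh (z / 2) = exp (- z / 2) * (exp z - 1) / 2"
    by (simp_all add: cosh_def sinh_def scaleR_conv_of_real algebra_simps)
qed

lemma des_mgf_A: "des_mgf 1 fA fA'"
proof
  fix n :: nat and z :: complex
  assume n: "1 \<le> n"
  show "(fA n has_field_derivative fA' n z) (at z)" by (rule fA_deriv)
  define e where "e = exp (- (of_nat n - 1) * z / 2)"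
  have e: "exp (- (of_nat (Suc n) - 1) * z / 2) = exp (- z / 2) * e" unfolding e_def by (simp add: exp_add[symmetric] field_simps)
  have alg: "x * e * ((1 + (N - 1) * y) * p + (1 - y) * q) / (N * F) = x * (y + 1) / 2 * (e * p / F) - 2 / N * (x * (y - 1) / 2) * (e * (q - (N - 1 - 1) / 2 * p) / F)"
    if "N \<noteq> 0" "F \<noteq> 0" for x e y p q N F :: complex
    using that by (simp add: field_simps)
  have "of_nat (Suc n) \<noteq> (0 :: complex)" by (rule of_nat_neq_0)
  from alg[OF this, of "fact n" "exp (- z / 2)" e "exp z" "pA n z" "pA' n z"]
  show "fA (Suc n) z = cosh (z / 2) * fA n z - 2 / of_nat (Suc n) * sinh (z / 2) * fA' n z"
    unfolding fA_def[of "Suc n"] e pA_Suc cosh_half unfolding fA_def fA'_def e_def[symmetric] by simp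
next
  show "fA 1 z = 1" for z by (simp add: fA_def pA_def)
qed simp

lemma des_mgf_B: "des_mgf 0 fB fB'"
proof
  fix n :: nat and z :: complex
  show "(fB n has_field_derivative fB' n z) (at z)" by (rule fB_deriv)
  define e where "e = exp (- of_nat n * z / 2)"
  have e: "exp (- of_nat (Suc n) * z / 2) = exp (- z / 2) * e" unfolding e_def by (simp add: exp_add[symmetric] field_simps)
  have alg: "x * e * ((1 + (2 * (N - 1) + 1) * y) * p + 2 * (1 - y) * q) / (2 * G * (N * F)) = x * (y + 1) / 2 * (e * p / (G * F)) - 2 / N * (x * (y - 1) / 2) * (e * (q - (N - 1) / 2 * p) / (G * F))"
    if "N \<noteq> 0" "F \<noteq> 0" "G \<noteq> 0" for x e y p q N F G :: complex
    using that by (simp add: field_simps)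
  have "of_nat (Suc n) \<noteq> (0 :: complex)" by (rule of_nat_neq_0)
  from alg[OF this, of "fact n" "2 ^ n" "exp (- z / 2)" e "exp z" "pB n z" "pB' n z"]
  show "fB (Suc n) z = cosh (z / 2) * fB n z - 2 / of_nat (Suc n) * sinh (z / 2) * fB' n z"
    unfolding fB_def[of "Suc n"] e pB_Suc cosh_half unfolding fB_def fB'_def e_def[symmetric] by simp
next
  show "fB 0 z = 1" for z by (simp add: fB_def pB_def)
qed simp

interpretation A: des_mgf 1 fA fA' by (rule des_mgf_A)
interpretation B: des_mgf 0 fB fB' by (rule des_mgf_B)

text \<open>Types B and A coincide in rank one. The estimates for \<open>fB\<close> start at index
  2, so this case is borrowed from \<open>fA\<close>.\<close>

lemma fB_1: "fB 1 z = fA 2 z"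
proof -
  have "(fA 1 has_field_derivative 0) (at z)" "(fB 0 has_field_derivative 0) (at z)"
    using A.f_base B.f_base by (auto intro!: DERIV_cong_ev[THEN iffD1, OF refl _ refl DERIV_const[of 1 "at z"]] always_eventually)
  then have "fA' 1 z = 0" "fB' 0 z = 0" using DERIV_unique[OF fA_deriv] DERIV_unique[OF fB_deriv] by blast+
  then show ?thesis using A.rec[of 1 z] B.rec[of 0 z] A.f_base B.f_base by (simp add: numeral_2_eq_2)
qed

lemma mgf_exp: "mgf S X \<mu> z = exp (- z * of_real \<mu>) * (\<Sum>w\<in>S. exp z ^ X w) / of_nat (card S)"
proof -
  have "exp (z * (of_nat (X w) - of_real \<mu>)) = exp (- z * of_real \<mu>) * exp z ^ X w" for w
    by (simp add: exp_of_nat_mult[symmetric] exp_add[symmetric] algebra_simps)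
  then show ?thesis by (simp add: mgf_def sum_distrib_left)
qed

lemma mgf_des_A: "mgf (carrier (weyl_A m)) (cox_des (weyl_A m)) (real m / 2) z = fA (m + 1) z"
  unfolding mgf_exp fA_def pA_def using sum_des_A[of "\<lambda>d. exp z ^ d" m] card_weyl_A[of m] by (simp add: mult.commute del: eulA.simps fact_Suc)

lemma mgf_des_B: "1 \<le> m \<Longrightarrow> mgf (carrier (weyl_B m)) (cox_des (weyl_B m)) (real m / 2) z = fB m z"
  unfolding mgf_exp fB_def pB_def using sum_des_B[of m "\<lambda>d. exp z ^ d"] card_weyl_B[of m] by (simp add: mult.commute del: eulB.simps fact_Suc)

text \<open>The factor \<open>exp z\<close> in \<open>sum_des_D\<close> makes up for the centring:
  \<open>fA (m - 1)\<close> is centred at \<open>(m - 2) / 2\<close>, one less than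
  \<open>m / 2\<close>.\<close>

lemma mgf_des_D:
  assumes m: "2 \<le> m"
  shows "mgf (carrier (weyl_D m)) (cox_des (weyl_D m)) (real m / 2) z = 2 * fB m z - fA (m - 1) z"
proof -
  obtain k where k: "m = Suc k" "1 \<le> k" using m by (cases m) auto
  have c: "of_nat (card (carrier (weyl_D m))) = (2 ^ m * fact m / 2 :: complex)"
  proof -
    have "complex_of_nat (2 * card (carrier (weyl_D m))) = 2 ^ m * fact m"
      using card_weyl_D[of m] m by (metis of_nat_fact of_nat_mult of_nat_numeral of_nat_power le_trans one_le_numeral)
    then show ?thesis by (simp add: mult.commute)
  qed
  have s: "(\<Sum>w\<in>carrier (weyl_D m). exp z ^ cox_des (weyl_D m) w) = pB m z - exp z * 2 ^ m * of_nat m * pA k z / 2"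
    using sum_des_D[OF m, of "exp z"] by (simp add: pA_def pB_def k(1) field_simps)
  have e: "exp (- (of_nat k - 1) * z / 2) = exp (- of_nat m * z / 2) * exp z"
    by (simp add: exp_add[symmetric] k(1) field_simps)
  have e2: "exp (- z * of_real (real m / 2)) = exp (- of_nat m * z / 2)" by (simp add: mult.commute)
  have F: "fact m = (of_nat m * fact k :: complex)" by (simp add: k(1))
  have alg: "E * (p - y * T * M * q / 2) / (T * (M * F) / 2) = 2 * (E * p / (T * (M * F))) - E * y * q / F"
    if "T \<noteq> 0" "M \<noteq> 0" "F \<noteq> 0" for E p y T M q F :: complex using that by (simp add: field_simps)
  have "(2 ^ m :: complex) \<noteq> 0" "of_nat m \<noteq> (0 :: complex)" "fact k \<noteq> (0 :: complex)" using m by auto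
  from alg[OF this, of "exp (- of_nat m * z / 2)" "pB m z" "exp z" "pA k z"]
  show ?thesis unfolding mgf_exp c s e2 fB_def F using e by (simp add: fA_def k(1))
qed

section \<open>Bounds for the components\<close>

text \<open>Errors are recorded in the form \<open>norm (a - 1) \<le> exp x - 1\<close> because the
  exponents then simply add under multiplication, with no loss over arbitrarily many
  factors.\<close>

lemma mult_dev:
  fixes a b :: complex
  assumes "norm (a - 1) \<le> exp x - 1" "norm (b - 1) \<le> exp y - 1"
  shows "norm (a * b - 1) \<le> exp (x + y) - 1"
proof -
  have "norm b \<le> exp y" using norm_triangle_ineq[of "b - 1" 1] assms(2) by simp
  then have "norm (a - 1) * norm b \<le> (exp x - 1) * exp y"
    using assms(1) order_trans[OF norm_ge_zero assms(1)] by (intro mult_mono) auto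
  moreover have "a * b - 1 = (a - 1) * b + (b - 1)" by (simp add: algebra_simps)
  then have "norm (a * b - 1) \<le> norm (a - 1) * norm b + norm (b - 1)" by (metis norm_triangle_ineq norm_mult)
  ultimately show ?thesis using assms(2) by (simp add: exp_add algebra_simps)
qed

lemma prod_dev:
  fixes a :: "'i \<Rightarrow> complex"
  assumes "finite I" "\<And>i. i \<in> I \<Longrightarrow> norm (a i - 1) \<le> exp (e i) - 1"
  shows "norm ((\<Prod>i\<in>I. a i) - 1) \<le> exp (\<Sum>i\<in>I. e i) - 1"
  using assms
proof (induction I rule: finite_induct)
  case (insert i I)
  then show ?case using mult_dev[of "a i" "e i" "\<Prod>i\<in>I. a i" "\<Sum>i\<in>I. e i"] by simp
qed simp

lemma power_dev:
  fixes a :: complex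
  assumes "norm (a - 1) \<le> exp e - 1"
  shows "norm (a ^ n - 1) \<le> exp (real n * e) - 1"
  using prod_dev[of "{..<n}" "\<lambda>_. a" "\<lambda>_. e"] assms by simp

lemma dev_mono: "norm a \<le> exp x - 1 \<Longrightarrow> x \<le> y \<Longrightarrow> norm a \<le> exp y - 1"
  by (meson diff_right_mono exp_le_cancel_iff order_trans)

lemma quartic_dev:
  fixes a z :: complex
  shows "norm (a - 1) \<le> C * norm (z\<^sup>2) ^ 2 \<Longrightarrow> norm (a - 1) \<le> exp (C * norm z ^ 4) - 1"
proof -
  assume a: "norm (a - 1) \<le> C * norm (z\<^sup>2) ^ 2"
  have "norm (z\<^sup>2) ^ 2 = norm z ^ 4" by (simp add: norm_power flip: power_mult)
  then have "norm (a - 1) \<le> C * norm z ^ 4" using a by simp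
  then show ?thesis using exp_ge_add_one_self[of "C * norm z ^ 4"] by linarith
qed

text \<open>\<open>Gh' 0 = 1 / 24\<close> is half the variance 1 / 12 of the uniform distribution on
  the unit interval. Hence the linear terms in \<open>v = z ^ 2\<close> cancel, and the error is
  quartic in \<open>z\<close>.\<close>

lemma Gh_gauss: "\<exists>C\<ge>0. \<forall>v. norm v \<le> 1 \<longrightarrow> norm (Gh v * exp (- v / 24) - 1) \<le> C * norm v ^ 2"
proof -
  let ?\<phi> = "\<lambda>v. Gh v * exp (- v / 24)"
  have "(?\<phi> has_field_derivative (Gh' 0 * exp (- 0 / 24) + exp (- 0 / 24) * (- 1 / 24) * Gh 0)) (at 0)"
    by (rule DERIV_mult[OF Gh_deriv]) (auto intro!: derivative_eq_intros)
  then have "deriv ?\<phi> 0 = 0" by (intro DERIV_imp_deriv) (simp add: Gh'_0 Gh_0)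
  moreover have "?\<phi> holomorphic_on ball 0 36" by (intro holomorphic_intros Gh_holomorphic) auto
  ultimately show ?thesis using holomorphic_quadratic_remainder[of ?\<phi> 36 1] by (simp add: Gh_0)
qed

lemma Gh_gauss_inverse: "\<exists>C\<ge>0. \<forall>v. norm v \<le> 1 \<longrightarrow> norm (exp (v / 24) / Gh v - 1) \<le> C * norm v ^ 2"
proof -
  let ?\<phi> = "\<lambda>v. exp (v / 24) / Gh v"
  have "(?\<phi> has_field_derivative ((exp (0 / 24) * (1 / 24)) * Gh 0 - exp (0 / 24) * Gh' 0) / (Gh 0 * Gh 0)) (at 0)"
    by (rule DERIV_divide[OF _ Gh_deriv]) (auto intro!: derivative_eq_intros simp: Gh_0)
  then have "deriv ?\<phi> 0 = 0" by (intro DERIV_imp_deriv) (simp add: Gh'_0 Gh_0)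
  moreover have "?\<phi> holomorphic_on ball 0 36" using Gh_nonzero by (intro holomorphic_intros Gh_holomorphic) auto
  ultimately show ?thesis using holomorphic_quadratic_remainder[of ?\<phi> 36 1] by (simp add: Gh_0)
qed

text \<open>The correction factor of type D: \<open>2 * Gh - 1\<close> has derivative 1 / 12 at 0,
  which adds 2 / 12 to the variance in \<open>D_dev\<close>.\<close>

lemma Gh_gauss_D: "\<exists>C\<ge>0. \<forall>v. norm v \<le> 1 \<longrightarrow> norm (exp (- v / 12) * (2 * Gh v - 1) - 1) \<le> C * norm v ^ 2"
proof -
  let ?\<phi> = "\<lambda>v. exp (- v / 12) * (2 * Gh v - 1)"
  have "((\<lambda>v. 2 * Gh v - 1) has_field_derivative 2 * Gh' 0) (at 0)"
    by (auto intro!: derivative_eq_intros Gh_deriv)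
  then have "(?\<phi> has_field_derivative (exp (- 0 / 12) * (- 1 / 12) * (2 * Gh 0 - 1) + 2 * Gh' 0 * exp (- 0 / 12))) (at 0)"
    by (intro DERIV_mult) (auto intro!: derivative_eq_intros)
  then have "deriv ?\<phi> 0 = 0" by (intro DERIV_imp_deriv) (simp add: Gh'_0 Gh_0)
  moreover have "?\<phi> holomorphic_on ball 0 36" by (intro holomorphic_intros Gh_holomorphic) auto
  ultimately show ?thesis using holomorphic_quadratic_remainder[of ?\<phi> 36 1] by (simp add: Gh_0)
qed

lemma norm_le_from_dev:
  assumes "norm (f * exp (- of_real \<sigma> * z\<^sup>2 / 2) - 1) \<le> exp e - (1::real)"
  shows "norm f \<le> exp (\<sigma> * Re (z\<^sup>2) / 2 + e)"
proof -
  have "norm (f * exp (- of_real \<sigma> * z\<^sup>2 / 2)) \<le> exp e"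
    using norm_triangle_ineq[of "f * exp (- of_real \<sigma> * z\<^sup>2 / 2) - 1" 1] assms by simp
  moreover have "norm (exp (- of_real \<sigma> * z\<^sup>2 / 2)) = exp (- (\<sigma> * Re (z\<^sup>2) / 2))"
    unfolding norm_exp_eq_Re by simp
  ultimately have "norm f * exp (- (\<sigma> * Re (z\<^sup>2) / 2)) \<le> exp e" by (simp only: norm_mult)
  then have "norm f \<le> exp (\<sigma> * Re (z\<^sup>2) / 2) * exp e" by (simp add: exp_minus field_simps)
  then show ?thesis by (simp only: exp_add)
qed

lemma norm_cosh_half: "norm (cosh (cpl t \<theta> / 2)) ^ 2 = sinh (t / 2) ^ 2 + cos (\<theta> / 2) ^ 2"
proof -
  have "cosh (cpl t \<theta> / 2) = cos (\<i> * (cpl t \<theta> / 2))" by (rule cosh_conv_cos)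
  then have "norm (cosh (cpl t \<theta> / 2)) ^ 2 = cos (- \<theta> / 2) ^ 2 + (exp (t / 2) - inverse (exp (t / 2)))\<^sup>2 / 4"
    by (simp add: norm_cos_squared)
  also have "(exp (t / 2) - inverse (exp (t / 2)))\<^sup>2 / 4 = sinh (t / 2) ^ 2"
    by (simp add: sinh_def exp_minus power_divide)
  finally show ?thesis by simp
qed

lemma cos_half_sq_le:
  assumes "0 \<le> \<delta>" "\<delta> \<le> \<bar>\<theta>\<bar>" "\<bar>\<theta>\<bar> \<le> pi" shows "cos (\<theta> / 2) ^ 2 \<le> cos (\<delta> / 2) ^ 2"
proof -
  have "cos (\<bar>\<theta>\<bar> / 2) \<le> cos (\<delta> / 2)" using assms by (intro cos_monotone_0_pi_le) auto
  moreover have "0 \<le> cos (\<bar>\<theta>\<bar> / 2)" using assms by (intro cos_ge_zero) auto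
  ultimately have "cos (\<bar>\<theta>\<bar> / 2) ^ 2 \<le> cos (\<delta> / 2) ^ 2" by (intro power_mono)
  moreover have "cos (\<bar>\<theta>\<bar> / 2) = cos (\<theta> / 2)" by (cases "0 \<le> \<theta>") (auto simp: abs_if)
  ultimately show ?thesis by simp
qed

text \<open>By \<open>norm_cosh_half\<close> the real part \<open>t\<close> adds only
  \<open>sinh (t / 2) ^ 2\<close> to the square of \<open>cos (\<theta> / 2)\<close>. For small
  \<open>t\<close> this fits into the gap between the cosines belonging to \<open>\<theta>'\<close>
  and \<open>\<delta>\<close>.\<close>

lemma cosh_half_le:
  assumes "0 < \<theta>'" "\<theta>' < \<delta>" "\<delta> \<le> pi"
  shows "\<exists>\<eta>>0. \<forall>t \<theta>. \<bar>t\<bar> \<le> \<eta> \<longrightarrow> \<delta> \<le> \<bar>\<theta>\<bar> \<longrightarrow> \<bar>\<theta>\<bar> \<le> pi \<longrightarrow> norm (cosh (cpl t \<theta> / 2)) \<le> cos (\<theta>' / 2)"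
proof -
  have c0: "0 \<le> cos (\<delta> / 2)" using assms by (intro cos_ge_zero) auto
  have "cos (\<delta> / 2) < cos (\<theta>' / 2)" using assms by (intro cos_monotone_0_pi) auto
  then have g: "cos (\<delta> / 2) ^ 2 < cos (\<theta>' / 2) ^ 2" and cp: "0 \<le> cos (\<theta>' / 2)" using c0 by (auto intro!: power_strict_mono)
  have "((\<lambda>t::real. sinh (t / 2) ^ 2) \<longlongrightarrow> sinh (0 / 2) ^ 2) (at_right 0)" by (intro tendsto_intros) auto
  then have "((\<lambda>t::real. sinh (t / 2) ^ 2) \<longlongrightarrow> 0) (at_right 0)" by simp
  then have "\<forall>\<^sub>F t::real in at_right 0. sinh (t / 2) ^ 2 < cos (\<theta>' / 2) ^ 2 - cos (\<delta> / 2) ^ 2"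
    by (rule order_tendstoD) (use g in simp)
  then have "\<forall>\<^sub>F t::real in at_right 0. sinh (t / 2) ^ 2 < cos (\<theta>' / 2) ^ 2 - cos (\<delta> / 2) ^ 2 \<and> 0 < t"
    by (auto intro: eventually_conj eventually_at_right_less)
  then obtain \<eta> :: real where \<eta>: "0 < \<eta>" "sinh (\<eta> / 2) ^ 2 < cos (\<theta>' / 2) ^ 2 - cos (\<delta> / 2) ^ 2"
    using eventually_happens'[OF trivial_limit_at_right_real] by blast
  show ?thesis
  proof (intro exI[of _ \<eta>] conjI allI impI)
    fix t \<theta> :: real assume a: "\<bar>t\<bar> \<le> \<eta>" "\<delta> \<le> \<bar>\<theta>\<bar>" "\<bar>\<theta>\<bar> \<le> pi"
    have "\<bar>sinh (t / 2)\<bar> \<le> sinh (\<eta> / 2)"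
    proof -
      have "\<bar>sinh (t / 2)\<bar> = sinh (\<bar>t\<bar> / 2)" by (cases "0 \<le> t") (auto simp: abs_if)
      then show ?thesis using a by simp
    qed
    then have "sinh (t / 2) ^ 2 \<le> sinh (\<eta> / 2) ^ 2" by (metis abs_ge_zero power2_abs power_mono)
    moreover have "cos (\<theta> / 2) ^ 2 \<le> cos (\<delta> / 2) ^ 2" using a assms by (intro cos_half_sq_le) auto
    ultimately have "norm (cosh (cpl t \<theta> / 2)) ^ 2 \<le> cos (\<theta>' / 2) ^ 2" unfolding norm_cosh_half using \<eta> by linarith
    then show "norm (cosh (cpl t \<theta> / 2)) \<le> cos (\<theta>' / 2)" using cp by (rule power2_le_imp_le)
  qed (rule \<eta>)
qed

context des_mgf
begin

lemma f_dev: "\<exists>C\<ge>0. \<forall>n\<ge>2. \<forall>z. norm z \<le> 1 \<longrightarrow> norm (f n z * exp (- of_real (real (n + 1) / 12) * z\<^sup>2 / 2) - 1) \<le> exp (C * real n * norm z ^ 4) - 1"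
proof -
  obtain C where C: "C \<ge> 0" "\<And>v. norm v \<le> 1 \<Longrightarrow> norm (Gh v * exp (- v / 24) - 1) \<le> C * norm v ^ 2" using Gh_gauss by blast
  obtain K where K: "K \<ge> 0" "\<And>n v. n \<ge> 2 \<Longrightarrow> norm v \<le> 1 \<Longrightarrow> norm (gh n v - 1) \<le> K * norm v ^ 2" using gh_bound by blast
  show ?thesis
  proof (intro exI[of _ "2 * C + K"] conjI allI impI)
    fix n :: nat and z :: complex assume n: "n \<ge> 2" and z: "norm z \<le> 1"
    have v: "norm (z\<^sup>2) \<le> 1" using z by (simp add: norm_power power_le_one)
    have "norm ((Gh (z\<^sup>2) * exp (- z\<^sup>2 / 24)) ^ (n + 1) - 1) \<le> exp (real (n + 1) * (C * norm z ^ 4)) - 1"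
      by (intro power_dev quartic_dev C v)
    moreover have "norm (gh n (z\<^sup>2) - 1) \<le> exp (K * norm z ^ 4) - 1" by (intro quartic_dev K n v)
    ultimately have "norm ((Gh (z\<^sup>2) * exp (- z\<^sup>2 / 24)) ^ (n + 1) * gh n (z\<^sup>2) - 1) \<le> exp (real (n + 1) * (C * norm z ^ 4) + K * norm z ^ 4) - 1"
      by (rule mult_dev)
    moreover have "real (n + 1) * (C * norm z ^ 4) + K * norm z ^ 4 \<le> (2 * C + K) * real n * norm z ^ 4"
    proof -
      have "real (n + 1) * C \<le> 2 * real n * C" "K \<le> real n * K" using n C K by (auto intro!: mult_right_mono simp: mult_le_cancel_right1)
      then have "real (n + 1) * C + K \<le> (2 * C + K) * real n" by (simp add: algebra_simps)
      then have "(real (n + 1) * C + K) * norm z ^ 4 \<le> (2 * C + K) * real n * norm z ^ 4" by (intro mult_right_mono) auto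
      then show ?thesis by (simp add: algebra_simps)
    qed
    moreover have "(Gh (z\<^sup>2) * exp (- z\<^sup>2 / 24)) ^ (n + 1) * gh n (z\<^sup>2) = f n z * exp (- of_real (real (n + 1) / 12) * z\<^sup>2 / 2)"
    proof -
      have "exp (- z\<^sup>2 / 24) ^ (n + 1) = exp (of_nat (n + 1) * (- z\<^sup>2 / 24))" by (rule exp_of_nat_mult[symmetric])
      also have "of_nat (n + 1) * (- z\<^sup>2 / 24) = - of_real (real (n + 1) / 12) * z\<^sup>2 / 2" by simp
      finally show ?thesis using f_eq[of n z] n n0 z by (simp only: power_mult_distrib) simp
    qed
    ultimately show "norm (f n z * exp (- of_real (real (n + 1) / 12) * z\<^sup>2 / 2) - 1) \<le> exp ((2 * C + K) * real n * norm z ^ 4) - 1"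
      using dev_mono by metis
  qed (use C K in auto)
qed

lemma f_far:
  assumes \<delta>: "0 < \<delta>"
  shows "\<exists>c>0. \<exists>\<eta>>0. \<forall>n\<ge>2. \<forall>t \<theta>. \<bar>t\<bar> \<le> \<eta> \<longrightarrow> \<delta> \<le> \<bar>\<theta>\<bar> \<longrightarrow> \<bar>\<theta>\<bar> \<le> pi \<longrightarrow> norm (f n (cpl t \<theta>)) \<le> exp (- c * real n)"
proof -
  obtain C where C: "C \<ge> 0" "\<And>n z. n \<ge> 2 \<Longrightarrow> norm z \<le> 1 \<Longrightarrow>
    norm (f n z * exp (- of_real (real (n + 1) / 12) * z\<^sup>2 / 2) - 1) \<le> exp (C * real n * norm z ^ 4) - 1" using f_dev by blast
  define \<delta>1 where "\<delta>1 = min \<delta> pi"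
  \<comment> \<open>At \<open>i * \<theta>'\<close> the Gaussian exponent is below
    \<open>- n * \<theta>' ^ 2 / 24\<close>. The last bound gives
    \<open>C * \<theta>' ^ 2 \<le> 1 / 48\<close>, because 49 exceeds 48, so the quartic error
    spends at most half of it.\<close>
  define \<theta>' where "\<theta>' = min (\<delta>1 / 2) (min 1 (1 / (7 * sqrt (C + 1))))"
  have d1: "0 < \<delta>1" "\<delta>1 \<le> pi" "\<delta>1 \<le> \<delta>" using \<delta> by (auto simp: \<delta>1_def)
  have t': "0 < \<theta>'" "\<theta>' < \<delta>1" "\<theta>' \<le> 1" using d1 C by (auto simp: \<theta>'_def min_less_iff_disj)
  have "\<theta>' ^ 2 \<le> (1 / (7 * sqrt (C + 1))) ^ 2" using t' by (intro power_mono) (auto simp: \<theta>'_def)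
  also have "\<dots> = 1 / (49 * (C + 1))" using C by (simp add: power_divide power_mult_distrib)
  finally have "C * \<theta>' ^ 2 \<le> C * (1 / (49 * (C + 1)))" using C by (intro mult_left_mono) auto
  also have "\<dots> \<le> 1 / 48" using C by (simp add: field_simps)
  finally have Ct: "C * \<theta>' ^ 4 \<le> \<theta>' ^ 2 / 48"
    using mult_right_mono[of "C * \<theta>' ^ 2" "1 / 48" "\<theta>' ^ 2"] by (simp add: mult.assoc flip: power_add)
  obtain \<eta> where \<eta>: "0 < \<eta>" "\<And>t \<theta>. \<bar>t\<bar> \<le> \<eta> \<Longrightarrow> \<delta>1 \<le> \<bar>\<theta>\<bar> \<Longrightarrow> \<bar>\<theta>\<bar> \<le> pi \<Longrightarrow> norm (cosh (cpl t \<theta> / 2)) \<le> cos (\<theta>' / 2)"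
    using cosh_half_le[OF t'(1,2) d1(2)] by blast
  show ?thesis
  proof (rule exI[of _ "\<theta>' ^ 2 / 48"], rule conjI, use t' in simp, rule exI[of _ \<eta>], rule conjI[OF \<eta>(1)], intro allI impI)
    fix n :: nat and t \<theta> assume n: "n \<ge> 2" and a: "\<bar>t\<bar> \<le> \<eta>" "\<delta> \<le> \<bar>\<theta>\<bar>" "\<bar>\<theta>\<bar> \<le> pi"
    have "norm (cosh (cpl t \<theta> / 2)) \<le> cos (\<theta>' / 2)" using \<eta>(2)[of t \<theta>] a d1 by simp
    then have "norm (f n (cpl t \<theta>)) \<le> norm (f n (\<i> * of_real \<theta>'))" using n n0 by (intro norm_le_imaginary) auto
    also have "\<dots> \<le> exp (real (n + 1) / 12 * Re ((\<i> * of_real \<theta>')\<^sup>2) / 2 + C * real n * norm (\<i> * of_real \<theta>') ^ 4)"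
      using t' by (intro norm_le_from_dev C n) (simp add: norm_mult)
    also have "\<dots> \<le> exp (- (\<theta>' ^ 2 / 48) * real n)"
    proof -
      have r1: "Re ((\<i> * of_real \<theta>')\<^sup>2) = - (\<theta>' ^ 2)" by (simp add: power_mult_distrib power2_eq_square)
      have r2: "norm (\<i> * of_real \<theta>') ^ 4 = \<theta>' ^ 4" by (simp add: norm_mult)
      have "C * real n * \<theta>' ^ 4 \<le> real n * (\<theta>' ^ 2 / 48)" using mult_left_mono[OF Ct, of "real n"] by (simp add: mult_ac)
      moreover have "0 \<le> \<theta>' ^ 2" by simp
      moreover have "real (n + 1) / 12 * - (\<theta>' ^ 2) / 2 = - (real n * \<theta>' ^ 2) / 24 - \<theta>' ^ 2 / 24" by (simp add: field_simps)
      moreover have "- (\<theta>' ^ 2 / 48) * real n = - (real n * \<theta>' ^ 2) / 48" "real n * (\<theta>' ^ 2 / 48) = (real n * \<theta>' ^ 2) / 48" by simp_all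
      ultimately have "real (n + 1) / 12 * Re ((\<i> * of_real \<theta>')\<^sup>2) / 2 + C * real n * norm (\<i> * of_real \<theta>') ^ 4 \<le> - (\<theta>' ^ 2 / 48) * real n"
        unfolding r1 r2 by linarith
      then show ?thesis by (simp only: exp_le_cancel_iff)
    qed
    finally show "norm (f n (cpl t \<theta>)) \<le> exp (- (\<theta>' ^ 2 / 48) * real n)" .
  qed
qed

end

text \<open>Both terms contain \<open>Gh (z ^ 2) ^ m\<close>. Without it the difference is
  \<open>2 * Gh * B.gh m - A.gh (m - 1)\<close>, which equals \<open>2 * Gh - 1\<close> up to a
  quartic error.\<close>

lemma D_dev: "\<exists>C\<ge>0. \<forall>m\<ge>3. \<forall>z. norm z \<le> 1 \<longrightarrow>
  norm ((2 * fB m z - fA (m - 1) z) * exp (- of_real (real (m + 2) / 12) * z\<^sup>2 / 2) - 1) \<le> exp (C * real m * norm z ^ 4) - 1"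
proof -
  obtain C where C: "C \<ge> 0" "\<And>v. norm v \<le> 1 \<Longrightarrow> norm (Gh v * exp (- v / 24) - 1) \<le> C * norm v ^ 2" using Gh_gauss by blast
  obtain C2 where C2: "C2 \<ge> 0" "\<And>v. norm v \<le> 1 \<Longrightarrow> norm (exp (- v / 12) * (2 * Gh v - 1) - 1) \<le> C2 * norm v ^ 2" using Gh_gauss_D by blast
  obtain K where K: "K \<ge> 0" "\<And>n v. n \<ge> 2 \<Longrightarrow> norm v \<le> 1 \<Longrightarrow> norm (A.gh n v - 1) \<le> K * norm v ^ 2" using A.gh_bound by blast
  obtain L where L: "L \<ge> 0" "\<And>n v. n \<ge> 2 \<Longrightarrow> norm v \<le> 1 \<Longrightarrow> norm (B.gh n v - 1) \<le> L * norm v ^ 2" using B.gh_bound by blast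
  have "continuous_on (cball 0 1) Gh" by (rule holomorphic_on_imp_continuous_on[OF Gh_holomorphic])
  then have "bounded (Gh ` cball 0 1)" by (intro compact_imp_bounded compact_continuous_image) auto
  then obtain M where M: "0 < M" "\<And>v. norm v \<le> 1 \<Longrightarrow> norm (Gh v) \<le> M" unfolding bounded_pos by auto
  define K3 where "K3 = C2 + 3 * (2 * M * L + K)"
  show ?thesis
  proof (intro exI[of _ "C + K3"] conjI allI impI)
    fix m :: nat and z :: complex assume m: "m \<ge> 3" and z: "norm z \<le> 1"
    define v where "v = z\<^sup>2"
    have v: "norm v \<le> 1" using z by (simp add: v_def norm_power power_le_one)
    have e: "norm (exp (- v / 12)) \<le> 3"
    proof -
      have "Re (- v / 12) \<le> 1" using abs_Re_le_cmod[of v] v by simp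
      then have "exp (Re (- v / 12)) \<le> exp 1" by (simp only: exp_le_cancel_iff)
      then show ?thesis using exp_le unfolding norm_exp_eq_Re by linarith
    qed
    define r where "r = exp (- v / 12) * (2 * Gh v * B.gh m v - A.gh (m - 1) v)"
    have "r - 1 = (exp (- v / 12) * (2 * Gh v - 1) - 1) + exp (- v / 12) * (2 * Gh v * (B.gh m v - 1) - (A.gh (m - 1) v - 1))"
      by (simp add: r_def algebra_simps)
    then have "norm (r - 1) \<le> norm (exp (- v / 12) * (2 * Gh v - 1) - 1) + norm (exp (- v / 12)) * norm (2 * Gh v * (B.gh m v - 1) - (A.gh (m - 1) v - 1))"
      by (metis norm_triangle_ineq norm_mult)
    also have "\<dots> \<le> C2 * norm v ^ 2 + 3 * (2 * M * (L * norm v ^ 2) + K * norm v ^ 2)"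
    proof (intro add_mono mult_mono C2 v e)
      have "norm (2 * Gh v * (B.gh m v - 1) - (A.gh (m - 1) v - 1)) \<le> norm (2 * Gh v * (B.gh m v - 1)) + norm (A.gh (m - 1) v - 1)" by (rule norm_triangle_ineq4)
      also have "\<dots> \<le> 2 * M * (L * norm v ^ 2) + K * norm v ^ 2"
        unfolding norm_mult using M(2)[OF v] M(1) L(2)[OF _ v, of m] K(2)[OF _ v, of "m - 1"] m
        by (intro add_mono mult_mono) auto
      finally show "norm (2 * Gh v * (B.gh m v - 1) - (A.gh (m - 1) v - 1)) \<le> 2 * M * (L * norm v ^ 2) + K * norm v ^ 2" .
    qed auto
    also have "\<dots> = K3 * norm (z\<^sup>2) ^ 2" by (simp add: K3_def v_def algebra_simps)
    finally have r: "norm (r - 1) \<le> exp (K3 * norm z ^ 4) - 1" by (rule quartic_dev)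
    have "norm ((Gh v * exp (- v / 24)) ^ m - 1) \<le> exp (real m * (C * norm z ^ 4)) - 1"
      unfolding v_def by (intro power_dev quartic_dev C v[unfolded v_def])
    from mult_dev[OF this r] have "norm ((Gh v * exp (- v / 24)) ^ m * r - 1) \<le> exp (real m * (C * norm z ^ 4) + K3 * norm z ^ 4) - 1" .
    moreover have "real m * (C * norm z ^ 4) + K3 * norm z ^ 4 \<le> (C + K3) * real m * norm z ^ 4"
    proof -
      have "0 \<le> K3" using C2 M L K by (simp add: K3_def)
      then have "K3 * 1 \<le> K3 * real m" using m by (intro mult_left_mono) auto
      then have "K3 * norm z ^ 4 \<le> K3 * real m * norm z ^ 4" by (intro mult_right_mono) auto
      then show ?thesis by (simp add: algebra_simps)
    qed
    moreover have "(Gh v * exp (- v / 24)) ^ m * r = (2 * fB m z - fA (m - 1) z) * exp (- of_real (real (m + 2) / 12) * z\<^sup>2 / 2)"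
    proof -
      have "exp (- v / 24) ^ m * exp (- v / 12) = exp (of_nat m * (- v / 24) + - v / 12)" by (simp only: exp_of_nat_mult exp_add)
      also have "of_nat m * (- v / 24) + - v / 12 = - of_real (real (m + 2) / 12) * z\<^sup>2 / 2" by (simp add: v_def field_simps)
      finally have E: "exp (- v / 24) ^ m * exp (- v / 12) = exp (- of_real (real (m + 2) / 12) * z\<^sup>2 / 2)" .
      have fs: "fB m z = Gh v ^ m * Gh v * B.gh m v" "fA (m - 1) z = Gh v ^ m * A.gh (m - 1) v"
        using A.f_eq[of "m - 1" z] B.f_eq[of m z] m z by (simp_all add: v_def mult.commute)
      have "(Gh v * exp (- v / 24)) ^ m * r = (Gh v ^ m * (2 * Gh v * B.gh m v - A.gh (m - 1) v)) * (exp (- v / 24) ^ m * exp (- v / 12))"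
        by (simp only: r_def power_mult_distrib mult_ac)
      then show ?thesis unfolding E fs by (simp add: algebra_simps)
    qed
    ultimately show "norm ((2 * fB m z - fA (m - 1) z) * exp (- of_real (real (m + 2) / 12) * z\<^sup>2 / 2) - 1) \<le> exp ((C + K3) * real m * norm z ^ 4) - 1"
      using dev_mono by metis
  qed (use C C2 M L K in \<open>simp add: K3_def\<close>)
qed

lemma exp_minus_one_le: "\<bar>exp x - 1\<bar> \<le> exp \<bar>x\<bar> - (1::real)"
proof (cases "0 \<le> x")
  case False
  have "1 - exp x \<le> - x" using exp_ge_add_one_self[of x] by linarith
  also have "- x \<le> exp (- x) - 1" using exp_ge_add_one_self[of "- x"] by linarith
  finally show ?thesis using False by simp
qed simp

text \<open>Carries bounds on the imaginary axis over to a strip whose width is a small multiple of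
  \<open>1 / R\<close>.\<close>

lemma mgf_perturb:
  fixes X :: "'w \<Rightarrow> nat"
  assumes A: "card A \<noteq> 0" and R: "\<And>w. w \<in> A \<Longrightarrow> \<bar>real (X w) - \<mu>\<bar> \<le> R"
  shows "norm (mgf A X \<mu> (cpl t \<theta>) - mgf A X \<mu> (\<i> * of_real \<theta>)) \<le> exp (\<bar>t\<bar> * R) - 1"
proof -
  have d: "norm (exp (cpl t \<theta> * (of_nat (X w) - of_real \<mu>)) - exp (\<i> * of_real \<theta> * (of_nat (X w) - of_real \<mu>))) \<le> exp (\<bar>t\<bar> * R) - 1" if "w \<in> A" for w
  proof -
    let ?x = "real (X w) - \<mu>"
    have x: "of_nat (X w) - of_real \<mu> = complex_of_real ?x" by simp
    have "exp (cpl t \<theta> * of_real ?x) - exp (\<i> * of_real \<theta> * of_real ?x) = exp (\<i> * of_real (\<theta> * ?x)) * of_real (exp (t * ?x) - 1)"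
      by (simp add: exp_of_real[symmetric] algebra_simps exp_add[symmetric] del: exp_of_real)
    then have "norm (exp (cpl t \<theta> * of_real ?x) - exp (\<i> * of_real \<theta> * of_real ?x)) = \<bar>exp (t * ?x) - 1\<bar>"
      by (simp only: norm_mult norm_exp_i_times norm_of_real) simp
    also have "\<dots> \<le> exp \<bar>t * ?x\<bar> - 1" by (rule exp_minus_one_le)
    also have "\<bar>t * ?x\<bar> \<le> \<bar>t\<bar> * R" unfolding abs_mult using R[OF that] by (intro mult_left_mono) auto
    finally show ?thesis unfolding x by simp
  qed
  have "mgf A X \<mu> (cpl t \<theta>) - mgf A X \<mu> (\<i> * of_real \<theta>) =
    (\<Sum>w\<in>A. exp (cpl t \<theta> * (of_nat (X w) - of_real \<mu>)) - exp (\<i> * of_real \<theta> * (of_nat (X w) - of_real \<mu>))) / of_nat (card A)"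
    by (simp add: mgf_def sum_subtractf diff_divide_distrib)
  also have "norm \<dots> \<le> (\<Sum>w\<in>A. exp (\<bar>t\<bar> * R) - 1) / card A"
  proof -
    have "norm (\<Sum>w\<in>A. exp (cpl t \<theta> * (of_nat (X w) - of_real \<mu>)) - exp (\<i> * of_real \<theta> * (of_nat (X w) - of_real \<mu>))) \<le> (\<Sum>w\<in>A. exp (\<bar>t\<bar> * R) - 1)"
      by (rule sum_norm_le) (rule d)
    then show ?thesis unfolding norm_divide by (simp only: norm_of_nat) (rule divide_right_mono, auto)
  qed
  also have "\<dots> = exp (\<bar>t\<bar> * R) - 1" using A by simp
  finally show ?thesis .
qed

text \<open>The values 0 and 1 contribute two terms whose sum has modulus
  \<open>2 * \<bar>cos (\<theta> / 2)\<bar>\<close>, which stays below 2 away from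
  \<open>\<theta> = 0\<close>. The constants depend on the group, so this serves finitely many
  groups at a time.\<close>

lemma small_far:
  fixes X :: "'w \<Rightarrow> nat"
  assumes A: "finite A" "w0 \<in> A" "w1 \<in> A" "X w0 = 0" "X w1 = 1" and \<delta>: "0 < \<delta>"
  shows "\<exists>c>0. \<exists>\<eta>>0. \<forall>t \<theta>. \<bar>t\<bar> \<le> \<eta> \<longrightarrow> \<delta> \<le> \<bar>\<theta>\<bar> \<longrightarrow> \<bar>\<theta>\<bar> \<le> pi \<longrightarrow> norm (mgf A X \<mu> (cpl t \<theta>)) \<le> exp (- c)"
proof (cases "\<delta> \<le> pi")
  case False
  then show ?thesis by (intro exI[of _ 1] conjI allI impI) auto
next
  case True
  define n where "n = real (card A)"
  have "card {w0, w1} \<le> card A" using A by (intro card_mono) auto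
  moreover have ne: "w0 \<noteq> w1" using A by auto
  ultimately have n: "2 \<le> n" by (simp add: n_def)
  \<comment> \<open>The loss on the imaginary axis is \<open>2 * \<kappa>\<close>; one half of it
    pays for the passage to the strip.\<close>
  define \<kappa> where "\<kappa> = (1 - cos (\<delta> / 2)) / n"
  have "cos (\<delta> / 2) < cos 0" using \<delta> True by (intro cos_monotone_0_pi) auto
  then have \<kappa>: "0 < \<kappa>" using n by (simp add: \<kappa>_def)
  define R where "R = (\<Sum>w\<in>A. \<bar>real (X w) - \<mu>\<bar>)"
  have R: "\<bar>real (X w) - \<mu>\<bar> \<le> R" if "w \<in> A" for w unfolding R_def using A(1) that by (intro member_le_sum) auto
  have R0: "0 \<le> R" unfolding R_def by (intro sum_nonneg) auto
  have im: "norm (mgf A X \<mu> (\<i> * of_real \<theta>)) \<le> 1 - 2 * \<kappa>" if th: "\<delta> \<le> \<bar>\<theta>\<bar>" "\<bar>\<theta>\<bar> \<le> pi" for \<theta>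
  proof -
    let ?e = "\<lambda>w. exp (\<i> * of_real \<theta> * (of_nat (X w) - of_real \<mu>))"
    have ne1: "norm (?e w) = 1" for w by simp
    have "(\<Sum>w\<in>A. ?e w) = ?e w0 + ?e w1 + (\<Sum>w\<in>A - {w0, w1}. ?e w)"
      using A ne by (subst sum.subset_diff[of "{w0, w1}" A]) auto
    moreover have "norm (?e w0 + ?e w1) \<le> 2 * cos (\<delta> / 2)"
    proof -
      have "?e w0 + ?e w1 = exp (\<i> * of_real \<theta> * (- of_real \<mu>)) * (1 + exp (\<i> * of_real \<theta>))"
        using A by (simp add: algebra_simps exp_add[symmetric])
      moreover have "1 + exp (\<i> * of_real \<theta>) = exp (\<i> * of_real (\<theta> / 2)) * (2 * cos (of_real (\<theta> / 2)))"
        by (simp add: cos_exp_eq algebra_simps exp_add[symmetric])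
      ultimately have "norm (?e w0 + ?e w1) = norm (exp (\<i> * of_real \<theta> * (- of_real \<mu>))) * (norm (exp (\<i> * of_real (\<theta> / 2))) * norm (2 * cos (complex_of_real (\<theta> / 2))))"
        by (simp only: norm_mult)
      also have "norm (exp (\<i> * of_real \<theta> * (- of_real \<mu>))) = 1" by simp
      also have "norm (exp (\<i> * of_real (\<theta> / 2))) = 1" by (rule norm_exp_i_times)
      also have "norm (2 * cos (complex_of_real (\<theta> / 2))) = 2 * \<bar>cos (\<theta> / 2)\<bar>" by (simp only: norm_mult cos_of_real norm_of_real) simp
      also have "\<bar>cos (\<theta> / 2)\<bar> \<le> \<bar>cos (\<delta> / 2)\<bar>" using cos_half_sq_le[OF _ th] \<delta> by (simp add: abs_le_square_iff)
      also have "\<bar>cos (\<delta> / 2)\<bar> = cos (\<delta> / 2)" using \<delta> True by (intro abs_of_nonneg cos_ge_zero) auto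
      finally show ?thesis by simp
    qed
    moreover have "norm (\<Sum>w\<in>A - {w0, w1}. ?e w) \<le> n - 2"
    proof -
      have "norm (\<Sum>w\<in>A - {w0, w1}. ?e w) \<le> (\<Sum>w\<in>A - {w0, w1}. 1)" by (rule sum_norm_le) (simp only: ne1 order_refl)
      also have "\<dots> = real (card (A - {w0, w1}))" by simp
      also have "\<dots> = n - 2" using A ne n by (simp add: n_def card_Diff_subset of_nat_diff)
      finally show ?thesis .
    qed
    ultimately have "norm (\<Sum>w\<in>A. ?e w) \<le> 2 * cos (\<delta> / 2) + (n - 2)" by (smt (verit) norm_triangle_ineq)
    also have "\<dots> = n * (1 - 2 * \<kappa>)" using n by (simp add: \<kappa>_def field_simps)
    finally have "norm (\<Sum>w\<in>A. ?e w) / n \<le> 1 - 2 * \<kappa>" using n by (simp add: field_simps)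
    then show ?thesis by (simp add: mgf_def norm_divide n_def)
  qed
  have "((\<lambda>t::real. exp (t * R) - 1) \<longlongrightarrow> exp (0 * R) - 1) (at_right 0)" by (intro tendsto_intros)
  then have "((\<lambda>t::real. exp (t * R) - 1) \<longlongrightarrow> 0) (at_right 0)" by simp
  then have "\<forall>\<^sub>F t::real in at_right 0. exp (t * R) - 1 < \<kappa>" by (rule order_tendstoD) (rule \<kappa>)
  then have "\<forall>\<^sub>F t::real in at_right 0. exp (t * R) - 1 < \<kappa> \<and> 0 < t" by (auto intro: eventually_conj eventually_at_right_less)
  then obtain \<eta> :: real where \<eta>: "0 < \<eta>" "exp (\<eta> * R) - 1 < \<kappa>"
    using eventually_happens'[OF trivial_limit_at_right_real] by blast
  show ?thesis
  proof (rule exI[of _ \<kappa>], rule conjI[OF \<kappa>], rule exI[of _ \<eta>], rule conjI[OF \<eta>(1)], intro allI impI)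
    fix t \<theta> assume a: "\<bar>t\<bar> \<le> \<eta>" "\<delta> \<le> \<bar>\<theta>\<bar>" "\<bar>\<theta>\<bar> \<le> pi"
    have "norm (mgf A X \<mu> (cpl t \<theta>) - mgf A X \<mu> (\<i> * of_real \<theta>)) \<le> exp (\<bar>t\<bar> * R) - 1"
      by (rule mgf_perturb) (use n R in \<open>auto simp: n_def\<close>)
    moreover have "exp (\<bar>t\<bar> * R) \<le> exp (\<eta> * R)" using a(1) R0 by (simp add: mult_right_mono)
    ultimately have "norm (mgf A X \<mu> (cpl t \<theta>) - mgf A X \<mu> (\<i> * of_real \<theta>)) \<le> exp (\<eta> * R) - 1" by linarith
    then have "norm (mgf A X \<mu> (cpl t \<theta>)) \<le> (1 - 2 * \<kappa>) + \<kappa>"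
      using im[OF a(2,3)] \<eta>(2) norm_triangle_sub[of "mgf A X \<mu> (cpl t \<theta>)" "mgf A X \<mu> (\<i> * of_real \<theta>)"] by linarith
    also have "\<dots> \<le> exp (- \<kappa>)" using exp_ge_add_one_self[of "- \<kappa>"] by linarith
    finally show "norm (mgf A X \<mu> (cpl t \<theta>)) \<le> exp (- \<kappa>)" .
  qed
qed

section \<open>Uniform distributions, the factors of the inversion numbers\<close>

lemma sin_mult_ge:
  assumes "0 \<le> x" "x \<le> pi" "0 \<le> c" "c \<le> 1" shows "c * sin x \<le> sin (c * x)"
proof -
  have "convex_on {0..pi} (\<lambda>x. - sin x)"
  proof (rule f''_ge0_imp_convex[where f' = "\<lambda>x. - cos x" and f'' = sin])
    show "((\<lambda>x. - sin x) has_real_derivative - cos x) (at x)" for x :: real by (intro DERIV_minus DERIV_sin)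
    show "((\<lambda>x. - cos x) has_real_derivative sin x) (at x)" for x :: real using DERIV_minus[OF DERIV_cos] by simp
  qed (simp_all add: sin_ge_zero)
  from convex_onD[OF this, of c 0 x] show ?thesis using assms by (simp add: mult.commute)
qed

definition unif :: "nat \<Rightarrow> complex \<Rightarrow> complex" where
  "unif d = mgf {..<d} (\<lambda>j. j) ((real d - 1) / 2)"

text \<open>A telescoping sum, as for the Dirichlet kernel. The multiplied form stays meaningful at
  the zeros of \<open>sinh (z / 2)\<close>.\<close>

lemma unif_sinh: "sinh (z / 2) * (of_nat d * unif d z) = sinh (of_nat d * z / 2)"
proof (cases "d = 0")
  case False
  have s: "sinh w = (exp w - exp (- w)) / 2" for w :: complex by (simp add: sinh_def scaleR_conv_of_real)
  have c: "of_nat j - complex_of_real ((real d - 1) / 2) = of_nat j - of_nat d / 2 + 1 / 2" for j by (simp add: field_simps)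
  have "(exp (z / 2) - exp (- (z / 2))) * (\<Sum>j<d. exp (z * (of_nat j - of_nat d / 2 + 1 / 2))) = (\<Sum>j<d. exp (z * (of_nat (Suc j) - of_nat d / 2)) - exp (z * (of_nat j - of_nat d / 2)))"
    unfolding sum_distrib_left
  proof (intro sum.cong refl)
    fix j
    have "exp (z / 2) * exp (z * (of_nat j - of_nat d / 2 + 1 / 2)) = exp (z * (of_nat (Suc j) - of_nat d / 2))"
      "exp (- (z / 2)) * exp (z * (of_nat j - of_nat d / 2 + 1 / 2)) = exp (z * (of_nat j - of_nat d / 2))"
      by (simp_all add: exp_add[symmetric] algebra_simps)
    then show "(exp (z / 2) - exp (- (z / 2))) * exp (z * (of_nat j - of_nat d / 2 + 1 / 2)) = exp (z * (of_nat (Suc j) - of_nat d / 2)) - exp (z * (of_nat j - of_nat d / 2))"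
      by (simp only: left_diff_distrib)
  qed
  also have "\<dots> = exp (z * (of_nat d - of_nat d / 2)) - exp (z * (of_nat 0 - of_nat d / 2))"
    by (rule sum_lessThan_telescope)
  also have "z * (of_nat d - of_nat d / 2) = of_nat d * z / 2" by (simp add: field_simps)
  also have "z * (of_nat 0 - of_nat d / 2) = - (of_nat d * z / 2)" by simp
  finally have "(exp (z / 2) - exp (- (z / 2))) * (\<Sum>j<d. exp (z * (of_nat j - of_nat d / 2 + 1 / 2))) = exp (of_nat d * z / 2) - exp (- (of_nat d * z / 2))" .
  then show ?thesis using False unfolding s unif_def mgf_def c by simp
qed simp

text \<open>A uniform variable on \<open>d\<close> consecutive integers plus an independent uniform
  variable on the unit interval is uniform on an interval of length \<open>d\<close>.\<close>

lemma unif_Gh: assumes d: "1 \<le> d" shows "unif d z * Gh (z\<^sup>2) = Gh ((of_nat d * z)\<^sup>2)"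
proof (cases "z = 0")
  case True
  then show ?thesis using d by (simp add: Gh_0 unif_def mgf_def)
next
  case False
  have "z * of_nat d * (unif d z * Gh (z\<^sup>2)) = of_nat d * unif d z * (z * Gh (z\<^sup>2))" by (simp add: mult_ac)
  also have "\<dots> = 2 * (sinh (z / 2) * (of_nat d * unif d z))" by (simp add: Gh_sinh)
  also have "\<dots> = 2 * sinh (of_nat d * z / 2)" by (simp only: unif_sinh)
  also have "\<dots> = z * of_nat d * Gh ((of_nat d * z)\<^sup>2)" using Gh_sinh[of "of_nat d * z"] by (simp add: mult_ac)
  finally show ?thesis using False d by simp
qed

text \<open>By \<open>unif_Gh\<close> this is the quotient of Gaussian approximations on the scales
  \<open>d\<close> and 1, so the variances \<open>d ^ 2 / 12\<close> and 1 / 12 subtract, and the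
  error on the smaller scale is absorbed by that on the larger one.\<close>

lemma unif_dev: "\<exists>C\<ge>0. \<forall>d\<ge>1. \<forall>z. real d * norm z \<le> 1 \<longrightarrow>
  norm (unif d z * exp (- of_real ((real d ^ 2 - 1) / 12) * z\<^sup>2 / 2) - 1) \<le> exp (C * (real d * norm z) ^ 4) - 1"
proof -
  obtain C where C: "C \<ge> 0" "\<And>v. norm v \<le> 1 \<Longrightarrow> norm (Gh v * exp (- v / 24) - 1) \<le> C * norm v ^ 2" using Gh_gauss by blast
  obtain K where K: "K \<ge> 0" "\<And>v. norm v \<le> 1 \<Longrightarrow> norm (exp (v / 24) / Gh v - 1) \<le> K * norm v ^ 2" using Gh_gauss_inverse by blast
  show ?thesis
  proof (intro exI[of _ "C + K"] conjI allI impI)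
    fix d :: nat and z :: complex assume d: "1 \<le> d" and z: "real d * norm z \<le> 1"
    have "1 * norm z \<le> real d * norm z" using d by (intro mult_right_mono) auto
    then have z1: "norm z \<le> 1" "norm z \<le> real d * norm z" using z by linarith+
    have v: "norm (z\<^sup>2) \<le> 1" using z1 by (simp add: norm_power power_le_one)
    have dv: "norm ((of_nat d * z)\<^sup>2) \<le> 1" using z by (simp add: norm_power norm_mult power_le_one)
    have "norm (Gh ((of_nat d * z)\<^sup>2) * exp (- (of_nat d * z)\<^sup>2 / 24) - 1) \<le> exp (C * norm (of_nat d * z) ^ 4) - 1"
      by (intro quartic_dev C dv)
    moreover have "norm (exp (z\<^sup>2 / 24) / Gh (z\<^sup>2) - 1) \<le> exp (K * norm z ^ 4) - 1" by (intro quartic_dev K v)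
    ultimately have "norm (Gh ((of_nat d * z)\<^sup>2) * exp (- (of_nat d * z)\<^sup>2 / 24) * (exp (z\<^sup>2 / 24) / Gh (z\<^sup>2)) - 1)
      \<le> exp (C * norm (of_nat d * z) ^ 4 + K * norm z ^ 4) - 1" by (rule mult_dev)
    moreover have "C * norm (of_nat d * z) ^ 4 + K * norm z ^ 4 \<le> (C + K) * (real d * norm z) ^ 4"
    proof -
      have "norm z ^ 4 \<le> (real d * norm z) ^ 4" using z1 by (intro power_mono) auto
      then have "K * norm z ^ 4 \<le> K * (real d * norm z) ^ 4" using K by (intro mult_left_mono) auto
      then show ?thesis by (simp add: norm_mult distrib_right)
    qed
    moreover have "Gh ((of_nat d * z)\<^sup>2) * exp (- (of_nat d * z)\<^sup>2 / 24) * (exp (z\<^sup>2 / 24) / Gh (z\<^sup>2)) = unif d z * exp (- of_real ((real d ^ 2 - 1) / 12) * z\<^sup>2 / 2)"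
    proof -
      have G: "Gh (z\<^sup>2) \<noteq> 0" using v by (intro Gh_nonzero) simp
      have "exp (- (of_nat d * z)\<^sup>2 / 24) * exp (z\<^sup>2 / 24) = exp (- (of_nat d * z)\<^sup>2 / 24 + z\<^sup>2 / 24)" by (rule exp_add[symmetric])
      also have "- (of_nat d * z)\<^sup>2 / 24 + z\<^sup>2 / 24 = - of_real ((real d ^ 2 - 1) / 12) * z\<^sup>2 / 2"
        by (simp add: field_simps power_mult_distrib)
      finally have E: "exp (- (of_nat d * z)\<^sup>2 / 24) * exp (z\<^sup>2 / 24) = exp (- of_real ((real d ^ 2 - 1) / 12) * z\<^sup>2 / 2)" .
      have "a * g * e * (f / g) = a * (e * f)" if "g \<noteq> 0" for a g e f :: complex using that by simp
      from this[OF G] show ?thesis unfolding unif_Gh[OF d, symmetric] E[symmetric] .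
    qed
    ultimately show "norm (unif d z * exp (- of_real ((real d ^ 2 - 1) / 12) * z\<^sup>2 / 2) - 1) \<le> exp ((C + K) * (real d * norm z) ^ 4) - 1"
      using dev_mono by metis
  qed (use C K in auto)
qed

lemma unif_imaginary: "\<bar>sin (\<theta> / 2)\<bar> * (real d * norm (unif d (\<i> * of_real \<theta>))) = \<bar>sin (real d * \<theta> / 2)\<bar>"
proof -
  have sh: "norm (sinh (\<i> * complex_of_real x)) = \<bar>sin x\<bar>" for x
  proof -
    have "sinh (\<i> * complex_of_real x) = \<i> * sin (complex_of_real x)" by (simp add: sinh_conv_sin)
    then show ?thesis by (simp add: norm_mult sin_of_real)
  qed
  have "norm (sinh (\<i> * of_real \<theta> / 2)) * (real d * norm (unif d (\<i> * of_real \<theta>))) = norm (sinh (of_nat d * (\<i> * of_real \<theta>) / 2))"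
    unfolding unif_sinh[symmetric] norm_mult by simp
  moreover have "\<i> * complex_of_real \<theta> / 2 = \<i> * of_real (\<theta> / 2)" "of_nat d * (\<i> * of_real \<theta>) / 2 = \<i> * complex_of_real (real d * \<theta> / 2)" by simp_all
  ultimately show ?thesis by (simp only: sh)
qed

text \<open>With \<open>\<phi> = d * \<bar>\<theta>\<bar> / 2\<close>, the modulus is
  \<open>\<bar>sin \<phi>\<bar>\<close> over \<open>d * sin (\<phi> / d)\<close>. For
  \<open>\<phi> \<ge> pi\<close> the denominator alone yields 1 / 2. For smaller
  \<open>\<phi>\<close>, concavity of the sine gives
  \<open>d * sin (\<phi> / d) \<ge> 2 * sin (\<phi> / 2)\<close>, and the modulus is at most
  \<open>cos (\<phi> / 2)\<close>. Both bounds are uniform in \<open>d\<close>.\<close>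

lemma unif_far:
  assumes "0 < \<delta>"
  shows "\<exists>\<kappa>>0. \<forall>d\<ge>2. \<forall>\<theta>. \<delta> \<le> real d * \<bar>\<theta>\<bar> \<longrightarrow> \<bar>\<theta>\<bar> \<le> pi \<longrightarrow> norm (unif d (\<i> * of_real \<theta>)) \<le> 1 - \<kappa>"
proof -
  define \<delta>1 where "\<delta>1 = min \<delta> pi"
  have d1: "0 < \<delta>1" "\<delta>1 \<le> pi" "\<delta>1 \<le> \<delta>" using assms by (auto simp: \<delta>1_def)
  define \<kappa> where "\<kappa> = min (1 / 2) (1 - cos (\<delta>1 / 4))"
  have "cos (\<delta>1 / 4) < cos 0" using d1 by (intro cos_monotone_0_pi) auto
  then have k0: "0 < \<kappa>" by (simp add: \<kappa>_def)
  show ?thesis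
  proof (intro exI[of _ \<kappa>] conjI allI impI k0)
    fix d :: nat and \<theta> :: real assume d: "2 \<le> d" and a: "\<delta> \<le> real d * \<bar>\<theta>\<bar>" "\<bar>\<theta>\<bar> \<le> pi"
    define \<phi> where "\<phi> = real d * \<bar>\<theta>\<bar> / 2"
    define U where "U = norm (unif d (\<i> * of_real \<theta>))"
    have U0: "0 \<le> U" by (simp add: U_def)
    have abs_sin: "\<bar>sin x\<bar> = \<bar>sin \<bar>x\<bar>\<bar>" for x :: real by (cases "0 \<le> x") (auto simp: abs_if)
    have s0: "0 \<le> sin (\<bar>\<theta>\<bar> / 2)" using a by (intro sin_ge_zero) auto
    have "\<bar>sin (\<theta> / 2)\<bar> = sin (\<bar>\<theta>\<bar> / 2)" using abs_sin[of "\<theta> / 2"] s0 by (simp add: abs_divide)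
    moreover have "\<bar>sin (real d * \<theta> / 2)\<bar> = \<bar>sin \<phi>\<bar>" using abs_sin[of "real d * \<theta> / 2"] by (simp add: \<phi>_def abs_mult)
    ultimately have eq: "sin (\<bar>\<theta>\<bar> / 2) * (real d * U) = \<bar>sin \<phi>\<bar>" using unif_imaginary[of \<theta> d] by (simp add: U_def)
    have \<phi>: "\<delta>1 / 2 \<le> \<phi>" using a(1) d1 by (simp add: \<phi>_def)
    show "norm (unif d (\<i> * of_real \<theta>)) \<le> 1 - \<kappa>"
    proof (cases "pi \<le> \<phi>")
      case True
      have "\<bar>\<theta>\<bar> / pi * sin (pi / 2) \<le> sin (\<bar>\<theta>\<bar> / pi * (pi / 2))" using a by (intro sin_mult_ge) auto
      then have "\<bar>\<theta>\<bar> / pi \<le> sin (\<bar>\<theta>\<bar> / 2)" by simp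
      then have "\<bar>\<theta>\<bar> / pi * (real d * U) \<le> sin (\<bar>\<theta>\<bar> / 2) * (real d * U)" using U0 by (intro mult_right_mono) auto
      also have "\<dots> \<le> 1" unfolding eq by simp
      finally have "2 * \<phi> * U \<le> pi" by (simp add: \<phi>_def field_simps)
      moreover have "2 * pi * U \<le> 2 * \<phi> * U" using True U0 by (intro mult_right_mono) auto
      ultimately have "pi * (2 * U) \<le> pi * 1" by (simp only: mult_ac mult_1_right)
      then have "2 * U \<le> 1" by (simp only: mult_le_cancel_left_pos pi_gt_zero)
      then show ?thesis by (simp add: U_def \<kappa>_def)
    next
      case False
      have \<phi>0: "0 < \<phi>" using \<phi> d1 by linarith
      have sp: "0 < sin (\<phi> / 2)" using False \<phi>0 by (intro sin_gt_zero) auto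
      have cp: "0 \<le> cos (\<phi> / 2)" using False \<phi>0 by (intro cos_ge_zero) auto
      have "2 / real d * sin (\<phi> / 2) \<le> sin (2 / real d * (\<phi> / 2))" using False \<phi>0 d by (intro sin_mult_ge) auto
      also have "2 / real d * (\<phi> / 2) = \<bar>\<theta>\<bar> / 2" using d by (simp add: \<phi>_def)
      finally have "2 / real d * sin (\<phi> / 2) * (real d * U) \<le> \<bar>sin \<phi>\<bar>" using eq U0 mult_right_mono[of "2 / real d * sin (\<phi> / 2)" "sin (\<bar>\<theta>\<bar> / 2)" "real d * U"] by simp
      also have "\<bar>sin \<phi>\<bar> = 2 * sin (\<phi> / 2) * cos (\<phi> / 2)" using sin_double[of "\<phi> / 2"] sp cp by (simp add: abs_mult)
      finally have "(2 * sin (\<phi> / 2)) * U \<le> (2 * sin (\<phi> / 2)) * cos (\<phi> / 2)" using d by simp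
      then have "U \<le> cos (\<phi> / 2)" using sp by simp
      also have "\<dots> \<le> cos (\<delta>1 / 4)" using \<phi> False d1 by (intro cos_monotone_0_pi_le) auto
      finally show ?thesis by (simp add: U_def \<kappa>_def)
    qed
  qed
qed

lemma norm_unif_le:
  assumes d: "1 \<le> d" and b: "norm (unif d (\<i> * of_real \<theta>)) \<le> b"
  shows "norm (unif d (cpl t \<theta>)) \<le> b + (exp (\<bar>t\<bar> * real d) - 1)"
proof -
  have "norm (unif d (cpl t \<theta>) - unif d (\<i> * of_real \<theta>)) \<le> exp (\<bar>t\<bar> * real d) - 1"
    unfolding unif_def by (rule mgf_perturb) (use d in \<open>auto simp: abs_le_iff field_simps\<close>)
  then show ?thesis using b norm_triangle_sub[of "unif d (cpl t \<theta>)" "unif d (\<i> * of_real \<theta>)"] by linarith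
qed

lemma norm_unif_imaginary_le_1: "norm (unif d (\<i> * of_real \<theta>)) \<le> 1"
proof -
  have "norm (exp (\<i> * of_real \<theta> * (of_nat j - of_real \<mu>))) = 1" for j :: nat and \<mu> by simp
  then have "norm (\<Sum>j<d. exp (\<i> * of_real \<theta> * (of_nat j - of_real ((real d - 1) / 2)))) \<le> (\<Sum>j<d. 1)"
    by (intro sum_norm_le) simp
  then show ?thesis by (cases "d = 0") (simp_all add: unif_def mgf_def norm_divide divide_le_eq_1)
qed

lemma mgf_prod_unif:
  assumes K: "finite K" "\<And>k. k \<in> K \<Longrightarrow> 1 \<le> d k"
    and gf: "\<And>y :: complex. (\<Sum>w\<in>S. y ^ X w) = (\<Prod>k\<in>K. \<Sum>j<d k. y ^ j)"
  shows "mgf S X (\<Sum>k\<in>K. (real (d k) - 1) / 2) z = (\<Prod>k\<in>K. unif (d k) z)"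
proof -
  have "of_nat (card S) = (\<Prod>k\<in>K. of_nat (d k) :: complex)" using gf[of 1] by simp
  moreover have "exp (- z * of_real (\<Sum>k\<in>K. (real (d k) - 1) / 2)) = (\<Prod>k\<in>K. exp (- z * of_real ((real (d k) - 1) / 2)))"
    using K by (simp only: of_real_sum sum_distrib_left exp_sum)
  ultimately have "mgf S X (\<Sum>k\<in>K. (real (d k) - 1) / 2) z = (\<Prod>k\<in>K. exp (- z * of_real ((real (d k) - 1) / 2)) * (\<Sum>j<d k. exp z ^ j) / of_nat (d k))"
    unfolding mgf_exp gf by (simp only: prod.distrib prod_dividef)
  also have "\<dots> = (\<Prod>k\<in>K. unif (d k) z)" unfolding unif_def mgf_exp by simp
  finally show ?thesis .
qed

lemma sum_power_add: "(\<Sum>j<k + n. y ^ j) = (\<Sum>j<k. y ^ j) + y ^ k * (\<Sum>j<n. (y :: complex) ^ j)"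
  by (induction n) (simp_all add: algebra_simps power_add)

lemma sum_power_double: "(1 + y ^ k) * (\<Sum>j<k. y ^ j) = (\<Sum>j<2 * k. (y :: complex) ^ j)"
  using sum_power_add[of y k k] unfolding mult_2[of k] by (simp add: distrib_right)

text \<open>The factor \<open>1 + y ^ (k - 1)\<close> is paired with the geometric sum of length
  \<open>k - 1\<close>. What is left over is \<open>1 + y ^ 0 = 2\<close> and the sum of length
  \<open>m\<close>; the degrees 2, 4, ..., 2m - 2, m of type D appear.\<close>

lemma prod_D:
  assumes "1 \<le> m"
  shows "(\<Prod>k\<in>{1..m}. (1 + y ^ (k - 1)) * (\<Sum>j<k. y ^ j)) = 2 * ((\<Prod>k\<in>{1..<m}. \<Sum>j<2 * k. y ^ j) * (\<Sum>j<m. (y :: complex) ^ j))"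
  using assms
proof (induction m rule: dec_induct)
  case (step m)
  have "(\<Prod>k\<in>{1..Suc m}. (1 + y ^ (k - 1)) * (\<Sum>j<k. y ^ j)) = (\<Prod>k\<in>{1..m}. (1 + y ^ (k - 1)) * (\<Sum>j<k. y ^ j)) * ((1 + y ^ m) * (\<Sum>j<Suc m. y ^ j))"
    by simp
  also have "\<dots> = 2 * ((\<Prod>k\<in>{1..<m}. \<Sum>j<2 * k. y ^ j) * ((1 + y ^ m) * (\<Sum>j<m. y ^ j)) * (\<Sum>j<Suc m. y ^ j))"
    unfolding step.IH by (simp only: mult_ac)
  also have "(\<Prod>k\<in>{1..<m}. \<Sum>j<2 * k. y ^ j) * ((1 + y ^ m) * (\<Sum>j<m. y ^ j)) = (\<Prod>k\<in>{1..<Suc m}. \<Sum>j<2 * k. y ^ j)"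
    unfolding sum_power_double using step by (simp only: prod.atLeastLessThan_Suc)
  finally show ?case .
qed simp

text \<open>\<open>d\<close> lists the degrees of the Coxeter group. Bounds on them in terms of
  \<open>k\<close> and the rank are all that is kept, so that the three types need not be told apart
  afterwards.\<close>

definition inv_factors :: "(int \<Rightarrow> int) coxeter \<Rightarrow> (nat \<Rightarrow> nat) \<Rightarrow> bool" where
  "inv_factors V d \<longleftrightarrow> (\<forall>k\<in>{1..cox_rank V}. 2 \<le> d k \<and> k \<le> d k \<and> d k \<le> 2 * cox_rank V) \<and>
    (\<forall>z. mgf (carrier V) (cox_inv V) (\<Sum>k\<in>{1..cox_rank V}. (real (d k) - 1) / 2) z = (\<Prod>k\<in>{1..cox_rank V}. unif (d k) z))"

lemma inv_factors_ex:
  assumes "V \<in> classical_weyl_groups" shows "\<exists>d. inv_factors V d"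
proof -
  consider (A) m where "V = weyl_A m" "1 \<le> m" | (B) m where "V = weyl_B m" "1 \<le> m" | (D) m where "V = weyl_D m" "3 \<le> m"
    using assms by (auto simp: classical_weyl_groups_def)
  then show ?thesis
  proof cases
    case (A m)
    have "(\<Sum>w\<in>carrier V. y ^ cox_inv V w) = (\<Prod>k\<in>{1..m}. \<Sum>j<k + 1. y ^ j)" for y :: complex
    proof -
      have "(\<Prod>k\<in>{1..m + 1}. \<Sum>j<k. y ^ j) = (\<Sum>j<1. y ^ j) * (\<Prod>k\<in>{Suc 1..Suc m}. \<Sum>j<k. y ^ j)"
        by (simp add: prod.atLeast_Suc_atMost)
      also have "\<dots> = (\<Prod>k\<in>{1..m}. \<Sum>j<k + 1. y ^ j)" unfolding prod.shift_bounds_cl_Suc_ivl by simp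
      finally show ?thesis using sum_inv_A[where y = y and m = m] A by simp
    qed
    then have "mgf (carrier V) (cox_inv V) (\<Sum>k\<in>{1..m}. (real (k + 1) - 1) / 2) z = (\<Prod>k\<in>{1..m}. unif (k + 1) z)" for z
      by (intro mgf_prod_unif) auto
    then show ?thesis using A by (intro exI[of _ "\<lambda>k. k + 1"]) (auto simp: inv_factors_def cox_rank_weyl_A)
  next
    case (B m)
    have "(\<Sum>w\<in>carrier V. y ^ cox_inv V w) = (\<Prod>k\<in>{1..m}. \<Sum>j<2 * k. y ^ j)" for y :: complex
      using sum_inv_B[where y = y and m = m] B by (simp add: sum_power_double)
    then have "mgf (carrier V) (cox_inv V) (\<Sum>k\<in>{1..m}. (real (2 * k) - 1) / 2) z = (\<Prod>k\<in>{1..m}. unif (2 * k) z)" for z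
      by (intro mgf_prod_unif) auto
    then show ?thesis using B by (intro exI[of _ "\<lambda>k. 2 * k"]) (auto simp: inv_factors_def cox_rank_weyl_B)
  next
    case (D m)
    define d where "d k = (if k < m then 2 * k else m)" for k
    have "(\<Sum>w\<in>carrier V. y ^ cox_inv V w) = (\<Prod>k\<in>{1..m}. \<Sum>j<d k. y ^ j)" for y :: complex
    proof -
      have "{1..m} = insert m {1..<m}" using D by auto
      then have "(\<Prod>k\<in>{1..m}. \<Sum>j<d k. y ^ j) = (\<Prod>k\<in>{1..<m}. \<Sum>j<2 * k. y ^ j) * (\<Sum>j<m. y ^ j)" by (simp add: d_def mult.commute)
      moreover have "2 * (\<Sum>w\<in>carrier V. y ^ cox_inv V w) = 2 * ((\<Prod>k\<in>{1..<m}. \<Sum>j<2 * k. y ^ j) * (\<Sum>j<m. y ^ j))"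
        using sum_inv_D[where y = y and m = m] D prod_D[of m y] by simp
      ultimately show ?thesis by simp
    qed
    then have "mgf (carrier V) (cox_inv V) (\<Sum>k\<in>{1..m}. (real (d k) - 1) / 2) z = (\<Prod>k\<in>{1..m}. unif (d k) z)" for z
      using D by (intro mgf_prod_unif) (auto simp: d_def)
    then show ?thesis using D by (intro exI[of _ d]) (auto simp: inv_factors_def cox_rank_weyl_D d_def)
  qed
qed

definition inv_degs :: "(int \<Rightarrow> int) coxeter \<Rightarrow> nat \<Rightarrow> nat" where
  "inv_degs V = (SOME d. inv_factors V d)"

lemma inv_factors_degs: "V \<in> classical_weyl_groups \<Longrightarrow> inv_factors V (inv_degs V)"
  unfolding inv_degs_def using inv_factors_ex by (rule someI_ex)

section \<open>Products of components\<close>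

text \<open>The coordinates of a uniform element of a product are independent.\<close>

lemma mgf_PiE:
  assumes I: "finite I" "\<And>i. i \<in> I \<Longrightarrow> finite (A i)"
    and X: "\<And>w. w \<in> PiE I A \<Longrightarrow> X w = (\<Sum>i\<in>I. Y i (w i))"
  shows "mgf (PiE I A) X (\<Sum>i\<in>I. \<mu> i) z = (\<Prod>i\<in>I. mgf (A i) (Y i) (\<mu> i) z)"
proof -
  have "exp (z * (of_nat (X w) - of_real (\<Sum>i\<in>I. \<mu> i))) = (\<Prod>i\<in>I. exp (z * (of_nat (Y i (w i)) - of_real (\<mu> i))))" if "w \<in> PiE I A" for w
    unfolding X[OF that] of_nat_sum of_real_sum sum_subtractf[symmetric] sum_distrib_left by (rule exp_sum[OF I(1)])
  then have "(\<Sum>w\<in>PiE I A. exp (z * (of_nat (X w) - of_real (\<Sum>i\<in>I. \<mu> i)))) = (\<Sum>w\<in>PiE I A. \<Prod>i\<in>I. exp (z * (of_nat (Y i (w i)) - of_real (\<mu> i))))"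
    by (intro sum.cong refl)
  also have "\<dots> = (\<Prod>i\<in>I. \<Sum>v\<in>A i. exp (z * (of_nat (Y i v) - of_real (\<mu> i))))"
    by (rule prod_sum_PiE[symmetric, OF I])
  finally show ?thesis unfolding mgf_def prod_dividef card_PiE[OF I(1)] of_nat_prod by (rule arg_cong2[where f = "(/)"]) (rule refl)
qed

lemma classical_cases:
  assumes "V \<in> classical_weyl_groups"
  obtains (A) m where "V = weyl_A m" "1 \<le> m" "cox_rank V = m" | (B) m where "V = weyl_B m" "1 \<le> m" "cox_rank V = m"
    | (D) m where "V = weyl_D m" "3 \<le> m" "cox_rank V = m"
  using assms by (auto simp: classical_weyl_groups_def cox_rank_weyl_A cox_rank_weyl_B cox_rank_weyl_D)

lemma root_action_classical:
  assumes "V \<in> classical_weyl_groups"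
  shows "\<exists>P S. root_action V pact converse prefl P S \<and> S \<noteq> {}"
  using assms
proof (cases rule: classical_cases)
  case (A m)
  have "simpleA m \<noteq> {}" using A by (simp add: simpleA_def)
  then show ?thesis using root_action_weyl_A A by blast
next
  case (B m)
  have "simpleB m \<noteq> {}" by (simp add: simpleB_def)
  then show ?thesis using root_action_weyl_B B by blast
next
  case (D m)
  have "simpleD m \<noteq> {}" by (simp add: simpleD_def)
  moreover have "2 \<le> m" using D by simp
  ultimately show ?thesis using root_action_weyl_D D(1) by blast
qed

lemma card_classical:
  assumes "V \<in> classical_weyl_groups" shows "card (carrier V) \<noteq> 0"
  using assms
proof (cases rule: classical_cases)
  case (D m)
  then have "2 * card (carrier V) = 2 ^ m * fact m" using card_weyl_D[of m] by simp
  then show ?thesis by (metis fact_nonzero mult_eq_0_iff power_not_zero zero_neq_numeral)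
qed (simp_all add: card_weyl_A card_weyl_B del: fact_Suc)

lemma finite_classical: "V \<in> classical_weyl_groups \<Longrightarrow> finite (carrier V)"
  using card_classical card.infinite by blast

lemma finite_cox_prod:
  assumes "finite I" "\<And>i. i \<in> I \<Longrightarrow> V i \<in> classical_weyl_groups"
  shows "finite (carrier (cox_prod I V))" "carrier (cox_prod I V) \<noteq> {}"
proof -
  show "finite (carrier (cox_prod I V))" unfolding cox_prod_simps using assms finite_classical by (intro finite_PiE) auto
  have "carrier (V i) \<noteq> {}" if "i \<in> I" for i using card_classical[OF assms(2)[OF that]] by auto
  then show "carrier (cox_prod I V) \<noteq> {}" unfolding cox_prod_simps by (simp add: PiE_eq_empty_iff)
qed

lemma mgf_cox_prod:
  assumes I: "finite I" "\<And>i. i \<in> I \<Longrightarrow> V i \<in> classical_weyl_groups"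
  shows "mgf (carrier (cox_prod I V)) (cox_des (cox_prod I V)) (\<Sum>i\<in>I. \<mu> i) z = (\<Prod>i\<in>I. mgf (carrier (V i)) (cox_des (V i)) (\<mu> i) z)"
    "mgf (carrier (cox_prod I V)) (cox_inv (cox_prod I V)) (\<Sum>i\<in>I. \<mu> i) z = (\<Prod>i\<in>I. mgf (carrier (V i)) (cox_inv (V i)) (\<mu> i) z)"
proof -
  have "\<exists>P S. \<forall>i\<in>I. root_action (V i) pact converse prefl (P i) (S i)"
    using root_action_classical[OF I(2)] by metis
  then obtain P S where ra: "\<And>i. i \<in> I \<Longrightarrow> root_action (V i) pact converse prefl (P i) (S i)" by blast
  have c: "carrier (cox_prod I V) = PiE I (\<lambda>i. carrier (V i))" by (simp add: cox_prod_simps)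
  show "mgf (carrier (cox_prod I V)) (cox_des (cox_prod I V)) (\<Sum>i\<in>I. \<mu> i) z = (\<Prod>i\<in>I. mgf (carrier (V i)) (cox_des (V i)) (\<mu> i) z)"
    unfolding c
  proof (rule mgf_PiE[OF I(1)])
    show "cox_des (cox_prod I V) w = (\<Sum>i\<in>I. cox_des (V i) (w i))" if "w \<in> PiE I (\<lambda>i. carrier (V i))" for w
      by (rule cox_des_cox_prod[OF I(1) ra]) (use that c in simp_all)
  qed (use I finite_classical in simp)
  show "mgf (carrier (cox_prod I V)) (cox_inv (cox_prod I V)) (\<Sum>i\<in>I. \<mu> i) z = (\<Prod>i\<in>I. mgf (carrier (V i)) (cox_inv (V i)) (\<mu> i) z)"
    unfolding c
  proof (rule mgf_PiE[OF I(1)])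
    show "cox_inv (cox_prod I V) w = (\<Sum>i\<in>I. cox_inv (V i) (w i))" if "w \<in> PiE I (\<lambda>i. carrier (V i))" for w
      by (rule cox_inv_cox_prod[OF I(1) ra]) (use that c in simp_all)
  qed (use I finite_classical in simp)
qed

section \<open>Descents in products\<close>

abbreviation gdev :: "(complex \<Rightarrow> complex) \<Rightarrow> real \<Rightarrow> complex \<Rightarrow> real" where
  "gdev F v z \<equiv> norm (F z * exp (- of_real v * z\<^sup>2 / 2) - 1)"

lemma gdev_prod:
  assumes "finite I" "\<And>i. i \<in> I \<Longrightarrow> gdev (F i) (v i) z \<le> exp (e i) - 1"
  shows "gdev (\<lambda>z. \<Prod>i\<in>I. F i z) (\<Sum>i\<in>I. v i) z \<le> exp (\<Sum>i\<in>I. e i) - 1"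
proof -
  have "(\<Prod>i\<in>I. exp (- of_real (v i) * z\<^sup>2 / 2)) = exp (\<Sum>i\<in>I. - of_real (v i) * z\<^sup>2 / 2)" by (rule exp_sum[OF assms(1), symmetric])
  also have "(\<Sum>i\<in>I. - of_real (v i) * z\<^sup>2 / 2) = - of_real (\<Sum>i\<in>I. v i) * z\<^sup>2 / 2" by (simp add: sum_negf sum_distrib_right sum_divide_distrib)
  finally have "(\<Prod>i\<in>I. F i z) * exp (- of_real (\<Sum>i\<in>I. v i) * z\<^sup>2 / 2) = (\<Prod>i\<in>I. F i z * exp (- of_real (v i) * z\<^sup>2 / 2))"
    by (simp only: prod.distrib)
  then show ?thesis using prod_dev[OF assms] by simp
qed

text \<open>\<open>v\<close> plays the part of the variance; afterwards only its linear order of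
  magnitude in the rank matters.\<close>

definition des_var :: "(int \<Rightarrow> int) coxeter \<Rightarrow> real \<Rightarrow> real \<Rightarrow> bool" where
  "des_var V C v \<longleftrightarrow> real (cox_rank V) / 12 \<le> v \<and> v \<le> real (cox_rank V) \<and>
    (\<forall>z. norm z \<le> 1 \<longrightarrow> gdev (mgf (carrier V) (cox_des V) (real (cox_rank V) / 2)) v z \<le> exp (C * real (cox_rank V) * norm z ^ 4) - 1)"

lemma des_near: "\<exists>C\<ge>0. \<forall>V\<in>classical_weyl_groups. \<exists>v. des_var V C v"
proof -
  obtain CA where CA: "CA \<ge> 0" "\<And>n z. n \<ge> 2 \<Longrightarrow> norm z \<le> 1 \<Longrightarrow> gdev (fA n) (real (n + 1) / 12) z \<le> exp (CA * real n * norm z ^ 4) - 1" using A.f_dev by blast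
  obtain CB where CB: "CB \<ge> 0" "\<And>n z. n \<ge> 2 \<Longrightarrow> norm z \<le> 1 \<Longrightarrow> gdev (fB n) (real (n + 1) / 12) z \<le> exp (CB * real n * norm z ^ 4) - 1" using B.f_dev by blast
  obtain CD where CD: "CD \<ge> 0" "\<And>n z. n \<ge> 3 \<Longrightarrow> norm z \<le> 1 \<Longrightarrow> gdev (\<lambda>z. 2 * fB n z - fA (n - 1) z) (real (n + 2) / 12) z \<le> exp (CD * real n * norm z ^ 4) - 1" using D_dev by blast
  \<comment> \<open>Type A of rank \<open>m\<close> uses \<open>fA\<close> at the index
    \<open>m + 1 \<le> 2 * m\<close>, whence the factor 2.\<close>
  define C where "C = 2 * CA + CB + CD"
  have le: "C' * k * r ^ 4 \<le> C * m * r ^ 4" if "C' * k \<le> C * m" for C' k m r :: real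
    using that by (intro mult_right_mono) auto
  have "\<exists>v. des_var V C v" if V: "V \<in> classical_weyl_groups" for V
    using V
  proof (cases rule: classical_cases)
    case (A m)
    have r: "CA * real (m + 1) \<le> C * real m"
    proof -
      have "CA * real (m + 1) \<le> CA * (2 * real m)" using A CA by (intro mult_left_mono) auto
      also have "\<dots> \<le> C * real m" using CA CB CD by (simp add: C_def algebra_simps)
      finally show ?thesis .
    qed
    have "gdev (fA (m + 1)) (real (m + 2) / 12) z \<le> exp (C * real m * norm z ^ 4) - 1" if "norm z \<le> 1" for z
      using dev_mono[OF CA(2)[of "m + 1" z] le[OF r]] that A by (simp add: add.commute)
    then show ?thesis using A mgf_des_A[of m] by (intro exI[of _ "real (m + 2) / 12"]) (auto simp: des_var_def)
  next
    case (B m)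
    show ?thesis
    proof (cases "m = 1")
      case True
      have r: "CA * real 2 \<le> C * real m" using True CA CB CD by (simp add: C_def)
      have "gdev (fB 1) (3 / 12) z \<le> exp (C * real m * norm z ^ 4) - 1" if "norm z \<le> 1" for z
        using dev_mono[OF CA(2)[of 2 z] le[OF r]] that by (simp add: fB_1[unfolded One_nat_def])
      then show ?thesis using B True mgf_des_B[of 1] by (intro exI[of _ "3 / 12"]) (auto simp: des_var_def)
    next
      case False
      have r: "CB * real m \<le> C * real m" using CA CB CD by (intro mult_right_mono) (auto simp: C_def)
      have "gdev (fB m) (real (m + 1) / 12) z \<le> exp (C * real m * norm z ^ 4) - 1" if "norm z \<le> 1" for z
        using dev_mono[OF CB(2)[of m z] le[OF r]] that B False by simp
      then show ?thesis using B mgf_des_B[of m] by (intro exI[of _ "real (m + 1) / 12"]) (auto simp: des_var_def)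
    qed
  next
    case (D m)
    have r: "CD * real m \<le> C * real m" using CA CB CD by (intro mult_right_mono) (auto simp: C_def)
    have "gdev (\<lambda>z. 2 * fB m z - fA (m - 1) z) (real (m + 2) / 12) z \<le> exp (C * real m * norm z ^ 4) - 1" if "norm z \<le> 1" for z
      using dev_mono[OF CD(2)[of m z] le[OF r]] that D by simp
    then show ?thesis using D mgf_des_D[of m] by (intro exI[of _ "real (m + 2) / 12"]) (auto simp: des_var_def)
  qed
  then show ?thesis using CA CB CD by (intro exI[of _ C]) (auto simp: C_def)
qed

definition far :: "(complex \<Rightarrow> complex) \<Rightarrow> real \<Rightarrow> real \<Rightarrow> real \<Rightarrow> bool" where
  "far F \<delta> \<eta> c \<longleftrightarrow> (\<forall>t \<theta>. \<bar>t\<bar> \<le> \<eta> \<longrightarrow> \<delta> \<le> \<bar>\<theta>\<bar> \<longrightarrow> \<bar>\<theta>\<bar> \<le> pi \<longrightarrow> norm (F (cpl t \<theta>)) \<le> exp (- c))"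

lemma far_mono:
  assumes "far F \<delta> \<eta> c" "\<eta>' \<le> \<eta>" "c' \<le> c" shows "far F \<delta> \<eta>' c'"
  unfolding far_def
proof (intro allI impI)
  fix t \<theta> assume "\<bar>t\<bar> \<le> \<eta>'" "\<delta> \<le> \<bar>\<theta>\<bar>" "\<bar>\<theta>\<bar> \<le> pi"
  then have "norm (F (cpl t \<theta>)) \<le> exp (- c)" using assms unfolding far_def by (meson order_trans)
  also have "\<dots> \<le> exp (- c')" using assms by simp
  finally show "norm (F (cpl t \<theta>)) \<le> exp (- c')" .
qed

lemma far_prod:
  assumes "finite I" "\<And>i. i \<in> I \<Longrightarrow> far (F i) \<delta> \<eta> (c i)" shows "far (\<lambda>z. \<Prod>i\<in>I. F i z) \<delta> \<eta> (\<Sum>i\<in>I. c i)"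
  unfolding far_def
proof (intro allI impI)
  fix t \<theta> assume "\<bar>t\<bar> \<le> \<eta>" "\<delta> \<le> \<bar>\<theta>\<bar>" "\<bar>\<theta>\<bar> \<le> pi"
  then have "norm (\<Prod>i\<in>I. F i (cpl t \<theta>)) \<le> (\<Prod>i\<in>I. exp (- c i))"
    unfolding prod_norm[symmetric] using assms by (intro prod_mono) (auto simp: far_def)
  then show "norm (\<Prod>i\<in>I. F i (cpl t \<theta>)) \<le> exp (- (\<Sum>i\<in>I. c i))" using assms by (simp add: exp_sum sum_negf[symmetric])
qed

abbreviation desF :: "(int \<Rightarrow> int) coxeter \<Rightarrow> complex \<Rightarrow> complex" where
  "desF V \<equiv> mgf (carrier V) (cox_des V) (real (cox_rank V) / 2)"

lemma des_far_single:
  assumes V: "V \<in> classical_weyl_groups" and \<delta>: "0 < \<delta>" shows "\<exists>c>0. \<exists>\<eta>>0. far (desF V) \<delta> \<eta> c"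
proof -
  obtain P S where ra: "root_action V pact converse prefl P S" "S \<noteq> {}" using root_action_classical[OF V] by blast
  then obtain \<alpha> where \<alpha>: "\<alpha> \<in> S" by auto
  interpret root_action V pact converse prefl P S by (rule ra)
  have "prefl \<alpha> \<in> carrier V" using \<alpha> S_P refl_carrier by auto
  from small_far[where X = "cox_des V" and \<mu> = "real (cox_rank V) / 2", OF finite_classical[OF V] one_closed this cox_des_one cox_des_gen[OF \<alpha>] \<delta>]
  show ?thesis unfolding far_def .
qed

lemma far_finite:
  assumes "finite K" "\<And>k. k \<in> K \<Longrightarrow> \<exists>c>0. \<exists>\<eta>>0. far (F k) \<delta> \<eta> c"
  shows "\<exists>c>0. \<exists>\<eta>>0. \<forall>k\<in>K. far (F k) \<delta> \<eta> c"
  using assms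
proof (induction K rule: finite_induct)
  case empty
  then show ?case using zero_less_one by blast
next
  case (insert k K)
  obtain c \<eta> where 1: "c > 0" "\<eta> > 0" "\<forall>k\<in>K. far (F k) \<delta> \<eta> c" using insert by auto
  obtain c' \<eta>' where 2: "c' > 0" "\<eta>' > 0" "far (F k) \<delta> \<eta>' c'" using insert.prems[of k] by auto
  have "\<forall>j\<in>insert k K. far (F j) \<delta> (min \<eta> \<eta>') (min c c')"
    using 1 2 far_mono[of _ _ _ _ "min \<eta> \<eta>'" "min c c'"] by (metis insert_iff min.cobounded1 min.cobounded2)
  moreover have "min c c' > 0" "min \<eta> \<eta>' > 0" using 1 2 by auto
  ultimately show ?case by blast
qed

text \<open>The triangle inequality for \<open>2 * fB m - fA (m - 1)\<close> costs a factor 3, which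
  is paid for with half of the decay rate once \<open>m\<close> is large. The remaining
  \<open>m\<close> are finitely many and fall to \<open>des_far_single\<close>.\<close>

lemma des_far_D:
  assumes \<delta>: "0 < \<delta>" shows "\<exists>c>0. \<exists>\<eta>>0. \<forall>m\<ge>3. far (desF (weyl_D m)) \<delta> \<eta> (c * real m)"
proof -
  obtain cA \<eta>A where A: "cA > 0" "\<eta>A > 0" "\<And>n t \<theta>. n \<ge> 2 \<Longrightarrow> \<bar>t\<bar> \<le> \<eta>A \<Longrightarrow> \<delta> \<le> \<bar>\<theta>\<bar> \<Longrightarrow> \<bar>\<theta>\<bar> \<le> pi \<Longrightarrow> norm (fA n (cpl t \<theta>)) \<le> exp (- cA * real n)"
    using A.f_far[OF \<delta>] by blast
  obtain cB \<eta>B where B: "cB > 0" "\<eta>B > 0" "\<And>n t \<theta>. n \<ge> 2 \<Longrightarrow> \<bar>t\<bar> \<le> \<eta>B \<Longrightarrow> \<delta> \<le> \<bar>\<theta>\<bar> \<Longrightarrow> \<bar>\<theta>\<bar> \<le> pi \<Longrightarrow> norm (fB n (cpl t \<theta>)) \<le> exp (- cB * real n)"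
    using B.f_far[OF \<delta>] by blast
  define c where "c = min cA cB"
  have c: "0 < c" "c \<le> cA" "c \<le> cB" using A B by (auto simp: c_def)
  \<comment> \<open>\<open>6 / c \<le> m\<close> gives \<open>c / 3 * m \<ge> 2\<close>, and then
    \<open>exp (c / 3 * m)\<close> is at least 3.\<close>
  define m0 where "m0 = 3 + nat \<lceil>6 / c\<rceil>"
  have big: "far (desF (weyl_D m)) \<delta> (min \<eta>A \<eta>B) (c / 3 * real m)" if m: "m0 \<le> m" for m
    unfolding far_def
  proof (intro allI impI)
    fix t \<theta> assume h: "\<bar>t\<bar> \<le> min \<eta>A \<eta>B" "\<delta> \<le> \<bar>\<theta>\<bar>" "\<bar>\<theta>\<bar> \<le> pi"
    have m3: "3 \<le> m" using m by (simp add: m0_def)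
    have "6 / c \<le> real m" using m unfolding m0_def by linarith
    then have m6: "2 \<le> c / 3 * real m" using c by (simp add: field_simps)
    have "norm (fA (m - 1) (cpl t \<theta>)) \<le> exp (- cA * real (m - 1))" using A(3)[of "m - 1"] h m3 by auto
    \<comment> \<open>The comparison of the exponents uses \<open>m - 1 \<ge> 2 / 3 * m\<close>,
      which is where \<open>m \<ge> 3\<close> enters.\<close>
    also have "c * (2 / 3 * real m) \<le> cA * real (m - 1)" using m3 c by (intro mult_mono) auto
    then have "exp (- cA * real (m - 1)) \<le> exp (- (2 * (c / 3 * real m)))" by simp
    finally have a: "norm (fA (m - 1) (cpl t \<theta>)) \<le> exp (- (2 * (c / 3 * real m)))" .
    have "norm (fB m (cpl t \<theta>)) \<le> exp (- cB * real m)" using B(3)[of m] h m3 by auto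
    also have "c * (2 / 3 * real m) \<le> cB * real m" using m3 c by (intro mult_mono) auto
    then have "exp (- cB * real m) \<le> exp (- (2 * (c / 3 * real m)))" by simp
    finally have b: "norm (fB m (cpl t \<theta>)) \<le> exp (- (2 * (c / 3 * real m)))" .
    have "norm (2 * fB m (cpl t \<theta>) - fA (m - 1) (cpl t \<theta>)) \<le> norm (2 * fB m (cpl t \<theta>)) + norm (fA (m - 1) (cpl t \<theta>))" by (rule norm_triangle_ineq4)
    also have "\<dots> \<le> 3 * exp (- (2 * (c / 3 * real m)))" using a b by (simp add: norm_mult)
    also have "\<dots> \<le> exp (c / 3 * real m) * exp (- (2 * (c / 3 * real m)))"
    proof (rule mult_right_mono)
      show "3 \<le> exp (c / 3 * real m)" using exp_ge_add_one_self[of "c / 3 * real m"] m6 by linarith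
    qed simp
    also have "\<dots> = exp (- (c / 3 * real m))" by (simp add: exp_add[symmetric])
    finally show "norm (desF (weyl_D m) (cpl t \<theta>)) \<le> exp (- (c / 3 * real m))"
      using mgf_des_D[of m] m3 by (simp add: cox_rank_weyl_D)
  qed
  have "\<exists>c>0. \<exists>\<eta>>0. \<forall>m\<in>{3..<m0}. far (desF (weyl_D m)) \<delta> \<eta> c"
    by (rule far_finite) (auto intro!: des_far_single \<delta> simp: classical_weyl_groups_def)
  then obtain c1 \<eta>1 where s: "c1 > 0" "\<eta>1 > 0" "\<And>m. m \<in> {3..<m0} \<Longrightarrow> far (desF (weyl_D m)) \<delta> \<eta>1 c1" by blast
  define c2 where "c2 = min (c / 3) (c1 / real m0)"
  have "m0 > 0" by (simp add: m0_def)
  then have c2: "0 < c2" "c2 \<le> c / 3" "c2 \<le> c1 / real m0" using c s unfolding c2_def by (simp, linarith+)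
  show ?thesis
  proof (rule exI[of _ c2], rule conjI[OF c2(1)], rule exI[of _ "min (min \<eta>A \<eta>B) \<eta>1"], intro conjI allI impI)
    show "0 < min (min \<eta>A \<eta>B) \<eta>1" using A B s by auto
    fix m :: nat assume m: "3 \<le> m"
    show "far (desF (weyl_D m)) \<delta> (min (min \<eta>A \<eta>B) \<eta>1) (c2 * real m)"
    proof (cases "m0 \<le> m")
      case True
      have "c2 * real m \<le> c / 3 * real m" using c2 by (intro mult_right_mono) auto
      then show ?thesis by (intro far_mono[OF big[OF True]]) auto
    next
      case False
      then have mm: "m \<in> {3..<m0}" using m by simp
      have "c2 * real m \<le> c1 / real m0 * real m0" using c2 False s by (intro mult_mono) auto
      then show ?thesis using \<open>m0 > 0\<close> by (intro far_mono[OF s(3)[OF mm]]) auto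
    qed
  qed
qed

lemma des_far:
  assumes \<delta>: "0 < \<delta>" shows "\<exists>c>0. \<exists>\<eta>>0. \<forall>V\<in>classical_weyl_groups. far (desF V) \<delta> \<eta> (c * real (cox_rank V))"
proof -
  obtain cA \<eta>A where A: "cA > 0" "\<eta>A > 0" "\<And>n t \<theta>. n \<ge> 2 \<Longrightarrow> \<bar>t\<bar> \<le> \<eta>A \<Longrightarrow> \<delta> \<le> \<bar>\<theta>\<bar> \<Longrightarrow> \<bar>\<theta>\<bar> \<le> pi \<Longrightarrow> norm (fA n (cpl t \<theta>)) \<le> exp (- cA * real n)"
    using A.f_far[OF \<delta>] by blast
  obtain cB \<eta>B where B: "cB > 0" "\<eta>B > 0" "\<And>n t \<theta>. n \<ge> 2 \<Longrightarrow> \<bar>t\<bar> \<le> \<eta>B \<Longrightarrow> \<delta> \<le> \<bar>\<theta>\<bar> \<Longrightarrow> \<bar>\<theta>\<bar> \<le> pi \<Longrightarrow> norm (fB n (cpl t \<theta>)) \<le> exp (- cB * real n)"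
    using B.f_far[OF \<delta>] by blast
  obtain cD \<eta>D where D0: "cD > 0" "\<eta>D > 0" "\<And>m. m \<ge> 3 \<Longrightarrow> far (desF (weyl_D m)) \<delta> \<eta>D (cD * real m)" using des_far_D[OF \<delta>] by blast
  define c \<eta> where "c = min (min cA cB) cD" and "\<eta> = min (min \<eta>A \<eta>B) \<eta>D"
  have c: "0 < c" "c \<le> cA" "c \<le> cB" "c \<le> cD" "0 < \<eta>" "\<eta> \<le> \<eta>A" "\<eta> \<le> \<eta>B" "\<eta> \<le> \<eta>D" using A B D0 by (auto simp: c_def \<eta>_def)
  have fA: "far (fA n) \<delta> \<eta>A (cA * real n)" if "2 \<le> n" for n using A(3) that unfolding far_def by auto
  have fB: "far (fB n) \<delta> \<eta>B (cB * real n)" if "2 \<le> n" for n using B(3) that unfolding far_def by auto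
  have "far (desF V) \<delta> \<eta> (c * real (cox_rank V))" if "V \<in> classical_weyl_groups" for V
    using that
  proof (cases rule: classical_cases)
    case (A m)
    have "desF V = fA (m + 1)" using A mgf_des_A[of m] by auto
    moreover have "c * real m \<le> cA * real (m + 1)" using c by (intro mult_mono) auto
    ultimately show ?thesis using A far_mono[OF fA[of "m + 1"] c(6)] by simp
  next
    case (B m)
    show ?thesis
    proof (cases "m = 1")
      case True
      have "desF V = fA 2" using B True mgf_des_B[of 1] by (auto simp: fB_1[unfolded One_nat_def])
      moreover have "c * real 1 \<le> cA * real 2" using c by (intro mult_mono) auto
      ultimately show ?thesis using B True far_mono[OF fA[of 2] c(6)] by simp
    next
      case False
      have "desF V = fB m" using B mgf_des_B[of m] by auto
      moreover have "c * real m \<le> cB * real m" using c by (intro mult_mono) auto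
      ultimately show ?thesis using B False far_mono[OF fB[of m] c(7)] by simp
    qed
  next
    case (D m)
    have "c * real m \<le> cD * real m" using c by (intro mult_mono) auto
    then show ?thesis using far_mono[OF D0(3)[of m] c(8)] D by simp
  qed
  then show ?thesis using c by blast
qed

lemma rank_ge_1: "V \<in> classical_weyl_groups \<Longrightarrow> 1 \<le> cox_rank V"
  by (erule classical_cases) auto

lemma sum_ranks_ge_1:
  assumes "finite I" "I \<noteq> {}" "\<And>i. i \<in> I \<Longrightarrow> V i \<in> classical_weyl_groups"
  shows "1 \<le> (\<Sum>i\<in>I. cox_rank (V i))"
proof -
  obtain i where i: "i \<in> I" using assms by auto
  have "1 \<le> cox_rank (V i)" using rank_ge_1 assms i by blast
  also have "\<dots> \<le> (\<Sum>i\<in>I. cox_rank (V i))" using assms i by (intro member_le_sum) auto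
  finally show ?thesis .
qed

text \<open>Every component is close to Gaussian on \<open>norm z \<le> 1\<close>, whatever its
  rank, so the scale is \<open>B = 1\<close>.\<close>

lemma des_setup:
  assumes I: "\<And>n. finite (I n)" "\<And>n. I n \<noteq> {}" "\<And>n i. i \<in> I n \<Longrightarrow> V n i \<in> classical_weyl_groups"
    and top: "filterlim (\<lambda>n. real (\<Sum>i\<in>I n. cox_rank (V n i))) at_top sequentially"
  shows "\<exists>\<mu> s B c C \<delta> D. tail_setup (\<lambda>n. carrier (cox_prod (I n) (V n))) (\<lambda>n. cox_des (cox_prod (I n) (V n))) \<mu> s
    (\<lambda>n. real (\<Sum>i\<in>I n. cox_rank (V n i))) B c C \<delta> D"
proof -
  define N where "N n = real (\<Sum>i\<in>I n. cox_rank (V n i))" for n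
  have N1: "1 \<le> N n" for n
  proof -
    have "1 \<le> (\<Sum>i\<in>I n. cox_rank (V n i))" using I by (intro sum_ranks_ge_1) auto
    then show ?thesis unfolding N_def by linarith
  qed
  obtain C where C: "C \<ge> 0" "\<And>V. V \<in> classical_weyl_groups \<Longrightarrow> \<exists>v. des_var V C v" using des_near by blast
  define \<sigma> where "\<sigma> V = (SOME v. des_var V C v)" for V
  have \<sigma>: "des_var V C (\<sigma> V)" if "V \<in> classical_weyl_groups" for V unfolding \<sigma>_def using someI_ex[OF C(2)[OF that]] .
  define s where "s n = sqrt (\<Sum>i\<in>I n. \<sigma> (V n i))" for n
  define \<mu> where "\<mu> n = (\<Sum>i\<in>I n. real (cox_rank (V n i)) / 2)" for n
  have F: "mgf (carrier (cox_prod (I n) (V n))) (cox_des (cox_prod (I n) (V n))) (\<mu> n) z = (\<Prod>i\<in>I n. desF (V n i) z)" for n z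
    unfolding \<mu>_def by (rule mgf_cox_prod(1)) (use I in auto)
  have lo: "N n / 12 \<le> (\<Sum>i\<in>I n. \<sigma> (V n i))" for n
    unfolding N_def of_nat_sum sum_divide_distrib using \<sigma> I(3) by (intro sum_mono) (auto simp: des_var_def)
  have hi: "(\<Sum>i\<in>I n. \<sigma> (V n i)) \<le> N n" for n
    unfolding N_def of_nat_sum using \<sigma> I(3) by (intro sum_mono) (auto simp: des_var_def)
  have s2: "(s n)\<^sup>2 = (\<Sum>i\<in>I n. \<sigma> (V n i))" for n unfolding s_def using lo[of n] N1[of n] by (intro real_sqrt_pow2) linarith
  have "tail_setup (\<lambda>n. carrier (cox_prod (I n) (V n))) (\<lambda>n. cox_des (cox_prod (I n) (V n))) \<mu> s N (\<lambda>_. 1) (sqrt (1 / 12)) C 1 1"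
  proof
    show "finite (carrier (cox_prod (I n) (V n)))" for n using finite_cox_prod(1)[OF I(1)] I(3) by blast
    show "0 < N n" for n using N1[of n] by linarith
    show "sqrt (1 / 12) * 1 * sqrt (N n) \<le> s n" for n
      unfolding s_def mult_1_right real_sqrt_mult[symmetric] using lo[of n] by simp
    show "s n \<le> 1 * (N n)\<^sup>2" for n
    proof -
      have "s n \<le> sqrt (N n)" unfolding s_def using hi[of n] by simp
      also have "sqrt (N n) \<le> sqrt ((N n)\<^sup>2)" using N1[of n] by (intro real_sqrt_le_mono self_le_power) auto
      also have "\<dots> = N n" using N1[of n] by simp
      also have "N n \<le> (N n)\<^sup>2" using N1[of n] by (intro self_le_power) auto
      finally show ?thesis by simp
    qed
    fix n and z :: complex assume "1 * norm z \<le> 1"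
    then have z: "norm z \<le> 1" by simp
    have "gdev (\<lambda>z. \<Prod>i\<in>I n. desF (V n i) z) (\<Sum>i\<in>I n. \<sigma> (V n i)) z \<le> exp (\<Sum>i\<in>I n. C * real (cox_rank (V n i)) * norm z ^ 4) - 1"
      by (rule gdev_prod[OF I(1)]) (use \<sigma> I(3) z in \<open>auto simp: des_var_def\<close>)
    also have "(\<Sum>i\<in>I n. C * real (cox_rank (V n i)) * norm z ^ 4) = C * N n * (1 * norm z) ^ 4"
      by (simp add: N_def sum_distrib_left sum_distrib_right)
    finally show "norm (mgf (carrier (cox_prod (I n) (V n))) (cox_des (cox_prod (I n) (V n))) (\<mu> n) z * exp (- (of_real (s n))\<^sup>2 * z\<^sup>2 / 2) - 1) \<le> exp (C * N n * (1 * norm z) ^ 4) - 1"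
      unfolding F of_real_power[symmetric] s2 .
  next
    fix \<epsilon> :: real assume "0 < \<epsilon>"
    from des_far[OF this] obtain c \<eta> where c: "c > 0" "\<eta> > 0" "\<And>V. V \<in> classical_weyl_groups \<Longrightarrow> far (desF V) \<epsilon> \<eta> (c * real (cox_rank V))" by blast
    have "far (\<lambda>z. \<Prod>i\<in>I n. desF (V n i) z) \<epsilon> \<eta> (c * N n)" for n
      unfolding N_def of_nat_sum sum_distrib_left by (rule far_prod[OF I(1)]) (use c I in auto)
    then have "\<forall>n t \<theta>. 0 \<le> t \<longrightarrow> 1 * t \<le> \<eta> \<longrightarrow> \<epsilon> \<le> 1 * \<bar>\<theta>\<bar> \<longrightarrow> \<bar>\<theta>\<bar> \<le> pi \<longrightarrow>
      norm (mgf (carrier (cox_prod (I n) (V n))) (cox_des (cox_prod (I n) (V n))) (\<mu> n) (cpl t \<theta>)) \<le> exp (- c * N n)"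
      unfolding F far_def by simp
    then show "\<exists>c' \<eta>. 0 < c' \<and> 0 < \<eta> \<and> (\<forall>n t \<theta>. 0 \<le> t \<longrightarrow> 1 * t \<le> \<eta> \<longrightarrow> \<epsilon> \<le> 1 * \<bar>\<theta>\<bar> \<longrightarrow> \<bar>\<theta>\<bar> \<le> pi \<longrightarrow>
      norm (mgf (carrier (cox_prod (I n) (V n))) (cox_des (cox_prod (I n) (V n))) (\<mu> n) (cpl t \<theta>)) \<le> exp (- c' * N n))"
      using c by blast
  qed (use C top N_def[abs_def] in auto)
  then show ?thesis unfolding N_def by blast
qed

section \<open>Inversions in products\<close>

lemma sum_squares_ge: "real m ^ 3 / 3 \<le> (\<Sum>k\<in>{1..m}. real k ^ 2)"
  by (induction m) (auto simp: power3_eq_cube power2_eq_square algebra_simps)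

abbreviation invF :: "(int \<Rightarrow> int) coxeter \<Rightarrow> complex \<Rightarrow> complex" where
  "invF V \<equiv> mgf (carrier V) (cox_inv V) (\<Sum>k\<in>{1..cox_rank V}. (real (inv_degs V k) - 1) / 2)"

definition inv_var :: "(int \<Rightarrow> int) coxeter \<Rightarrow> real" where
  "inv_var V = (\<Sum>k\<in>{1..cox_rank V}. (real (inv_degs V k) ^ 2 - 1) / 12)"

lemma inv_degs:
  assumes "V \<in> classical_weyl_groups"
  shows "k \<in> {1..cox_rank V} \<Longrightarrow> 2 \<le> inv_degs V k" "k \<in> {1..cox_rank V} \<Longrightarrow> k \<le> inv_degs V k"
    "k \<in> {1..cox_rank V} \<Longrightarrow> inv_degs V k \<le> 2 * cox_rank V"
    "invF V z = (\<Prod>k\<in>{1..cox_rank V}. unif (inv_degs V k) z)"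
  using inv_factors_degs[OF assms] by (auto simp: inv_factors_def)

text \<open>The degrees lie between \<open>k\<close> and twice the rank, so the variance is cubic in
  the rank. This is how the sum of the cubes of the ranks comes in.\<close>

lemma inv_var_bounds:
  assumes V: "V \<in> classical_weyl_groups" shows "real (cox_rank V) ^ 3 / 48 \<le> inv_var V" "inv_var V \<le> real (cox_rank V) ^ 3"
proof -
  have "real (cox_rank V) ^ 3 / 48 = (real (cox_rank V) ^ 3 / 3) / 16" by simp
  also have "\<dots> \<le> (\<Sum>k\<in>{1..cox_rank V}. real k ^ 2) / 16" using sum_squares_ge by (rule divide_right_mono) simp
  also have "\<dots> \<le> inv_var V" unfolding inv_var_def sum_divide_distrib
  proof (rule sum_mono)
    fix k assume k: "k \<in> {1..cox_rank V}"
    \<comment> \<open>For \<open>q \<ge> 4\<close>, subtracting 1 loses at most a quarter of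
      \<open>q\<close>.\<close>
    have aux: "p / 16 \<le> (q - 1) / 12" if "p \<le> q" "2 ^ 2 \<le> q" for p q :: real using that by simp
    have "real k ^ 2 \<le> real (inv_degs V k) ^ 2" using inv_degs(2)[OF V k] by (intro power_mono) auto
    moreover have "2 ^ 2 \<le> real (inv_degs V k) ^ 2" using inv_degs(1)[OF V k] by (intro power_mono) auto
    ultimately show "real k ^ 2 / 16 \<le> (real (inv_degs V k) ^ 2 - 1) / 12" by (rule aux)
  qed
  finally show "real (cox_rank V) ^ 3 / 48 \<le> inv_var V" .
  have "inv_var V \<le> (\<Sum>k\<in>{1..cox_rank V}. real (cox_rank V) ^ 2)" unfolding inv_var_def
  proof (rule sum_mono)
    fix k assume k: "k \<in> {1..cox_rank V}"
    have "real (inv_degs V k) ^ 2 \<le> (2 * real (cox_rank V)) ^ 2" using inv_degs(3)[OF V k] by (intro power_mono) auto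
    then have d: "real (inv_degs V k) ^ 2 \<le> 4 * real (cox_rank V) ^ 2" by (simp add: power_mult_distrib)
    have "(x - 1) / 12 \<le> q" if "x \<le> 4 * q" "0 \<le> q" for x q :: real using that by simp
    from this[OF d] show "(real (inv_degs V k) ^ 2 - 1) / 12 \<le> real (cox_rank V) ^ 2" by simp
  qed
  then show "inv_var V \<le> real (cox_rank V) ^ 3" by (simp add: power3_eq_cube power2_eq_square mult_ac)
qed

lemma inv_near: "\<exists>C\<ge>0. \<forall>V\<in>classical_weyl_groups. \<forall>B z. real (cox_rank V) \<le> B \<longrightarrow> B * norm z \<le> 1 / 2 \<longrightarrow>
  gdev (invF V) (inv_var V) z \<le> exp (C * real (cox_rank V) * (B * norm z) ^ 4) - 1"
proof -
  obtain C where C: "C \<ge> 0" "\<And>d z. 1 \<le> d \<Longrightarrow> real d * norm z \<le> 1 \<Longrightarrow> gdev (unif d) ((real d ^ 2 - 1) / 12) z \<le> exp (C * (real d * norm z) ^ 4) - 1"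
    using unif_dev by blast
  show ?thesis
  \<comment> \<open>The degrees reach twice the rank, and the error is quartic:
    \<open>16 = 2 ^ 4\<close>.\<close>
  proof (intro exI[of _ "16 * C"] conjI ballI allI impI)
    fix V B and z :: complex assume V: "V \<in> classical_weyl_groups" and B: "real (cox_rank V) \<le> B" "B * norm z \<le> 1 / 2"
    have d: "real (inv_degs V k) * norm z \<le> 2 * (B * norm z)" if k: "k \<in> {1..cox_rank V}" for k
    proof -
      have "real (inv_degs V k) \<le> 2 * B" using inv_degs(3)[OF V k] B by linarith
      then have "real (inv_degs V k) * norm z \<le> 2 * B * norm z" by (rule mult_right_mono) simp
      then show ?thesis by simp
    qed
    have "gdev (\<lambda>z. \<Prod>k\<in>{1..cox_rank V}. unif (inv_degs V k) z) (inv_var V) z \<le> exp (\<Sum>k\<in>{1..cox_rank V}. 16 * C * (B * norm z) ^ 4) - 1"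
      unfolding inv_var_def
    proof (rule gdev_prod)
      fix k assume k: "k \<in> {1..cox_rank V}"
      have "gdev (unif (inv_degs V k)) ((real (inv_degs V k) ^ 2 - 1) / 12) z \<le> exp (C * (real (inv_degs V k) * norm z) ^ 4) - 1"
        using inv_degs(1)[OF V k] d[OF k] B by (intro C) auto
      moreover have "C * (real (inv_degs V k) * norm z) ^ 4 \<le> C * (2 * (B * norm z)) ^ 4" using d[OF k] C by (intro mult_left_mono power_mono) auto
      then have "C * (real (inv_degs V k) * norm z) ^ 4 \<le> 16 * C * (B * norm z) ^ 4" by (simp add: power_mult_distrib)
      ultimately show "gdev (unif (inv_degs V k)) ((real (inv_degs V k) ^ 2 - 1) / 12) z \<le> exp (16 * C * (B * norm z) ^ 4) - 1" by (rule dev_mono)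
    qed simp
    then show "gdev (invF V) (inv_var V) z \<le> exp (16 * C * real (cox_rank V) * (B * norm z) ^ 4) - 1"
      unfolding inv_degs(4)[OF V] by (simp add: mult_ac)
  qed (use C in simp)
qed

text \<open>The weight \<open>k\<^sup>2 / B\<^sup>2 - \<kappa>0\<^sup>2\<close> is at most the indicator of \<open>\<kappa>0 * B \<le> k\<close>. It replaces a count of the large degrees.\<close>

lemma unif_factor_bound:
  assumes \<kappa>: "0 < \<kappa>" "\<And>\<theta>. \<delta> \<le> real d * \<bar>\<theta>\<bar> \<Longrightarrow> \<bar>\<theta>\<bar> \<le> pi \<Longrightarrow> norm (unif d (\<i> * of_real \<theta>)) \<le> 1 - 2 * \<kappa>"
    and \<eta>: "exp (2 * \<eta>) \<le> 1 + \<kappa>" and d: "1 \<le> d" "k \<le> d" "real d \<le> 2 * B" and k: "real k \<le> B" and B: "0 < B" and \<kappa>0: "0 < \<kappa>0"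
    and t: "0 \<le> t" "B * t \<le> \<eta>" and \<theta>: "\<delta> \<le> \<kappa>0 * (B * \<bar>\<theta>\<bar>)" "\<bar>\<theta>\<bar> \<le> pi"
  shows "norm (unif d (cpl t \<theta>)) \<le> exp (2 * (B * t) - \<kappa> * (real k ^ 2 / B\<^sup>2 - \<kappa>0\<^sup>2))"
proof -
  have "t * real d \<le> t * (2 * B)" using t d by (intro mult_left_mono) auto
  then have td: "exp (\<bar>t\<bar> * real d) \<le> exp (2 * (B * t))" using t by (simp add: mult_ac)
  show ?thesis
  proof (cases "\<kappa>0 * B \<le> real k")
    case True
    have "\<kappa>0 * B * \<bar>\<theta>\<bar> \<le> real d * \<bar>\<theta>\<bar>" using True d by (intro mult_right_mono) auto
    then have "norm (unif d (\<i> * of_real \<theta>)) \<le> 1 - 2 * \<kappa>" using \<theta> by (intro \<kappa>) (auto simp: mult_ac)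
    from norm_unif_le[OF d(1) this, of t] have "norm (unif d (cpl t \<theta>)) \<le> exp (2 * (B * t)) - 2 * \<kappa>" using td by linarith
    also have "exp (2 * (B * t)) \<le> exp (2 * \<eta>)" using t by simp
    also have "exp (2 * \<eta>) - 2 * \<kappa> \<le> 1 - \<kappa>" using \<eta> by simp
    also have "\<dots> \<le> exp (- \<kappa>)" using exp_ge_add_one_self[of "- \<kappa>"] by simp
    also have "\<dots> \<le> exp (2 * (B * t) - \<kappa> * (real k ^ 2 / B\<^sup>2 - \<kappa>0\<^sup>2))"
    proof -
      have "real k ^ 2 \<le> B\<^sup>2" using k by (intro power_mono) auto
      then have "real k ^ 2 / B\<^sup>2 - \<kappa>0\<^sup>2 \<le> 1" using B \<kappa>0 zero_le_power2[of \<kappa>0] divide_le_eq_1_pos[of "B\<^sup>2" "real k ^ 2"] zero_less_power[OF B, of 2] by linarith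
      then have "\<kappa> * (real k ^ 2 / B\<^sup>2 - \<kappa>0\<^sup>2) \<le> \<kappa> * 1" using \<kappa> by (intro mult_left_mono) auto
      moreover have "0 \<le> B * t" using B t by simp
      ultimately show ?thesis by simp
    qed
    finally show ?thesis by simp
  next
    case False
    from norm_unif_le[OF d(1) norm_unif_imaginary_le_1, of t \<theta>] have "norm (unif d (cpl t \<theta>)) \<le> exp (2 * (B * t))" using td by linarith
    also have "\<dots> \<le> exp (2 * (B * t) - \<kappa> * (real k ^ 2 / B\<^sup>2 - \<kappa>0\<^sup>2))"
    proof -
      have "real k ^ 2 \<le> (\<kappa>0 * B)\<^sup>2" using False by (intro power_mono) auto
      then have "real k ^ 2 / B\<^sup>2 - \<kappa>0\<^sup>2 \<le> 0" using B by (simp add: divide_le_eq power_mult_distrib)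
      then have "\<kappa> * (real k ^ 2 / B\<^sup>2 - \<kappa>0\<^sup>2) \<le> 0" using \<kappa> by (intro mult_nonneg_nonpos) auto
      then show ?thesis by simp
    qed
    finally show ?thesis .
  qed
qed

text \<open>Summed over the degrees of a component of rank \<open>r\<close>, the weights of
  \<open>unif_factor_bound\<close> give a gain proportional to \<open>r ^ 3 / B ^ 2\<close> and
  losses proportional to \<open>r\<close>. A component of small rank may show no decay by itself,
  but both quantities can be added up over the components.\<close>

lemma inv_far:
  assumes \<delta>: "0 < \<delta>" and \<kappa>0: "0 < \<kappa>0"
  shows "\<exists>\<kappa>>0. \<exists>\<eta>>0. \<forall>V\<in>classical_weyl_groups. \<forall>B t \<theta>. real (cox_rank V) \<le> B \<longrightarrow> 0 \<le> t \<longrightarrow> B * t \<le> \<eta> \<longrightarrow>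
    \<delta> \<le> \<kappa>0 * (B * \<bar>\<theta>\<bar>) \<longrightarrow> \<bar>\<theta>\<bar> \<le> pi \<longrightarrow>
    norm (invF V (cpl t \<theta>)) \<le> exp (2 * (B * t) * real (cox_rank V) - \<kappa> * (real (cox_rank V) ^ 3 / (3 * B\<^sup>2) - \<kappa>0\<^sup>2 * real (cox_rank V)))"
proof -
  obtain \<kappa>1 where \<kappa>1: "\<kappa>1 > 0" "\<And>d \<theta>. 2 \<le> d \<Longrightarrow> \<delta> \<le> real d * \<bar>\<theta>\<bar> \<Longrightarrow> \<bar>\<theta>\<bar> \<le> pi \<Longrightarrow> norm (unif d (\<i> * of_real \<theta>)) \<le> 1 - \<kappa>1"
    using unif_far[OF \<delta>] by blast
  \<comment> \<open>Half of the gap \<open>\<kappa>1\<close> on the imaginary axis is kept;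
    \<open>\<eta>\<close> is the width at which the growth \<open>exp (2 * \<eta>) - 1\<close> in
    the strip uses up the other half.\<close>
  define \<kappa> \<eta> where "\<kappa> = \<kappa>1 / 2" and "\<eta> = ln (1 + \<kappa>) / 2"
  have \<kappa>: "0 < \<kappa>" and \<eta>: "0 < \<eta>" "exp (2 * \<eta>) \<le> 1 + \<kappa>" using \<kappa>1 by (auto simp: \<kappa>_def \<eta>_def)
  show ?thesis
  proof (rule exI[of _ \<kappa>], rule conjI[OF \<kappa>], rule exI[of _ \<eta>], rule conjI[OF \<eta>(1)], intro ballI allI impI)
    fix V B t \<theta> assume V: "V \<in> classical_weyl_groups" and B: "real (cox_rank V) \<le> B" and t: "0 \<le> t" "B * t \<le> \<eta>" and \<theta>: "\<delta> \<le> \<kappa>0 * (B * \<bar>\<theta>\<bar>)" "\<bar>\<theta>\<bar> \<le> pi"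
    have B0: "0 < B" using B rank_ge_1[OF V] by linarith
    have "norm (invF V (cpl t \<theta>)) = (\<Prod>k\<in>{1..cox_rank V}. norm (unif (inv_degs V k) (cpl t \<theta>)))"
      unfolding inv_degs(4)[OF V] by (rule prod_norm[symmetric])
    also have "\<dots> \<le> (\<Prod>k\<in>{1..cox_rank V}. exp (2 * (B * t) - \<kappa> * (real k ^ 2 / B\<^sup>2 - \<kappa>0\<^sup>2)))"
    proof (rule prod_mono, intro conjI norm_ge_zero)
      fix k assume k: "k \<in> {1..cox_rank V}"
      show "norm (unif (inv_degs V k) (cpl t \<theta>)) \<le> exp (2 * (B * t) - \<kappa> * (real k ^ 2 / B\<^sup>2 - \<kappa>0\<^sup>2))"
      proof (rule unif_factor_bound[OF \<kappa> _ \<eta>(2) _ _ _ _ B0 \<kappa>0 t \<theta>])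
        show "norm (unif (inv_degs V k) (\<i> * of_real \<theta>)) \<le> 1 - 2 * \<kappa>" if "\<delta> \<le> real (inv_degs V k) * \<bar>\<theta>\<bar>" "\<bar>\<theta>\<bar> \<le> pi" for \<theta>
          using \<kappa>1(2)[OF inv_degs(1)[OF V k] that] by (simp add: \<kappa>_def)
      qed (use inv_degs[OF V, of k] k B in auto)
    qed
    also have "\<dots> = exp (\<Sum>k\<in>{1..cox_rank V}. 2 * (B * t) - \<kappa> * (real k ^ 2 / B\<^sup>2 - \<kappa>0\<^sup>2))" by (rule exp_sum[symmetric]) simp
    also have "(\<Sum>k\<in>{1..cox_rank V}. 2 * (B * t) - \<kappa> * (real k ^ 2 / B\<^sup>2 - \<kappa>0\<^sup>2)) =
      2 * (B * t) * real (cox_rank V) - \<kappa> * ((\<Sum>k\<in>{1..cox_rank V}. real k ^ 2) / B\<^sup>2 - \<kappa>0\<^sup>2 * real (cox_rank V))"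
      by (simp add: sum_subtractf sum_distrib_left[symmetric] sum_divide_distrib[symmetric] mult_ac)
    also have "\<dots> \<le> 2 * (B * t) * real (cox_rank V) - \<kappa> * (real (cox_rank V) ^ 3 / (3 * B\<^sup>2) - \<kappa>0\<^sup>2 * real (cox_rank V))"
    proof -
      have "real (cox_rank V) ^ 3 / 3 / B\<^sup>2 \<le> (\<Sum>k\<in>{1..cox_rank V}. real k ^ 2) / B\<^sup>2" using sum_squares_ge by (rule divide_right_mono) simp
      then have "\<kappa> * (real (cox_rank V) ^ 3 / (3 * B\<^sup>2) - \<kappa>0\<^sup>2 * real (cox_rank V)) \<le> \<kappa> * ((\<Sum>k\<in>{1..cox_rank V}. real k ^ 2) / B\<^sup>2 - \<kappa>0\<^sup>2 * real (cox_rank V))"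
        using \<kappa> by (intro mult_left_mono) auto
      then show ?thesis by simp
    qed
    finally show "norm (invF V (cpl t \<theta>)) \<le> exp (2 * (B * t) * real (cox_rank V) - \<kappa> * (real (cox_rank V) ^ 3 / (3 * B\<^sup>2) - \<kappa>0\<^sup>2 * real (cox_rank V)))"
      by simp
  qed
qed

text \<open>\<open>c0\<close> encodes the limsup hypothesis in squared form. By
  \<open>inv_var_bounds\<close> it yields \<open>s \<ge> c * B * sqrt N\<close>, and away from the
  real axis it makes the total gain from \<open>inv_far\<close> proportional to
  \<open>N\<close>.\<close>

lemma inv_setup:
  assumes I: "\<And>n. finite (I n)" "\<And>n. I n \<noteq> {}" "\<And>n i. i \<in> I n \<Longrightarrow> V n i \<in> classical_weyl_groups"
    and top: "filterlim (\<lambda>n. real (\<Sum>i\<in>I n. cox_rank (V n i))) at_top sequentially"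
    and B: "\<And>n i. i \<in> I n \<Longrightarrow> real (cox_rank (V n i)) \<le> B n"
    and c0: "0 < c0" "\<And>n. c0 * real (\<Sum>i\<in>I n. cox_rank (V n i)) * (B n)\<^sup>2 \<le> (\<Sum>i\<in>I n. real (cox_rank (V n i)) ^ 3)"
  shows "\<exists>\<mu> s B c C \<delta> D. tail_setup (\<lambda>n. carrier (cox_prod (I n) (V n))) (\<lambda>n. cox_inv (cox_prod (I n) (V n))) \<mu> s
    (\<lambda>n. real (\<Sum>i\<in>I n. cox_rank (V n i))) B c C \<delta> D"
proof -
  define N where "N n = real (\<Sum>i\<in>I n. cox_rank (V n i))" for n
  define r where "r n i = real (cox_rank (V n i))" for n i
  have N_sum: "N n = (\<Sum>i\<in>I n. r n i)" for n by (simp add: N_def r_def)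
  have c0': "c0 * N n * (B n)\<^sup>2 \<le> (\<Sum>i\<in>I n. r n i ^ 3)" for n using c0(2) by (simp add: N_def r_def)
  have N1: "1 \<le> N n" for n
  proof -
    have "1 \<le> (\<Sum>i\<in>I n. cox_rank (V n i))" using I by (intro sum_ranks_ge_1) auto
    then show ?thesis unfolding N_def by linarith
  qed
  have B1: "1 \<le> B n" for n
  proof -
    obtain i where i: "i \<in> I n" using I(2)[of n] by auto
    show ?thesis using B[OF i] rank_ge_1[OF I(3)[OF i]] by linarith
  qed
  obtain C where C: "C \<ge> 0" "\<And>V B z. V \<in> classical_weyl_groups \<Longrightarrow> real (cox_rank V) \<le> B \<Longrightarrow> B * norm z \<le> 1 / 2 \<Longrightarrow>
     gdev (invF V) (inv_var V) z \<le> exp (C * real (cox_rank V) * (B * norm z) ^ 4) - 1" using inv_near by blast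
  define s where "s n = sqrt (\<Sum>i\<in>I n. inv_var (V n i))" for n
  define \<mu> where "\<mu> n = (\<Sum>i\<in>I n. \<Sum>k\<in>{1..cox_rank (V n i)}. (real (inv_degs (V n i) k) - 1) / 2)" for n
  have F: "mgf (carrier (cox_prod (I n) (V n))) (cox_inv (cox_prod (I n) (V n))) (\<mu> n) z = (\<Prod>i\<in>I n. invF (V n i) z)" for n z
    unfolding \<mu>_def by (rule mgf_cox_prod(2)) (use I in auto)
  have lo: "c0 / 48 * (B n)\<^sup>2 * N n \<le> (\<Sum>i\<in>I n. inv_var (V n i))" for n
  proof -
    have "c0 / 48 * (B n)\<^sup>2 * N n \<le> (\<Sum>i\<in>I n. r n i ^ 3 / 48)" using c0'[of n] by (simp add: sum_divide_distrib[symmetric] mult_ac)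
    also have "\<dots> \<le> (\<Sum>i\<in>I n. inv_var (V n i))" unfolding r_def by (intro sum_mono inv_var_bounds I)
    finally show ?thesis .
  qed
  have hi: "(\<Sum>i\<in>I n. inv_var (V n i)) \<le> N n ^ 4" for n
  proof -
    have "(\<Sum>i\<in>I n. inv_var (V n i)) \<le> (\<Sum>i\<in>I n. r n i ^ 3)" unfolding r_def by (intro sum_mono inv_var_bounds I)
    also have "\<dots> \<le> (\<Sum>i\<in>I n. r n i * (N n)\<^sup>2)"
    proof (rule sum_mono)
      fix i assume i: "i \<in> I n"
      have "r n i \<le> N n" unfolding N_sum using i I by (intro member_le_sum) (auto simp: r_def)
      then have "r n i * (r n i)\<^sup>2 \<le> r n i * (N n)\<^sup>2" by (intro mult_left_mono power_mono) (auto simp: r_def)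
      then show "r n i ^ 3 \<le> r n i * (N n)\<^sup>2" by (simp add: power3_eq_cube power2_eq_square)
    qed
    also have "\<dots> = N n ^ 3" unfolding sum_distrib_right[symmetric] N_sum[symmetric] by (simp add: power3_eq_cube power2_eq_square)
    also have "\<dots> \<le> N n ^ 4" using N1[of n] by (intro power_increasing) auto
    finally show ?thesis .
  qed
  have pos: "0 \<le> (\<Sum>i\<in>I n. inv_var (V n i))" for n
  proof -
    have "0 \<le> c0 / 48 * (B n)\<^sup>2 * N n" using c0 N1[of n] by simp
    then show ?thesis using lo[of n] by linarith
  qed
  have s2: "(s n)\<^sup>2 = (\<Sum>i\<in>I n. inv_var (V n i))" for n unfolding s_def by (rule real_sqrt_pow2[OF pos])
  have "tail_setup (\<lambda>n. carrier (cox_prod (I n) (V n))) (\<lambda>n. cox_inv (cox_prod (I n) (V n))) \<mu> s N B (sqrt (c0 / 48)) C (1 / 2) 1"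
  proof
    show "finite (carrier (cox_prod (I n) (V n)))" for n using finite_cox_prod(1)[OF I(1)] I(3) by blast
    show "0 < N n" for n using N1[of n] by linarith
    show "sqrt (c0 / 48) * B n * sqrt (N n) \<le> s n" for n
    proof -
      have "sqrt (c0 / 48) * B n * sqrt (N n) = sqrt (c0 / 48 * (B n)\<^sup>2 * N n)" using B1[of n] by (simp only: real_sqrt_mult real_sqrt_abs abs_of_nonneg)
      then show ?thesis unfolding s_def using lo[of n] by simp
    qed
    show "s n \<le> 1 * (N n)\<^sup>2" for n
    proof -
      have "s n \<le> sqrt (((N n)\<^sup>2)\<^sup>2)" unfolding s_def using hi[of n] by (intro real_sqrt_le_mono) (simp add: power_mult[symmetric])
      then show ?thesis by (simp only: real_sqrt_abs abs_of_nonneg zero_le_power2 mult_1_left)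
    qed
    fix n and z :: complex assume z: "B n * norm z \<le> 1 / 2"
    have "gdev (\<lambda>z. \<Prod>i\<in>I n. invF (V n i) z) (\<Sum>i\<in>I n. inv_var (V n i)) z \<le> exp (\<Sum>i\<in>I n. C * real (cox_rank (V n i)) * (B n * norm z) ^ 4) - 1"
      by (rule gdev_prod[OF I(1)]) (rule C(2)[OF I(3) B z])
    also have "(\<Sum>i\<in>I n. C * real (cox_rank (V n i)) * (B n * norm z) ^ 4) = C * N n * (B n * norm z) ^ 4"
      by (simp add: N_def sum_distrib_left sum_distrib_right)
    finally show "norm (mgf (carrier (cox_prod (I n) (V n))) (cox_inv (cox_prod (I n) (V n))) (\<mu> n) z * exp (- (of_real (s n))\<^sup>2 * z\<^sup>2 / 2) - 1) \<le> exp (C * N n * (B n * norm z) ^ 4) - 1"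
      unfolding F of_real_power[symmetric] s2 .
  next
    fix \<epsilon> :: real assume \<epsilon>: "0 < \<epsilon>"
    \<comment> \<open>Up to the factor \<open>\<kappa>\<close>, the gain is
      \<open>c0 / 3 * N\<close> and the weights cost \<open>\<kappa>0 ^ 2 * N = c0 / 6 * N\<close>.
      With \<open>B * t \<le> \<kappa> * c0 / 24\<close> the strip takes half of the remainder, and
      \<open>c0 / 12 * N\<close> survives.\<close>
    define \<kappa>0 where "\<kappa>0 = sqrt (c0 / 6)"
    have \<kappa>0: "0 < \<kappa>0" "\<kappa>0\<^sup>2 = c0 / 6" using c0 by (auto simp: \<kappa>0_def)
    from inv_far[OF mult_pos_pos[OF \<kappa>0(1) \<epsilon>] \<kappa>0(1)] obtain \<kappa> \<eta> where \<kappa>: "\<kappa> > 0" "\<eta> > 0" "\<And>V B t \<theta>. V \<in> classical_weyl_groups \<Longrightarrow> real (cox_rank V) \<le> B \<Longrightarrow> 0 \<le> t \<Longrightarrow> B * t \<le> \<eta> \<Longrightarrow>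
      \<kappa>0 * \<epsilon> \<le> \<kappa>0 * (B * \<bar>\<theta>\<bar>) \<Longrightarrow> \<bar>\<theta>\<bar> \<le> pi \<Longrightarrow> norm (invF V (cpl t \<theta>)) \<le> exp (2 * (B * t) * real (cox_rank V) - \<kappa> * (real (cox_rank V) ^ 3 / (3 * B\<^sup>2) - \<kappa>0\<^sup>2 * real (cox_rank V)))" by blast
    have "norm (mgf (carrier (cox_prod (I n) (V n))) (cox_inv (cox_prod (I n) (V n))) (\<mu> n) (cpl t \<theta>)) \<le> exp (- (\<kappa> * c0 / 12) * N n)"
      if t: "0 \<le> t" "B n * t \<le> min \<eta> (\<kappa> * c0 / 24)" and \<theta>: "\<epsilon> \<le> B n * \<bar>\<theta>\<bar>" "\<bar>\<theta>\<bar> \<le> pi" for n t \<theta>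
    proof -
      have \<epsilon>': "\<kappa>0 * \<epsilon> \<le> \<kappa>0 * (B n * \<bar>\<theta>\<bar>)" using \<theta> \<kappa>0 by (intro mult_left_mono) auto
      have "norm (\<Prod>i\<in>I n. invF (V n i) (cpl t \<theta>)) = (\<Prod>i\<in>I n. norm (invF (V n i) (cpl t \<theta>)))" by (rule prod_norm[symmetric])
      also have "\<dots> \<le> (\<Prod>i\<in>I n. exp (2 * (B n * t) * r n i - \<kappa> * (r n i ^ 3 / (3 * (B n)\<^sup>2) - \<kappa>0\<^sup>2 * r n i)))"
        unfolding r_def by (rule prod_mono, intro conjI norm_ge_zero \<kappa>(3)) (use I(3) B t \<theta> \<epsilon>' in auto)
      also have "\<dots> = exp (\<Sum>i\<in>I n. 2 * (B n * t) * r n i - \<kappa> * (r n i ^ 3 / (3 * (B n)\<^sup>2) - \<kappa>0\<^sup>2 * r n i))" by (rule exp_sum[OF I(1), symmetric])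
      also have "(\<Sum>i\<in>I n. 2 * (B n * t) * r n i - \<kappa> * (r n i ^ 3 / (3 * (B n)\<^sup>2) - \<kappa>0\<^sup>2 * r n i)) =
         2 * (B n * t) * N n - \<kappa> * ((\<Sum>i\<in>I n. r n i ^ 3) / (3 * (B n)\<^sup>2) - \<kappa>0\<^sup>2 * N n)"
        unfolding sum_subtractf sum_distrib_left[symmetric] sum_divide_distrib[symmetric] N_sum ..
      also have "\<dots> \<le> - (\<kappa> * c0 / 12) * N n"
      proof -
        have "c0 * N n * (B n)\<^sup>2 / (3 * (B n)\<^sup>2) \<le> (\<Sum>i\<in>I n. r n i ^ 3) / (3 * (B n)\<^sup>2)" using c0' by (rule divide_right_mono) simp
        then have "c0 * N n / 3 - c0 / 6 * N n \<le> (\<Sum>i\<in>I n. r n i ^ 3) / (3 * (B n)\<^sup>2) - \<kappa>0\<^sup>2 * N n"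
        proof -
          have "c0 * N n * (B n)\<^sup>2 / (3 * (B n)\<^sup>2) = c0 * N n / 3" using B1[of n] by simp
          then show ?thesis unfolding \<kappa>0(2) using \<open>c0 * N n * (B n)\<^sup>2 / (3 * (B n)\<^sup>2) \<le> _\<close> by linarith
        qed
        then have "\<kappa> * (c0 / 6 * N n) \<le> \<kappa> * ((\<Sum>i\<in>I n. r n i ^ 3) / (3 * (B n)\<^sup>2) - \<kappa>0\<^sup>2 * N n)" using \<kappa> by (intro mult_left_mono) auto
        moreover have "2 * (B n * t) * N n \<le> 2 * (\<kappa> * c0 / 24) * N n" using t N1[of n] by (intro mult_right_mono mult_left_mono) auto
        moreover have "2 * (\<kappa> * c0 / 24) * N n = \<kappa> * c0 * N n / 12" "\<kappa> * (c0 / 6 * N n) = \<kappa> * c0 * N n / 6" "- (\<kappa> * c0 / 12) * N n = - (\<kappa> * c0 * N n / 12)" by simp_all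
        ultimately show ?thesis by linarith
      qed
      finally show ?thesis unfolding F by simp
    qed
    moreover have "0 < \<kappa> * c0 / 12" "0 < min \<eta> (\<kappa> * c0 / 24)" using \<kappa> c0 by auto
    ultimately show "\<exists>c' \<eta>. 0 < c' \<and> 0 < \<eta> \<and> (\<forall>n t \<theta>. 0 \<le> t \<longrightarrow> B n * t \<le> \<eta> \<longrightarrow> \<epsilon> \<le> B n * \<bar>\<theta>\<bar> \<longrightarrow> \<bar>\<theta>\<bar> \<le> pi \<longrightarrow>
      norm (mgf (carrier (cox_prod (I n) (V n))) (cox_inv (cox_prod (I n) (V n))) (\<mu> n) (cpl t \<theta>)) \<le> exp (- c' * N n))"
      by blast
  qed (use C c0 top B1 N_def[abs_def] in auto)
  then show ?thesis unfolding N_def by blast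
qed

section \<open>Extreme values\<close>

lemma exp_quotient_limits:
  fixes a :: real
  shows "((\<lambda>t. (exp (t * a) - 1) / t) \<longlongrightarrow> a) (at_right 0)" "((\<lambda>t. (exp (t * a) - 1 - t * a) / t\<^sup>2) \<longlongrightarrow> a\<^sup>2 / 2) (at_right 0)"
proof -
  show "((\<lambda>t. (exp (t * a) - 1) / t) \<longlongrightarrow> a) (at_right 0)" by real_asymp
  show "((\<lambda>t. (exp (t * a) - 1 - t * a) / t\<^sup>2) \<longlongrightarrow> a\<^sup>2 / 2) (at_right 0)" by (real_asymp simp: power2_eq_square)
qed

lemma gauss_quotient_limits:
  fixes v K :: real
  shows "((\<lambda>t. (exp (v * t\<^sup>2 / 2) * exp (K * t ^ 4) - 1) / t\<^sup>2) \<longlongrightarrow> v / 2) (at_right 0)"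
    "((\<lambda>t. (exp (v * t\<^sup>2 / 2) * (2 - exp (K * t ^ 4)) - 1) / t\<^sup>2) \<longlongrightarrow> v / 2) (at_right 0)"
proof -
  show "((\<lambda>t. (exp (v * t\<^sup>2 / 2) * exp (K * t ^ 4) - 1) / t\<^sup>2) \<longlongrightarrow> v / 2) (at_right 0)" by real_asymp
  show "((\<lambda>t. (exp (v * t\<^sup>2 / 2) * (2 - exp (K * t ^ 4)) - 1) / t\<^sup>2) \<longlongrightarrow> v / 2) (at_right 0)" by real_asymp
qed

lemma gumbel_ratio:
  "((\<lambda>u::real. (sqrt (2 * u) - (ln u + ln (4 * pi)) / (2 * sqrt (2 * u)) + x / sqrt (2 * u)) / sqrt (2 * u)) \<longlongrightarrow> 1) at_top"
  by real_asymp

text \<open>With \<open>\<xi> = sqrt (2 * u) - d\<close> the cross term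
  \<open>sqrt (2 * u) * d\<close> is exactly \<open>ln (4 * pi * u) / 2 - x\<close>, so
  \<open>exp u * exp (- \<xi> ^ 2 / 2)\<close> is \<open>sqrt (4 * pi * u) * exp (- x)\<close> up to
  the factor \<open>exp (- d ^ 2 / 2)\<close>, which tends to 1. This is what the constants of
  \<open>gumbel_beta\<close> are made for, with \<open>u\<close> the logarithm of the sample
  size.\<close>

lemma gumbel_calibration:
  fixes x :: real
  defines "\<xi> \<equiv> \<lambda>u. sqrt (2 * u) - (ln u + ln (4 * pi)) / (2 * sqrt (2 * u)) + x / sqrt (2 * u)"
  shows "((\<lambda>u. exp u * exp (- (\<xi> u)\<^sup>2 / 2) / (\<xi> u * sqrt (2 * pi))) \<longlongrightarrow> exp (- x)) at_top"
proof -
  define d where "d u = (ln u + ln (4 * pi) - 2 * x) / (2 * sqrt (2 * u))" for u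
  have \<xi>: "\<xi> u = sqrt (2 * u) - d u" for u by (simp add: \<xi>_def d_def diff_divide_distrib)
  have d: "(d \<longlongrightarrow> 0) at_top" unfolding d_def[abs_def] by real_asymp
  have q: "((\<lambda>u. \<xi> u / sqrt (2 * u)) \<longlongrightarrow> 1) at_top" unfolding \<xi>_def by (rule gumbel_ratio)
  have "((\<lambda>u. exp (- x) * exp (- (d u)\<^sup>2 / 2) / (\<xi> u / sqrt (2 * u))) \<longlongrightarrow> exp (- x) * exp (- 0\<^sup>2 / 2) / 1) at_top"
    by (intro tendsto_intros d q) simp_all
  then have lim: "((\<lambda>u. exp (- x) * exp (- (d u)\<^sup>2 / 2) / (\<xi> u / sqrt (2 * u))) \<longlongrightarrow> exp (- x)) at_top" by simp
  show ?thesis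
  proof (rule Lim_transform_eventually[OF lim])
    have "exp (- x) * exp (- (d u)\<^sup>2 / 2) / (\<xi> u / sqrt (2 * u)) = exp u * exp (- (\<xi> u)\<^sup>2 / 2) / (\<xi> u * sqrt (2 * pi))" if u: "0 < u" for u
    proof -
      have a: "sqrt (2 * u) * d u = (ln u + ln (4 * pi)) / 2 - x" using u by (simp add: d_def field_simps)
      have "(\<xi> u)\<^sup>2 = (sqrt (2 * u))\<^sup>2 - 2 * (sqrt (2 * u) * d u) + (d u)\<^sup>2" unfolding \<xi> by (simp add: power2_diff)
      then have \<xi>2: "(\<xi> u)\<^sup>2 = 2 * u - 2 * ((ln u + ln (4 * pi)) / 2 - x) + (d u)\<^sup>2" unfolding a using u by simp
      have L: "ln (u * (4 * pi)) = ln u + ln (4 * pi)" using u by (simp only: ln_mult) simp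
      have "u + - (\<xi> u)\<^sup>2 / 2 = ln (u * (4 * pi)) / 2 + (- x + - (d u)\<^sup>2 / 2)" unfolding \<xi>2 L by (simp add: field_simps)
      then have "exp u * exp (- (\<xi> u)\<^sup>2 / 2) = exp (ln (u * (4 * pi)) / 2) * (exp (- x) * exp (- (d u)\<^sup>2 / 2))" by (simp only: exp_add[symmetric])
      also have "exp (ln (u * (4 * pi)) / 2) = sqrt (2 * u) * sqrt (2 * pi)"
      proof -
        have "exp (ln (u * (4 * pi)) / 2) = exp (ln (sqrt (u * (4 * pi))))" using u by (simp add: ln_sqrt)
        also have "\<dots> = sqrt ((2 * u) * (2 * pi))" using u by (simp add: mult_ac)
        finally show ?thesis by (simp only: real_sqrt_mult)
      qed
      finally have E: "exp u * exp (- (\<xi> u)\<^sup>2 / 2) = sqrt (2 * u) * sqrt (2 * pi) * (exp (- x) * exp (- (d u)\<^sup>2 / 2))" .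
      have "a / (b / p) = p * q * a / (b * q)" if "p \<noteq> 0" "q \<noteq> 0" for a b p q :: real using that by simp
      then show ?thesis unfolding E using u by simp
    qed
    then show "\<forall>\<^sub>F u in at_top. exp (- x) * exp (- (d u)\<^sup>2 / 2) / (\<xi> u / sqrt (2 * u)) = exp u * exp (- (\<xi> u)\<^sup>2 / 2) / (\<xi> u * sqrt (2 * pi))"
      by (rule eventually_mono[OF eventually_gt_at_top[of 0]])
  qed
qed

lemma ln_ratio: "((\<lambda>p::real. ln (1 - p) / p) \<longlongrightarrow> -1) (at 0)"
  by real_asymp

lemma power_one_minus_tendsto:
  fixes p :: "nat \<Rightarrow> real"
  assumes m: "filterlim m at_top sequentially" and lim: "(\<lambda>n. real (m n) * p n) \<longlonglongrightarrow> c" and c: "0 < c"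
  shows "(\<lambda>n. (1 - p n) ^ m n) \<longlonglongrightarrow> exp (- c)"
proof -
  have m': "filterlim (\<lambda>n. real (m n)) at_top sequentially" by (rule filterlim_compose[OF filterlim_real_sequentially m])
  have mpn: "(\<lambda>n. real (m n) * p n / real (m n)) \<longlonglongrightarrow> 0" by (rule tendsto_divide_0[OF lim filterlim_at_top_imp_at_infinity[OF m']])
  have mp: "\<forall>\<^sub>F n in sequentially. 0 < real (m n)" using m' unfolding filterlim_at_top_dense by blast
  have p0: "p \<longlonglongrightarrow> 0" by (rule Lim_transform_eventually[OF mpn]) (use mp in \<open>eventually_elim, simp\<close>)
  have pos: "\<forall>\<^sub>F n in sequentially. 0 < p n" using order_tendstoD(1)[OF lim c] mp by eventually_elim (simp add: zero_less_mult_iff)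
  have lt1: "\<forall>\<^sub>F n in sequentially. p n < 1" using order_tendstoD(2)[OF p0] by simp
  have "filterlim p (at 0) sequentially" unfolding filterlim_at using p0 pos by (auto elim: eventually_mono)
  from tendsto_mult[OF lim filterlim_compose[OF ln_ratio this]] have "(\<lambda>n. exp (real (m n) * p n * (ln (1 - p n) / p n))) \<longlonglongrightarrow> exp (c * -1)"
    by (rule tendsto_exp)
  moreover have "\<forall>\<^sub>F n in sequentially. exp (real (m n) * p n * (ln (1 - p n) / p n)) = (1 - p n) ^ m n"
    using pos lt1
  proof eventually_elim
    case (elim n)
    then have "real (m n) * p n * (ln (1 - p n) / p n) = real (m n) * ln (1 - p n)" by simp
    then show ?case using elim by (simp add: exp_of_nat_mult)
  qed
  ultimately show ?thesis by (simp add: Lim_transform_eventually)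
qed

context tail_setup
begin

lemma card_A: "card (A n) \<noteq> 0"
proof
  assume "card (A n) = 0"
  then have "mgf (A n) (X n) (\<mu> n) 0 = 0" by (simp add: mgf_def)
  with H1[of n 0] cst show False by simp
qed

text \<open>By \<open>H1\<close> the function \<open>f\<close> is
  \<open>1 + s ^ 2 * t ^ 2 / 2 + O(t ^ 4)\<close> as \<open>t\<close> tends to 0. Comparison with
  the expansion of the exponentials gives the mean at the order \<open>t\<close> and the variance at
  the order \<open>t ^ 2\<close>.\<close>

lemma moments:
  shows "(\<Sum>w\<in>A n. real (X n w)) / card (A n) = \<mu> n" "(\<Sum>w\<in>A n. (real (X n w) - \<mu> n)\<^sup>2) / card (A n) = (s n)\<^sup>2"
proof -
  define Y where "Y w = real (X n w) - \<mu> n" for w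
  define k where "k = real (card (A n))"
  have k: "0 < k" using card_A[of n] by (simp add: k_def)
  define f where "f t = (\<Sum>w\<in>A n. exp (t * Y w)) / k" for t
  define K where "K = C * N n * B n ^ 4"
  have dev: "\<bar>f t * exp (- (s n)\<^sup>2 * t\<^sup>2 / 2) - 1\<bar> \<le> exp (K * t ^ 4) - 1" if t: "0 < t" "B n * t \<le> \<delta>" for t
  proof -
    have "mgf (A n) (X n) (\<mu> n) (of_real t) * exp (- (of_real (s n))\<^sup>2 * (of_real t)\<^sup>2 / 2) - 1 = complex_of_real (f t * exp (- (s n)\<^sup>2 * t\<^sup>2 / 2) - 1)"
      unfolding mgf_def f_def k_def Y_def by (simp add: exp_of_real[symmetric] del: exp_of_real)
    then show ?thesis using H1[of n "of_real t"] t by (simp add: K_def power_mult_distrib mult_ac del: of_real_diff of_real_mult)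
  qed
  have ev: "\<forall>\<^sub>F t in at_right 0. 0 < t \<and> B n * t \<le> \<delta>"
  proof -
    have "\<forall>\<^sub>F t in at_right 0. t < \<delta> / B n" using cst Bpos by (intro eventually_at_rightI[of 0 "\<delta> / B n"]) auto
    moreover have "\<forall>\<^sub>F t::real in at_right 0. 0 < t" by (simp add: eventually_at_filter)
    ultimately show ?thesis by eventually_elim (use Bpos[of n] in \<open>simp add: pos_less_divide_eq mult.commute\<close>)
  qed
  have q: "((\<lambda>t. (f t - 1) / t\<^sup>2) \<longlongrightarrow> (s n)\<^sup>2 / 2) (at_right 0)"
  proof (rule tendsto_sandwich[OF _ _ gauss_quotient_limits(2)[of _ K] gauss_quotient_limits(1)[of _ K]])
    have "exp ((s n)\<^sup>2 * t\<^sup>2 / 2) * (2 - exp (K * t ^ 4)) \<le> f t \<and> f t \<le> exp ((s n)\<^sup>2 * t\<^sup>2 / 2) * exp (K * t ^ 4)" if t: "0 < t" "B n * t \<le> \<delta>" for t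
    proof -
      define E where "E = exp ((s n)\<^sup>2 * t\<^sup>2 / 2)"
      have E: "0 < E" "E * exp (- (s n)\<^sup>2 * t\<^sup>2 / 2) = 1" by (simp_all add: E_def exp_add[symmetric])
      have "E * (f t * exp (- (s n)\<^sup>2 * t\<^sup>2 / 2)) = f t * (E * exp (- (s n)\<^sup>2 * t\<^sup>2 / 2))" by (simp only: mult_ac)
      then have f: "E * (f t * exp (- (s n)\<^sup>2 * t\<^sup>2 / 2)) = f t" using E by simp
      have "2 - exp (K * t ^ 4) \<le> f t * exp (- (s n)\<^sup>2 * t\<^sup>2 / 2)" "f t * exp (- (s n)\<^sup>2 * t\<^sup>2 / 2) \<le> exp (K * t ^ 4)" using dev[OF t] by linarith+
      then have "E * (2 - exp (K * t ^ 4)) \<le> E * (f t * exp (- (s n)\<^sup>2 * t\<^sup>2 / 2))" "E * (f t * exp (- (s n)\<^sup>2 * t\<^sup>2 / 2)) \<le> E * exp (K * t ^ 4)"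
        using E by (auto intro!: mult_left_mono)
      then show ?thesis unfolding f by (simp add: E_def)
    qed
    then have *: "\<forall>\<^sub>F t in at_right 0. exp ((s n)\<^sup>2 * t\<^sup>2 / 2) * (2 - exp (K * t ^ 4)) \<le> f t \<and> f t \<le> exp ((s n)\<^sup>2 * t\<^sup>2 / 2) * exp (K * t ^ 4)"
      using ev by (auto elim: eventually_mono)
    show "\<forall>\<^sub>F t in at_right 0. (exp ((s n)\<^sup>2 * t\<^sup>2 / 2) * (2 - exp (K * t ^ 4)) - 1) / t\<^sup>2 \<le> (f t - 1) / t\<^sup>2"
      using * by eventually_elim (intro divide_right_mono, auto)
    show "\<forall>\<^sub>F t in at_right 0. (f t - 1) / t\<^sup>2 \<le> (exp ((s n)\<^sup>2 * t\<^sup>2 / 2) * exp (K * t ^ 4) - 1) / t\<^sup>2"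
      using * by eventually_elim (intro divide_right_mono, auto)
  qed
  have pos: "\<forall>\<^sub>F t::real in at_right 0. 0 < t" by (simp add: eventually_at_filter)
  have one: "f t - 1 = (\<Sum>w\<in>A n. exp (t * Y w) - 1) / k" for t using k by (simp add: f_def sum_subtractf k_def diff_divide_distrib)
  have "((\<lambda>t. (\<Sum>w\<in>A n. (exp (t * Y w) - 1) / t) / k) \<longlongrightarrow> (\<Sum>w\<in>A n. Y w) / k) (at_right 0)"
    by (intro tendsto_divide tendsto_sum exp_quotient_limits tendsto_const) (use k in simp)
  moreover have "((\<lambda>t. t * ((f t - 1) / t\<^sup>2)) \<longlongrightarrow> 0 * ((s n)\<^sup>2 / 2)) (at_right 0)" by (intro tendsto_mult q tendsto_ident_at)
  then have "((\<lambda>t. (\<Sum>w\<in>A n. (exp (t * Y w) - 1) / t) / k) \<longlongrightarrow> 0 * ((s n)\<^sup>2 / 2)) (at_right 0)"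
    by (rule Lim_transform_eventually)
      (use pos in \<open>eventually_elim, simp add: one sum_divide_distrib[symmetric] power2_eq_square\<close>)
  ultimately have Y1: "(\<Sum>w\<in>A n. Y w) / k = 0" using tendsto_unique[OF trivial_limit_at_right_real] by fastforce
  then have Y0: "(\<Sum>w\<in>A n. Y w) = 0" using k by simp
  then show "(\<Sum>w\<in>A n. real (X n w)) / card (A n) = \<mu> n" using k by (simp add: Y_def sum_subtractf k_def field_simps)
  have two: "f t - 1 = (\<Sum>w\<in>A n. exp (t * Y w) - 1 - t * Y w) / k" for t
    unfolding one by (simp add: sum_subtractf sum_distrib_left[symmetric] Y0)
  have "((\<lambda>t. (\<Sum>w\<in>A n. (exp (t * Y w) - 1 - t * Y w) / t\<^sup>2) / k) \<longlongrightarrow> (\<Sum>w\<in>A n. (Y w)\<^sup>2 / 2) / k) (at_right 0)"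
    by (intro tendsto_divide tendsto_sum exp_quotient_limits tendsto_const) (use k in simp)
  moreover have "((\<lambda>t. (\<Sum>w\<in>A n. (exp (t * Y w) - 1 - t * Y w) / t\<^sup>2) / k) \<longlongrightarrow> (s n)\<^sup>2 / 2) (at_right 0)"
    using q unfolding two by (simp add: sum_divide_distrib[symmetric] mult.commute)
  ultimately have "(\<Sum>w\<in>A n. (Y w)\<^sup>2 / 2) / k = (s n)\<^sup>2 / 2" using tendsto_unique[OF trivial_limit_at_right_real] by blast
  then show "(\<Sum>w\<in>A n. (real (X n w) - \<mu> n)\<^sup>2) / card (A n) = (s n)\<^sup>2" by (simp add: sum_divide_distrib[symmetric] Y_def k_def)
qed

text \<open>The sample size is a sequence \<open>m\<close> of its own because the groups will be
  reindexed by a shift.\<close>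

theorem gumbel_limit:
  fixes m :: "nat \<Rightarrow> nat"
  assumes m: "filterlim m at_top sequentially" and small: "(\<lambda>n. ln (real (m n)) ^ 3 / N n) \<longlonglongrightarrow> 0"
  shows "(\<lambda>n. (1 - tail (A n) (X n) (\<lfloor>\<mu> n + s n * (gumbel_beta (m n) + x / gumbel_alpha (m n))\<rfloor> + 1)) ^ m n) \<longlonglongrightarrow> exp (- exp (- x))"
proof (rule power_one_minus_tendsto[OF m])
  define u where "u n = ln (real (m n))" for n
  have m': "filterlim (\<lambda>n. real (m n)) at_top sequentially" by (rule filterlim_compose[OF filterlim_real_sequentially m])
  have u: "filterlim u at_top sequentially" unfolding u_def by (rule filterlim_compose[OF ln_at_top m'])
  define \<xi> where "\<xi> n = sqrt (2 * u n) - (ln (u n) + ln (4 * pi)) / (2 * sqrt (2 * u n)) + x / sqrt (2 * u n)" for n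
  have \<xi>: "gumbel_beta (m n) + x / gumbel_alpha (m n) = \<xi> n" for n by (simp add: gumbel_beta_def gumbel_alpha_def \<xi>_def u_def)
  define \<alpha> where "\<alpha> n = sqrt (2 * u n)" for n
  have ratio: "(\<lambda>n. \<xi> n / \<alpha> n) \<longlonglongrightarrow> 1" unfolding \<xi>_def \<alpha>_def by (rule filterlim_compose[OF gumbel_ratio u])
  have u2: "filterlim (\<lambda>n. 2 * u n) at_top sequentially" by (rule filterlim_tendsto_pos_mult_at_top[OF tendsto_const _ u]) simp
  have \<alpha>: "filterlim \<alpha> at_top sequentially" unfolding \<alpha>_def by (rule filterlim_compose[OF sqrt_at_top u2])
  have evu: "\<forall>\<^sub>F n in sequentially. 1 \<le> u n" using u by (simp add: filterlim_at_top)
  have \<xi>_top: "filterlim \<xi> at_top sequentially"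
  proof -
    have "filterlim (\<lambda>n. \<xi> n / \<alpha> n * \<alpha> n) at_top sequentially" by (rule filterlim_tendsto_pos_mult_at_top[OF ratio _ \<alpha>]) simp
    then show ?thesis by (rule filterlim_mono_eventually[OF _ order_refl order_refl]) (use evu in \<open>eventually_elim, simp add: \<alpha>_def\<close>)
  qed
  \<comment> \<open>The statistic is integer valued, so exceeding the threshold means reaching
    \<open>k\<close>, and \<open>y\<close> is \<open>k\<close> standardised. The rounding error
    \<open>e\<close> is at most one lattice step \<open>1 / s\<close>; it is harmless because
    \<open>e * \<xi>\<close> is of order \<open>sqrt (u / N)\<close>.\<close>
  define k where "k n = \<lfloor>\<mu> n + s n * \<xi> n\<rfloor> + 1" for n
  define y where "y n = (of_int (k n) - \<mu> n) / s n" for n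
  define e where "e n = y n - \<xi> n" for n
  have ke: "of_int (k n) = \<mu> n + s n * y n" for n using s_pos[of n] by (simp add: y_def)
  have e: "0 \<le> e n" "e n \<le> 1 / s n" for n
  proof -
    have "0 \<le> s n * e n" "s n * e n \<le> 1" using ke[of n] by (auto simp: e_def k_def right_diff_distrib) linarith+
    then show "0 \<le> e n" "e n \<le> 1 / s n" using s_pos[of n] by (auto simp: zero_le_mult_iff pos_le_divide_eq mult.commute)
  qed
  have inv_s: "(\<lambda>n. 1 / s n) \<longlonglongrightarrow> 0" by (rule tendsto_divide_0[OF tendsto_const filterlim_at_top_imp_at_infinity[OF s_top]])
  have e0: "e \<longlonglongrightarrow> 0" by (rule tendsto_sandwich[OF _ _ tendsto_const inv_s]) (use e in auto)
  have y_top: "filterlim y at_top sequentially" by (rule filterlim_at_top_mono[OF \<xi>_top]) (use e(1) in \<open>auto simp: e_def\<close>)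
  have ev\<alpha>: "\<forall>\<^sub>F n in sequentially. 1 \<le> \<alpha> n" using \<alpha> by (simp add: filterlim_at_top)
  have ev\<xi>: "\<forall>\<^sub>F n in sequentially. \<xi> n \<le> 2 * \<alpha> n" "\<forall>\<^sub>F n in sequentially. 0 < \<xi> n"
  proof -
    have "\<forall>\<^sub>F n in sequentially. \<xi> n / \<alpha> n < 2" by (rule order_tendstoD(2)[OF ratio]) simp
    then show "\<forall>\<^sub>F n in sequentially. \<xi> n \<le> 2 * \<alpha> n" using ev\<alpha> by eventually_elim (simp add: pos_divide_less_eq)
    show "\<forall>\<^sub>F n in sequentially. 0 < \<xi> n" using \<xi>_top by (simp add: filterlim_at_top_dense)
  qed
  have eve: "\<forall>\<^sub>F n in sequentially. e n \<le> 1" using order_tendstoD(2)[OF e0, of 1] by (auto elim: eventually_mono)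
  have u_small: "(\<lambda>n. u n ^ j / N n) \<longlonglongrightarrow> 0" if "j \<le> 3" for j
  proof (rule tendsto_sandwich[OF _ _ tendsto_const small])
    show "\<forall>\<^sub>F n in sequentially. 0 \<le> u n ^ j / N n" using evu by eventually_elim (use N in \<open>auto intro!: divide_nonneg_pos\<close>)
    show "\<forall>\<^sub>F n in sequentially. u n ^ j / N n \<le> ln (real (m n)) ^ 3 / N n"
      using evu by eventually_elim (use N that in \<open>auto intro!: divide_right_mono power_increasing simp: u_def less_imp_le\<close>)
  qed
  have y4: "(\<lambda>n. y n ^ 4 / N n) \<longlonglongrightarrow> 0"
  proof (rule tendsto_sandwich[OF _ _ tendsto_const])
    \<comment> \<open>\<open>y \<le> 3 * \<alpha>\<close> and \<open>\<alpha> ^ 2 = 2 * u\<close>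
      give \<open>81 * 4 = 324\<close>.\<close>
    show "(\<lambda>n. 324 * (u n ^ 2 / N n)) \<longlonglongrightarrow> 0" using tendsto_mult[OF tendsto_const u_small[of 2], of 324] by simp
    show "\<forall>\<^sub>F n in sequentially. 0 \<le> y n ^ 4 / N n" using N by (auto intro!: always_eventually divide_nonneg_pos)
    show "\<forall>\<^sub>F n in sequentially. y n ^ 4 / N n \<le> 324 * (u n ^ 2 / N n)"
      using ev\<xi> ev\<alpha> eve evu
    proof eventually_elim
      case (elim n)
      have "y n \<le> 3 * \<alpha> n" "0 \<le> y n" using elim e(1)[of n] by (simp_all add: e_def)
      then have "y n ^ 4 \<le> (3 * \<alpha> n) ^ 4" by (intro power_mono) auto
      also have "(3 * \<alpha> n) ^ 4 = 81 * ((\<alpha> n)\<^sup>2)\<^sup>2" by (simp add: power_mult_distrib power_mult[symmetric])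
      also have "(\<alpha> n)\<^sup>2 = 2 * u n" using elim by (simp add: \<alpha>_def)
      finally have "y n ^ 4 \<le> 324 * u n ^ 2" by (simp add: power_mult_distrib)
      then have "y n ^ 4 / N n \<le> 324 * u n ^ 2 / N n" using N[of n] by (intro divide_right_mono) auto
      then show ?case by simp
    qed
  qed
  have T: "(\<lambda>n. tail (A n) (X n) (k n) * (sqrt (2 * pi) * (y n * exp ((y n)\<^sup>2 / 2)))) \<longlonglongrightarrow> 1" by (rule tail_asymp[OF ke y_top y4])
  have cal: "(\<lambda>n. exp (u n) * exp (- (\<xi> n)\<^sup>2 / 2) / (\<xi> n * sqrt (2 * pi))) \<longlonglongrightarrow> exp (- x)"
    unfolding \<xi>_def by (rule filterlim_compose[OF gumbel_calibration u])
  have e\<xi>: "(\<lambda>n. e n * \<xi> n) \<longlonglongrightarrow> 0"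
  proof (rule tendsto_sandwich[OF _ _ tendsto_const])
    have "(\<lambda>n. sqrt (2 * (u n ^ 1 / N n))) \<longlonglongrightarrow> sqrt (2 * 0)" by (intro tendsto_real_sqrt tendsto_mult tendsto_const u_small) simp
    then show "(\<lambda>n. 2 / c * sqrt (2 * (u n ^ 1 / N n))) \<longlonglongrightarrow> 0" using tendsto_mult[OF tendsto_const, of _ 0 _ "2 / c"] by simp
    show "\<forall>\<^sub>F n in sequentially. 0 \<le> e n * \<xi> n" using ev\<xi>(2) by eventually_elim (use e in simp)
    show "\<forall>\<^sub>F n in sequentially. e n * \<xi> n \<le> 2 / c * sqrt (2 * (u n ^ 1 / N n))"
      using ev\<xi> ev\<alpha>
    proof eventually_elim
      case (elim n)
      have "c * 1 * sqrt (N n) \<le> c * B n * sqrt (N n)" using cst B[of n] N[of n] by (intro mult_right_mono mult_left_mono) auto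
      then have s: "c * sqrt (N n) \<le> s n" using s_ge[of n] by simp
      have cN: "0 < c * sqrt (N n)" using cst N[of n] by simp
      have "e n * \<xi> n \<le> 1 / s n * (2 * \<alpha> n)" using e elim s_pos[of n] by (intro mult_mono) auto
      also have "\<dots> \<le> 1 / (c * sqrt (N n)) * (2 * \<alpha> n)" using s cN elim s_pos[of n] by (intro mult_right_mono frac_le) auto
      also have "\<dots> = 2 / c * sqrt (2 * (u n ^ 1 / N n))" by (simp add: \<alpha>_def real_sqrt_divide real_sqrt_mult)
      finally show ?case .
    qed
  qed
  have diff: "(\<lambda>n. exp (- (e n * \<xi> n + (e n)\<^sup>2 / 2))) \<longlonglongrightarrow> exp (- (0 + 0\<^sup>2 / 2))" by (intro tendsto_intros e\<xi> e0) simp_all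
  have xy: "(\<lambda>n. 1 / (1 + e n / \<xi> n)) \<longlonglongrightarrow> 1 / (1 + 0)"
    by (intro tendsto_divide tendsto_add tendsto_const tendsto_divide_0[OF e0 filterlim_at_top_imp_at_infinity[OF \<xi>_top]]) simp
  \<comment> \<open>The tail asymptotics at \<open>y\<close>, the calibration at
    \<open>\<xi>\<close>, and two corrections for the passage from \<open>\<xi>\<close> to
    \<open>y\<close>. Eventually the product equals \<open>m\<close> times the tail
    probability.\<close>
  have "(\<lambda>n. (tail (A n) (X n) (k n) * (sqrt (2 * pi) * (y n * exp ((y n)\<^sup>2 / 2)))) * (exp (u n) * exp (- (\<xi> n)\<^sup>2 / 2) / (\<xi> n * sqrt (2 * pi))) *
    (1 / (1 + e n / \<xi> n)) * exp (- (e n * \<xi> n + (e n)\<^sup>2 / 2))) \<longlonglongrightarrow> 1 * exp (- x) * (1 / (1 + 0)) * exp (- (0 + 0\<^sup>2 / 2))"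
    by (intro tendsto_mult T cal xy diff)
  then have lim: "(\<lambda>n. (tail (A n) (X n) (k n) * (sqrt (2 * pi) * (y n * exp ((y n)\<^sup>2 / 2)))) * (exp (u n) * exp (- (\<xi> n)\<^sup>2 / 2) / (\<xi> n * sqrt (2 * pi))) *
    (1 / (1 + e n / \<xi> n)) * exp (- (e n * \<xi> n + (e n)\<^sup>2 / 2))) \<longlonglongrightarrow> exp (- x)" by simp
  have mpos: "\<forall>\<^sub>F n in sequentially. 0 < real (m n)" using m' unfolding filterlim_at_top_dense by blast
  have "(\<lambda>n. real (m n) * tail (A n) (X n) (k n)) \<longlonglongrightarrow> exp (- x)"
  proof (rule Lim_transform_eventually[OF lim])
    show "\<forall>\<^sub>F n in sequentially. (tail (A n) (X n) (k n) * (sqrt (2 * pi) * (y n * exp ((y n)\<^sup>2 / 2)))) * (exp (u n) * exp (- (\<xi> n)\<^sup>2 / 2) / (\<xi> n * sqrt (2 * pi))) *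
      (1 / (1 + e n / \<xi> n)) * exp (- (e n * \<xi> n + (e n)\<^sup>2 / 2)) = real (m n) * tail (A n) (X n) (k n)"
      using ev\<xi>(2) mpos
    proof eventually_elim
      case (elim n)
      have y: "y n = \<xi> n + e n" by (simp add: e_def)
      have E: "exp ((y n)\<^sup>2 / 2) * exp (- (\<xi> n)\<^sup>2 / 2) * exp (- (e n * \<xi> n + (e n)\<^sup>2 / 2)) = 1"
        unfolding exp_add[symmetric] y by (simp add: power2_eq_square field_simps)
      have Y: "y n / (\<xi> n * (1 + e n / \<xi> n)) = 1"
      proof -
        have "\<xi> n * (1 + e n / \<xi> n) = y n" using elim by (simp add: y distrib_left)
        then show ?thesis using elim e(1)[of n] by (simp add: y)
      qed
      have alg: "T * (q * (Y * E1)) * (U * E2 / (Z * q)) * (1 / W) * E3 = U * T * (E1 * E2 * E3) * (Y / (Z * W))" if "q \<noteq> 0" for T q Y E1 U E2 Z W E3 :: real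
        using that by simp
      show ?case using elim by (subst alg) (simp_all only: E Y u_def exp_ln, simp_all)
    qed
  qed
  then show "(\<lambda>n. real (m n) * tail (A n) (X n) (\<lfloor>\<mu> n + s n * (gumbel_beta (m n) + x / gumbel_alpha (m n))\<rfloor> + 1)) \<longlonglongrightarrow> exp (- x)"
    unfolding \<xi> k_def .
qed simp

end

context prob_space
begin

lemma expectation_uniform:
  fixes X :: "'a \<Rightarrow> real" and f :: "real \<Rightarrow> real"
  assumes A: "finite A" "A \<noteq> {}" and X: "random_variable borel X" and f: "f \<in> borel_measurable borel"
    and distr: "distr M borel X = distr (measure_pmf (pmf_of_set A)) borel Y"
  shows "expectation (\<lambda>\<omega>. f (X \<omega>)) = (\<Sum>w\<in>A. f (Y w)) / card A"
proof -
  have "expectation (\<lambda>\<omega>. f (X \<omega>)) = integral\<^sup>L (distr M borel X) f" by (rule integral_distr[OF X f, symmetric])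
  also have "\<dots> = measure_pmf.expectation (pmf_of_set A) (\<lambda>w. f (Y w))" unfolding distr by (rule integral_distr[OF _ f]) simp
  also have "\<dots> = (\<Sum>w\<in>A. f (Y w)) / card A" by (rule integral_pmf_of_set[OF A(2,1)])
  finally show ?thesis .
qed

text \<open>\<open>tail\<close> counts from its integer argument on, and the integers above
  \<open>c\<close> begin at \<open>\<lfloor>c\<rfloor> + 1\<close>. Independence produces the
  power.\<close>

lemma prob_Max_le:
  fixes X :: "nat \<Rightarrow> 'a \<Rightarrow> real" and Y :: "'w \<Rightarrow> nat"
  assumes A: "finite A" "A \<noteq> {}" and n: "1 \<le> n" and indep: "indep_vars (\<lambda>_. borel) X {1..n}"
    and distr: "\<And>i. i \<in> {1..n} \<Longrightarrow> distr M borel (X i) = distr (measure_pmf (pmf_of_set A)) borel (\<lambda>w. real (Y w))"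
  shows "prob {\<omega> \<in> space M. Max ((\<lambda>i. X i \<omega>) ` {1..n}) \<le> c} = (1 - tail A Y (\<lfloor>c\<rfloor> + 1)) ^ n"
proof -
  have one: "prob (X i -` {..c} \<inter> space M) = 1 - tail A Y (\<lfloor>c\<rfloor> + 1)" if i: "i \<in> {1..n}" for i
  proof -
    have X: "random_variable borel (X i)" using indep i by (auto simp: indep_vars_def2)
    have "prob (X i -` {..c} \<inter> space M) = measure (distr M borel (X i)) {..c}" by (rule measure_distr[OF X, symmetric]) simp
    also have "\<dots> = measure (measure_pmf (pmf_of_set A)) ((\<lambda>w. real (Y w)) -` {..c} \<inter> space (measure_pmf (pmf_of_set A)))"
      unfolding distr[OF i] by (rule measure_distr) simp_all
    also have "\<dots> = card (A \<inter> {w. real (Y w) \<le> c}) / card A" by (simp add: measure_pmf_of_set[OF A(2,1)] vimage_def)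
    also have "card (A \<inter> {w. real (Y w) \<le> c}) = card A - card {w \<in> A. \<lfloor>c\<rfloor> + 1 \<le> int (Y w)}"
    proof -
      have "A \<inter> {w. real (Y w) \<le> c} = A - {w \<in> A. \<lfloor>c\<rfloor> + 1 \<le> int (Y w)}"
      proof -
        have "\<lfloor>c\<rfloor> + 1 \<le> int k \<longleftrightarrow> \<not> real k \<le> c" for k :: nat by linarith
        then show ?thesis by auto
      qed
      then show ?thesis using A by (simp add: card_Diff_subset)
    qed
    also have "real (card A - card {w \<in> A. \<lfloor>c\<rfloor> + 1 \<le> int (Y w)}) / card A = 1 - tail A Y (\<lfloor>c\<rfloor> + 1)"
    proof -
      have "card {w \<in> A. \<lfloor>c\<rfloor> + 1 \<le> int (Y w)} \<le> card A" using A by (intro card_mono) auto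
      then show ?thesis using A by (simp add: tail_def of_nat_diff diff_divide_distrib)
    qed
    finally show ?thesis .
  qed
  have "{\<omega> \<in> space M. Max ((\<lambda>i. X i \<omega>) ` {1..n}) \<le> c} = (\<Inter>i\<in>{1..n}. X i -` {..c} \<inter> space M)" using n by auto
  also have "prob \<dots> = (\<Prod>i\<in>{1..n}. prob (X i -` {..c} \<inter> space M))" by (rule indep_varsD[OF indep]) (use n in auto)
  also have "\<dots> = (1 - tail A Y (\<lfloor>c\<rfloor> + 1)) ^ n" using one by simp
  finally show ?thesis .
qed

end

section \<open>Conclusion for inversions and descents\<close>

lemma limsup_bound:
  fixes f :: "nat \<Rightarrow> real"
  assumes "limsup (\<lambda>n. ereal (f n)) < \<infinity>" shows "\<exists>K>0. \<forall>\<^sub>F n in sequentially. f n < K"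
proof -
  obtain k :: nat where "limsup (\<lambda>n. ereal (f n)) < ereal (real k)" using assms less_PInf_Ex_of_nat by auto
  from Limsup_lessD[OF this] have "\<forall>\<^sub>F n in sequentially. f n < real (Suc k)" by (auto elim: eventually_mono)
  then show ?thesis by (intro exI[of _ "real (Suc k)"]) auto
qed

theorem theorem4p4:
  fixes l :: "nat \<Rightarrow> nat"
    and V :: "nat \<Rightarrow> nat \<Rightarrow> (int \<Rightarrow> int) coxeter"
    and W :: "nat \<Rightarrow> (nat \<Rightarrow> int \<Rightarrow> int) coxeter"
    and N nmax :: "nat \<Rightarrow> nat"
    and stat :: "(nat \<Rightarrow> int \<Rightarrow> int) coxeter \<Rightarrow> (nat \<Rightarrow> int \<Rightarrow> int) \<Rightarrow> nat"
    and \<Omega> :: "nat \<Rightarrow> 'a measure"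
    and X :: "nat \<Rightarrow> nat \<Rightarrow> 'a \<Rightarrow> real"
    and M :: "nat \<Rightarrow> 'a \<Rightarrow> real"
    and \<mu> s a b :: "nat \<Rightarrow> real"
    and x :: real
  assumes l: "\<And>n. n \<ge> 1 \<Longrightarrow> l n \<ge> 1"
    and V: "\<And>n i. n \<ge> 1 \<Longrightarrow> i \<in> {1..l n} \<Longrightarrow> V n i \<in> classical_weyl_groups"
    and W: "\<And>n. W n = cox_prod {1..l n} (V n)"
    and N: "\<And>n. N n = cox_rank (W n)"
    and N_growth: "(\<lambda>n. ln (real n) ^ 3) \<in> o(\<lambda>n. real (N n))"
    and nmax: "\<And>n. nmax n = Max ((\<lambda>i. cox_rank (V n i)) ` {1..l n})"
    and prob: "\<And>n. n \<ge> 1 \<Longrightarrow> prob_space (\<Omega> n)"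
    and indep: "\<And>n. n \<ge> 1 \<Longrightarrow> prob_space.indep_vars (\<Omega> n) (\<lambda>_. borel) (X n) {1..n}"
    and distr: "\<And>n i. n \<ge> 1 \<Longrightarrow> i \<in> {1..n} \<Longrightarrow>
      distr (\<Omega> n) borel (X n i) =
      distr (measure_pmf (pmf_of_set (carrier (W n)))) borel (\<lambda>w. real (stat (W n) w))"
    and M: "\<And>n \<omega>. M n \<omega> = Max ((\<lambda>i. X n i \<omega>) ` {1..n})"
    and \<mu>: "\<And>n. \<mu> n = prob_space.expectation (\<Omega> n) (X n 1)"
    and s: "\<And>n. s n = sqrt (prob_space.variance (\<Omega> n) (X n 1))"
    and a: "\<And>n. a n = s n / gumbel_alpha n"
    and b: "\<And>n. b n = gumbel_beta n * s n + \<mu> n"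
    and stat:
      "stat = cox_inv \<and>
       limsup (\<lambda>n. ereal (real (nmax n) * sqrt (real (N n)) /
                  sqrt (\<Sum>i\<in>{1..l n}. real (cox_rank (V n i)) ^ 3))) < \<infinity> \<or>
       stat = cox_des"
  shows "(\<lambda>n. measure (\<Omega> n) {\<omega> \<in> space (\<Omega> n). M n \<omega> \<le> a n * x + b n})
           \<longlonglongrightarrow> exp (- exp (- x))"
proof -
  have N_sum: "N n = (\<Sum>i\<in>{1..l n}. cox_rank (V n i))" if "1 \<le> n" for n
    unfolding N W using that V by (intro cox_rank_cox_prod) auto
  have ratio: "(\<lambda>n. ln (real n) ^ 3 / real (N n)) \<longlonglongrightarrow> 0" by (rule smalloD_tendsto[OF N_growth])
  have N_top: "filterlim (\<lambda>n. real (N n)) at_top sequentially"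
  proof (rule filterlim_at_top_mono)
    show "filterlim (\<lambda>n. ln (real n) ^ 3) at_top sequentially" by real_asymp
    have "\<forall>\<^sub>F n in sequentially. norm (ln (real n) ^ 3) \<le> 1 * norm (real (N n))" using landau_o.smallD[OF N_growth, of 1] by simp
    then show "\<forall>\<^sub>F n in sequentially. ln (real n) ^ 3 \<le> real (N n)" by eventually_elim auto
  qed
  \<comment> \<open>The locale speaks about all indices, whereas the groups are prescribed from 1 on
    and the limsup bound for \<open>inv\<close> holds only eventually. Hence everything is shifted
    by \<open>n0\<close>.\<close>
  have core: ?thesis
    if n0: "1 \<le> n0" and T: "tail_setup (\<lambda>n. carrier (cox_prod {1..l (n + n0)} (V (n + n0)))) (\<lambda>n. stat (cox_prod {1..l (n + n0)} (V (n + n0)))) \<mu>' s'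
      (\<lambda>n. real (\<Sum>i\<in>{1..l (n + n0)}. cox_rank (V (n + n0) i))) B c C \<delta> D" for n0 \<mu>' s' B c C \<delta> D
  proof -
    have T': "tail_setup (\<lambda>n. carrier (W (n + n0))) (\<lambda>n. stat (W (n + n0))) \<mu>' s' (\<lambda>n. real (N (n + n0))) B c C \<delta> D"
      using T n0 unfolding W[symmetric] by (simp only: N_sum trans_le_add2)
    interpret T: tail_setup "\<lambda>n. carrier (W (n + n0))" "\<lambda>n. stat (W (n + n0))" \<mu>' s' "\<lambda>n. real (N (n + n0))" B c C \<delta> D by (rule T')
    have "(\<lambda>n. ln (real (n + n0)) ^ 3 / real (N (n + n0))) \<longlonglongrightarrow> 0" using LIMSEQ_ignore_initial_segment[OF ratio] .
    from T.gumbel_limit[OF filterlim_add_const_nat_at_top this, of x]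
    have lim: "(\<lambda>n. (1 - tail (carrier (W (n + n0))) (stat (W (n + n0))) (\<lfloor>\<mu>' n + s' n * (gumbel_beta (n + n0) + x / gumbel_alpha (n + n0))\<rfloor> + 1)) ^ (n + n0)) \<longlonglongrightarrow> exp (- exp (- x))" .
    have "measure (\<Omega> (n + n0)) {\<omega> \<in> space (\<Omega> (n + n0)). M (n + n0) \<omega> \<le> a (n + n0) * x + b (n + n0)} =
      (1 - tail (carrier (W (n + n0))) (stat (W (n + n0))) (\<lfloor>\<mu>' n + s' n * (gumbel_beta (n + n0) + x / gumbel_alpha (n + n0))\<rfloor> + 1)) ^ (n + n0)" for n
    proof -
      define m where "m = n + n0"
      have m: "1 \<le> m" using n0 by (simp add: m_def)
      interpret P: prob_space "\<Omega> m" by (rule prob[OF m])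
      have A: "finite (carrier (W m))" "carrier (W m) \<noteq> {}" unfolding W using finite_cox_prod[of "{1..l m}" "V m"] V[OF m] by auto
      have one: "1 \<in> {1..m}" using m by simp
      have rv: "P.random_variable borel (X m 1)" using indep[OF m] one unfolding P.indep_vars_def2 by blast
      note E = P.expectation_uniform[OF A rv _ distr[OF m one]]
      \<comment> \<open>This identifies the parameters of the locale with the expectation and the
        standard deviation that define the norming constants.\<close>
      have mom: "(\<Sum>w\<in>carrier (W m). real (stat (W m) w)) / card (carrier (W m)) = \<mu>' n"
        "(\<Sum>w\<in>carrier (W m). (real (stat (W m) w) - \<mu>' n)\<^sup>2) / card (carrier (W m)) = (s' n)\<^sup>2"
        using T.moments[of n] by (simp_all add: m_def)
      have \<mu>m: "\<mu> m = \<mu>' n" unfolding \<mu> using E[of "\<lambda>y. y"] mom(1) by simp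
      have "P.variance (X m 1) = (s' n)\<^sup>2" unfolding \<mu>[symmetric] \<mu>m using E[of "\<lambda>y. (y - \<mu>' n)\<^sup>2"] mom(2) by simp
      then have sm: "s m = s' n" unfolding s using T.s_pos[of n] by simp
      have "a m * x + b m = \<mu>' n + s' n * (gumbel_beta m + x / gumbel_alpha m)" by (simp add: a b \<mu>m sm distrib_left mult.commute)
      then show ?thesis unfolding m_def[symmetric] M using P.prob_Max_le[OF A m indep[OF m] distr[OF m]] by simp
    qed
    with lim have "(\<lambda>n. measure (\<Omega> (n + n0)) {\<omega> \<in> space (\<Omega> (n + n0)). M (n + n0) \<omega> \<le> a (n + n0) * x + b (n + n0)}) \<longlonglongrightarrow> exp (- exp (- x))"
      by (simp only:)
    then show ?thesis by (rule LIMSEQ_offset)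
  qed
  have top: "filterlim (\<lambda>n. real (\<Sum>i\<in>{1..l (n + n0)}. cox_rank (V (n + n0) i))) at_top sequentially" if "1 \<le> n0" for n0
    using filterlim_compose[OF N_top filterlim_add_const_nat_at_top[of n0]] that by (simp add: N_sum)
  have I: "finite {1..l (n + n0)}" "{1..l (n + n0)} \<noteq> {}" "\<And>i. i \<in> {1..l (n + n0)} \<Longrightarrow> V (n + n0) i \<in> classical_weyl_groups" if "1 \<le> n0" for n n0
    using l[of "n + n0"] V[of "n + n0"] that by auto
  from stat show ?thesis
  proof
    assume st: "stat = cox_des"
    have n0: "1 \<le> (1::nat)" by simp
    from des_setup[of "\<lambda>n. {1..l (n + 1)}" "\<lambda>n. V (n + 1)", OF I[OF n0] top[OF n0]]
    show ?thesis unfolding st[symmetric] using core[OF n0] by blast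
  next
    assume st: "stat = cox_inv \<and> limsup (\<lambda>n. ereal (real (nmax n) * sqrt (real (N n)) / sqrt (\<Sum>i\<in>{1..l n}. real (cox_rank (V n i)) ^ 3))) < \<infinity>"
    from limsup_bound[OF conjunct2[OF this]] obtain K where K: "K > 0" "\<forall>\<^sub>F n in sequentially. real (nmax n) * sqrt (real (N n)) / sqrt (\<Sum>i\<in>{1..l n}. real (cox_rank (V n i)) ^ 3) < K"
      by blast
    then obtain n1 where n1: "\<And>n. n1 \<le> n \<Longrightarrow> real (nmax n) * sqrt (real (N n)) / sqrt (\<Sum>i\<in>{1..l n}. real (cox_rank (V n i)) ^ 3) < K"
      unfolding eventually_sequentially by blast
    define n0 where "n0 = n1 + 1"
    have n0: "1 \<le> n0" by (simp add: n0_def)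
    have B: "real (cox_rank (V (n + n0) i)) \<le> real (nmax (n + n0))" if "i \<in> {1..l (n + n0)}" for n i
      unfolding nmax of_nat_le_iff using that by (intro Max_ge) auto
    \<comment> \<open>The bound \<open>nmax * sqrt N < K * sqrt S\<close> from the limsup, with
      \<open>S\<close> the sum of the cubes of the ranks, is squared; so \<open>1 / K ^ 2\<close>
      serves as \<open>c0\<close>.\<close>
    have c0: "1 / K\<^sup>2 * real (\<Sum>i\<in>{1..l (n + n0)}. cox_rank (V (n + n0) i)) * (real (nmax (n + n0)))\<^sup>2 \<le> (\<Sum>i\<in>{1..l (n + n0)}. real (cox_rank (V (n + n0) i)) ^ 3)" for n
    proof -
      define m where "m = n + n0"
      define S where "S = (\<Sum>i\<in>{1..l m}. real (cox_rank (V m i)) ^ 3)"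
      have m: "1 \<le> m" "n1 \<le> m" by (auto simp: m_def n0_def)
      \<comment> \<open>There is a component, and its rank is at least 1, so \<open>S\<close> is
        positive and can be multiplied out of the quotient.\<close>
      have "1 \<in> {1..l m}" using l[OF m(1)] by simp
      then have "1 \<le> real (cox_rank (V m 1)) ^ 3" using rank_ge_1[OF V[OF m(1)]] by simp
      also have "\<dots> \<le> S" unfolding S_def using \<open>1 \<in> {1..l m}\<close> by (intro member_le_sum) auto
      finally have S: "1 \<le> S" .
      have "real (nmax m) * sqrt (real (N m)) \<le> K * sqrt S" using n1[OF m(2), folded S_def] S by (simp add: pos_divide_less_eq)
      then have "(real (nmax m) * sqrt (real (N m)))\<^sup>2 \<le> (K * sqrt S)\<^sup>2" by (intro power_mono) auto
      then have "(real (nmax m))\<^sup>2 * real (N m) \<le> K\<^sup>2 * S" using S by (simp add: power_mult_distrib)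
      then have "1 / K\<^sup>2 * real (N m) * (real (nmax m))\<^sup>2 \<le> S" using K by (simp add: pos_divide_le_eq mult_ac)
      then show ?thesis unfolding N_sum[OF m(1)] unfolding S_def m_def .
    qed
    have "0 < 1 / K\<^sup>2" using K by simp
    from inv_setup[of "\<lambda>n. {1..l (n + n0)}" "\<lambda>n. V (n + n0)", OF I[OF n0] top[OF n0] B this c0]
    show ?thesis unfolding conjunct1[OF st, symmetric] using core[OF n0] by blast
  qed
qed

end
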